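(* Let $k$ be a field, $\mathcal{C}=(\mathcal{C},\mathbb{E},\mathfrak{s},\mathbb{E}^{-1})$ a $k$-linear Hom-finite Krull--Schmidt extriangulated category with a negative first extension, and let $(\Theta,\mathbb{P},\mathbb{I})$ be a mixed bistratifying system in $\mathcal{C}$. Put $B:=\mathrm{End}_{\mathcal{C}}(\mathbb{P})$, $\Psi:=\mathcal{C}(\mathbb{P},-):\mathcal{C}\to\mathrm{mod}\,B$, $C:=\mathrm{End}_{\mathcal{C}}(\mathbb{I})^{op}$ and $\Phi:=\mathcal{C}(-,\mathbb{I}):\mathcal{C}\to\mathrm{mod}\,C$. Then the following statements hold. (1) $(\Phi(\Theta),\Phi(\mathbb{I}),\Phi(\mathbb{P}))$ is a mixed bistratifying system in $\mathrm{mod}\,C$. Moreover, $\Phi(\mathbb{P})$ is a Wakamatsu tilting $C$-module and $(\Phi'\Phi(\Theta),\Phi'\Phi(\mathbb{P}),\Phi'\Phi(\mathbb{I}))\cong(\Psi(\Theta),\Psi(\mathbb{P}),\Psi(\mathbb{I}))$ holds, where $\Phi':=\mathrm{Hom}_{C}(-,\Phi(\mathbb{P}))$. In particular, $\mathrm{End}_{\mathcal{C}}(\mathbb{P})\cong\mathrm{End}_{C}(\Phi(\mathbb{P}))^{op}$. (2) $(\Psi(\Theta),\Psi(\mathbb{P}),\Psi(\mathbb{I}))$ is a mixed bistratifying system in $\mathrm{mod}\,B$. Moreover, $\Psi(\mathbb{I})$ is a Wakamatsu tilting $B$-module and $(\Psi'\Psi(\Theta),\Psi'\Psi(\mathbb{I}),\Psi'\Psi(\mathbb{P}))\cong(\Phi(\Theta),\Phi(\mathbb{I}),\Phi(\mathbb{P}))$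 holds, where $\Psi':=\mathrm{Hom}_{B}(-,\Psi(\mathbb{I}))$. In particular, $\mathrm{End}_{\mathcal{C}}(\mathbb{I})\cong\mathrm{End}_{B}(\Psi(\mathbb{I}))$.
   Context: All categories are skeletally small; subcategories are full and closed under isomorphisms. Extriangulated categories $(\mathcal{C},\mathbb{E},\mathfrak{s})$ are in the sense of Nakaoka--Palu: $\mathcal{C}$ is additive, $\mathbb{E}:\mathcal{C}^{op}\times\mathcal{C}\to\mathrm{Ab}$ is an additive bifunctor, and $\mathfrak{s}$ assigns to each $\delta\in\mathbb{E}(C,A)$ an equivalence class $[A\to B\to C]$ of complexes, subject to their axioms. If $\mathfrak{s}(\delta)=[A\xrightarrow{f}B\xrightarrow{g}C]$, then $A\xrightarrow{f}B\xrightarrow{g}C\overset{\delta}{\dashrightarrow}$ is an $\mathfrak{s}$-conflation. A negative first extension on $\mathcal{C}$ is an additive bifunctor $\mathbb{E}^{-1}:\mathcal{C}^{op}\times\mathcal{C}\to\mathrm{Ab}$ together with, for each $\delta\in\mathbb{E}(C,A)$, natural transformations $\mathbb{E}^{-1}(-,C)\to\mathcal{C}(-,A)$ and $\mathbb{E}^{-1}(A,-)\to\mathcal{C}(C,-)$ such that for every $\mathfrak{s}$-conflation $A\to B\to C\overset{\delta}{\dashrightarrow}$ and every $W$ the sequences $\mathbb{E}^{-1}(W,A)\to\mathbb{E}^{-1}(W,B)\to\mathbb{E}^{-1}(W,C)\to\mathcal{C}(W,A)\to\mathcal{C}(W,B)$ and $\mathbb{E}^{-1}(C,W)\to\mathbb{E}^{-1}(B,W)\to\mathbb{E}^{-1}(A,W)\to\mathcal{C}(C,W)\to\mathcal{C}(B,W)$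 are exact. For a finite dimensional algebra $A$, $\mathrm{mod}\,A$ (finitely generated right modules) is regarded as such a category with $\mathbb{E}=\mathrm{Ext}^1_A$, conflations the short exact sequences, and $\mathbb{E}^{-1}=0$. $\mathcal{X}*\mathcal{Y}$ is the subcategory of all $M$ with an $\mathfrak{s}$-conflation $X\to M\to Y\dashrightarrow$, $X\in\mathcal{X}$, $Y\in\mathcal{Y}$; $\mathcal{F}(M):=\bigcup_{l>0}\mathrm{add}\,M*\cdots*\mathrm{add}\,M$ ($l$ factors). An ordered set of objects is identified with the direct sum of its members. A brick is an object whose endomorphism ring is a division ring; a stone is an indecomposable object $M$ with $\mathbb{E}(M,M)=0$. Let $\Theta=(\Theta(1),\dots,\Theta(t))$ be an ordered set of objects such that each $\Theta(i)$ is a brick or a stone, $\mathcal{C}(\Theta(i),\Theta(j))=0$ for $i>j$, and $\mathbb{E}^{-1}(\Theta,\Theta)=0$. With an ordered set $\mathbb{P}=(P(1),\dots,P(t))$ of indecomposable objects, $(\Theta,\mathbb{P})$ is a mixed stratifying system if for each $i$ there is an $\mathfrak{s}$-conflation $K(i)\to P(i)\to\Theta(i)\dashrightarrow$ with $K(i)\in\mathcal{F}(\Theta(i)\oplus\cdots\oplus\Theta(t))$ and $\mathbb{E}(P(i),\mathcal{F}(\Theta))=0$. With an ordered set $\mathbb{I}=(I(1),\dots,I(t))$ of indecomposable objects, $(\Theta,\mathbb{I})$ is a mixed costratifying system if for each $i$ there is an $\mathfrak{s}$-conflation $\Theta(i)\to I(i)\to C(i)\dashrightarrow$ with $\mathbb{E}(\mathcal{F}(\Theta),I(i))=0$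 and $C(i)\in\mathcal{F}(\Theta(1)\oplus\cdots\oplus\Theta(i))$. $(\Theta,\mathbb{P},\mathbb{I})$ is a mixed bistratifying system if $(\Theta,\mathbb{P})$ is a mixed stratifying system and $(\Theta,\mathbb{I})$ is a mixed costratifying system. For a covariant functor $\Psi$ and an ordered set $X=(X(1),\dots,X(t))$, $\Psi(X):=(\Psi(X(1)),\dots,\Psi(X(t)))$; for a contravariant functor $\Phi$ the order is reversed: $\Phi(X):=(\Phi(X(t)),\dots,\Phi(X(1)))$. A module $W$ over a finite dimensional algebra $A$ is Wakamatsu tilting if $\mathrm{Ext}_A^i(W,W)=0$ for all $i\ge1$ and there is an exact sequence $0\to A\xrightarrow{f^0}W^0\xrightarrow{f^1}W^1\xrightarrow{f^2}\cdots$ with $W^i\in\mathrm{add}\,W$ and $\mathrm{Ext}_A^j(\mathrm{Cok}\,f^i,W)=0$ for all $i\ge0$, $j\ge1$. The isomorphisms of triples in (1) and (2) are termwise, identifying right modules over $\mathrm{End}_C(\Phi(\mathbb{P}))^{op}$ with $B$-modules, respectively over $\mathrm{End}_B(\Psi(\mathbb{I}))^{op}$ with $C$-modules. *)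

theory Defs
  imports "HOL-Algebra.Module" "HOL-Algebra.QuotRing"
begin

section \<open>Rings, algebras and right modules\<close>

definition skew_field :: "('a, 'x) ring_scheme \<Rightarrow> bool" where
  "skew_field R \<longleftrightarrow> ring R \<and> Units R = carrier R - {\<zero>\<^bsub>R\<^esub>}"

definition local_ring :: "('a, 'x) ring_scheme \<Rightarrow> bool" where
  "local_ring R \<longleftrightarrow> ring R \<and> \<one>\<^bsub>R\<^esub> \<noteq> \<zero>\<^bsub>R\<^esub> \<and>
     (\<forall>x \<in> carrier R - Units R. \<forall>y \<in> carrier R - Units R. x \<oplus>\<^bsub>R\<^esub> y \<notin> Units R)"

definition trivial_group :: "('a, 'x) ring_scheme \<Rightarrow> bool" where
  "trivial_group G \<longleftrightarrow> carrier G = {\<zero>\<^bsub>G\<^esub>}"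

text \<open>A (noncommutative) algebra over \<open>k\<close> is stored in the record type \<^typ>\<open>('k, 'a) module\<close>, whose
  fields are the ring operations together with the scalar multiplication.\<close>

definition opp :: "('k, 'a) module \<Rightarrow> ('k, 'a) module" where
  "opp A = A\<lparr>mult := \<lambda>x y. y \<otimes>\<^bsub>A\<^esub> x\<rparr>"

definition alg_iso :: "'k ring \<Rightarrow> ('k, 'a) module \<Rightarrow> ('k, 'b) module \<Rightarrow> ('a \<Rightarrow> 'b) set" where
  "alg_iso k A A' = {h \<in> ring_iso A A'.
     \<forall>c \<in> carrier k. \<forall>a \<in> carrier A. h (c \<odot>\<^bsub>A\<^esub> a) = c \<odot>\<^bsub>A'\<^esub> h a}"

text \<open>In a right module \<open>M\<close> over \<open>A\<close>, the field \<open>a \<odot>\<^bsub>M\<^esub> x\<close> holds the product of \<open>x\<close> with \<open>a\<close> on the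
  right; hence the order of the factors in the associativity law.  The fields \<open>mult\<close> and \<open>one\<close>
  of a module record are irrelevant.\<close>

definition right_module :: "('k, 'a) module \<Rightarrow> ('a, 'u) module \<Rightarrow> bool" where
  "right_module A M \<longleftrightarrow> ring A \<and> abelian_group M \<and>
     (\<forall>a \<in> carrier A. \<forall>x \<in> carrier M. a \<odot>\<^bsub>M\<^esub> x \<in> carrier M) \<and>
     (\<forall>a \<in> carrier A. \<forall>b \<in> carrier A. \<forall>x \<in> carrier M.
        (a \<oplus>\<^bsub>A\<^esub> b) \<odot>\<^bsub>M\<^esub> x = a \<odot>\<^bsub>M\<^esub> x \<oplus>\<^bsub>M\<^esub> b \<odot>\<^bsub>M\<^esub> x) \<and>
     (\<forall>a \<in> carrier A. \<forall>x \<in> carrier M. \<forall>y \<in> carrier M.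
        a \<odot>\<^bsub>M\<^esub> (x \<oplus>\<^bsub>M\<^esub> y) = a \<odot>\<^bsub>M\<^esub> x \<oplus>\<^bsub>M\<^esub> a \<odot>\<^bsub>M\<^esub> y) \<and>
     (\<forall>a \<in> carrier A. \<forall>b \<in> carrier A. \<forall>x \<in> carrier M.
        (a \<otimes>\<^bsub>A\<^esub> b) \<odot>\<^bsub>M\<^esub> x = b \<odot>\<^bsub>M\<^esub> (a \<odot>\<^bsub>M\<^esub> x)) \<and>
     (\<forall>x \<in> carrier M. \<one>\<^bsub>A\<^esub> \<odot>\<^bsub>M\<^esub> x = x)"

text \<open>For a field \<open>k\<close>, \<open>fin_gen k V\<close> says that \<open>V\<close> is finite dimensional.  The locale
  \<open>submodule\<close> does not refer to the multiplication of the ring, so it also describes the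
  submodules of a right module.\<close>

definition fin_gen :: "('a, 'x) ring_scheme \<Rightarrow> ('a, 'u) module \<Rightarrow> bool" where
  "fin_gen R M \<longleftrightarrow> (\<exists>S. finite S \<and> S \<subseteq> carrier M \<and>
     (\<forall>U. submodule U R M \<longrightarrow> S \<subseteq> U \<longrightarrow> U = carrier M))"

text \<open>Homomorphisms of right modules are made extensional, so that equality of homomorphisms is
  equality in HOL.\<close>

definition rhom :: "('k, 'a) module \<Rightarrow> ('a, 'u) module \<Rightarrow> ('a, 'v) module \<Rightarrow> ('u \<Rightarrow> 'v) set" where
  "rhom A M N = {f \<in> carrier M \<rightarrow>\<^sub>E carrier N.
     (\<forall>x \<in> carrier M. \<forall>y \<in> carrier M. f (x \<oplus>\<^bsub>M\<^esub> y) = f x \<oplus>\<^bsub>N\<^esub> f y) \<and>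
     (\<forall>a \<in> carrier A. \<forall>x \<in> carrier M. f (a \<odot>\<^bsub>M\<^esub> x) = a \<odot>\<^bsub>N\<^esub> f x)}"

definition rmod_iso :: "('k, 'a) module \<Rightarrow> ('a, 'u) module \<Rightarrow> ('a, 'v) module \<Rightarrow> bool" where
  "rmod_iso A M N \<longleftrightarrow> right_module A M \<and> right_module A N \<and>
     (\<exists>f \<in> rhom A M N. bij_betw f (carrier M) (carrier N))"

definition restrict_scalars :: "('b \<Rightarrow> 'a) \<Rightarrow> ('a, 'u) module \<Rightarrow> ('b, 'u) module" where
  "restrict_scalars h M = \<lparr>carrier = carrier M, mult = mult M, one = one M,
     zero = zero M, add = add M, smult = (\<lambda>b x. h b \<odot>\<^bsub>M\<^esub> x)\<rparr>"

section \<open>Linear categories\<close>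

text \<open>The Hom spaces of different pairs of objects need not be disjoint; therefore composition
  carries the three objects: \<open>comp \<C> X Y Z g f\<close> is \<open>g\<close> after \<open>f\<close>, where \<open>f\<close> goes from \<open>X\<close> to \<open>Y\<close>
  and \<open>g\<close> from \<open>Y\<close> to \<open>Z\<close>.\<close>

record ('k, 'o, 'm) lin_cat =
  Ob :: "'o set"
  Hom :: "'o \<Rightarrow> 'o \<Rightarrow> ('k, 'm) module"
  ident :: "'o \<Rightarrow> 'm"
  comp :: "'o \<Rightarrow> 'o \<Rightarrow> 'o \<Rightarrow> 'm \<Rightarrow> 'm \<Rightarrow> 'm"

locale linear_category =
  fixes k :: "'k ring" and \<C> :: "('k, 'o, 'm, 'x) lin_cat_scheme"
  assumes field: "field k"
    and Hom_module: "\<lbrakk>X \<in> Ob \<C>; Y \<in> Ob \<C>\<rbrakk> \<Longrightarrow> module k (Hom \<C> X Y)"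
    and ident_closed: "X \<in> Ob \<C> \<Longrightarrow> ident \<C> X \<in> carrier (Hom \<C> X X)"
    and comp_closed: "\<lbrakk>X \<in> Ob \<C>; Y \<in> Ob \<C>; Z \<in> Ob \<C>; f \<in> carrier (Hom \<C> X Y);
        g \<in> carrier (Hom \<C> Y Z)\<rbrakk> \<Longrightarrow> comp \<C> X Y Z g f \<in> carrier (Hom \<C> X Z)"
    and comp_ident_left: "\<lbrakk>X \<in> Ob \<C>; Y \<in> Ob \<C>; f \<in> carrier (Hom \<C> X Y)\<rbrakk>
        \<Longrightarrow> comp \<C> X Y Y (ident \<C> Y) f = f"
    and comp_ident_right: "\<lbrakk>X \<in> Ob \<C>; Y \<in> Ob \<C>; f \<in> carrier (Hom \<C> X Y)\<rbrakk>
        \<Longrightarrow> comp \<C> X X Y f (ident \<C> X) = f"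
    and comp_assoc: "\<lbrakk>W \<in> Ob \<C>; X \<in> Ob \<C>; Y \<in> Ob \<C>; Z \<in> Ob \<C>; f \<in> carrier (Hom \<C> W X);
        g \<in> carrier (Hom \<C> X Y); h \<in> carrier (Hom \<C> Y Z)\<rbrakk>
        \<Longrightarrow> comp \<C> W X Z (comp \<C> X Y Z h g) f = comp \<C> W Y Z h (comp \<C> W X Y g f)"
    and comp_add_left: "\<lbrakk>X \<in> Ob \<C>; Y \<in> Ob \<C>; Z \<in> Ob \<C>; f \<in> carrier (Hom \<C> X Y);
        g \<in> carrier (Hom \<C> Y Z); g' \<in> carrier (Hom \<C> Y Z)\<rbrakk>
        \<Longrightarrow> comp \<C> X Y Z (g \<oplus>\<^bsub>Hom \<C> Y Z\<^esub> g') f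
          = comp \<C> X Y Z g f \<oplus>\<^bsub>Hom \<C> X Z\<^esub> comp \<C> X Y Z g' f"
    and comp_add_right: "\<lbrakk>X \<in> Ob \<C>; Y \<in> Ob \<C>; Z \<in> Ob \<C>; f \<in> carrier (Hom \<C> X Y);
        f' \<in> carrier (Hom \<C> X Y); g \<in> carrier (Hom \<C> Y Z)\<rbrakk>
        \<Longrightarrow> comp \<C> X Y Z g (f \<oplus>\<^bsub>Hom \<C> X Y\<^esub> f')
          = comp \<C> X Y Z g f \<oplus>\<^bsub>Hom \<C> X Z\<^esub> comp \<C> X Y Z g f'"
    and comp_smult_left: "\<lbrakk>X \<in> Ob \<C>; Y \<in> Ob \<C>; Z \<in> Ob \<C>; f \<in> carrier (Hom \<C> X Y);
        g \<in> carrier (Hom \<C> Y Z); c \<in> carrier k\<rbrakk>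
        \<Longrightarrow> comp \<C> X Y Z (c \<odot>\<^bsub>Hom \<C> Y Z\<^esub> g) f = c \<odot>\<^bsub>Hom \<C> X Z\<^esub> comp \<C> X Y Z g f"
    and comp_smult_right: "\<lbrakk>X \<in> Ob \<C>; Y \<in> Ob \<C>; Z \<in> Ob \<C>; f \<in> carrier (Hom \<C> X Y);
        g \<in> carrier (Hom \<C> Y Z); c \<in> carrier k\<rbrakk>
        \<Longrightarrow> comp \<C> X Y Z g (c \<odot>\<^bsub>Hom \<C> X Y\<^esub> f) = c \<odot>\<^bsub>Hom \<C> X Z\<^esub> comp \<C> X Y Z g f"

definition EndAlg :: "('k, 'o, 'm, 'x) lin_cat_scheme \<Rightarrow> 'o \<Rightarrow> ('k, 'm) module" where
  "EndAlg \<C> X = (Hom \<C> X X)\<lparr>mult := comp \<C> X X X, one := ident \<C> X\<rparr>"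

definition cat_iso :: "('k, 'o, 'm, 'x) lin_cat_scheme \<Rightarrow> 'o \<Rightarrow> 'o \<Rightarrow> 'm \<Rightarrow> bool" where
  "cat_iso \<C> X Y f \<longleftrightarrow> f \<in> carrier (Hom \<C> X Y) \<and>
     (\<exists>g \<in> carrier (Hom \<C> Y X). comp \<C> X Y X g f = ident \<C> X \<and> comp \<C> Y X Y f g = ident \<C> Y)"

definition zero_object :: "('k, 'o, 'm, 'x) lin_cat_scheme \<Rightarrow> 'o \<Rightarrow> bool" where
  "zero_object \<C> X \<longleftrightarrow> X \<in> Ob \<C> \<and>
     (\<forall>Y \<in> Ob \<C>. trivial_group (Hom \<C> X Y) \<and> trivial_group (Hom \<C> Y X))"

definition biproduct ::
  "('k, 'o, 'm, 'x) lin_cat_scheme \<Rightarrow> 'o list \<Rightarrow> 'o \<Rightarrow> (nat \<Rightarrow> 'm) \<Rightarrow> (nat \<Rightarrow> 'm) \<Rightarrow> bool" where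
  "biproduct \<C> Xs S i p \<longleftrightarrow> set Xs \<subseteq> Ob \<C> \<and> S \<in> Ob \<C> \<and>
     (\<forall>r < length Xs. i r \<in> carrier (Hom \<C> (Xs ! r) S) \<and> p r \<in> carrier (Hom \<C> S (Xs ! r))) \<and>
     (\<forall>r < length Xs. \<forall>s < length Xs. comp \<C> (Xs ! r) S (Xs ! s) (p s) (i r) =
        (if r = s then ident \<C> (Xs ! r) else \<zero>\<^bsub>Hom \<C> (Xs ! r) (Xs ! s)\<^esub>)) \<and>
     ident \<C> S = (\<Oplus>\<^bsub>Hom \<C> S S\<^esub> r \<in> {..<length Xs}. comp \<C> S (Xs ! r) S (i r) (p r))"

definition direct_sum :: "('k, 'o, 'm, 'x) lin_cat_scheme \<Rightarrow> 'o list \<Rightarrow> 'o \<Rightarrow> bool" where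
  "direct_sum \<C> Xs S \<longleftrightarrow> (\<exists>i p. biproduct \<C> Xs S i p)"

text \<open>A choice of direct sum of an ordered set of objects, used wherever an ordered set is
  identified with the direct sum of its members.\<close>

definition dsum :: "('k, 'o, 'm, 'x) lin_cat_scheme \<Rightarrow> 'o list \<Rightarrow> 'o" where
  "dsum \<C> Xs = (SOME S. direct_sum \<C> Xs S)"

definition indecomposable :: "('k, 'o, 'm, 'x) lin_cat_scheme \<Rightarrow> 'o \<Rightarrow> bool" where
  "indecomposable \<C> X \<longleftrightarrow> X \<in> Ob \<C> \<and> \<not> zero_object \<C> X \<and>
     (\<forall>Y Z. direct_sum \<C> [Y, Z] X \<longrightarrow> zero_object \<C> Y \<or> zero_object \<C> Z)"

definition add_closure :: "('k, 'o, 'm, 'x) lin_cat_scheme \<Rightarrow> 'o \<Rightarrow> 'o set" where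
  "add_closure \<C> M =
     {X. \<exists>n S Y. direct_sum \<C> (replicate n M) S \<and> direct_sum \<C> [X, Y] S}"

locale additive_linear_category = linear_category +
  assumes direct_sum_exists: "set Xs \<subseteq> Ob \<C> \<Longrightarrow> \<exists>S. direct_sum \<C> Xs S"

locale Hom_finite_Krull_Schmidt_category = additive_linear_category +
  assumes Hom_finite: "\<lbrakk>X \<in> Ob \<C>; Y \<in> Ob \<C>\<rbrakk> \<Longrightarrow> fin_gen k (Hom \<C> X Y)"
    and Krull_Schmidt: "X \<in> Ob \<C> \<Longrightarrow>
        \<exists>Xs. direct_sum \<C> Xs X \<and> (\<forall>Y \<in> set Xs. local_ring (EndAlg \<C> Y))"

section \<open>Extriangulated categories with a negative first extension\<close>

text \<open>\<open>Ext \<C> C A\<close> is the group of extensions of \<open>C\<close> by \<open>A\<close>.  For \<open>a\<close> from \<open>A\<close> to \<open>A'\<close>,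
  \<open>ext_push \<C> C A A' a\<close> maps \<open>Ext \<C> C A\<close> to \<open>Ext \<C> C A'\<close>; for \<open>c\<close> from \<open>C'\<close> to \<open>C\<close>,
  \<open>ext_pull \<C> C C' A c\<close> maps \<open>Ext \<C> C A\<close> to \<open>Ext \<C> C' A\<close>.  The same conventions hold for the
  negative extensions \<open>Neg\<close>.  The set \<open>realization \<C> C A \<delta>\<close> consists of triples \<open>(x, B, y)\<close> with
  \<open>x\<close> from \<open>A\<close> to \<open>B\<close> and \<open>y\<close> from \<open>B\<close> to \<open>C\<close>.  For \<open>\<delta>\<close> in \<open>Ext \<C> C A\<close>,
  \<open>neg_conn_contra \<C> C A \<delta> W\<close> maps \<open>Neg \<C> W C\<close> to \<open>Hom \<C> W A\<close> and
  \<open>neg_conn_cov \<C> C A \<delta> W\<close> maps \<open>Neg \<C> A W\<close> to \<open>Hom \<C> C W\<close>.\<close>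

record ('k, 'o, 'm, 'e, 'n) ext_cat = "('k, 'o, 'm) lin_cat" +
  Ext :: "'o \<Rightarrow> 'o \<Rightarrow> 'e ring"
  ext_push :: "'o \<Rightarrow> 'o \<Rightarrow> 'o \<Rightarrow> 'm \<Rightarrow> 'e \<Rightarrow> 'e"
  ext_pull :: "'o \<Rightarrow> 'o \<Rightarrow> 'o \<Rightarrow> 'm \<Rightarrow> 'e \<Rightarrow> 'e"
  realization :: "'o \<Rightarrow> 'o \<Rightarrow> 'e \<Rightarrow> ('m \<times> 'o \<times> 'm) set"
  Neg :: "'o \<Rightarrow> 'o \<Rightarrow> 'n ring"
  neg_push :: "'o \<Rightarrow> 'o \<Rightarrow> 'o \<Rightarrow> 'm \<Rightarrow> 'n \<Rightarrow> 'n"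
  neg_pull :: "'o \<Rightarrow> 'o \<Rightarrow> 'o \<Rightarrow> 'm \<Rightarrow> 'n \<Rightarrow> 'n"
  neg_conn_contra :: "'o \<Rightarrow> 'o \<Rightarrow> 'e \<Rightarrow> 'o \<Rightarrow> 'n \<Rightarrow> 'm"
  neg_conn_cov :: "'o \<Rightarrow> 'o \<Rightarrow> 'e \<Rightarrow> 'o \<Rightarrow> 'n \<Rightarrow> 'm"

locale additive_bifunctor =
  fixes \<C> :: "('k, 'o, 'm, 'x) lin_cat_scheme"
    and F :: "'o \<Rightarrow> 'o \<Rightarrow> 'f ring"
    and push :: "'o \<Rightarrow> 'o \<Rightarrow> 'o \<Rightarrow> 'm \<Rightarrow> 'f \<Rightarrow> 'f"
    and pull :: "'o \<Rightarrow> 'o \<Rightarrow> 'o \<Rightarrow> 'm \<Rightarrow> 'f \<Rightarrow> 'f"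
  assumes group: "\<lbrakk>C \<in> Ob \<C>; A \<in> Ob \<C>\<rbrakk> \<Longrightarrow> abelian_group (F C A)"
    and push_hom: "\<lbrakk>C \<in> Ob \<C>; A \<in> Ob \<C>; A' \<in> Ob \<C>; a \<in> carrier (Hom \<C> A A')\<rbrakk>
        \<Longrightarrow> push C A A' a \<in> hom (add_monoid (F C A)) (add_monoid (F C A'))"
    and pull_hom: "\<lbrakk>C \<in> Ob \<C>; C' \<in> Ob \<C>; A \<in> Ob \<C>; c \<in> carrier (Hom \<C> C' C)\<rbrakk>
        \<Longrightarrow> pull C C' A c \<in> hom (add_monoid (F C A)) (add_monoid (F C' A))"
    and push_ident: "\<lbrakk>C \<in> Ob \<C>; A \<in> Ob \<C>; d \<in> carrier (F C A)\<rbrakk>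
        \<Longrightarrow> push C A A (ident \<C> A) d = d"
    and pull_ident: "\<lbrakk>C \<in> Ob \<C>; A \<in> Ob \<C>; d \<in> carrier (F C A)\<rbrakk>
        \<Longrightarrow> pull C C A (ident \<C> C) d = d"
    and push_comp: "\<lbrakk>C \<in> Ob \<C>; A \<in> Ob \<C>; A' \<in> Ob \<C>; A'' \<in> Ob \<C>; a \<in> carrier (Hom \<C> A A');
        a' \<in> carrier (Hom \<C> A' A''); d \<in> carrier (F C A)\<rbrakk>
        \<Longrightarrow> push C A A'' (comp \<C> A A' A'' a' a) d = push C A' A'' a' (push C A A' a d)"
    and pull_comp: "\<lbrakk>C \<in> Ob \<C>; C' \<in> Ob \<C>; C'' \<in> Ob \<C>; A \<in> Ob \<C>; c \<in> carrier (Hom \<C> C' C);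
        c' \<in> carrier (Hom \<C> C'' C'); d \<in> carrier (F C A)\<rbrakk>
        \<Longrightarrow> pull C C'' A (comp \<C> C'' C' C c c') d = pull C' C'' A c' (pull C C' A c d)"
    and push_pull: "\<lbrakk>C \<in> Ob \<C>; C' \<in> Ob \<C>; A \<in> Ob \<C>; A' \<in> Ob \<C>; a \<in> carrier (Hom \<C> A A');
        c \<in> carrier (Hom \<C> C' C); d \<in> carrier (F C A)\<rbrakk>
        \<Longrightarrow> push C' A A' a (pull C C' A c d) = pull C C' A' c (push C A A' a d)"
    and push_add: "\<lbrakk>C \<in> Ob \<C>; A \<in> Ob \<C>; A' \<in> Ob \<C>; a \<in> carrier (Hom \<C> A A');
        a' \<in> carrier (Hom \<C> A A'); d \<in> carrier (F C A)\<rbrakk>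
        \<Longrightarrow> push C A A' (a \<oplus>\<^bsub>Hom \<C> A A'\<^esub> a') d
          = push C A A' a d \<oplus>\<^bsub>F C A'\<^esub> push C A A' a' d"
    and pull_add: "\<lbrakk>C \<in> Ob \<C>; C' \<in> Ob \<C>; A \<in> Ob \<C>; c \<in> carrier (Hom \<C> C' C);
        c' \<in> carrier (Hom \<C> C' C); d \<in> carrier (F C A)\<rbrakk>
        \<Longrightarrow> pull C C' A (c \<oplus>\<^bsub>Hom \<C> C' C\<^esub> c') d
          = pull C C' A c d \<oplus>\<^bsub>F C' A\<^esub> pull C C' A c' d"

definition sequences :: "('k, 'o, 'm, 'x) lin_cat_scheme \<Rightarrow> 'o \<Rightarrow> 'o \<Rightarrow> ('m \<times> 'o \<times> 'm) set" where
  "sequences \<C> A C =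
     {(x, B, y). B \<in> Ob \<C> \<and> x \<in> carrier (Hom \<C> A B) \<and> y \<in> carrier (Hom \<C> B C)}"

definition seq_equiv :: "('k, 'o, 'm, 'x) lin_cat_scheme \<Rightarrow> 'o \<Rightarrow> 'o
    \<Rightarrow> ('m \<times> 'o \<times> 'm) rel" where
  "seq_equiv \<C> A C = {((x, B, y), (x', B', y')).
     (x, B, y) \<in> sequences \<C> A C \<and> (x', B', y') \<in> sequences \<C> A C \<and>
     (\<exists>b. cat_iso \<C> B B' b \<and> comp \<C> A B B' b x = x' \<and> comp \<C> B B' C y' b = y)}"

definition conflation ::
  "('k, 'o, 'm, 'e, 'n, 'x) ext_cat_scheme \<Rightarrow> 'o \<Rightarrow> 'm \<Rightarrow> 'o \<Rightarrow> 'm \<Rightarrow> 'o \<Rightarrow> 'e \<Rightarrow> bool" where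
  "conflation \<C> A x B y C \<delta> \<longleftrightarrow> A \<in> Ob \<C> \<and> B \<in> Ob \<C> \<and> C \<in> Ob \<C> \<and>
     \<delta> \<in> carrier (Ext \<C> C A) \<and> (x, B, y) \<in> realization \<C> C A \<delta>"

definition ext_morphism ::
  "('k, 'o, 'm, 'e, 'n, 'x) ext_cat_scheme \<Rightarrow> 'o \<Rightarrow> 'o \<Rightarrow> 'e \<Rightarrow> 'o \<Rightarrow> 'o \<Rightarrow> 'e
    \<Rightarrow> 'm \<Rightarrow> 'm \<Rightarrow> bool" where
  "ext_morphism \<C> C A \<delta> C' A' \<delta>' a c \<longleftrightarrow>
     a \<in> carrier (Hom \<C> A A') \<and> c \<in> carrier (Hom \<C> C C') \<and>
     ext_push \<C> C A A' a \<delta> = ext_pull \<C> C' C A' c \<delta>'"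

text \<open>The axioms of Nakaoka and Palu.  In \<open>realization_sum\<close>, the displayed element of
  \<open>Ext \<C> SC SA\<close> is the sum of extensions \<open>\<delta> \<oplus> \<delta>'\<close>: it has components \<open>\<delta>\<close>, \<open>0\<close>, \<open>0\<close>, \<open>\<delta>'\<close>, and
  the displayed morphisms are the direct sums of \<open>x, x'\<close> and of \<open>y, y'\<close>.\<close>

locale extriangulated_category = additive_linear_category k \<C>
  for k :: "'k ring" and \<C> :: "('k, 'o, 'm, 'e, 'n, 'x) ext_cat_scheme" +
  assumes ET1: "additive_bifunctor \<C> (Ext \<C>) (ext_push \<C>) (ext_pull \<C>)"
    and realization_class: "\<lbrakk>C \<in> Ob \<C>; A \<in> Ob \<C>; \<delta> \<in> carrier (Ext \<C> C A)\<rbrakk>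
        \<Longrightarrow> realization \<C> C A \<delta> \<in> sequences \<C> A C // seq_equiv \<C> A C"
    and realization_morphism: "\<lbrakk>conflation \<C> A x B y C \<delta>; conflation \<C> A' x' B' y' C' \<delta>';
        ext_morphism \<C> C A \<delta> C' A' \<delta>' a c\<rbrakk>
        \<Longrightarrow> \<exists>b \<in> carrier (Hom \<C> B B'). comp \<C> A B B' b x = comp \<C> A A' B' x' a \<and>
              comp \<C> B B' C' y' b = comp \<C> B C C' c y"
    and realization_zero: "biproduct \<C> [A, C] S i p
        \<Longrightarrow> (i 0, S, p 1) \<in> realization \<C> C A \<zero>\<^bsub>Ext \<C> C A\<^esub>"
    and realization_sum: "\<lbrakk>conflation \<C> A x B y C \<delta>; conflation \<C> A' x' B' y' C' \<delta>';
        biproduct \<C> [A, A'] SA iA pA; biproduct \<C> [B, B'] SB iB pB;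
        biproduct \<C> [C, C'] SC iC pC\<rbrakk>
        \<Longrightarrow> (comp \<C> SA A SB (comp \<C> A B SB (iB 0) x) (pA 0)
               \<oplus>\<^bsub>Hom \<C> SA SB\<^esub> comp \<C> SA A' SB (comp \<C> A' B' SB (iB 1) x') (pA 1),
             SB,
             comp \<C> SB B SC (comp \<C> B C SC (iC 0) y) (pB 0)
               \<oplus>\<^bsub>Hom \<C> SB SC\<^esub> comp \<C> SB B' SC (comp \<C> B' C' SC (iC 1) y') (pB 1))
            \<in> realization \<C> SC SA
               (ext_push \<C> SC A SA (iA 0) (ext_pull \<C> C SC A (pC 0) \<delta>)
                 \<oplus>\<^bsub>Ext \<C> SC SA\<^esub> ext_push \<C> SC A' SA (iA 1) (ext_pull \<C> C' SC A' (pC 1) \<delta>'))"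
    and ET3: "\<lbrakk>conflation \<C> A x B y C \<delta>; conflation \<C> A' x' B' y' C' \<delta>';
        a \<in> carrier (Hom \<C> A A'); b \<in> carrier (Hom \<C> B B');
        comp \<C> A B B' b x = comp \<C> A A' B' x' a\<rbrakk>
        \<Longrightarrow> \<exists>c. ext_morphism \<C> C A \<delta> C' A' \<delta>' a c \<and> comp \<C> B C C' c y = comp \<C> B B' C' y' b"
    and ET3_op: "\<lbrakk>conflation \<C> A x B y C \<delta>; conflation \<C> A' x' B' y' C' \<delta>';
        b \<in> carrier (Hom \<C> B B'); c \<in> carrier (Hom \<C> C C');
        comp \<C> B C C' c y = comp \<C> B B' C' y' b\<rbrakk>
        \<Longrightarrow> \<exists>a. ext_morphism \<C> C A \<delta> C' A' \<delta>' a c \<and> comp \<C> A B B' b x = comp \<C> A A' B' x' a"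
    and ET4: "\<lbrakk>conflation \<C> A f B f' D \<delta>; conflation \<C> B g C g' F \<delta>'\<rbrakk>
        \<Longrightarrow> \<exists>E h h' d e \<delta>''. conflation \<C> A h C h' E \<delta>'' \<and>
              d \<in> carrier (Hom \<C> D E) \<and> e \<in> carrier (Hom \<C> E F) \<and>
              comp \<C> A B C g f = h \<and>
              comp \<C> B C E h' g = comp \<C> B D E d f' \<and>
              comp \<C> C E F e h' = g' \<and>
              conflation \<C> D d E e F (ext_push \<C> F B D f' \<delta>') \<and>
              ext_pull \<C> E D A d \<delta>'' = \<delta> \<and>
              ext_push \<C> E A B f \<delta>'' = ext_pull \<C> F E B e \<delta>'"
    and ET4_op: "\<lbrakk>conflation \<C> D f' A f B \<delta>; conflation \<C> F g' B g C \<delta>'\<rbrakk>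
        \<Longrightarrow> \<exists>E h h' d e \<delta>''. conflation \<C> E h' A h C \<delta>'' \<and>
              d \<in> carrier (Hom \<C> D E) \<and> e \<in> carrier (Hom \<C> E F) \<and>
              comp \<C> A B C g f = h \<and>
              comp \<C> D E A h' d = f' \<and>
              comp \<C> E A B f h' = comp \<C> E F B g' e \<and>
              conflation \<C> D d E e F (ext_pull \<C> B F D g' \<delta>) \<and>
              ext_push \<C> C E F e \<delta>'' = \<delta>' \<and>
              ext_push \<C> B D E d \<delta> = ext_pull \<C> C B E g \<delta>''"

locale extriangulated_category_neg = extriangulated_category k \<C>
  for k :: "'k ring" and \<C> :: "('k, 'o, 'm, 'e, 'n, 'x) ext_cat_scheme" +
  assumes neg_bifunctor: "additive_bifunctor \<C> (Neg \<C>) (neg_push \<C>) (neg_pull \<C>)"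
    and neg_conn_contra_hom: "\<lbrakk>A \<in> Ob \<C>; C \<in> Ob \<C>; W \<in> Ob \<C>; \<delta> \<in> carrier (Ext \<C> C A)\<rbrakk>
        \<Longrightarrow> neg_conn_contra \<C> C A \<delta> W \<in> hom (add_monoid (Neg \<C> W C)) (add_monoid (Hom \<C> W A))"
    and neg_conn_contra_natural: "\<lbrakk>A \<in> Ob \<C>; C \<in> Ob \<C>; W \<in> Ob \<C>; W' \<in> Ob \<C>;
        \<delta> \<in> carrier (Ext \<C> C A); w \<in> carrier (Hom \<C> W' W); u \<in> carrier (Neg \<C> W C)\<rbrakk>
        \<Longrightarrow> neg_conn_contra \<C> C A \<delta> W' (neg_pull \<C> W W' C w u)
          = comp \<C> W' W A (neg_conn_contra \<C> C A \<delta> W u) w"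
    and neg_conn_cov_hom: "\<lbrakk>A \<in> Ob \<C>; C \<in> Ob \<C>; W \<in> Ob \<C>; \<delta> \<in> carrier (Ext \<C> C A)\<rbrakk>
        \<Longrightarrow> neg_conn_cov \<C> C A \<delta> W \<in> hom (add_monoid (Neg \<C> A W)) (add_monoid (Hom \<C> C W))"
    and neg_conn_cov_natural: "\<lbrakk>A \<in> Ob \<C>; C \<in> Ob \<C>; W \<in> Ob \<C>; W' \<in> Ob \<C>;
        \<delta> \<in> carrier (Ext \<C> C A); w \<in> carrier (Hom \<C> W W'); u \<in> carrier (Neg \<C> A W)\<rbrakk>
        \<Longrightarrow> neg_conn_cov \<C> C A \<delta> W' (neg_push \<C> A W W' w u)
          = comp \<C> C W W' w (neg_conn_cov \<C> C A \<delta> W u)"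
    and exact_cov: "\<lbrakk>conflation \<C> A x B y C \<delta>; W \<in> Ob \<C>\<rbrakk> \<Longrightarrow>
          neg_push \<C> W A B x ` carrier (Neg \<C> W A)
            = a_kernel (Neg \<C> W B) (Neg \<C> W C) (neg_push \<C> W B C y) \<and>
          neg_push \<C> W B C y ` carrier (Neg \<C> W B)
            = a_kernel (Neg \<C> W C) (Hom \<C> W A) (neg_conn_contra \<C> C A \<delta> W) \<and>
          neg_conn_contra \<C> C A \<delta> W ` carrier (Neg \<C> W C)
            = a_kernel (Hom \<C> W A) (Hom \<C> W B) (comp \<C> W A B x)"
    and exact_contra: "\<lbrakk>conflation \<C> A x B y C \<delta>; W \<in> Ob \<C>\<rbrakk> \<Longrightarrow>
          neg_pull \<C> C B W y ` carrier (Neg \<C> C W)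
            = a_kernel (Neg \<C> B W) (Neg \<C> A W) (neg_pull \<C> B A W x) \<and>
          neg_pull \<C> B A W x ` carrier (Neg \<C> B W)
            = a_kernel (Neg \<C> A W) (Hom \<C> C W) (neg_conn_cov \<C> C A \<delta> W) \<and>
          neg_conn_cov \<C> C A \<delta> W ` carrier (Neg \<C> A W)
            = a_kernel (Hom \<C> C W) (Hom \<C> B W) (\<lambda>f. comp \<C> B C W f y)"

section \<open>Mixed bistratifying systems\<close>

definition star :: "('k, 'o, 'm, 'e, 'n, 'x) ext_cat_scheme \<Rightarrow> 'o set \<Rightarrow> 'o set \<Rightarrow> 'o set" where
  "star \<C> \<X> \<Y> = {M. \<exists>X \<in> \<X>. \<exists>Y \<in> \<Y>. \<exists>x y \<delta>. conflation \<C> X x M y Y \<delta>}"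

text \<open>\<open>star_power \<C> \<X> l\<close> has \<open>l + 1\<close> factors.  Bracketing does not matter, since the operation
  \<open>star\<close> is associative in an extriangulated category.\<close>

fun star_power :: "('k, 'o, 'm, 'e, 'n, 'x) ext_cat_scheme \<Rightarrow> 'o set \<Rightarrow> nat \<Rightarrow> 'o set" where
  "star_power \<C> \<X> 0 = \<X>"
| "star_power \<C> \<X> (Suc l) = star \<C> \<X> (star_power \<C> \<X> l)"

definition filt :: "('k, 'o, 'm, 'e, 'n, 'x) ext_cat_scheme \<Rightarrow> 'o \<Rightarrow> 'o set" where
  "filt \<C> M = (\<Union>l. star_power \<C> (add_closure \<C> M) l)"

definition brick :: "('k, 'o, 'm, 'x) lin_cat_scheme \<Rightarrow> 'o \<Rightarrow> bool" where
  "brick \<C> M \<longleftrightarrow> M \<in> Ob \<C> \<and> skew_field (EndAlg \<C> M)"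

definition stone :: "('k, 'o, 'm, 'e, 'n, 'x) ext_cat_scheme \<Rightarrow> 'o \<Rightarrow> bool" where
  "stone \<C> M \<longleftrightarrow> indecomposable \<C> M \<and> trivial_group (Ext \<C> M M)"

definition mixed_base :: "('k, 'o, 'm, 'e, 'n, 'x) ext_cat_scheme \<Rightarrow> 'o list \<Rightarrow> bool" where
  "mixed_base \<C> \<Theta> \<longleftrightarrow> (\<forall>X \<in> set \<Theta>. brick \<C> X \<or> stone \<C> X) \<and>
     (\<forall>i < length \<Theta>. \<forall>j < i. trivial_group (Hom \<C> (\<Theta> ! i) (\<Theta> ! j))) \<and>
     trivial_group (Neg \<C> (dsum \<C> \<Theta>) (dsum \<C> \<Theta>))"

text \<open>Ordered sets are lists; list positions start at \<open>0\<close>, so that \<open>drop i \<Theta>\<close> starts with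
  the entry \<open>\<Theta> ! i\<close> and \<open>take (Suc i) \<Theta>\<close> ends with it.\<close>

definition mixed_stratifying ::
  "('k, 'o, 'm, 'e, 'n, 'x) ext_cat_scheme \<Rightarrow> 'o list \<Rightarrow> 'o list \<Rightarrow> bool" where
  "mixed_stratifying \<C> \<Theta> P \<longleftrightarrow> mixed_base \<C> \<Theta> \<and> length P = length \<Theta> \<and>
     (\<forall>X \<in> set P. indecomposable \<C> X) \<and>
     (\<forall>i < length \<Theta>.
        (\<exists>K \<in> filt \<C> (dsum \<C> (drop i \<Theta>)). \<exists>x y \<delta>. conflation \<C> K x (P ! i) y (\<Theta> ! i) \<delta>) \<and>
        (\<forall>X \<in> filt \<C> (dsum \<C> \<Theta>). trivial_group (Ext \<C> (P ! i) X)))"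

definition mixed_costratifying ::
  "('k, 'o, 'm, 'e, 'n, 'x) ext_cat_scheme \<Rightarrow> 'o list \<Rightarrow> 'o list \<Rightarrow> bool" where
  "mixed_costratifying \<C> \<Theta> I \<longleftrightarrow> mixed_base \<C> \<Theta> \<and> length I = length \<Theta> \<and>
     (\<forall>X \<in> set I. indecomposable \<C> X) \<and>
     (\<forall>i < length \<Theta>.
        (\<exists>C \<in> filt \<C> (dsum \<C> (take (Suc i) \<Theta>)). \<exists>x y \<delta>. conflation \<C> (\<Theta> ! i) x (I ! i) y C \<delta>) \<and>
        (\<forall>X \<in> filt \<C> (dsum \<C> \<Theta>). trivial_group (Ext \<C> X (I ! i))))"

definition mixed_bistratifying ::
  "('k, 'o, 'm, 'e, 'n, 'x) ext_cat_scheme \<Rightarrow> 'o list \<Rightarrow> 'o list \<Rightarrow> 'o list \<Rightarrow> bool" where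
  "mixed_bistratifying \<C> \<Theta> P I \<longleftrightarrow> mixed_stratifying \<C> \<Theta> P \<and> mixed_costratifying \<C> \<Theta> I"

section \<open>Finitely generated modules over a finite dimensional algebra\<close>

text \<open>The carriers of the modules considered live in one fixed type, which has to contain a copy
  of every finite dimensional right module over an algebra with elements of type \<open>'a\<close> over a
  field with elements of type \<open>'k\<close>: coordinate vectors are lists \<open>Inr v\<close>.  The first
  summand accommodates the algebra itself and the Hom spaces of the category it comes from.\<close>

type_synonym ('k, 'a) elt = "'a + 'k list"
type_synonym ('k, 'a) rmod = "('a, ('k, 'a) elt) module"
type_synonym ('k, 'a) rmap = "('k, 'a) elt \<Rightarrow> ('k, 'a) elt"

definition mod_Ob :: "('k, 'a) module \<Rightarrow> ('k, 'a) rmod set" where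
  "mod_Ob A = {M. right_module A M \<and> fin_gen A M}"

definition mod_Hom ::
  "('k, 'a) module \<Rightarrow> ('k, 'a) rmod \<Rightarrow> ('k, 'a) rmod \<Rightarrow> ('k, ('k, 'a) rmap) module" where
  "mod_Hom A M N = \<lparr>carrier = rhom A M N, mult = undefined, one = undefined,
     zero = (\<lambda>x \<in> carrier M. \<zero>\<^bsub>N\<^esub>),
     add = (\<lambda>f g. \<lambda>x \<in> carrier M. f x \<oplus>\<^bsub>N\<^esub> g x),
     smult = (\<lambda>c f. \<lambda>x \<in> carrier M. (c \<odot>\<^bsub>A\<^esub> \<one>\<^bsub>A\<^esub>) \<odot>\<^bsub>N\<^esub> f x)\<rparr>"

definition projective :: "('k, 'a) module \<Rightarrow> ('k, 'a) rmod \<Rightarrow> bool" where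
  "projective A Q \<longleftrightarrow> Q \<in> mod_Ob A \<and>
     (\<forall>M \<in> mod_Ob A. \<forall>N \<in> mod_Ob A. \<forall>g \<in> rhom A M N. \<forall>f \<in> rhom A Q N.
        g ` carrier M = carrier N \<longrightarrow> (\<exists>h \<in> rhom A Q M. compose (carrier Q) g h = f))"

text \<open>\<open>d 0\<close> is the augmentation from \<open>Q 0\<close> to \<open>M\<close>, and \<open>d (Suc n)\<close> goes from \<open>Q (Suc n)\<close> to
  \<open>Q n\<close>.\<close>

definition proj_resolution ::
  "('k, 'a) module \<Rightarrow> ('k, 'a) rmod \<Rightarrow> (nat \<Rightarrow> ('k, 'a) rmod) \<Rightarrow> (nat \<Rightarrow> ('k, 'a) rmap) \<Rightarrow> bool" where
  "proj_resolution A M Q d \<longleftrightarrow> (\<forall>n. projective A (Q n)) \<and>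
     d 0 \<in> rhom A (Q 0) M \<and> d 0 ` carrier (Q 0) = carrier M \<and>
     (\<forall>n. d (Suc n) \<in> rhom A (Q (Suc n)) (Q n)) \<and>
     d 1 ` carrier (Q 1) = a_kernel (Q 0) M (d 0) \<and>
     (\<forall>n. d (Suc (Suc n)) ` carrier (Q (Suc (Suc n))) = a_kernel (Q (Suc n)) (Q n) (d (Suc n)))"

definition chosen_resolution ::
  "('k, 'a) module \<Rightarrow> ('k, 'a) rmod \<Rightarrow> (nat \<Rightarrow> ('k, 'a) rmod) \<times> (nat \<Rightarrow> ('k, 'a) rmap)" where
  "chosen_resolution A M = (SOME (Q, d). proj_resolution A M Q d)"

definition res_mod :: "('k, 'a) module \<Rightarrow> ('k, 'a) rmod \<Rightarrow> nat \<Rightarrow> ('k, 'a) rmod" where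
  "res_mod A M = fst (chosen_resolution A M)"

definition res_map :: "('k, 'a) module \<Rightarrow> ('k, 'a) rmod \<Rightarrow> nat \<Rightarrow> ('k, 'a) rmap" where
  "res_map A M = snd (chosen_resolution A M)"

definition cocycles ::
  "('k, 'a) module \<Rightarrow> nat \<Rightarrow> ('k, 'a) rmod \<Rightarrow> ('k, 'a) rmod \<Rightarrow> ('k, 'a) rmap set" where
  "cocycles A n M N = {f \<in> rhom A (res_mod A M n) N.
     \<forall>x \<in> carrier (res_mod A M (Suc n)). f (res_map A M (Suc n) x) = \<zero>\<^bsub>N\<^esub>}"

fun coboundaries ::
  "('k, 'a) module \<Rightarrow> nat \<Rightarrow> ('k, 'a) rmod \<Rightarrow> ('k, 'a) rmod \<Rightarrow> ('k, 'a) rmap set" where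
  "coboundaries A 0 M N = {\<zero>\<^bsub>mod_Hom A (res_mod A M 0) N\<^esub>}"
| "coboundaries A (Suc n) M N =
     {compose (carrier (res_mod A M (Suc n))) g (res_map A M (Suc n)) |
       g. g \<in> rhom A (res_mod A M n) N}"

definition ext_class ::
  "('k, 'a) module \<Rightarrow> nat \<Rightarrow> ('k, 'a) rmod \<Rightarrow> ('k, 'a) rmod \<Rightarrow> ('k, 'a) rmap \<Rightarrow> ('k, 'a) rmap set" where
  "ext_class A n M N f = coboundaries A n M N +>\<^bsub>mod_Hom A (res_mod A M n) N\<^esub> f"

definition mod_Ext ::
  "('k, 'a) module \<Rightarrow> nat \<Rightarrow> ('k, 'a) rmod \<Rightarrow> ('k, 'a) rmod \<Rightarrow> ('k, 'a) rmap set ring" where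
  "mod_Ext A n M N = \<lparr>carrier = ext_class A n M N ` cocycles A n M N,
     mult = undefined, one = undefined,
     zero = coboundaries A n M N,
     add = (\<lambda>X Y. X <+>\<^bsub>mod_Hom A (res_mod A M n) N\<^esub> Y)\<rparr>"

text \<open>The classes in each of the following unions coincide: they do not depend on the cocycle or on the lifts \<open>c0\<close>, \<open>c1\<close>.\<close>

definition mod_ext_push ::
  "('k, 'a) module \<Rightarrow> ('k, 'a) rmod \<Rightarrow> ('k, 'a) rmod \<Rightarrow> ('k, 'a) rmod \<Rightarrow> ('k, 'a) rmap
    \<Rightarrow> ('k, 'a) rmap set \<Rightarrow> ('k, 'a) rmap set" where
  "mod_ext_push A M N N' a X =
     (\<Union>f \<in> X. ext_class A 1 M N' (compose (carrier (res_mod A M 1)) a f))"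

definition mod_ext_pull ::
  "('k, 'a) module \<Rightarrow> ('k, 'a) rmod \<Rightarrow> ('k, 'a) rmod \<Rightarrow> ('k, 'a) rmod \<Rightarrow> ('k, 'a) rmap
    \<Rightarrow> ('k, 'a) rmap set \<Rightarrow> ('k, 'a) rmap set" where
  "mod_ext_pull A M M' N c X =
     \<Union>{ext_class A 1 M' N (compose (carrier (res_mod A M' 1)) f c1) | f c0 c1. f \<in> X \<and>
         c0 \<in> rhom A (res_mod A M' 0) (res_mod A M 0) \<and>
         c1 \<in> rhom A (res_mod A M' 1) (res_mod A M 1) \<and>
         compose (carrier (res_mod A M' 0)) (res_map A M 0) c0
           = compose (carrier (res_mod A M' 0)) c (res_map A M' 0) \<and>
         compose (carrier (res_mod A M' 1)) (res_map A M 1) c1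
           = compose (carrier (res_mod A M' 1)) c0 (res_map A M' 1)}"

definition mod_short_exact ::
  "('k, 'a) module \<Rightarrow> ('k, 'a) rmod \<Rightarrow> ('k, 'a) rmap \<Rightarrow> ('k, 'a) rmod \<Rightarrow> ('k, 'a) rmap
    \<Rightarrow> ('k, 'a) rmod \<Rightarrow> bool" where
  "mod_short_exact A N x E y M \<longleftrightarrow> N \<in> mod_Ob A \<and> E \<in> mod_Ob A \<and> M \<in> mod_Ob A \<and>
     x \<in> rhom A N E \<and> y \<in> rhom A E M \<and> inj_on x (carrier N) \<and>
     x ` carrier N = a_kernel E M y \<and> y ` carrier E = carrier M"

text \<open>A short exact sequence realizes the class of the cocycle that is induced on \<open>Q 1\<close> by
  a lift of the augmentation \<open>Q 0 \<longrightarrow> M\<close> to the middle term.\<close>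

definition mod_realization ::
  "('k, 'a) module \<Rightarrow> ('k, 'a) rmod \<Rightarrow> ('k, 'a) rmod \<Rightarrow> ('k, 'a) rmap set
    \<Rightarrow> (('k, 'a) rmap \<times> ('k, 'a) rmod \<times> ('k, 'a) rmap) set" where
  "mod_realization A M N X = {(x, E, y). mod_short_exact A N x E y M \<and>
     (\<exists>f \<in> X. \<exists>h \<in> rhom A (res_mod A M 0) E.
        compose (carrier (res_mod A M 0)) y h = res_map A M 0 \<and>
        compose (carrier (res_mod A M 1)) x f
          = compose (carrier (res_mod A M 1)) h (res_map A M 1))}"

definition mod_cat ::
  "('k, 'a) module \<Rightarrow> ('k, ('k, 'a) rmod, ('k, 'a) rmap, ('k, 'a) rmap set, unit) ext_cat" where
  "mod_cat A = \<lparr>Ob = mod_Ob A, Hom = mod_Hom A,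
     ident = (\<lambda>M. \<lambda>x \<in> carrier M. x),
     comp = (\<lambda>X Y Z g f. compose (carrier X) g f),
     Ext = mod_Ext A 1,
     ext_push = mod_ext_push A,
     ext_pull = mod_ext_pull A,
     realization = mod_realization A,
     Neg = (\<lambda>M N. \<lparr>carrier = UNIV, mult = undefined, one = undefined,
              zero = (), add = (\<lambda>u v. ())\<rparr>),
     neg_push = (\<lambda>W M N f u. ()),
     neg_pull = (\<lambda>M M' W f u. ()),
     neg_conn_contra = (\<lambda>M N X W u. \<zero>\<^bsub>mod_Hom A W N\<^esub>),
     neg_conn_cov = (\<lambda>M N X W u. \<zero>\<^bsub>mod_Hom A M W\<^esub>)\<rparr>"

definition regular_module :: "('k, 'a) module \<Rightarrow> ('k, 'a) rmod" where
  "regular_module A = \<lparr>carrier = Inl ` carrier A, mult = undefined, one = undefined,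
     zero = Inl \<zero>\<^bsub>A\<^esub>, add = (\<lambda>u v. Inl (projl u \<oplus>\<^bsub>A\<^esub> projl v)),
     smult = (\<lambda>a u. Inl (projl u \<otimes>\<^bsub>A\<^esub> a))\<rparr>"

text \<open>\<open>D 0\<close> is the regular module and \<open>D (Suc i)\<close> is the module usually called \<open>W\<^sup>i\<close>; the map \<open>f i\<close>
  goes from \<open>D i\<close> to \<open>D (Suc i)\<close>, and \<open>q\<close> exhibits \<open>L\<close> as its cokernel.\<close>

definition wakamatsu_tilting :: "('k, 'a) module \<Rightarrow> ('k, 'a) rmod \<Rightarrow> bool" where
  "wakamatsu_tilting A W \<longleftrightarrow> W \<in> mod_Ob A \<and>
     (\<forall>i \<ge> 1. trivial_group (mod_Ext A i W W)) \<and>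
     (\<exists>D f. D 0 = regular_module A \<and> (\<forall>i. D (Suc i) \<in> add_closure (mod_cat A) W) \<and>
        (\<forall>i. f i \<in> rhom A (D i) (D (Suc i))) \<and>
        inj_on (f 0) (carrier (D 0)) \<and>
        (\<forall>i. f i ` carrier (D i) = a_kernel (D (Suc i)) (D (Suc (Suc i))) (f (Suc i))) \<and>
        (\<forall>i. \<exists>L \<in> mod_Ob A. \<exists>q \<in> rhom A (D (Suc i)) L.
           q ` carrier (D (Suc i)) = carrier L \<and>
           a_kernel (D (Suc i)) L q = f i ` carrier (D i) \<and>
           (\<forall>j \<ge> 1. trivial_group (mod_Ext A j L W))))"

section \<open>Hom functors\<close>

text \<open>The covariant functor \<open>Hom \<C> Q _\<close> to right modules over \<open>EndAlg \<C> Q\<close>, on objects and on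
  morphisms.\<close>

definition cov_hom :: "('k, 'o, 'm, 'x) lin_cat_scheme \<Rightarrow> 'o \<Rightarrow> 'o \<Rightarrow> ('k, 'm) rmod" where
  "cov_hom \<C> Q X = \<lparr>carrier = Inl ` carrier (Hom \<C> Q X), mult = undefined, one = undefined,
     zero = Inl \<zero>\<^bsub>Hom \<C> Q X\<^esub>, add = (\<lambda>u v. Inl (projl u \<oplus>\<^bsub>Hom \<C> Q X\<^esub> projl v)),
     smult = (\<lambda>b u. Inl (comp \<C> Q Q X (projl u) b))\<rparr>"

definition cov_hom_map ::
  "('k, 'o, 'm, 'x) lin_cat_scheme \<Rightarrow> 'o \<Rightarrow> 'o \<Rightarrow> 'o \<Rightarrow> 'm \<Rightarrow> ('k, 'm) rmap" where
  "cov_hom_map \<C> Q X Y f = (\<lambda>u \<in> Inl ` carrier (Hom \<C> Q X). Inl (comp \<C> Q X Y f (projl u)))"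

text \<open>The contravariant functor \<open>Hom \<C> _ J\<close> to right modules over \<open>opp (EndAlg \<C> J)\<close>.\<close>

definition contra_hom :: "('k, 'o, 'm, 'x) lin_cat_scheme \<Rightarrow> 'o \<Rightarrow> 'o \<Rightarrow> ('k, 'm) rmod" where
  "contra_hom \<C> J X = \<lparr>carrier = Inl ` carrier (Hom \<C> X J), mult = undefined, one = undefined,
     zero = Inl \<zero>\<^bsub>Hom \<C> X J\<^esub>, add = (\<lambda>u v. Inl (projl u \<oplus>\<^bsub>Hom \<C> X J\<^esub> projl v)),
     smult = (\<lambda>c u. Inl (comp \<C> X J J c (projl u)))\<rparr>"

definition contra_hom_map ::
  "('k, 'o, 'm, 'x) lin_cat_scheme \<Rightarrow> 'o \<Rightarrow> 'o \<Rightarrow> 'o \<Rightarrow> 'm \<Rightarrow> ('k, 'm) rmap" where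
  "contra_hom_map \<C> J X Y f = (\<lambda>u \<in> Inl ` carrier (Hom \<C> Y J). Inl (comp \<C> X Y J (projl u) f))"

text \<open>The effect of a contravariant functor on an ordered set: the order is reversed.\<close>

definition contra_map :: "('a \<Rightarrow> 'b) \<Rightarrow> 'a list \<Rightarrow> 'b list" where
  "contra_map F Xs = rev (map F Xs)"

end

theory Submission
  imports Defs "HOL-Combinatorics.List_Permutation"
begin

text \<open>
  Part (1) is part (2) for the opposite category with the order reversed, so only (2) needs an
  argument. The class \<open>\<F>(\<Theta>)\<close> is closed under extensions and has no negative first
  extensions; by a horseshoe argument \<open>add \<bbbP>\<close> provides enough projectives for it, and dually
  \<open>add \<bbbI>\<close> provides enough injectives. Hence \<open>\<Psi> = \<C>(\<bbbP>, -)\<close> is exact and fully faithful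
  on \<open>\<F>(\<Theta>)\<close> and sends pairs with \<open>\<bbbE>(M, N) = 0\<close> to pairs with vanishing \<open>Ext\<^sup>1\<close>, so it
  carries the bistratifying system to one in \<open>mod B\<close>. Dimension shifting along \<open>add \<bbbP>\<close>-covers
  kills the higher extension groups into \<open>\<Psi>(\<bbbI>)\<close>, and \<open>\<Psi>\<close> turns an \<open>add \<bbbI>\<close>-coresolution
  of \<open>\<bbbP>\<close> into the coresolution of \<open>B\<close> required of a Wakamatsu tilting module. The statements on
  duality and on endomorphism algebras are full faithfulness again.
\<close>

section \<open>Preadditive categories\<close>

text \<open>Exactness of \<Psi> is not automatic: in an extriangulated category inflations need not
  be monic and deflations need not be epic. Vanishing of \<open>Neg\<close> on the filtered objects
  restores both cancellation properties. On the module side \<open>Ext\<close> is computed from a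
  chosen resolution, and all carriers live in one fixed type, in which kernels are at hand but
  direct sums of arbitrary modules are not. Hence \<open>mod_cat B\<close> is treated only as a
  preadditive category. Vanishing of \<open>Ext\<^sup>1\<close> becomes an extension property for
  homomorphisms defined on kernels, conflations of modules are used through the mere existence of a
  class, and stable retracts, expressed by maps alone, take the place of Schanuel's lemma. A module
  filtered by the images of \<Theta> need not be literally of the form \<open>\<Psi> M\<close>, so
  vanishing for such modules is propagated inside \<open>mod B\<close> along short exact sequences.
  Covers consist of full copies of \<bbbP> and not of summands: their images are then free
  \<open>B\<close>-modules with an explicit basis.\<close>

lemma (in abelian_group) idem_zero:
  assumes "x \<in> carrier G" "x \<oplus> x = x"
  shows "x = \<zero>"
  using assms by (metis l_zero local.add.right_cancel zero_closed)

text \<open>Hom groups without scalars and without existence of direct sums: the common ground of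
  \<C> and of \<open>mod_cat A\<close>, so that the calculus of biproducts is developed once for
  both.\<close>

locale preadditive =
  fixes \<C> :: "('k, 'o, 'm, 'x) lin_cat_scheme"
  assumes Hom_group: "\<lbrakk>X \<in> Ob \<C>; Y \<in> Ob \<C>\<rbrakk> \<Longrightarrow> abelian_group (Hom \<C> X Y)"
    and Id_in: "X \<in> Ob \<C> \<Longrightarrow> ident \<C> X \<in> carrier (Hom \<C> X X)"
    and cmp_in: "\<lbrakk>X \<in> Ob \<C>; Y \<in> Ob \<C>; Z \<in> Ob \<C>; f \<in> carrier (Hom \<C> X Y);
        g \<in> carrier (Hom \<C> Y Z)\<rbrakk> \<Longrightarrow> comp \<C> X Y Z g f \<in> carrier (Hom \<C> X Z)"
    and cmp_Id_left: "\<lbrakk>X \<in> Ob \<C>; Y \<in> Ob \<C>; f \<in> carrier (Hom \<C> X Y)\<rbrakk>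
        \<Longrightarrow> comp \<C> X Y Y (ident \<C> Y) f = f"
    and cmp_Id_right: "\<lbrakk>X \<in> Ob \<C>; Y \<in> Ob \<C>; f \<in> carrier (Hom \<C> X Y)\<rbrakk>
        \<Longrightarrow> comp \<C> X X Y f (ident \<C> X) = f"
    and cmp_assoc: "\<lbrakk>W \<in> Ob \<C>; X \<in> Ob \<C>; Y \<in> Ob \<C>; Z \<in> Ob \<C>; f \<in> carrier (Hom \<C> W X);
        g \<in> carrier (Hom \<C> X Y); h \<in> carrier (Hom \<C> Y Z)\<rbrakk>
        \<Longrightarrow> comp \<C> W X Z (comp \<C> X Y Z h g) f = comp \<C> W Y Z h (comp \<C> W X Y g f)"
    and cmp_add_left: "\<lbrakk>X \<in> Ob \<C>; Y \<in> Ob \<C>; Z \<in> Ob \<C>; f \<in> carrier (Hom \<C> X Y);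
        g \<in> carrier (Hom \<C> Y Z); g' \<in> carrier (Hom \<C> Y Z)\<rbrakk>
        \<Longrightarrow> comp \<C> X Y Z (g \<oplus>\<^bsub>Hom \<C> Y Z\<^esub> g') f
          = comp \<C> X Y Z g f \<oplus>\<^bsub>Hom \<C> X Z\<^esub> comp \<C> X Y Z g' f"
    and cmp_add_right: "\<lbrakk>X \<in> Ob \<C>; Y \<in> Ob \<C>; Z \<in> Ob \<C>; f \<in> carrier (Hom \<C> X Y);
        f' \<in> carrier (Hom \<C> X Y); g \<in> carrier (Hom \<C> Y Z)\<rbrakk>
        \<Longrightarrow> comp \<C> X Y Z g (f \<oplus>\<^bsub>Hom \<C> X Y\<^esub> f')
          = comp \<C> X Y Z g f \<oplus>\<^bsub>Hom \<C> X Z\<^esub> comp \<C> X Y Z g f'"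

sublocale linear_category \<subseteq> preadditive \<C>
proof (rule preadditive.intro, goal_cases)
  case (1 X Y)
  then show ?case using Hom_module[of X Y] unfolding module_def by blast
qed (simp_all add: ident_closed comp_closed comp_ident_left comp_ident_right comp_assoc
  comp_add_left comp_add_right)

context preadditive
begin

abbreviation Mor where "Mor X Y \<equiv> carrier (Hom \<C> X Y)"
abbreviation Z0 where "Z0 X Y \<equiv> \<zero>\<^bsub>Hom \<C> X Y\<^esub>"

lemmas [simp, intro] = Id_in cmp_in
lemmas [simp] = cmp_Id_left cmp_Id_right cmp_add_left cmp_add_right

lemma zero_in [simp, intro]: "\<lbrakk>X \<in> Ob \<C>; Y \<in> Ob \<C>\<rbrakk> \<Longrightarrow> Z0 X Y \<in> Mor X Y"
  using Hom_group abelian_groupE(2) by blast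

lemma add_in [simp, intro]: "\<lbrakk>X \<in> Ob \<C>; Y \<in> Ob \<C>; f \<in> Mor X Y; g \<in> Mor X Y\<rbrakk>
    \<Longrightarrow> f \<oplus>\<^bsub>Hom \<C> X Y\<^esub> g \<in> Mor X Y"
  by (meson Hom_group abelian_groupE(1))

lemma uminus_in [simp, intro]: "\<lbrakk>X \<in> Ob \<C>; Y \<in> Ob \<C>; f \<in> Mor X Y\<rbrakk> \<Longrightarrow> \<ominus>\<^bsub>Hom \<C> X Y\<^esub> f \<in> Mor X Y"
  by (meson Hom_group abelian_group.a_inv_closed)

lemma add_zero [simp]: "\<lbrakk>X \<in> Ob \<C>; Y \<in> Ob \<C>; f \<in> Mor X Y\<rbrakk> \<Longrightarrow> f \<oplus>\<^bsub>Hom \<C> X Y\<^esub> Z0 X Y = f"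
  "\<lbrakk>X \<in> Ob \<C>; Y \<in> Ob \<C>; f \<in> Mor X Y\<rbrakk> \<Longrightarrow> Z0 X Y \<oplus>\<^bsub>Hom \<C> X Y\<^esub> f = f"
  using Hom_group[of X Y] by (simp_all add: abelian_group.axioms(1) abelian_monoid.l_zero abelian_monoid.r_zero)

lemma add_uminus [simp]: "\<lbrakk>X \<in> Ob \<C>; Y \<in> Ob \<C>; f \<in> Mor X Y\<rbrakk> \<Longrightarrow> f \<oplus>\<^bsub>Hom \<C> X Y\<^esub> (\<ominus>\<^bsub>Hom \<C> X Y\<^esub> f) = Z0 X Y"
  "\<lbrakk>X \<in> Ob \<C>; Y \<in> Ob \<C>; f \<in> Mor X Y\<rbrakk> \<Longrightarrow> (\<ominus>\<^bsub>Hom \<C> X Y\<^esub> f) \<oplus>\<^bsub>Hom \<C> X Y\<^esub> f = Z0 X Y"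
  using Hom_group[of X Y] by (simp_all add: abelian_group.r_neg abelian_group.l_neg)

lemma cmp_zero_left [simp]:
  assumes "X \<in> Ob \<C>" "Y \<in> Ob \<C>" "Z \<in> Ob \<C>" "f \<in> Mor X Y"
  shows "comp \<C> X Y Z (Z0 Y Z) f = Z0 X Z"
proof (rule abelian_group.idem_zero[OF Hom_group])
  show "comp \<C> X Y Z (Z0 Y Z) f \<oplus>\<^bsub>Hom \<C> X Z\<^esub> comp \<C> X Y Z (Z0 Y Z) f = comp \<C> X Y Z (Z0 Y Z) f"
    using cmp_add_left[OF assms zero_in zero_in] assms by (simp del: cmp_add_left)
qed (use assms in auto)

lemma cmp_zero_right [simp]:
  assumes "X \<in> Ob \<C>" "Y \<in> Ob \<C>" "Z \<in> Ob \<C>" "g \<in> Mor Y Z"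
  shows "comp \<C> X Y Z g (Z0 X Y) = Z0 X Z"
proof (rule abelian_group.idem_zero[OF Hom_group])
  show "comp \<C> X Y Z g (Z0 X Y) \<oplus>\<^bsub>Hom \<C> X Z\<^esub> comp \<C> X Y Z g (Z0 X Y) = comp \<C> X Y Z g (Z0 X Y)"
    using cmp_add_right[OF assms(1-3) zero_in zero_in assms(4)] assms by (simp del: cmp_add_right)
qed (use assms in auto)

lemma uminus_eqI:
  assumes "X \<in> Ob \<C>" "Y \<in> Ob \<C>" "f \<in> Mor X Y" "g \<in> Mor X Y" "f \<oplus>\<^bsub>Hom \<C> X Y\<^esub> g = Z0 X Y"
  shows "f = \<ominus>\<^bsub>Hom \<C> X Y\<^esub> g"
proof -
  interpret abelian_group "Hom \<C> X Y" using assms Hom_group by auto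
  show ?thesis using assms minus_equality by metis
qed

lemma cmp_uminus_left [simp]:
  assumes "X \<in> Ob \<C>" "Y \<in> Ob \<C>" "Z \<in> Ob \<C>" "f \<in> Mor X Y" "g \<in> Mor Y Z"
  shows "comp \<C> X Y Z (\<ominus>\<^bsub>Hom \<C> Y Z\<^esub> g) f = \<ominus>\<^bsub>Hom \<C> X Z\<^esub> comp \<C> X Y Z g f"
proof (rule uminus_eqI)
  show "comp \<C> X Y Z (\<ominus>\<^bsub>Hom \<C> Y Z\<^esub> g) f \<oplus>\<^bsub>Hom \<C> X Z\<^esub> comp \<C> X Y Z g f = Z0 X Z"
    using assms cmp_add_left[of X Y Z f "\<ominus>\<^bsub>Hom \<C> Y Z\<^esub> g" g] by (simp del: cmp_add_left)
qed (use assms in auto)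

lemma cmp_uminus_right [simp]:
  assumes "X \<in> Ob \<C>" "Y \<in> Ob \<C>" "Z \<in> Ob \<C>" "f \<in> Mor X Y" "g \<in> Mor Y Z"
  shows "comp \<C> X Y Z g (\<ominus>\<^bsub>Hom \<C> X Y\<^esub> f) = \<ominus>\<^bsub>Hom \<C> X Z\<^esub> comp \<C> X Y Z g f"
proof (rule uminus_eqI)
  show "comp \<C> X Y Z g (\<ominus>\<^bsub>Hom \<C> X Y\<^esub> f) \<oplus>\<^bsub>Hom \<C> X Z\<^esub> comp \<C> X Y Z g f = Z0 X Z"
    using assms cmp_add_right[of X Y Z "\<ominus>\<^bsub>Hom \<C> X Y\<^esub> f" f g] by (simp del: cmp_add_right)
qed (use assms in auto)

lemma finsum_in [intro]:
  assumes "X \<in> Ob \<C>" "Y \<in> Ob \<C>" "\<And>a. a \<in> A \<Longrightarrow> f a \<in> Mor X Y"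
  shows "finsum (Hom \<C> X Y) f A \<in> Mor X Y"
proof -
  interpret abelian_group "Hom \<C> X Y" using assms Hom_group by auto
  show ?thesis using assms by (intro finsum_closed) auto
qed

lemma cmp_finsum_left:
  assumes "finite A" "X \<in> Ob \<C>" "Y \<in> Ob \<C>" "Z \<in> Ob \<C>" "f \<in> Mor X Y" "\<And>a. a \<in> A \<Longrightarrow> g a \<in> Mor Y Z"
  shows "comp \<C> X Y Z (finsum (Hom \<C> Y Z) g A) f = finsum (Hom \<C> X Z) (\<lambda>a. comp \<C> X Y Z (g a) f) A"
proof -
  interpret a: abelian_group "Hom \<C> Y Z" using assms Hom_group by auto
  interpret b: abelian_group "Hom \<C> X Z" using assms Hom_group by auto
  show ?thesis using assms(1,6)
  proof (induction A)
    case empty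
    then show ?case using assms by simp
  next
    case (insert x F)
    have 1: "finsum (Hom \<C> Y Z) g (insert x F) = g x \<oplus>\<^bsub>Hom \<C> Y Z\<^esub> finsum (Hom \<C> Y Z) g F"
      using insert by (intro a.finsum_insert) auto
    have 2: "finsum (Hom \<C> X Z) (\<lambda>a. comp \<C> X Y Z (g a) f) (insert x F)
        = comp \<C> X Y Z (g x) f \<oplus>\<^bsub>Hom \<C> X Z\<^esub> finsum (Hom \<C> X Z) (\<lambda>a. comp \<C> X Y Z (g a) f) F"
      using insert assms(2-5) by (intro b.finsum_insert) auto
    have 3: "finsum (Hom \<C> Y Z) g F \<in> Mor Y Z" using insert assms(2-5) by auto
    show ?case unfolding 1 2 using insert assms(2-5) 3 by simp
  qed
qed

lemma cmp_finsum_right: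
  assumes "finite A" "X \<in> Ob \<C>" "Y \<in> Ob \<C>" "Z \<in> Ob \<C>" "f \<in> Mor Y Z" "\<And>a. a \<in> A \<Longrightarrow> g a \<in> Mor X Y"
  shows "comp \<C> X Y Z f (finsum (Hom \<C> X Y) g A) = finsum (Hom \<C> X Z) (\<lambda>a. comp \<C> X Y Z f (g a)) A"
proof -
  interpret a: abelian_group "Hom \<C> X Y" using assms Hom_group by auto
  interpret b: abelian_group "Hom \<C> X Z" using assms Hom_group by auto
  show ?thesis using assms(1,6)
  proof (induction A)
    case empty
    then show ?case using assms by simp
  next
    case (insert x F)
    have 1: "finsum (Hom \<C> X Y) g (insert x F) = g x \<oplus>\<^bsub>Hom \<C> X Y\<^esub> finsum (Hom \<C> X Y) g F"
      using insert by (intro a.finsum_insert) auto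
    have 2: "finsum (Hom \<C> X Z) (\<lambda>a. comp \<C> X Y Z f (g a)) (insert x F)
        = comp \<C> X Y Z f (g x) \<oplus>\<^bsub>Hom \<C> X Z\<^esub> finsum (Hom \<C> X Z) (\<lambda>a. comp \<C> X Y Z f (g a)) F"
      using insert assms(2-5) by (intro b.finsum_insert) auto
    have 3: "finsum (Hom \<C> X Y) g F \<in> Mor X Y" using insert assms(2-5) by auto
    show ?case unfolding 1 2 using insert assms(2-5) 3 by simp
  qed
qed

lemma finsum_delta:
  assumes "X \<in> Ob \<C>" "Y \<in> Ob \<C>" "f \<in> Mor X Y" "s < (n::nat)"
    "\<And>r. r < n \<Longrightarrow> g r = (if r = s then f else Z0 X Y)"
  shows "finsum (Hom \<C> X Y) g {..<n} = f"
proof -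
  interpret abelian_group "Hom \<C> X Y" using assms Hom_group by auto
  have "finsum (Hom \<C> X Y) g {..<n} = finsum (Hom \<C> X Y) (\<lambda>r. if s = r then f else Z0 X Y) {..<n}"
    using assms by (intro finsum_cong') auto
  also have "\<dots> = f" using assms by (intro add.finprod_singleton[of s "{..<n}" "\<lambda>_. f"]) auto
  finally show ?thesis .
qed

lemma finsum_lessThan_add:
  assumes "X \<in> Ob \<C>" "Y \<in> Ob \<C>" "\<And>r. r < n + m \<Longrightarrow> g r \<in> Mor X Y"
  shows "finsum (Hom \<C> X Y) g {..<n + (m::nat)} =
    finsum (Hom \<C> X Y) g {..<n} \<oplus>\<^bsub>Hom \<C> X Y\<^esub> finsum (Hom \<C> X Y) (\<lambda>r. g (n + r)) {..<m}"
proof -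
  interpret abelian_group "Hom \<C> X Y" using assms Hom_group by auto
  show ?thesis using assms(3)
  proof (induction m)
    case 0
    then show ?case by (auto intro!: r_zero[symmetric] finsum_closed)
  next
    case (Suc m)
    have a: "finsum (Hom \<C> X Y) g {..<n + Suc m} = g (n + m) \<oplus>\<^bsub>Hom \<C> X Y\<^esub> finsum (Hom \<C> X Y) g {..<n + m}"
      unfolding add_Suc_right lessThan_Suc using Suc.prems by (intro finsum_insert) auto
    have b: "finsum (Hom \<C> X Y) (\<lambda>r. g (n + r)) {..<Suc m}
        = g (n + m) \<oplus>\<^bsub>Hom \<C> X Y\<^esub> finsum (Hom \<C> X Y) (\<lambda>r. g (n + r)) {..<m}"
      unfolding lessThan_Suc using Suc.prems by (intro finsum_insert) auto
    have "finsum (Hom \<C> X Y) g {..<n} \<in> Mor X Y" "finsum (Hom \<C> X Y) (\<lambda>r. g (n + r)) {..<m} \<in> Mor X Y"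
      using Suc.prems by (auto intro!: finsum_closed)
    then show ?case unfolding a b using Suc by (simp add: a_lcomm)
  qed
qed

section \<open>Isomorphisms, biproducts and zero objects\<close>

lemma cat_iso_Id [simp]: "X \<in> Ob \<C> \<Longrightarrow> cat_iso \<C> X X (ident \<C> X)"
  unfolding cat_iso_def using Id_in cmp_Id_left by blast

definition isoc :: "'o \<Rightarrow> 'o \<Rightarrow> bool" where
  "isoc X Y \<longleftrightarrow> X \<in> Ob \<C> \<and> Y \<in> Ob \<C> \<and> (\<exists>f. cat_iso \<C> X Y f)"

lemma isocE:
  assumes "isoc X Y"
  obtains f g where "X \<in> Ob \<C>" "Y \<in> Ob \<C>" "f \<in> Mor X Y" "g \<in> Mor Y X"
    "comp \<C> X Y X g f = ident \<C> X" "comp \<C> Y X Y f g = ident \<C> Y"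
  using assms unfolding isoc_def cat_iso_def by blast

lemma isocI:
  assumes "X \<in> Ob \<C>" "Y \<in> Ob \<C>" "f \<in> Mor X Y" "g \<in> Mor Y X"
    "comp \<C> X Y X g f = ident \<C> X" "comp \<C> Y X Y f g = ident \<C> Y"
  shows "isoc X Y"
  using assms unfolding isoc_def cat_iso_def by blast

lemma isoc_refl [simp]: "X \<in> Ob \<C> \<Longrightarrow> isoc X X"
  unfolding isoc_def using cat_iso_Id by blast

lemma isoc_sym: "isoc X Y \<Longrightarrow> isoc Y X"
  by (auto elim!: isocE intro: isocI)

lemma biproductD:
  assumes "biproduct \<C> Xs S i p"
  shows "S \<in> Ob \<C>" "r < length Xs \<Longrightarrow> Xs ! r \<in> Ob \<C>" "r < length Xs \<Longrightarrow> i r \<in> Mor (Xs ! r) S"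
    "r < length Xs \<Longrightarrow> p r \<in> Mor S (Xs ! r)"
    "\<lbrakk>r < length Xs; s < length Xs\<rbrakk> \<Longrightarrow> comp \<C> (Xs ! r) S (Xs ! s) (p s) (i r) =
        (if r = s then ident \<C> (Xs ! r) else Z0 (Xs ! r) (Xs ! s))"
    "finsum (Hom \<C> S S) (\<lambda>r. comp \<C> S (Xs ! r) S (i r) (p r)) {..<length Xs} = ident \<C> S"
  using assms unfolding biproduct_def by (auto simp: subset_iff)

lemma direct_sum_Ob: "direct_sum \<C> Xs S \<Longrightarrow> S \<in> Ob \<C>" "direct_sum \<C> Xs S \<Longrightarrow> set Xs \<subseteq> Ob \<C>"
  unfolding direct_sum_def biproduct_def by auto

lemma biproduct_expand_left:
  assumes b: "biproduct \<C> Xs S i p" and "Y \<in> Ob \<C>" "f \<in> Mor S Y"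
  shows "f = finsum (Hom \<C> S Y) (\<lambda>r. comp \<C> S (Xs ! r) Y (comp \<C> (Xs ! r) S Y f (i r)) (p r)) {..<length Xs}"
proof -
  note [simp] = biproductD[OF b]
  have "f = comp \<C> S S Y f (ident \<C> S)" using assms by simp
  also have "\<dots> = finsum (Hom \<C> S Y) (\<lambda>r. comp \<C> S S Y f (comp \<C> S (Xs ! r) S (i r) (p r))) {..<length Xs}"
    unfolding biproductD(6)[OF b, symmetric] using assms by (subst cmp_finsum_right) auto
  also have "\<dots> = finsum (Hom \<C> S Y) (\<lambda>r. comp \<C> S (Xs ! r) Y (comp \<C> (Xs ! r) S Y f (i r)) (p r)) {..<length Xs}"
    using assms abelian_group.axioms(1)[OF Hom_group, of S Y]
    by (intro abelian_monoid.finsum_cong') (auto simp: cmp_assoc)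
  finally show ?thesis .
qed

text \<open>The identity of \<open>S\<close> is the sum of the composites \<open>i r\<close> after
  \<open>p r\<close>, so a map out of \<open>S\<close> is recovered from its components.\<close>

lemma biproduct_eqI_left:
  assumes b: "biproduct \<C> Xs S i p" and "Y \<in> Ob \<C>" "f \<in> Mor S Y" "g \<in> Mor S Y"
    and eq: "\<And>r. r < length Xs \<Longrightarrow> comp \<C> (Xs ! r) S Y f (i r) = comp \<C> (Xs ! r) S Y g (i r)"
  shows "f = g"
proof -
  note [simp] = biproductD[OF b]
  have "finsum (Hom \<C> S Y) (\<lambda>r. comp \<C> S (Xs ! r) Y (comp \<C> (Xs ! r) S Y f (i r)) (p r)) {..<length Xs}
    = finsum (Hom \<C> S Y) (\<lambda>r. comp \<C> S (Xs ! r) Y (comp \<C> (Xs ! r) S Y g (i r)) (p r)) {..<length Xs}"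
    using assms abelian_group.axioms(1)[OF Hom_group, of S Y] eq
    by (intro abelian_monoid.finsum_cong') auto
  then show ?thesis
    using biproduct_expand_left[OF b assms(2,3)] biproduct_expand_left[OF b assms(2,4)] by simp
qed

lemma biproduct_copair:
  assumes b: "biproduct \<C> Xs S i p" and "Y \<in> Ob \<C>" and m: "\<And>r. r < length Xs \<Longrightarrow> m r \<in> Mor (Xs ! r) Y"
  obtains f where "f \<in> Mor S Y" "\<And>r. r < length Xs \<Longrightarrow> comp \<C> (Xs ! r) S Y f (i r) = m r"
proof
  note [simp] = biproductD[OF b]
  let ?f = "finsum (Hom \<C> S Y) (\<lambda>r. comp \<C> S (Xs ! r) Y (m r) (p r)) {..<length Xs}"
  show "?f \<in> Mor S Y" using assms by auto
  fix s assume s: "s < length Xs"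
  have "comp \<C> (Xs ! s) S Y ?f (i s)
    = finsum (Hom \<C> (Xs ! s) Y) (\<lambda>r. comp \<C> (Xs ! s) S Y (comp \<C> S (Xs ! r) Y (m r) (p r)) (i s)) {..<length Xs}"
    using assms s by (subst cmp_finsum_left) auto
  also have "\<dots> = m s"
    using assms s by (intro finsum_delta[of _ _ _ s]) (auto simp: cmp_assoc)
  finally show "comp \<C> (Xs ! s) S Y ?f (i s) = m s" .
qed

text \<open>Copairing each family of injections over the other sum gives mutually inverse maps,
  because both composites fix all injections.\<close>

lemma direct_sum_unique:
  assumes "direct_sum \<C> Xs S" "direct_sum \<C> Xs T"
  shows "isoc S T"
proof -
  obtain i p where b: "biproduct \<C> Xs S i p" using assms(1) direct_sum_def by metis
  obtain j q where c: "biproduct \<C> Xs T j q" using assms(2) direct_sum_def by metis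
  note [simp] = biproductD(1-4)[OF b] biproductD(1-4)[OF c]
  obtain f where f: "f \<in> Mor S T" "\<And>r. r < length Xs \<Longrightarrow> comp \<C> (Xs ! r) S T f (i r) = j r"
    using biproduct_copair[OF b, of T j] by auto
  obtain g where g: "g \<in> Mor T S" "\<And>r. r < length Xs \<Longrightarrow> comp \<C> (Xs ! r) T S g (j r) = i r"
    using biproduct_copair[OF c, of S i] by auto
  have "comp \<C> S T S g f = ident \<C> S"
    by (rule biproduct_eqI_left[OF b]) (use f g in \<open>auto simp: cmp_assoc\<close>)
  moreover have "comp \<C> T S T f g = ident \<C> T"
    by (rule biproduct_eqI_left[OF c]) (use f g in \<open>auto simp: cmp_assoc\<close>)
  ultimately show ?thesis using f g by (intro isocI[of S T f g]) auto
qed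

lemma biproduct_iso:
  assumes b: "biproduct \<C> Xs S i p" and "T \<in> Ob \<C>" "f \<in> Mor S T" "g \<in> Mor T S"
    "comp \<C> S T S g f = ident \<C> S" "comp \<C> T S T f g = ident \<C> T"
  shows "biproduct \<C> Xs T (\<lambda>r. comp \<C> (Xs ! r) S T f (i r)) (\<lambda>r. comp \<C> T S (Xs ! r) (p r) g)"
proof -
  note [simp] = biproductD[OF b] assms(2-6)
  have "ident \<C> T = comp \<C> T S T f (comp \<C> T S S (ident \<C> S) g)" by simp
  also have "\<dots> = finsum (Hom \<C> T T) (\<lambda>r. comp \<C> T S T f (comp \<C> T S S (comp \<C> S (Xs ! r) S (i r) (p r)) g)) {..<length Xs}"
    unfolding biproductD(6)[OF b, symmetric]
    by (subst cmp_finsum_left, auto)+ (subst cmp_finsum_right, auto)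
  also have "\<dots> = finsum (Hom \<C> T T) (\<lambda>r. comp \<C> T (Xs ! r) T (comp \<C> (Xs ! r) S T f (i r)) (comp \<C> T S (Xs ! r) (p r) g)) {..<length Xs}"
    using abelian_group.axioms(1)[OF Hom_group, of T T]
    by (intro abelian_monoid.finsum_cong') (auto simp: cmp_assoc)
  finally have e: "ident \<C> T = \<dots>" .
  have d: "comp \<C> (Xs ! r) T (Xs ! s) (comp \<C> T S (Xs ! s) (p s) g) (comp \<C> (Xs ! r) S T f (i r))
      = (if r = s then ident \<C> (Xs ! r) else Z0 (Xs ! r) (Xs ! s))"
    if "r < length Xs" "s < length Xs" for r s
  proof -
    have "comp \<C> (Xs ! r) T (Xs ! s) (comp \<C> T S (Xs ! s) (p s) g) (comp \<C> (Xs ! r) S T f (i r))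
      = comp \<C> (Xs ! r) S (Xs ! s) (p s) (comp \<C> (Xs ! r) S S (comp \<C> S T S g f) (i r))"
      using that by (simp add: cmp_assoc del: assms(5))
    then show ?thesis using that by simp
  qed
  show ?thesis using b e d unfolding biproduct_def by auto
qed

lemma direct_sum_isoc: "\<lbrakk>direct_sum \<C> Xs S; isoc S T\<rbrakk> \<Longrightarrow> direct_sum \<C> Xs T"
  unfolding direct_sum_def by (elim exE isocE) (rule exI, rule exI, rule biproduct_iso)

lemma direct_sum_list_isoc:
  assumes "direct_sum \<C> Xs S" "list_all2 isoc Xs Ys"
  shows "direct_sum \<C> Ys S"
proof -
  obtain i p where b: "biproduct \<C> Xs S i p" using assms(1) direct_sum_def by metis
  note [simp] = biproductD[OF b]
  have l: "length Ys = length Xs" using assms(2) list_all2_lengthD by force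
  have "\<forall>r. \<exists>f g. r < length Xs \<longrightarrow> f \<in> Mor (Xs ! r) (Ys ! r) \<and> g \<in> Mor (Ys ! r) (Xs ! r) \<and>
     comp \<C> (Xs ! r) (Ys ! r) (Xs ! r) g f = ident \<C> (Xs ! r) \<and>
     comp \<C> (Ys ! r) (Xs ! r) (Ys ! r) f g = ident \<C> (Ys ! r)"
    using list_all2_nthD[OF assms(2)] by (metis isocE)
  then obtain f g where fg [simp]: "\<And>r. r < length Xs \<Longrightarrow> f r \<in> Mor (Xs ! r) (Ys ! r)"
    "\<And>r. r < length Xs \<Longrightarrow> g r \<in> Mor (Ys ! r) (Xs ! r)"
    "\<And>r. r < length Xs \<Longrightarrow> comp \<C> (Xs ! r) (Ys ! r) (Xs ! r) (g r) (f r) = ident \<C> (Xs ! r)"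
    "\<And>r. r < length Xs \<Longrightarrow> comp \<C> (Ys ! r) (Xs ! r) (Ys ! r) (f r) (g r) = ident \<C> (Ys ! r)"
    by metis
  have Y [simp]: "r < length Xs \<Longrightarrow> Ys ! r \<in> Ob \<C>" for r
    using list_all2_nthD[OF assms(2)] by (auto simp: isoc_def)
  have 1: "comp \<C> (Ys ! r) S (Ys ! s) (comp \<C> S (Xs ! s) (Ys ! s) (f s) (p s)) (comp \<C> (Ys ! r) (Xs ! r) S (i r) (g r))
      = (if r = s then ident \<C> (Ys ! r) else Z0 (Ys ! r) (Ys ! s))"
    if "r < length Xs" "s < length Xs" for r s
  proof -
    have "comp \<C> (Ys ! r) S (Ys ! s) (comp \<C> S (Xs ! s) (Ys ! s) (f s) (p s)) (comp \<C> (Ys ! r) (Xs ! r) S (i r) (g r))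
      = comp \<C> (Ys ! r) (Xs ! s) (Ys ! s) (f s) (comp \<C> (Ys ! r) (Xs ! r) (Xs ! s) (comp \<C> (Xs ! r) S (Xs ! s) (p s) (i r)) (g r))"
      using that by (simp add: cmp_assoc del: biproductD(5)[OF b])
    then show ?thesis using that by auto
  qed
  have 2: "comp \<C> S (Ys ! r) S (comp \<C> (Ys ! r) (Xs ! r) S (i r) (g r)) (comp \<C> S (Xs ! r) (Ys ! r) (f r) (p r))
     = comp \<C> S (Xs ! r) S (i r) (p r)" if "r < length Xs" for r
  proof -
    have "comp \<C> S (Ys ! r) S (comp \<C> (Ys ! r) (Xs ! r) S (i r) (g r)) (comp \<C> S (Xs ! r) (Ys ! r) (f r) (p r))
     = comp \<C> S (Xs ! r) S (i r) (comp \<C> S (Xs ! r) (Xs ! r) (comp \<C> (Xs ! r) (Ys ! r) (Xs ! r) (g r) (f r)) (p r))"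
      using that by (simp add: cmp_assoc del: fg(3))
    then show ?thesis using that by simp
  qed
  have 3: "ident \<C> S = finsum (Hom \<C> S S) (\<lambda>r. comp \<C> S (Ys ! r) S (comp \<C> (Ys ! r) (Xs ! r) S (i r) (g r))
      (comp \<C> S (Xs ! r) (Ys ! r) (f r) (p r))) {..<length Xs}"
    unfolding biproductD(6)[OF b, symmetric] using abelian_group.axioms(1)[OF Hom_group, of S S]
    by (intro abelian_monoid.finsum_cong') (auto simp: 2)
  have 4: "set Ys \<subseteq> Ob \<C>" using Y l by (metis in_set_conv_nth subsetI)
  have "biproduct \<C> Ys S (\<lambda>r. comp \<C> (Ys ! r) (Xs ! r) S (i r) (g r)) (\<lambda>r. comp \<C> S (Xs ! r) (Ys ! r) (f r) (p r))"
    unfolding biproduct_def l using 1 3 4 by auto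
  then show ?thesis unfolding direct_sum_def by blast
qed

text \<open>A permutation reindexes the sum that expresses the identity. This serves twice: ordered
  sets are reversed in the opposite category, and summands are regrouped when complements are
  formed.\<close>

lemma direct_sum_perm:
  assumes "direct_sum \<C> Xs S" "mset Xs = mset Ys"
  shows "direct_sum \<C> Ys S"
proof -
  obtain i p where b: "biproduct \<C> Xs S i p" using assms(1) direct_sum_def by metis
  note [simp] = biproductD[OF b]
  obtain \<pi> where pi: "\<pi> permutes {..<length Xs}" "permute_list \<pi> Xs = Ys"
    using mset_eq_permutation[OF assms(2)[symmetric]] by auto
  have l: "length Ys = length Xs" using pi by auto
  have Y: "Ys ! r = Xs ! \<pi> r" if "r < length Xs" for r using pi that permute_list_nth by blast
  have in_: "\<pi> r < length Xs" if "r < length Xs" for r using pi that permutes_in_image by fastforce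
  have inj: "\<pi> r = \<pi> s \<longleftrightarrow> r = s" for r s using pi permutes_inj by (metis injD)
  interpret a: abelian_group "Hom \<C> S S" using Hom_group by auto
  have "ident \<C> S = finsum (Hom \<C> S S) (\<lambda>r. comp \<C> S (Xs ! r) S (i r) (p r)) (\<pi> ` {..<length Xs})"
    using b pi by (simp add: permutes_image)
  also have "\<dots> = finsum (Hom \<C> S S) (\<lambda>r. comp \<C> S (Xs ! \<pi> r) S (i (\<pi> r)) (p (\<pi> r))) {..<length Xs}"
    using in_ by (subst a.add.finprod_reindex[folded finsum_def]) (auto simp: inj inj_on_def)
  also have "\<dots> = finsum (Hom \<C> S S) (\<lambda>r. comp \<C> S (Ys ! r) S (i (\<pi> r)) (p (\<pi> r))) {..<length Xs}"
    using in_ by (intro a.finsum_cong') (auto simp: Y)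
  finally have "ident \<C> S = \<dots>" .
  moreover have "set Ys \<subseteq> Ob \<C>" using direct_sum_Ob(2)[OF assms(1)] mset_eq_setD[OF assms(2)] by simp
  ultimately have "biproduct \<C> Ys S (i \<circ> \<pi>) (p \<circ> \<pi>)"
    unfolding biproduct_def l by (auto simp: Y in_ inj)
  then show ?thesis unfolding direct_sum_def by blast
qed

text \<open>The two-term case of \<open>biproduct\<close> with all four maps named and the sum
  written out, which spares the index functions on \<open>nat\<close>.\<close>

definition bip where
  "bip X Y S i j p q \<longleftrightarrow> X \<in> Ob \<C> \<and> Y \<in> Ob \<C> \<and> S \<in> Ob \<C> \<and> i \<in> Mor X S \<and> j \<in> Mor Y S \<and>
     p \<in> Mor S X \<and> q \<in> Mor S Y \<and> comp \<C> X S X p i = ident \<C> X \<and> comp \<C> Y S Y q j = ident \<C> Y \<and>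
     comp \<C> X S Y q i = Z0 X Y \<and> comp \<C> Y S X p j = Z0 Y X \<and>
     comp \<C> S X S i p \<oplus>\<^bsub>Hom \<C> S S\<^esub> comp \<C> S Y S j q = ident \<C> S"

lemma bipD:
  assumes "bip X Y S i j p q"
  shows "X \<in> Ob \<C>" "Y \<in> Ob \<C>" "S \<in> Ob \<C>" "i \<in> Mor X S" "j \<in> Mor Y S"
     "p \<in> Mor S X" "q \<in> Mor S Y" "comp \<C> X S X p i = ident \<C> X" "comp \<C> Y S Y q j = ident \<C> Y"
     "comp \<C> X S Y q i = Z0 X Y" "comp \<C> Y S X p j = Z0 Y X"
     "comp \<C> S X S i p \<oplus>\<^bsub>Hom \<C> S S\<^esub> comp \<C> S Y S j q = ident \<C> S"
  using assms by (auto simp: bip_def)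

lemma finsum_two:
  assumes "X \<in> Ob \<C>" "Y \<in> Ob \<C>" "g 0 \<in> Mor X Y" "g 1 \<in> Mor X Y"
  shows "finsum (Hom \<C> X Y) g {..<Suc (Suc 0)} = g 0 \<oplus>\<^bsub>Hom \<C> X Y\<^esub> g 1"
proof -
  interpret abelian_group "Hom \<C> X Y" using assms Hom_group by auto
  show ?thesis using assms by (simp add: lessThan_Suc a_comm)
qed

lemma biproduct_pair: "biproduct \<C> [X, Y] S i p \<longleftrightarrow> bip X Y S (i 0) (i 1) (p 0) (p 1)"
proof
  assume b: "biproduct \<C> [X, Y] S i p"
  then have *: "X \<in> Ob \<C>" "Y \<in> Ob \<C>" "S \<in> Ob \<C>" by (auto simp: biproduct_def)
  have 0: "i 0 \<in> Mor X S" "p 0 \<in> Mor S X" "i 1 \<in> Mor Y S" "p 1 \<in> Mor S Y"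
    using biproductD(3,4)[OF b, of 0] biproductD(3,4)[OF b, of 1] by auto
  have "finsum (Hom \<C> S S) (\<lambda>r. comp \<C> S ([X,Y] ! r) S (i r) (p r)) {..<Suc (Suc 0)}
     = comp \<C> S X S (i 0) (p 0) \<oplus>\<^bsub>Hom \<C> S S\<^esub> comp \<C> S Y S (i 1) (p 1)"
    using * 0 by (subst finsum_two) auto
  then show "bip X Y S (i 0) (i 1) (p 0) (p 1)"
    using * 0 biproductD(6)[OF b] biproductD(5)[OF b, of 0 0] biproductD(5)[OF b, of 0 1]
      biproductD(5)[OF b, of 1 0] biproductD(5)[OF b, of 1 1]
    unfolding bip_def by auto
next
  assume b: "bip X Y S (i 0) (i 1) (p 0) (p 1)"
  note [simp] = bipD[OF b]
  have *: "finsum (Hom \<C> S S) (\<lambda>r. comp \<C> S ([X,Y] ! r) S (i r) (p r)) {..<Suc (Suc 0)} = ident \<C> S"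
    by (subst finsum_two) (auto simp del: One_nat_def)
  have 2: "r < 2 \<longleftrightarrow> r = 0 \<or> r = 1" for r :: nat by auto
  show "biproduct \<C> [X, Y] S i p"
    unfolding biproduct_def by (auto simp: * 2 less_Suc_eq simp del: One_nat_def, simp_all add: One_nat_def[symmetric] del: One_nat_def)
qed

lemma direct_sum_pair: "direct_sum \<C> [X, Y] S \<longleftrightarrow> (\<exists>i j p q. bip X Y S i j p q)"
proof
  assume "\<exists>i j p q. bip X Y S i j p q"
  then obtain i j p q where b: "bip X Y S i j p q" by auto
  have "biproduct \<C> [X, Y] S (\<lambda>r. if r = 0 then i else j) (\<lambda>r. if r = 0 then p else q)"
    unfolding biproduct_pair using b by simp
  then show "direct_sum \<C> [X, Y] S" unfolding direct_sum_def by blast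
next
  assume "direct_sum \<C> [X, Y] S"
  then show "\<exists>i j p q. bip X Y S i j p q" unfolding direct_sum_def biproduct_pair by blast
qed

lemma bip_swap: 
  assumes "bip X Y S i j p q" shows "bip Y X S j i q p"
proof -
  note [simp] = bipD(1-11)[OF assms]
  have "comp \<C> S Y S j q \<oplus>\<^bsub>Hom \<C> S S\<^esub> comp \<C> S X S i p = ident \<C> S"
    using bipD(12)[OF assms] Hom_group[of S S]
    by (metis abelian_groupE(4) bipD(1-7)[OF assms] cmp_in)
  then show ?thesis unfolding bip_def by simp
qed

text \<open>Every map into or out of \<open>X\<close> factors through the identity of
  \<open>X\<close>, so it vanishes when the identity does.\<close>

lemma zero_object_iff: "zero_object \<C> X \<longleftrightarrow> X \<in> Ob \<C> \<and> ident \<C> X = Z0 X X"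
proof
  assume "zero_object \<C> X"
  then show "X \<in> Ob \<C> \<and> ident \<C> X = Z0 X X"
    unfolding zero_object_def trivial_group_def using Id_in by blast
next
  assume a: "X \<in> Ob \<C> \<and> ident \<C> X = Z0 X X"
  have "f = Z0 X Y" if "f \<in> Mor X Y" "Y \<in> Ob \<C>" for f Y
    using that a cmp_zero_right[of X X Y f] cmp_Id_right[of X Y f] by simp
  moreover have "f = Z0 Y X" if "f \<in> Mor Y X" "Y \<in> Ob \<C>" for f Y
    using that a cmp_zero_left[of Y X X f] cmp_Id_left[of Y X f] by simp
  ultimately show "zero_object \<C> X" unfolding zero_object_def trivial_group_def using a by blast
qed

lemma direct_sum_Nil: "direct_sum \<C> [] S \<longleftrightarrow> zero_object \<C> S"
proof (cases "S \<in> Ob \<C>")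
  case True
  then interpret a: abelian_group "Hom \<C> S S" using Hom_group by auto
  show ?thesis using True unfolding zero_object_iff direct_sum_def biproduct_def by auto
next
  case False
  then show ?thesis unfolding zero_object_iff direct_sum_def biproduct_def by auto
qed

lemma direct_sum_single: "X \<in> Ob \<C> \<Longrightarrow> direct_sum \<C> [X] X"
proof -
  assume X: "X \<in> Ob \<C>"
  interpret a: abelian_group "Hom \<C> X X" using X Hom_group by auto
  have "biproduct \<C> [X] X (\<lambda>_. ident \<C> X) (\<lambda>_. ident \<C> X)"
    using X unfolding biproduct_def by (auto simp: lessThan_Suc)
  then show ?thesis unfolding direct_sum_def by blast
qed

lemma bip_zero_right:
  assumes "X \<in> Ob \<C>" "zero_object \<C> Z"
  shows "bip X Z X (ident \<C> X) (Z0 Z X) (ident \<C> X) (Z0 X Z)"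
  using assms by (auto simp: bip_def zero_object_iff)

lemma bip_zero_left:
  assumes "X \<in> Ob \<C>" "zero_object \<C> Z"
  shows "bip Z X X (Z0 Z X) (ident \<C> X) (Z0 X Z) (ident \<C> X)"
  using assms by (auto simp: bip_def zero_object_iff)

lemma direct_sum_append:
  assumes "direct_sum \<C> Xs S" "direct_sum \<C> Ys T" "direct_sum \<C> [S, T] U"
  shows "direct_sum \<C> (Xs @ Ys) U"
proof -
  obtain i p where b: "biproduct \<C> Xs S i p" using assms(1) direct_sum_def by metis
  obtain j q where c: "biproduct \<C> Ys T j q" using assms(2) direct_sum_def by metis
  obtain a1 a2 b1 b2 where d: "bip S T U a1 a2 b1 b2" using assms(3) direct_sum_pair by metis
  note [simp] = biproductD(1-5)[OF b] biproductD(1-5)[OF c] bipD[OF d]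
  let ?n = "length Xs" let ?m = "length Ys"
  \<comment> \<open>The first \<open>?n\<close> indices belong to \<open>Xs\<close>, the others to
    \<open>Ys\<close> after a shift by \<open>?n\<close>; each injection of the list is followed by
    an injection of the two-term sum \<open>U\<close>.\<close>
  define ii where "ii r = (if r < ?n then comp \<C> (Xs ! r) S U a1 (i r) else comp \<C> (Ys ! (r - ?n)) T U a2 (j (r - ?n)))" for r
  define pp where "pp r = (if r < ?n then comp \<C> U S (Xs ! r) (p r) b1 else comp \<C> U T (Ys ! (r - ?n)) (q (r - ?n)) b2)" for r
  have pre: "comp \<C> V U S b1 (comp \<C> V S U a1 f) = f" "comp \<C> V U T b2 (comp \<C> V S U a1 f) = Z0 V T"
    if "V \<in> Ob \<C>" "f \<in> Mor V S" for V f
    using that by (simp_all add: cmp_assoc[symmetric])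
  have pre2: "comp \<C> V U T b2 (comp \<C> V T U a2 f) = f" "comp \<C> V U S b1 (comp \<C> V T U a2 f) = Z0 V S"
    if "V \<in> Ob \<C>" "f \<in> Mor V T" for V f
    using that by (simp_all add: cmp_assoc[symmetric])
  have "ident \<C> U = comp \<C> U S U a1 (comp \<C> U S S (ident \<C> S) b1) \<oplus>\<^bsub>Hom \<C> U U\<^esub> comp \<C> U T U a2 (comp \<C> U T T (ident \<C> T) b2)"
    by simp
  also have "comp \<C> U S U a1 (comp \<C> U S S (ident \<C> S) b1) = 
     finsum (Hom \<C> U U) (\<lambda>r. comp \<C> U S U a1 (comp \<C> U S S (comp \<C> S (Xs ! r) S (i r) (p r)) b1)) {..<?n}"
    unfolding biproductD(6)[OF b, symmetric]
    by (subst cmp_finsum_left, auto)+ (subst cmp_finsum_right, auto)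
  also have "\<dots> = finsum (Hom \<C> U U) (\<lambda>r. comp \<C> U ((Xs @ Ys) ! r) U (ii r) (pp r)) {..<?n}"
    using abelian_group.axioms(1)[OF Hom_group, of U U]
    by (intro abelian_monoid.finsum_cong') (auto simp: cmp_assoc ii_def pp_def nth_append)
  also have "comp \<C> U T U a2 (comp \<C> U T T (ident \<C> T) b2) = 
     finsum (Hom \<C> U U) (\<lambda>r. comp \<C> U T U a2 (comp \<C> U T T (comp \<C> T (Ys ! r) T (j r) (q r)) b2)) {..<?m}"
    unfolding biproductD(6)[OF c, symmetric]
    by (subst cmp_finsum_left, auto)+ (subst cmp_finsum_right, auto)
  also have "\<dots> = finsum (Hom \<C> U U) (\<lambda>r. comp \<C> U ((Xs @ Ys) ! (?n + r)) U (ii (?n + r)) (pp (?n + r))) {..<?m}"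
    using abelian_group.axioms(1)[OF Hom_group, of U U]
    by (intro abelian_monoid.finsum_cong') (auto simp: cmp_assoc ii_def pp_def nth_append)
  finally have e: "ident \<C> U = finsum (Hom \<C> U U) (\<lambda>r. comp \<C> U ((Xs @ Ys) ! r) U (ii r) (pp r)) {..<length (Xs @ Ys)}"
    by (simp, subst finsum_lessThan_add) (auto simp: ii_def pp_def nth_append not_less less_diff_conv2 add.commute)
  have sub: "s - ?n < ?m" if "\<not> s < ?n" "s < ?n + ?m" for s using that by auto
  have "biproduct \<C> (Xs @ Ys) U ii pp"
    unfolding biproduct_def using e direct_sum_Ob(2)[OF assms(1)] direct_sum_Ob(2)[OF assms(2)]
    by (auto simp: ii_def pp_def nth_append cmp_assoc pre pre2 sub)
  then show ?thesis unfolding direct_sum_def by blast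
qed

section \<open>Additive closures and regrouping of direct sums\<close>

lemma add_closure_Ob: "X \<in> add_closure \<C> M \<Longrightarrow> X \<in> Ob \<C>"
  unfolding add_closure_def using direct_sum_Ob(2) by fastforce

lemma add_closure_isoc:
  assumes "isoc M N"
  shows "add_closure \<C> M = add_closure \<C> N"
proof -
  have "direct_sum \<C> (replicate n M) S \<longleftrightarrow> direct_sum \<C> (replicate n N) S" for n S
    using direct_sum_list_isoc[of "replicate n M" S "replicate n N"]
      direct_sum_list_isoc[of "replicate n N" S "replicate n M"] assms isoc_sym
    by (auto simp: list_all2_conv_all_nth)
  then show ?thesis unfolding add_closure_def by simp
qed

end

context additive_linear_category
begin

text \<open>Converse to \<open>direct_sum_append\<close>: some sum \<open>V\<close> of
  \<open>S\<close> and \<open>T\<close> exists, it is also a sum of \<open>Xs @ Ys\<close> and hence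
  isomorphic to \<open>U\<close>, and the decomposition is carried over.\<close>

lemma direct_sum_group:
  assumes "direct_sum \<C> (Xs @ Ys) U" "direct_sum \<C> Xs S" "direct_sum \<C> Ys T"
  shows "direct_sum \<C> [S, T] U"
proof -
  obtain V where V: "direct_sum \<C> [S, T] V"
    using direct_sum_exists[of "[S, T]"] assms direct_sum_Ob(1) by auto
  then have "isoc V U" using direct_sum_append[OF assms(2,3) V] assms(1) direct_sum_unique by blast
  with V show ?thesis using direct_sum_isoc by blast
qed

lemma bip_exists:
  assumes "X \<in> Ob \<C>" "Y \<in> Ob \<C>"
  obtains S i j p q where "bip X Y S i j p q"
  using direct_sum_exists[of "[X, Y]"] assms direct_sum_pair by auto

lemma zero_object_exists: obtains Z where "zero_object \<C> Z"
  using direct_sum_exists[of "[]"] direct_sum_Nil by auto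

lemma direct_sum_Cons:
  assumes "direct_sum \<C> (X # Xs) S"
  obtains T i j p q where "direct_sum \<C> Xs T" "bip X T S i j p q"
proof -
  obtain T where T: "direct_sum \<C> Xs T" using direct_sum_exists direct_sum_Ob(2)[OF assms] by auto
  then have "direct_sum \<C> [X, T] S"
    using direct_sum_group[of "[X]" Xs S X T] assms direct_sum_single direct_sum_Ob(2)[OF assms] by auto
  with T that show ?thesis using direct_sum_pair by auto
qed

lemma dsum_direct_sum: "set Xs \<subseteq> Ob \<C> \<Longrightarrow> direct_sum \<C> Xs (dsum \<C> Xs)"
  unfolding dsum_def using direct_sum_exists by (metis someI_ex)

text \<open>Induction on \<open>n\<close>: the sum of \<open>M\<close>, \<open>M'\<close>,
  \<open>S1\<close>, \<open>T1\<close> is regrouped into \<open>S\<close>, made of \<open>M\<close>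
  and \<open>S1\<close>, and a complement made of \<open>M'\<close> and \<open>T1\<close>.\<close>

lemma replicate_summand:
  assumes M: "direct_sum \<C> [M, M'] N"
  shows "direct_sum \<C> (replicate n M) S \<Longrightarrow>
    \<exists>T U. direct_sum \<C> (replicate n N) U \<and> direct_sum \<C> [S, T] U"
proof (induction n arbitrary: S)
  case 0
  then have "bip S S S (ident \<C> S) (Z0 S S) (ident \<C> S) (Z0 S S)"
    using bip_zero_right[of S S] by (simp add: direct_sum_Nil zero_object_iff)
  then have "direct_sum \<C> [S, S] S" unfolding direct_sum_pair by blast
  with 0 show ?case by auto
next
  case (Suc n)
  have ob: "M \<in> Ob \<C>" "M' \<in> Ob \<C>" "N \<in> Ob \<C>" using direct_sum_Ob[OF M] by auto
  obtain S1 where S1: "direct_sum \<C> (replicate n M) S1" "direct_sum \<C> [M, S1] S"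
    using direct_sum_Cons[of M "replicate n M" S] Suc.prems direct_sum_pair by (metis replicate_Suc)
  obtain T1 U1 where U1: "direct_sum \<C> (replicate n N) U1" "direct_sum \<C> [S1, T1] U1"
    using Suc.IH[OF S1(1)] by auto
  have ob2: "S1 \<in> Ob \<C>" "T1 \<in> Ob \<C>" "U1 \<in> Ob \<C>" using direct_sum_Ob[OF U1(2)] by auto
  obtain U where U: "direct_sum \<C> [N, U1] U" using direct_sum_exists[of "[N, U1]"] ob ob2 by auto
  have "direct_sum \<C> ([M, M'] @ [S1, T1]) U" using direct_sum_append[OF M U1(2) U] .
  then have p: "direct_sum \<C> ([M, S1] @ [M', T1]) U" by (rule direct_sum_perm) simp
  obtain T where T: "direct_sum \<C> [M', T1] T" using direct_sum_exists[of "[M', T1]"] ob ob2 by auto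
  have "direct_sum \<C> [S, T] U" using direct_sum_group[OF p S1(2) T] .
  moreover have "direct_sum \<C> (replicate (Suc n) N) U"
    using direct_sum_append[OF direct_sum_single[OF ob(3)] U1(1) U] by simp
  ultimately show ?case by blast
qed

text \<open>\<open>X\<close> is a summand of a power of \<open>M\<close>, which is a summand of the
  same power of \<open>N\<close>; the two complements are merged into one.\<close>

lemma add_closure_summand:
  assumes M: "direct_sum \<C> [M, M'] N"
  shows "add_closure \<C> M \<subseteq> add_closure \<C> N"
proof
  fix X assume "X \<in> add_closure \<C> M"
  then obtain n S Y where S: "direct_sum \<C> (replicate n M) S" "direct_sum \<C> [X, Y] S"
    unfolding add_closure_def by auto
  obtain T U where U: "direct_sum \<C> (replicate n N) U" "direct_sum \<C> [S, T] U"
    using replicate_summand[OF M S(1)] by auto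
  have ob: "X \<in> Ob \<C>" "Y \<in> Ob \<C>" "T \<in> Ob \<C>"
    using direct_sum_Ob(2)[OF S(2)] direct_sum_Ob(2)[OF U(2)] by auto
  have "direct_sum \<C> ([X] @ [Y, T]) U"
    using direct_sum_append[OF S(2) direct_sum_single U(2)] ob by simp
  moreover obtain V where "direct_sum \<C> [Y, T] V" using direct_sum_exists[of "[Y, T]"] ob by auto
  ultimately have "direct_sum \<C> [X, V] U" using direct_sum_group direct_sum_single ob by metis
  with U(1) show "X \<in> add_closure \<C> N" unfolding add_closure_def by blast
qed

lemma zero_in_add_closure:
  assumes "zero_object \<C> Z"
  shows "Z \<in> add_closure \<C> M"
proof -
  have "direct_sum \<C> [Z, Z] Z"
    using bip_zero_left[of Z Z] assms direct_sum_pair by (auto simp: zero_object_iff)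
  moreover have "direct_sum \<C> (replicate 0 M) Z" using assms direct_sum_Nil by simp
  ultimately show ?thesis unfolding add_closure_def by blast
qed

lemma replicate_in_add_closure:
  assumes "direct_sum \<C> (replicate n M) S"
  shows "S \<in> add_closure \<C> M"
proof -
  obtain Z where Z: "zero_object \<C> Z" using zero_object_exists by auto
  have "direct_sum \<C> [S, Z] S"
    using bip_zero_right[OF direct_sum_Ob(1)[OF assms] Z] direct_sum_pair by auto
  with assms show ?thesis unfolding add_closure_def by blast
qed

lemma summand_in_add_closure:
  assumes "direct_sum \<C> Xs D" "X \<in> set Xs"
  shows "X \<in> add_closure \<C> D"
proof -
  have X: "X \<in> Ob \<C>" using assms direct_sum_Ob(2) by auto
  obtain Ys where ys: "mset Xs = mset ([X] @ Ys)"
    using assms(2) by (metis append_Cons append_Nil mset_remove1 insert_DiffM mset.simps(2) set_mset_mset)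
  obtain Y where Y: "direct_sum \<C> Ys Y"
    using direct_sum_exists[of Ys] direct_sum_Ob(2)[OF assms(1)] mset_eq_setD[OF ys] by auto
  have "direct_sum \<C> [X, Y] D"
    using direct_sum_group[OF direct_sum_perm[OF assms(1) ys] direct_sum_single[OF X] Y] .
  moreover have "direct_sum \<C> (replicate 1 D) D" using direct_sum_single direct_sum_Ob(1)[OF assms(1)] by simp
  ultimately show ?thesis unfolding add_closure_def by blast
qed

end

section \<open>Extriangulated categories\<close>

lemma trivial_groupI: "\<lbrakk>\<zero>\<^bsub>G\<^esub> \<in> carrier G; \<And>x. x \<in> carrier G \<Longrightarrow> x = \<zero>\<^bsub>G\<^esub>\<rbrakk> \<Longrightarrow> trivial_group G"
  unfolding trivial_group_def by blast

lemma trivial_groupD: "\<lbrakk>trivial_group G; x \<in> carrier G\<rbrakk> \<Longrightarrow> x = \<zero>\<^bsub>G\<^esub>"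
  unfolding trivial_group_def by blast

lemma add_hom_zero:
  assumes "abelian_group G" "abelian_group H" "h \<in> hom (add_monoid G) (add_monoid H)"
  shows "h \<zero>\<^bsub>G\<^esub> = \<zero>\<^bsub>H\<^esub>"
  using hom_one[OF assms(3)] abelian_group.a_group[OF assms(1)] abelian_group.a_group[OF assms(2)] by simp

text \<open>Serves \<open>Ext\<close> and \<open>Neg\<close> with one set of lemmas: vanishing of
  either passes to retracts, finite direct sums and additive closures in each variable.\<close>

locale additive_bifunctor_cat = additive_linear_category k \<C> + additive_bifunctor \<C> F push pull
  for k :: "'k ring" and \<C> :: "('k, 'o, 'm, 'x) lin_cat_scheme"
    and F :: "'o \<Rightarrow> 'o \<Rightarrow> 'f ring"
    and push :: "'o \<Rightarrow> 'o \<Rightarrow> 'o \<Rightarrow> 'm \<Rightarrow> 'f \<Rightarrow> 'f"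
    and pull :: "'o \<Rightarrow> 'o \<Rightarrow> 'o \<Rightarrow> 'm \<Rightarrow> 'f \<Rightarrow> 'f"
begin

lemma F_zero_in [simp]: "\<lbrakk>X \<in> Ob \<C>; Y \<in> Ob \<C>\<rbrakk> \<Longrightarrow> \<zero>\<^bsub>F X Y\<^esub> \<in> carrier (F X Y)"
  using group abelian_groupE(2) by blast

lemma push_in [simp]: "\<lbrakk>C \<in> Ob \<C>; A \<in> Ob \<C>; A' \<in> Ob \<C>; a \<in> Mor A A'; d \<in> carrier (F C A)\<rbrakk>
    \<Longrightarrow> push C A A' a d \<in> carrier (F C A')"
  using push_hom[of C A A' a] by (auto simp: hom_def)

lemma pull_in [simp]: "\<lbrakk>C \<in> Ob \<C>; C' \<in> Ob \<C>; A \<in> Ob \<C>; c \<in> Mor C' C; d \<in> carrier (F C A)\<rbrakk>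
    \<Longrightarrow> pull C C' A c d \<in> carrier (F C' A)"
  using pull_hom[of C C' A c] by (auto simp: hom_def)

lemma push_zero [simp]: "\<lbrakk>C \<in> Ob \<C>; A \<in> Ob \<C>; A' \<in> Ob \<C>; a \<in> Mor A A'\<rbrakk> \<Longrightarrow> push C A A' a \<zero>\<^bsub>F C A\<^esub> = \<zero>\<^bsub>F C A'\<^esub>"
  using add_hom_zero[OF group group push_hom] by blast

lemma pull_zero [simp]: "\<lbrakk>C \<in> Ob \<C>; C' \<in> Ob \<C>; A \<in> Ob \<C>; c \<in> Mor C' C\<rbrakk> \<Longrightarrow> pull C C' A c \<zero>\<^bsub>F C A\<^esub> = \<zero>\<^bsub>F C' A\<^esub>"
  using add_hom_zero[OF group group pull_hom] by blast

lemma F_add_zero [simp]: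
  "\<lbrakk>X \<in> Ob \<C>; Y \<in> Ob \<C>; d \<in> carrier (F X Y)\<rbrakk> \<Longrightarrow> \<zero>\<^bsub>F X Y\<^esub> \<oplus>\<^bsub>F X Y\<^esub> d = d"
  "\<lbrakk>X \<in> Ob \<C>; Y \<in> Ob \<C>; d \<in> carrier (F X Y)\<rbrakk> \<Longrightarrow> d \<oplus>\<^bsub>F X Y\<^esub> \<zero>\<^bsub>F X Y\<^esub> = d"
  using group[of X Y] by (simp_all add: abelian_group.axioms(1) abelian_monoid.l_zero abelian_monoid.r_zero)

text \<open>The identity of \<open>X\<close> factors through \<open>S\<close>, so every element of
  \<open>F X A\<close> is pulled back from \<open>F S A\<close>.\<close>

lemma trivial_F_retract_left:
  assumes "trivial_group (F S A)" "S \<in> Ob \<C>" "X \<in> Ob \<C>" "A \<in> Ob \<C>" "i \<in> Mor X S" "p \<in> Mor S X"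
    "comp \<C> X S X p i = ident \<C> X"
  shows "trivial_group (F X A)"
proof (rule trivial_groupI)
  fix d assume d: "d \<in> carrier (F X A)"
  have "d = pull X X A (comp \<C> X S X p i) d" using d assms by (simp add: pull_ident)
  also have "\<dots> = pull S X A i (pull X S A p d)" using d assms by (intro pull_comp) auto
  also have "pull X S A p d = \<zero>\<^bsub>F S A\<^esub>" using d assms by (intro trivial_groupD[OF assms(1)]) auto
  finally show "d = \<zero>\<^bsub>F X A\<^esub>" using assms by simp
qed (use assms in simp)

lemma trivial_F_retract_right:
  assumes "trivial_group (F A S)" "S \<in> Ob \<C>" "X \<in> Ob \<C>" "A \<in> Ob \<C>" "i \<in> Mor X S" "p \<in> Mor S X"
    "comp \<C> X S X p i = ident \<C> X"
  shows "trivial_group (F A X)"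
proof (rule trivial_groupI)
  fix d assume d: "d \<in> carrier (F A X)"
  have "d = push A X X (comp \<C> X S X p i) d" using d assms by (simp add: push_ident)
  also have "\<dots> = push A S X p (push A X S i d)" using d assms by (intro push_comp) auto
  also have "push A X S i d = \<zero>\<^bsub>F A S\<^esub>" using d assms by (intro trivial_groupD[OF assms(1)]) auto
  finally show "d = \<zero>\<^bsub>F A X\<^esub>" using assms by simp
qed (use assms in simp)

lemma trivial_F_bip_left:
  assumes "bip X Y S i j p q" "trivial_group (F X A)" "trivial_group (F Y A)" "A \<in> Ob \<C>"
  shows "trivial_group (F S A)"
proof (rule trivial_groupI)
  note [simp] = bipD(1-7)[OF assms(1)] assms(4)
  fix d assume d [simp]: "d \<in> carrier (F S A)"
  have "d = pull S S A (comp \<C> S X S i p \<oplus>\<^bsub>Hom \<C> S S\<^esub> comp \<C> S Y S j q) d"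
    using bipD(12)[OF assms(1)] by (simp add: pull_ident)
  also have "\<dots> = pull S S A (comp \<C> S X S i p) d \<oplus>\<^bsub>F S A\<^esub> pull S S A (comp \<C> S Y S j q) d"
    by (intro pull_add) auto
  also have "\<dots> = pull X S A p (pull S X A i d) \<oplus>\<^bsub>F S A\<^esub> pull Y S A q (pull S Y A j d)"
    by (simp add: pull_comp)
  also have "pull S X A i d = \<zero>\<^bsub>F X A\<^esub>" by (intro trivial_groupD[OF assms(2)]) auto
  also have "pull S Y A j d = \<zero>\<^bsub>F Y A\<^esub>" by (intro trivial_groupD[OF assms(3)]) auto
  finally show "d = \<zero>\<^bsub>F S A\<^esub>" by simp
qed (use bipD[OF assms(1)] assms in simp)

lemma trivial_F_bip_right:
  assumes "bip X Y S i j p q" "trivial_group (F A X)" "trivial_group (F A Y)" "A \<in> Ob \<C>"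
  shows "trivial_group (F A S)"
proof (rule trivial_groupI)
  note [simp] = bipD(1-7)[OF assms(1)] assms(4)
  fix d assume d [simp]: "d \<in> carrier (F A S)"
  have "d = push A S S (comp \<C> S X S i p \<oplus>\<^bsub>Hom \<C> S S\<^esub> comp \<C> S Y S j q) d"
    using bipD(12)[OF assms(1)] by (simp add: push_ident)
  also have "\<dots> = push A S S (comp \<C> S X S i p) d \<oplus>\<^bsub>F A S\<^esub> push A S S (comp \<C> S Y S j q) d"
    by (intro push_add) auto
  also have "\<dots> = push A X S i (push A S X p d) \<oplus>\<^bsub>F A S\<^esub> push A Y S j (push A S Y q d)"
    by (simp add: push_comp)
  also have "push A S X p d = \<zero>\<^bsub>F A X\<^esub>" by (intro trivial_groupD[OF assms(2)]) auto
  also have "push A S Y q d = \<zero>\<^bsub>F A Y\<^esub>" by (intro trivial_groupD[OF assms(3)]) auto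
  finally show "d = \<zero>\<^bsub>F A S\<^esub>" by simp
qed (use bipD[OF assms(1)] assms in simp)

lemma trivial_F_zero_left:
  assumes "zero_object \<C> Z" "A \<in> Ob \<C>"
  shows "trivial_group (F Z A)"
proof (rule trivial_groupI)
  have Z: "Z \<in> Ob \<C>" "ident \<C> Z = Z0 Z Z" using assms zero_object_iff by auto
  fix d assume d: "d \<in> carrier (F Z A)"
  \<comment> \<open>The identity of \<open>Z\<close> is \<open>0 = 0 + 0\<close>, so additivity of
    \<open>pull\<close> in the morphism gives \<open>d + d = d\<close>.\<close>
  have "pull Z Z A (Z0 Z Z \<oplus>\<^bsub>Hom \<C> Z Z\<^esub> Z0 Z Z) d = pull Z Z A (Z0 Z Z) d \<oplus>\<^bsub>F Z A\<^esub> pull Z Z A (Z0 Z Z) d"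
    using Z d assms by (intro pull_add) auto
  moreover have "pull Z Z A (Z0 Z Z) d = d" using pull_ident[of Z A d] Z d assms by simp
  ultimately have "d \<oplus>\<^bsub>F Z A\<^esub> d = d" using Z by simp
  then show "d = \<zero>\<^bsub>F Z A\<^esub>" using abelian_group.idem_zero[OF group] Z d assms by blast
qed (use assms zero_object_iff in simp)

lemma trivial_F_zero_right:
  assumes "zero_object \<C> Z" "A \<in> Ob \<C>"
  shows "trivial_group (F A Z)"
proof (rule trivial_groupI)
  have Z: "Z \<in> Ob \<C>" "ident \<C> Z = Z0 Z Z" using assms zero_object_iff by auto
  fix d assume d: "d \<in> carrier (F A Z)"
  have "push A Z Z (Z0 Z Z \<oplus>\<^bsub>Hom \<C> Z Z\<^esub> Z0 Z Z) d = push A Z Z (Z0 Z Z) d \<oplus>\<^bsub>F A Z\<^esub> push A Z Z (Z0 Z Z) d"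
    using Z d assms by (intro push_add) auto
  moreover have "push A Z Z (Z0 Z Z) d = d" using push_ident[of A Z d] Z d assms by simp
  ultimately have "d \<oplus>\<^bsub>F A Z\<^esub> d = d" using Z by simp
  then show "d = \<zero>\<^bsub>F A Z\<^esub>" using abelian_group.idem_zero[OF group] Z d assms by blast
qed (use assms zero_object_iff in simp)

lemma trivial_F_direct_sum_left:
  "\<lbrakk>direct_sum \<C> Xs S; \<And>X. X \<in> set Xs \<Longrightarrow> trivial_group (F X A); A \<in> Ob \<C>\<rbrakk> \<Longrightarrow> trivial_group (F S A)"
proof (induction Xs arbitrary: S)
  case Nil
  then show ?case using trivial_F_zero_left direct_sum_Nil by blast
next
  case (Cons X Xs)
  obtain T i j p q where T: "direct_sum \<C> Xs T" "bip X T S i j p q"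
    using direct_sum_Cons[OF Cons.prems(1)] .
  show ?case using trivial_F_bip_left[OF T(2)] Cons.IH[OF T(1)] Cons.prems by simp
qed

lemma trivial_F_direct_sum_right:
  "\<lbrakk>direct_sum \<C> Xs S; \<And>X. X \<in> set Xs \<Longrightarrow> trivial_group (F A X); A \<in> Ob \<C>\<rbrakk> \<Longrightarrow> trivial_group (F A S)"
proof (induction Xs arbitrary: S)
  case Nil
  then show ?case using trivial_F_zero_right direct_sum_Nil by blast
next
  case (Cons X Xs)
  obtain T i j p q where T: "direct_sum \<C> Xs T" "bip X T S i j p q"
    using direct_sum_Cons[OF Cons.prems(1)] .
  show ?case using trivial_F_bip_right[OF T(2)] Cons.IH[OF T(1)] Cons.prems by simp
qed

lemma trivial_F_add_closure_left:
  assumes "X \<in> add_closure \<C> M" "trivial_group (F M A)" "A \<in> Ob \<C>"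
  shows "trivial_group (F X A)"
proof -
  obtain n S Y where S: "direct_sum \<C> (replicate n M) S" "direct_sum \<C> [X, Y] S"
    using assms(1) unfolding add_closure_def by auto
  obtain i j p q where b: "bip X Y S i j p q" using S(2) direct_sum_pair by auto
  have "trivial_group (F S A)" using trivial_F_direct_sum_left[OF S(1)] assms by auto
  then show ?thesis using trivial_F_retract_left[of S A X i p] bipD[OF b] assms(3) by simp
qed

lemma trivial_F_add_closure_right:
  assumes "X \<in> add_closure \<C> M" "trivial_group (F A M)" "A \<in> Ob \<C>"
  shows "trivial_group (F A X)"
proof -
  obtain n S Y where S: "direct_sum \<C> (replicate n M) S" "direct_sum \<C> [X, Y] S"
    using assms(1) unfolding add_closure_def by auto
  obtain i j p q where b: "bip X Y S i j p q" using S(2) direct_sum_pair by auto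
  have "trivial_group (F A S)" using trivial_F_direct_sum_right[OF S(1)] assms by auto
  then show ?thesis using trivial_F_retract_right[of A S X i p] bipD[OF b] assms(3) by simp
qed

end

sublocale extriangulated_category \<subseteq> E: additive_bifunctor_cat k \<C> "Ext \<C>" "ext_push \<C>" "ext_pull \<C>"
  using ET1 additive_linear_category_axioms by (intro additive_bifunctor_cat.intro)

sublocale extriangulated_category_neg \<subseteq> N: additive_bifunctor_cat k \<C> "Neg \<C>" "neg_push \<C>" "neg_pull \<C>"
  using neg_bifunctor additive_linear_category_axioms by (intro additive_bifunctor_cat.intro)

section \<open>Equivalence of sequences\<close>

context preadditive
begin

lemma cat_iso_comp:
  assumes "X \<in> Ob \<C>" "Y \<in> Ob \<C>" "Z \<in> Ob \<C>" "cat_iso \<C> X Y f" "cat_iso \<C> Y Z g"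
  shows "cat_iso \<C> X Z (comp \<C> X Y Z g f)"
proof -
  obtain f' g' where *: "f \<in> Mor X Y" "f' \<in> Mor Y X" "g \<in> Mor Y Z" "g' \<in> Mor Z Y"
    "comp \<C> X Y X f' f = ident \<C> X" "comp \<C> Y X Y f f' = ident \<C> Y"
    "comp \<C> Y Z Y g' g = ident \<C> Y" "comp \<C> Z Y Z g g' = ident \<C> Z"
    using assms unfolding cat_iso_def by blast
  have 1: "comp \<C> X Z X (comp \<C> Z Y X f' g') (comp \<C> X Y Z g f)
      = comp \<C> X Y X f' (comp \<C> X Y Y (comp \<C> Y Z Y g' g) f)"
    using assms *(1-4) by (simp add: cmp_assoc)
  have 2: "comp \<C> Z X Z (comp \<C> X Y Z g f) (comp \<C> Z Y X f' g')
      = comp \<C> Z Y Z g (comp \<C> Z Y Y (comp \<C> Y X Y f f') g')"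
    using assms *(1-4) by (simp add: cmp_assoc)
  show ?thesis unfolding cat_iso_def using assms * 1 2
    by (intro conjI bexI[of _ "comp \<C> Z Y X f' g'"]) simp_all
qed

text \<open>Realizations are classes in a quotient; symmetry and transitivity allow two members of
  one class to be compared directly.\<close>

lemma sym_seq_equiv:
  assumes "A \<in> Ob \<C>" "C \<in> Ob \<C>"
  shows "sym (seq_equiv \<C> A C)"
proof (rule symI, clarify)
  fix x B y x' B' y' assume "((x, B, y), x', B', y') \<in> seq_equiv \<C> A C"
  then obtain b where b: "(x, B, y) \<in> sequences \<C> A C" "(x', B', y') \<in> sequences \<C> A C"
    "cat_iso \<C> B B' b" "comp \<C> A B B' b x = x'" "comp \<C> B B' C y' b = y" unfolding seq_equiv_def by auto
  obtain c where c: "b \<in> Mor B B'" "c \<in> Mor B' B" "comp \<C> B B' B c b = ident \<C> B" "comp \<C> B' B B' b c = ident \<C> B'"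
    using b(3) unfolding cat_iso_def by blast
  have "cat_iso \<C> B' B c" using c unfolding cat_iso_def by blast
  moreover have "comp \<C> A B' B c x' = x"
    using b c assms by (auto simp: sequences_def cmp_assoc[symmetric])
  moreover have "comp \<C> B' B C y c = y'"
    using b c assms by (auto simp: sequences_def cmp_assoc)
  ultimately show "((x', B', y'), x, B, y) \<in> seq_equiv \<C> A C" unfolding seq_equiv_def using b by auto
qed

lemma trans_seq_equiv:
  assumes "A \<in> Ob \<C>" "C \<in> Ob \<C>"
  shows "trans (seq_equiv \<C> A C)"
proof (rule transI, clarify)
  fix x B y x' B' y' x'' B'' y'' 
  assume "((x, B, y), x', B', y') \<in> seq_equiv \<C> A C" "((x', B', y'), x'', B'', y'') \<in> seq_equiv \<C> A C"
  then obtain b c where b: "(x, B, y) \<in> sequences \<C> A C" "(x', B', y') \<in> sequences \<C> A C"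
    "(x'', B'', y'') \<in> sequences \<C> A C"
    "cat_iso \<C> B B' b" "comp \<C> A B B' b x = x'" "comp \<C> B B' C y' b = y" 
    "cat_iso \<C> B' B'' c" "comp \<C> A B' B'' c x' = x''" "comp \<C> B' B'' C y'' c = y'" unfolding seq_equiv_def by auto
  have m: "b \<in> Mor B B'" "c \<in> Mor B' B''" using b by (auto simp: cat_iso_def)
  have "cat_iso \<C> B B'' (comp \<C> B B' B'' c b)" using b cat_iso_comp by (auto simp: sequences_def)
  moreover have "comp \<C> A B B'' (comp \<C> B B' B'' c b) x = x''"
    using b m assms by (auto simp: sequences_def cmp_assoc)
  moreover have "comp \<C> B B'' C y'' (comp \<C> B B' B'' c b) = y"
    using b m assms by (auto simp: sequences_def cmp_assoc[symmetric])
  ultimately show "((x, B, y), x'', B'', y'') \<in> seq_equiv \<C> A C" unfolding seq_equiv_def using b by auto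
qed

end

section \<open>Conflations as weak kernel-cokernel pairs\<close>

context extriangulated_category
begin

lemma realization_subset: "\<lbrakk>C \<in> Ob \<C>; A \<in> Ob \<C>; \<delta> \<in> carrier (Ext \<C> C A)\<rbrakk>
    \<Longrightarrow> realization \<C> C A \<delta> \<subseteq> sequences \<C> A C"
  using realization_class[of C A \<delta>] unfolding quotient_def by (auto simp: seq_equiv_def)

lemma conflationD:
  assumes "conflation \<C> A x B y C \<delta>"
  shows "A \<in> Ob \<C>" "B \<in> Ob \<C>" "C \<in> Ob \<C>" "\<delta> \<in> carrier (Ext \<C> C A)" "x \<in> Mor A B" "y \<in> Mor B C"
  using assms realization_subset[of C A \<delta>] unfolding conflation_def sequences_def by auto

text \<open>Both triples lie in one class of \<open>seq_equiv\<close>, and the comparison map of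
  that relation is an isomorphism of the middle terms.\<close>

lemma conflation_unique:
  assumes "conflation \<C> A x B y C \<delta>" "conflation \<C> A x' B' y' C \<delta>"
  shows "isoc B B'"
proof -
  note D = conflationD[OF assms(1)]
  obtain s where s: "s \<in> sequences \<C> A C" "realization \<C> C A \<delta> = seq_equiv \<C> A C `` {s}"
    using realization_class[OF D(3,1,4)] by (rule quotientE)
  have "((x, B, y), (x', B', y')) \<in> seq_equiv \<C> A C"
    using assms s sym_seq_equiv[OF D(1,3)] trans_seq_equiv[OF D(1,3)]
    unfolding conflation_def by (auto dest: symD transD)
  then show ?thesis
    unfolding seq_equiv_def isoc_def by (auto simp: sequences_def)
qed

lemma bip_conflation:
  assumes "bip X Y S i j p q"
  shows "conflation \<C> X i S q Y \<zero>\<^bsub>Ext \<C> Y X\<^esub>"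
proof -
  have "biproduct \<C> [X, Y] S (\<lambda>r. if r = 0 then i else j) (\<lambda>r. if r = 0 then p else q)"
    unfolding biproduct_pair using assms by simp
  from realization_zero[OF this] show ?thesis
    using bipD[OF assms] unfolding conflation_def by simp
qed

lemma conflation_id_left:
  "\<lbrakk>A \<in> Ob \<C>; zero_object \<C> Z\<rbrakk> \<Longrightarrow> conflation \<C> A (ident \<C> A) A (Z0 A Z) Z \<zero>\<^bsub>Ext \<C> Z A\<^esub>"
  using bip_zero_right bip_conflation by blast

lemma conflation_id_right:
  "\<lbrakk>A \<in> Ob \<C>; zero_object \<C> Z\<rbrakk> \<Longrightarrow> conflation \<C> Z (Z0 Z A) A (ident \<C> A) A \<zero>\<^bsub>Ext \<C> A Z\<^esub>"
  using bip_zero_left bip_conflation by blast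

lemma zero_objectD: "zero_object \<C> Z \<Longrightarrow> Z \<in> Ob \<C>"
  "\<lbrakk>zero_object \<C> Z; X \<in> Ob \<C>; f \<in> Mor X Z\<rbrakk> \<Longrightarrow> f = Z0 X Z"
  "\<lbrakk>zero_object \<C> Z; X \<in> Ob \<C>; f \<in> Mor Z X\<rbrakk> \<Longrightarrow> f = Z0 Z X"
  unfolding zero_object_def trivial_group_def by auto

text \<open>(ET3), applied to the identity of \<open>A\<close> and to \<open>x\<close> from
  \<open>A = A -> 0\<close> to the given conflation, factors \<open>y\<close> after \<open>x\<close>
  through a zero object.\<close>

lemma conflation_comp_zero:
  assumes "conflation \<C> A x B y C \<delta>"
  shows "comp \<C> A B C y x = Z0 A C"
proof -
  note [simp] = conflationD[OF assms]
  obtain Z where Z: "zero_object \<C> Z" using zero_object_exists by auto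
  note [simp] = zero_objectD(1)[OF Z]
  obtain c where c: "ext_morphism \<C> Z A \<zero>\<^bsub>Ext \<C> Z A\<^esub> C A \<delta> (ident \<C> A) c"
     "comp \<C> A Z C c (Z0 A Z) = comp \<C> A B C y x"
    using ET3[OF conflation_id_left[OF _ Z] assms, of A "ident \<C> A" x] by auto
  then show ?thesis by (auto simp: ext_morphism_def)
qed

text \<open>(ET3) towards the split conflation \<open>0 -> W = W\<close>, with zero on the left and
  \<open>f\<close> in the middle, produces \<open>g\<close>. Its uniqueness is a separate matter and
  comes from \<open>deflation_epi\<close>.\<close>

lemma weak_cokernel:
  assumes "conflation \<C> A x B y C \<delta>" "W \<in> Ob \<C>" "f \<in> Mor B W" "comp \<C> A B W f x = Z0 A W"
  obtains g where "g \<in> Mor C W" "comp \<C> B C W g y = f"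
proof -
  note [simp] = conflationD[OF assms(1)] assms(2-4)
  obtain Z where Z: "zero_object \<C> Z" using zero_object_exists by auto
  note [simp] = zero_objectD(1)[OF Z]
  obtain g where "ext_morphism \<C> C A \<delta> W Z \<zero>\<^bsub>Ext \<C> W Z\<^esub> (Z0 A Z) g" "comp \<C> B C W g y = comp \<C> B W W (ident \<C> W) f"
    using ET3[OF assms(1) conflation_id_right[OF _ Z], of W "Z0 A Z" f] by auto
  then show ?thesis using that by (auto simp: ext_morphism_def)
qed

text \<open>(ET3)op from the split conflation \<open>W = W -> 0\<close>, with \<open>f\<close> in
  the middle and zero on the right.\<close>

lemma weak_kernel:
  assumes "conflation \<C> A x B y C \<delta>" "W \<in> Ob \<C>" "f \<in> Mor W B" "comp \<C> W B C y f = Z0 W C"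
  obtains g where "g \<in> Mor W A" "comp \<C> W A B x g = f"
proof -
  note [simp] = conflationD[OF assms(1)] assms(2-4)
  obtain Z where Z: "zero_object \<C> Z" using zero_object_exists by auto
  note [simp] = zero_objectD(1)[OF Z]
  obtain g where "ext_morphism \<C> Z W \<zero>\<^bsub>Ext \<C> Z W\<^esub> C A \<delta> g (Z0 Z C)" "comp \<C> W W B f (ident \<C> W) = comp \<C> W A B x g"
    using ET3_op[OF conflation_id_left[OF _ Z] assms(1), of W f "Z0 Z C"] by auto
  then show ?thesis using that by (auto simp: ext_morphism_def)
qed

text \<open>As the pushout is zero, \<open>(g, 1)\<close> is a morphism from \<delta> to the split
  extension of \<open>C\<close> by \<open>W\<close>; its realization on \<open>B\<close>, followed
  by the projection onto \<open>W\<close>, extends \<open>g\<close>.\<close>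

lemma extend_along_inflation:
  assumes "conflation \<C> A x B y C \<delta>" "W \<in> Ob \<C>" "g \<in> Mor A W" "ext_push \<C> C A W g \<delta> = \<zero>\<^bsub>Ext \<C> C W\<^esub>"
  obtains h where "h \<in> Mor B W" "comp \<C> A B W h x = g"
proof -
  note [simp] = conflationD[OF assms(1)] assms(2-4)
  obtain S i j p q where b: "bip W C S i j p q" using bip_exists[OF assms(2) conflationD(3)[OF assms(1)]] .
  note [simp] = bipD[OF b]
  have "ext_morphism \<C> C A \<delta> C W \<zero>\<^bsub>Ext \<C> C W\<^esub> g (ident \<C> C)"
    unfolding ext_morphism_def by simp
  from realization_morphism[OF assms(1) bip_conflation[OF b] this]
  obtain c where c: "c \<in> Mor B S" "comp \<C> A B S c x = comp \<C> A W S i g" by auto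
  have "comp \<C> A B W (comp \<C> B S W p c) x = comp \<C> A W W (comp \<C> W S W p i) g"
    using c by (simp add: cmp_assoc del: bipD(8)[OF b])
  then have "comp \<C> A B W (comp \<C> B S W p c) x = g" by simp
  then show ?thesis by (rule that[rotated]) (use c in simp)
qed

text \<open>Now the split extension is the source: a realization of \<open>(1, g)\<close> is
  restricted to the summand \<open>W\<close>.\<close>

lemma lift_along_deflation:
  assumes "conflation \<C> A x B y C \<delta>" "W \<in> Ob \<C>" "g \<in> Mor W C" "ext_pull \<C> C W A g \<delta> = \<zero>\<^bsub>Ext \<C> W A\<^esub>"
  obtains h where "h \<in> Mor W B" "comp \<C> W B C y h = g"
proof -
  note [simp] = conflationD[OF assms(1)] assms(2-4)
  obtain S i j p q where b: "bip A W S i j p q" using bip_exists[OF conflationD(1)[OF assms(1)] assms(2)] .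
  note [simp] = bipD[OF b]
  have "ext_morphism \<C> W A \<zero>\<^bsub>Ext \<C> W A\<^esub> C A \<delta> (ident \<C> A) g"
    unfolding ext_morphism_def by simp
  from realization_morphism[OF bip_conflation[OF b] assms(1) this]
  obtain c where c: "c \<in> Mor S B" "comp \<C> S B C y c = comp \<C> S W C g q" by auto
  have "comp \<C> W B C y (comp \<C> W S B c j) = comp \<C> W W C g (comp \<C> W S W q j)"
    using c by (simp add: cmp_assoc[symmetric] del: bipD(9)[OF b])
  then have "comp \<C> W B C y (comp \<C> W S B c j) = g" by simp
  then show ?thesis by (rule that[rotated]) (use c in simp)
qed

text \<open>The part of (ET4)op that is kept: deflations compose, and the kernel of the composite is
  an extension of the second kernel by the first.\<close>

lemma compose_deflations:
  assumes "conflation \<C> D f' A f B \<delta>" "conflation \<C> F g' B g C \<delta>'"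
  obtains E h' \<delta>'' d e \<eta> where "conflation \<C> E h' A (comp \<C> A B C g f) C \<delta>''" "conflation \<C> D d E e F \<eta>"
  using ET4_op[OF assms] by (elim exE conjE) (simp add: that)

lemma conflation_sum:
  assumes "conflation \<C> A x B y C \<delta>" "conflation \<C> A' x' B' y' C' \<delta>'"
    "direct_sum \<C> [A, A'] SA" "direct_sum \<C> [B, B'] SB" "direct_sum \<C> [C, C'] SC"
  obtains u v \<eta> where "conflation \<C> SA u SB v SC \<eta>"
proof -
  obtain iA pA where A: "biproduct \<C> [A, A'] SA iA pA" using assms(3) unfolding direct_sum_def by auto
  obtain iB pB where B: "biproduct \<C> [B, B'] SB iB pB" using assms(4) unfolding direct_sum_def by auto
  obtain iC pC where C: "biproduct \<C> [C, C'] SC iC pC" using assms(5) unfolding direct_sum_def by auto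
  note [simp] = conflationD[OF assms(1)] conflationD[OF assms(2)]
    bipD[OF A[unfolded biproduct_pair]] bipD[OF B[unfolded biproduct_pair]] bipD[OF C[unfolded biproduct_pair]]
  have c: "ext_push \<C> SC A SA (iA 0) (ext_pull \<C> C SC A (pC 0) \<delta>) \<in> carrier (Ext \<C> SC SA)"
    "ext_push \<C> SC A' SA (iA 1) (ext_pull \<C> C' SC A' (pC 1) \<delta>') \<in> carrier (Ext \<C> SC SA)"
    by (simp_all del: One_nat_def)
  have "ext_push \<C> SC A SA (iA 0) (ext_pull \<C> C SC A (pC 0) \<delta>)
       \<oplus>\<^bsub>Ext \<C> SC SA\<^esub> ext_push \<C> SC A' SA (iA 1) (ext_pull \<C> C' SC A' (pC 1) \<delta>') \<in> carrier (Ext \<C> SC SA)"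
    by (rule abelian_groupE(1)[OF E.group c]) (simp_all del: One_nat_def)
  with realization_sum[OF assms(1,2) A B C] show ?thesis
    by (intro that) (simp add: conflation_def)
qed

subsection \<open>Filtered objects\<close>

lemma star_Ob: "M \<in> star \<C> \<X> \<Y> \<Longrightarrow> M \<in> Ob \<C>"
  unfolding star_def using conflationD(2) by blast

text \<open>In one direction, the kernel of the composite deflation \<open>M -> Z\<close> is an
  extension of \<open>Y\<close> by \<open>X\<close>; in the other, the cone of the composite
  inflation \<open>X -> M\<close> is an extension of \<open>Z\<close> by \<open>Y\<close>.\<close>

lemma star_assoc: "star \<C> \<X> (star \<C> \<Y> \<Z>) = star \<C> (star \<C> \<X> \<Y>) \<Z>"
proof (intro equalityI subsetI)
  fix M assume "M \<in> star \<C> \<X> (star \<C> \<Y> \<Z>)"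
  then obtain X N x y \<delta> Y Z f g \<eta> where *: "X \<in> \<X>" "Y \<in> \<Y>" "Z \<in> \<Z>"
    "conflation \<C> X x M y N \<delta>" "conflation \<C> Y f N g Z \<eta>" unfolding star_def by blast
  obtain E h' \<delta>'' d e \<eta>' where c: "conflation \<C> E h' M (comp \<C> M N Z g y) Z \<delta>''" "conflation \<C> X d E e Y \<eta>'"
    using compose_deflations[OF *(4,5)] .
  have "E \<in> star \<C> \<X> \<Y>" using c(2) *(1,2) unfolding star_def by blast
  then show "M \<in> star \<C> (star \<C> \<X> \<Y>) \<Z>"
    using c(1) *(3) unfolding star_def by blast
next
  fix M assume "M \<in> star \<C> (star \<C> \<X> \<Y>) \<Z>"
  then obtain X N x y \<delta> Y Z f g \<eta> where *: "X \<in> \<X>" "Y \<in> \<Y>" "Z \<in> \<Z>"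
    "conflation \<C> X x N y Y \<delta>" "conflation \<C> N f M g Z \<eta>" unfolding star_def by blast
  obtain E h h' \<delta>'' d e \<eta>' where c: "conflation \<C> X h M h' E \<delta>''" "conflation \<C> Y d E e Z \<eta>'"
    using ET4[OF *(4,5)] by (elim exE conjE)
  have "E \<in> star \<C> \<Y> \<Z>" using c(2) *(2,3) unfolding star_def by blast
  then show "M \<in> star \<C> \<X> (star \<C> \<Y> \<Z>)"
    using c(1) *(1) unfolding star_def by blast
qed

text \<open>The exponent is one less than the number of factors, and
  \<open>(l + 1) + (m + 1)\<close> factors correspond to the exponent
  \<open>Suc (l + m)\<close>.\<close>

lemma star_star_power: "star \<C> (star_power \<C> \<X> l) (star_power \<C> \<X> m) = star_power \<C> \<X> (Suc (l + m))"
  by (induction l) (simp_all add: star_assoc[symmetric])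

lemma star_mono: "\<lbrakk>\<X> \<subseteq> \<X>'; \<Y> \<subseteq> \<Y>'\<rbrakk> \<Longrightarrow> star \<C> \<X> \<Y> \<subseteq> star \<C> \<X>' \<Y>'"
  unfolding star_def by blast

lemma star_power_mono: "\<X> \<subseteq> \<Y> \<Longrightarrow> star_power \<C> \<X> l \<subseteq> star_power \<C> \<Y> l"
  by (induction l) (simp_all add: star_mono)

lemma filt_mono: "add_closure \<C> M \<subseteq> add_closure \<C> N \<Longrightarrow> filt \<C> M \<subseteq> filt \<C> N"
  unfolding filt_def using star_power_mono by blast

lemma filt_Ob: "M \<in> filt \<C> D \<Longrightarrow> M \<in> Ob \<C>"
proof -
  have "star_power \<C> (add_closure \<C> D) l \<subseteq> Ob \<C>" for l
    using star_Ob add_closure_Ob by (cases l) auto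
  then show "M \<in> filt \<C> D \<Longrightarrow> M \<in> Ob \<C>" unfolding filt_def by auto
qed

lemma add_closure_filt: "X \<in> add_closure \<C> D \<Longrightarrow> X \<in> filt \<C> D"
  unfolding filt_def by (auto intro!: exI[of _ "0::nat"])

lemma filt_extension:
  assumes "conflation \<C> A x B y C \<delta>" "A \<in> filt \<C> D" "C \<in> filt \<C> D"
  shows "B \<in> filt \<C> D"
proof -
  obtain l m where "A \<in> star_power \<C> (add_closure \<C> D) l" "C \<in> star_power \<C> (add_closure \<C> D) m"
    using assms unfolding filt_def by auto
  then have "B \<in> star_power \<C> (add_closure \<C> D) (Suc (l + m))"
    using assms(1) unfolding star_star_power[symmetric] star_def by blast
  then show ?thesis unfolding filt_def by blast
qed

text \<open>The working form of filtrations: a property of filtered objects is checked on the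
  additive closure and on extensions. The proof splits off the leftmost factor.\<close>

lemma filt_induct [consumes 1, case_names add ext]:
  assumes "M \<in> filt \<C> D" "\<And>X. X \<in> add_closure \<C> D \<Longrightarrow> Q X"
    "\<And>A x B y C \<delta>. \<lbrakk>conflation \<C> A x B y C \<delta>; A \<in> filt \<C> D; C \<in> filt \<C> D; Q A; Q C\<rbrakk> \<Longrightarrow> Q B"
  shows "Q M"
proof -
  have "M \<in> star_power \<C> (add_closure \<C> D) l \<Longrightarrow> Q M" for l M
  proof (induction l arbitrary: M)
    case 0
    then show ?case using assms(2) by simp
  next
    case (Suc l)
    then obtain A C x y \<delta> where *: "A \<in> add_closure \<C> D" "C \<in> star_power \<C> (add_closure \<C> D) l"
      "conflation \<C> A x M y C \<delta>" unfolding star_power.simps star_def by blast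
    have "C \<in> filt \<C> D" using *(2) unfolding filt_def by blast
    then show ?case using assms(3)[OF *(3)] add_closure_filt[OF *(1)] assms(2)[OF *(1)] Suc.IH[OF *(2)] by simp
  qed
  then show ?thesis using assms(1) unfolding filt_def by auto
qed

lemma filt_pair:
  assumes "direct_sum \<C> [A, C] B" "A \<in> filt \<C> D" "C \<in> filt \<C> D"
  shows "B \<in> filt \<C> D"
proof -
  obtain i j p q where "bip A C B i j p q" using assms(1) unfolding direct_sum_pair by blast
  from filt_extension[OF bip_conflation[OF this] assms(2,3)] show ?thesis .
qed

lemma filt_zero: "zero_object \<C> Z \<Longrightarrow> Z \<in> filt \<C> D"
  using add_closure_filt zero_in_add_closure by blast

lemma filt_direct_sum:
  "\<lbrakk>direct_sum \<C> Xs S; set Xs \<subseteq> filt \<C> D\<rbrakk> \<Longrightarrow> S \<in> filt \<C> D"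
proof (induction Xs arbitrary: S)
  case Nil
  then show ?case using filt_zero direct_sum_Nil by blast
next
  case (Cons X Xs)
  obtain T i j p q where T: "direct_sum \<C> Xs T" "bip X T S i j p q"
    using direct_sum_Cons[OF Cons.prems(1)] .
  have "direct_sum \<C> [X, T] S" using T(2) unfolding direct_sum_pair by blast
  then show ?case using filt_pair[of X T S] Cons.IH[OF T(1)] Cons.prems by auto
qed

end

section \<open>The horseshoe construction\<close>

lemma (in abelian_group) add_cancel_mid:
  assumes "x \<in> carrier G" "u \<in> carrier G" "v \<in> carrier G"
  shows "(\<ominus> x \<oplus> v) \<oplus> (u \<oplus> x) = u \<oplus> v"
proof -
  have "(\<ominus> x \<oplus> v) \<oplus> (u \<oplus> x) = (\<ominus> x \<oplus> x) \<oplus> (u \<oplus> v)" using assms by (simp only: a_ac a_closed a_inv_closed)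
  then show ?thesis using assms by (simp add: l_neg)
qed

context extriangulated_category
begin

text \<open>If \<open>\<delta>\<close> is the pushout of \<open>\<kappa>\<close> along \<open>a\<close>, then \<open>(-a, \<iota>)\<close> from \<open>K\<close> to \<open>A \<oplus> Q\<close> is the
  composite of the split inflation \<open>(-a, 1)\<close> from \<open>K\<close> to \<open>A \<oplus> K\<close> with the inflation
  \<open>1 \<oplus> \<iota>\<close>; by (ET4) its cone realizes \<open>\<delta>\<close>.\<close>

lemma horseshoe:
  assumes \<delta>: "conflation \<C> A x M y Z \<delta>" and \<kappa>: "conflation \<C> K \<iota> Q q Z \<kappa>"
    and triv: "trivial_group (Ext \<C> Q A)"
  obtains S u v E \<epsilon> where "direct_sum \<C> [A, Q] S" "conflation \<C> K u S v E \<epsilon>" "isoc E M"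
proof -
  note [simp] = conflationD[OF \<delta>] conflationD[OF \<kappa>]
  \<comment> \<open>Vanishing of \<open>Ext \<C> Q A\<close> lifts \<open>q\<close> along
    \<open>y\<close>; then (ET3)op supplies \<open>a\<close>, and \<delta> is the pushout of
    \<kappa> along it.\<close>
  obtain W where W: "W \<in> Mor Q M" "comp \<C> Q M Z y W = q"
    using lift_along_deflation[OF \<delta>, of Q q] trivial_groupD[OF triv] by auto
  obtain a where a: "ext_morphism \<C> Z K \<kappa> Z A \<delta> a (ident \<C> Z)"
    using ET3_op[OF \<kappa> \<delta>, of W "ident \<C> Z"] W by auto
  then have aM [simp]: "a \<in> Mor K A" and a\<kappa>: "ext_push \<C> Z K A a \<kappa> = \<delta>"
    by (simp_all add: ext_morphism_def E.pull_ident)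
  obtain T iA iK pA pK where T: "bip A K T iA iK pA pK" using bip_exists[OF conflationD(1)[OF \<delta>] conflationD(1)[OF \<kappa>]] .
  note [simp] = bipD(1-11)[OF T]
  interpret T: abelian_group "Hom \<C> T T" using Hom_group by simp
  \<comment> \<open>\<open>f\<close> is \<open>(-a, 1)\<close> and \<open>f'\<close> is
    \<open>(1, a)\<close>. The sign makes \<open>f'\<close> after \<open>f\<close> vanish, so
    \<open>f\<close> embeds \<open>K\<close> as a summand of \<open>T\<close> with complement
    \<open>A\<close>.\<close>
  define f where "f = comp \<C> K A T iA (\<ominus>\<^bsub>Hom \<C> K A\<^esub> a) \<oplus>\<^bsub>Hom \<C> K T\<^esub> iK"
  define f' where "f' = pA \<oplus>\<^bsub>Hom \<C> T A\<^esub> comp \<C> T K A a pK"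
  have [simp]: "f \<in> Mor K T" "f' \<in> Mor T A" by (simp_all add: f_def f'_def)
  have c1: "comp \<C> K T A pA (comp \<C> K A T iA b) = b" "comp \<C> K T K pK (comp \<C> K A T iA b) = Z0 K K"
    if "b \<in> Mor K A" for b using that by (simp_all add: cmp_assoc[symmetric])
  have c2: "comp \<C> T A T iA (comp \<C> T K A (\<ominus>\<^bsub>Hom \<C> K A\<^esub> a) pK) = \<ominus>\<^bsub>Hom \<C> T T\<^esub> comp \<C> T A T iA (comp \<C> T K A a pK)"
    by simp
  have bf: "bip K A T f iA pK f'"
    unfolding bip_def
  proof (intro conjI)
    show "comp \<C> K T K pK f = ident \<C> K" by (simp add: f_def c1 del: cmp_uminus_right)
    show "comp \<C> A T A f' iA = ident \<C> A" by (simp add: f'_def cmp_assoc)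
    show "comp \<C> K T A f' f = Z0 K A"
      by (simp add: f'_def f_def c1 cmp_assoc del: cmp_uminus_right)
    have m: "comp \<C> T A T iA (comp \<C> T K A a pK) \<in> Mor T T" "comp \<C> T A T iA pA \<in> Mor T T" "comp \<C> T K T iK pK \<in> Mor T T"
      by simp_all
    have "comp \<C> T K T f pK \<oplus>\<^bsub>Hom \<C> T T\<^esub> comp \<C> T A T iA f' = comp \<C> T A T iA pA \<oplus>\<^bsub>Hom \<C> T T\<^esub> comp \<C> T K T iK pK"
      using T.add_cancel_mid[OF m] by (simp add: f_def f'_def cmp_assoc)
    then show "comp \<C> T K T f pK \<oplus>\<^bsub>Hom \<C> T T\<^esub> comp \<C> T A T iA f' = ident \<C> T"
      using bipD(12)[OF T] by simp
  qed simp_all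
  obtain Zo where Zo: "zero_object \<C> Zo" using zero_object_exists by auto
  note [simp] = zero_objectD(1)[OF Zo]
  obtain S jA jQ sA sQ where S: "bip A Q S jA jQ sA sQ" using bip_exists[OF conflationD(1)[OF \<delta>] conflationD(2)[OF \<kappa>]] .
  note [simp] = bipD(1-11)[OF S]
  have b1: "biproduct \<C> [A, K] T (\<lambda>r. if r = 0 then iA else iK) (\<lambda>r. if r = 0 then pA else pK)"
    and b2: "biproduct \<C> [A, Q] S (\<lambda>r. if r = 0 then jA else jQ) (\<lambda>r. if r = 0 then sA else sQ)"
    and b3: "biproduct \<C> [Zo, Z] Z (\<lambda>r. if r = 0 then Z0 Zo Z else ident \<C> Z) (\<lambda>r. if r = 0 then Z0 Z Zo else ident \<C> Z)"
    unfolding biproduct_pair using T S bip_zero_left[of Z Zo] Zo by simp_all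
  \<comment> \<open>The sum of \<open>A = A -> 0\<close> and the conflation of \<kappa>; its class
    is \<kappa> pushed along \<open>iK\<close>, since the first summand contributes zero.\<close>
  obtain g g' where g: "(g, S, g') \<in> realization \<C> Z T (ext_push \<C> Z K T iK \<kappa>)"
    using realization_sum[OF conflation_id_left[OF _ Zo] \<kappa> b1 b2 b3]
    by (simp add: E.pull_ident)
  then have g: "conflation \<C> T g S g' Z (ext_push \<C> Z K T iK \<kappa>)"
    by (simp add: conflation_def)
  obtain E h h' d e \<delta>'' where E: "conflation \<C> K h S h' E \<delta>''"
    "conflation \<C> A d E e Z (ext_push \<C> Z T A f' (ext_push \<C> Z K T iK \<kappa>))"
    using ET4[OF bip_conflation[OF bf] g] by (elim exE conjE)
  \<comment> \<open>The class that (ET4) attaches to \<open>E\<close> is \<kappa> pushed along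
    \<open>f'\<close> after \<open>iK\<close>, which is \<open>a\<close>. So \<open>E\<close> and
    \<open>M\<close> both realize \<delta>.\<close>
  have "ext_push \<C> Z T A f' (ext_push \<C> Z K T iK \<kappa>) = ext_push \<C> Z K A (comp \<C> K T A f' iK) \<kappa>"
    by (simp add: E.push_comp)
  also have "comp \<C> K T A f' iK = a" by (simp add: f'_def cmp_assoc)
  finally have "conflation \<C> A d E e Z \<delta>" using E(2) a\<kappa> by simp
  then have "isoc E M" using conflation_unique \<delta> by blast
  moreover have "direct_sum \<C> [A, Q] S" using S unfolding direct_sum_pair by blast
  ultimately show ?thesis using that E(1) by blast
qed

section \<open>Covers by copies of one object\<close>

definition covered :: "'o \<Rightarrow> 'o \<Rightarrow> 'o \<Rightarrow> bool" where
  "covered D Q M \<longleftrightarrow> (\<exists>K \<in> filt \<C> D. \<exists>n S x y \<delta>. direct_sum \<C> (replicate n Q) S \<and> conflation \<C> K x S y M \<delta>)"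

text \<open>The cover of \<open>A\<close> is followed by the deflation; the kernel of the composite
  is an extension of \<open>K\<close> by the old kernel and stays filtered.\<close>

lemma covered_deflation:
  assumes "conflation \<C> K x A y M \<delta>" "K \<in> filt \<C> D" "covered D Q A"
  shows "covered D Q M"
proof -
  obtain L n S u v \<eta> where *: "L \<in> filt \<C> D" "direct_sum \<C> (replicate n Q) S" "conflation \<C> L u S v A \<eta>"
    using assms(3) unfolding covered_def by blast
  obtain E h' \<delta>'' d e \<eta>' where c: "conflation \<C> E h' S (comp \<C> S A M y v) M \<delta>''" "conflation \<C> L d E e K \<eta>'"
    using compose_deflations[OF *(3) assms(1)] .
  have "E \<in> filt \<C> D" using filt_extension[OF c(2) *(1) assms(2)] .
  with c(1) *(2) show ?thesis unfolding covered_def by blast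
qed

lemma covered_self:
  assumes "direct_sum \<C> (replicate n Q) S"
  shows "covered D Q S"
proof -
  obtain Z where Z: "zero_object \<C> Z" using zero_object_exists by auto
  show ?thesis unfolding covered_def
    using conflation_id_right[OF direct_sum_Ob(1)[OF assms] Z] filt_zero[OF Z] assms by blast
qed

text \<open>An isomorphism is a deflation with zero kernel.\<close>

lemma covered_isoc:
  assumes "isoc E M" "covered D Q E"
  shows "covered D Q M"
proof -
  obtain f g where fg: "E \<in> Ob \<C>" "M \<in> Ob \<C>" "f \<in> Mor E M" "g \<in> Mor M E"
    "comp \<C> E M E g f = ident \<C> E" "comp \<C> M E M f g = ident \<C> M" using assms(1) by (rule isocE)
  obtain Z where Z: "zero_object \<C> Z" using zero_object_exists by auto
  have "bip Z M E (Z0 Z E) g (Z0 E Z) f"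
    using fg Z unfolding bip_def zero_object_iff by simp
  from covered_deflation[OF bip_conflation[OF this] filt_zero[OF Z] assms(2)] show ?thesis .
qed

lemma covered_sum:
  assumes "covered D Q X" "covered D Q Y" "direct_sum \<C> [X, Y] S"
  shows "covered D Q S"
proof -
  obtain K n U x y \<delta> where 1: "K \<in> filt \<C> D" "direct_sum \<C> (replicate n Q) U" "conflation \<C> K x U y X \<delta>"
    using assms(1) unfolding covered_def by blast
  obtain L m V z w \<eta> where 2: "L \<in> filt \<C> D" "direct_sum \<C> (replicate m Q) V" "conflation \<C> L z V w Y \<eta>"
    using assms(2) unfolding covered_def by blast
  obtain KL where KL: "direct_sum \<C> [K, L] KL"
    using direct_sum_exists[of "[K, L]"] conflationD(1)[OF 1(3)] conflationD(1)[OF 2(3)] by auto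
  obtain UV where UV: "direct_sum \<C> [U, V] UV"
    using direct_sum_exists[of "[U, V]"] conflationD(2)[OF 1(3)] conflationD(2)[OF 2(3)] by auto
  obtain u v \<epsilon> where "conflation \<C> KL u UV v S \<epsilon>" using conflation_sum[OF 1(3) 2(3) KL UV assms(3)] .
  moreover have "direct_sum \<C> (replicate (n + m) Q) UV"
    unfolding replicate_add using direct_sum_append[OF 1(2) 2(2) UV] .
  moreover have "KL \<in> filt \<C> D" using filt_pair[OF KL 1(1) 2(1)] .
  ultimately show ?thesis unfolding covered_def by blast
qed

text \<open>By the horseshoe, \<open>M\<close> is up to isomorphism a quotient, with filtered
  kernel, of the sum of \<open>A\<close> and the cover \<open>U\<close> of \<open>Z\<close>. Both
  summands are covered, hence so are their sum and its quotient.\<close>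

lemma covered_extension:
  assumes "conflation \<C> A x M y Z \<delta>" "covered D Q A" "covered D Q Z" "trivial_group (Ext \<C> Q A)"
  shows "covered D Q M"
proof -
  obtain K n U \<iota> q \<kappa> where *: "K \<in> filt \<C> D" "direct_sum \<C> (replicate n Q) U" "conflation \<C> K \<iota> U q Z \<kappa>"
    using assms(3) unfolding covered_def by blast
  have "trivial_group (Ext \<C> U A)"
    using E.trivial_F_direct_sum_left[OF *(2)] conflationD(1)[OF assms(1)] assms(4) by auto
  from horseshoe[OF assms(1) *(3) this] obtain S u v E \<epsilon>
    where E: "direct_sum \<C> [A, U] S" "conflation \<C> K u S v E \<epsilon>" "isoc E M" .
  have "covered D Q S" using covered_sum[OF assms(2) covered_self[OF *(2)] E(1)] .
  then have "covered D Q E" using covered_deflation[OF E(2) *(1)] by simp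
  then show ?thesis using covered_isoc E(3) by blast
qed

lemma covered_direct_sum:
  "\<lbrakk>direct_sum \<C> Xs S; \<And>X. X \<in> set Xs \<Longrightarrow> covered D Q X\<rbrakk> \<Longrightarrow> covered D Q S"
proof (induction Xs arbitrary: S)
  case Nil
  then have "direct_sum \<C> (replicate 0 Q) S" by simp
  then show ?case by (rule covered_self)
next
  case (Cons X Xs)
  obtain T i j p q where T: "direct_sum \<C> Xs T" "bip X T S i j p q"
    using direct_sum_Cons[OF Cons.prems(1)] .
  have "direct_sum \<C> [X, T] S" using T(2) unfolding direct_sum_pair by blast
  then show ?case using covered_sum[of D Q X T S] Cons.IH[OF T(1)] Cons.prems(2) by simp
qed

text \<open>A summand is the quotient by its complement, and the complement \<open>Y\<close> lies in
  the additive closure of \<open>D\<close> as well.\<close>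

lemma covered_add_closure:
  assumes "X \<in> add_closure \<C> D" "covered D Q D"
  shows "covered D Q X"
proof -
  obtain n S Y where S: "direct_sum \<C> (replicate n D) S" "direct_sum \<C> [X, Y] S"
    using assms(1) unfolding add_closure_def by auto
  obtain i j p q where b: "bip X Y S i j p q" using S(2) direct_sum_pair by auto
  have "direct_sum \<C> [Y, X] S" using bip_swap[OF b] direct_sum_pair by auto
  then have "Y \<in> filt \<C> D" using S(1) add_closure_filt unfolding add_closure_def by blast
  moreover have "covered D Q S" using covered_direct_sum[OF S(1)] assms(2) by auto
  ultimately show ?thesis using covered_deflation[OF bip_conflation[OF bip_swap[OF b]]] by blast
qed

lemma add_closure_sublist:
  assumes "direct_sum \<C> Xs N" "mset Xs = mset (Ys @ Zs)" "direct_sum \<C> Ys M"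
  shows "add_closure \<C> M \<subseteq> add_closure \<C> N"
proof -
  have "set Zs \<subseteq> Ob \<C>" using direct_sum_Ob(2)[OF assms(1)] mset_eq_setD[OF assms(2)] by auto
  then obtain M' where M': "direct_sum \<C> Zs M'" using direct_sum_exists by blast
  show ?thesis
    using add_closure_summand[OF direct_sum_group[OF direct_sum_perm[OF assms(1,2)] assms(3) M']] .
qed

text \<open>Each \<open>P ! i\<close> is a summand of \<open>Q\<close> with filtered complement and
  maps onto \<open>\<Theta> ! i\<close> with filtered kernel. Covers therefore exist for
  \<open>D\<close>, and \<open>covered_extension\<close> carries them to all filtered objects.
  \<open>D\<close> and \<open>Q\<close> are arbitrary direct sums, which admits reversed lists in
  the opposite category.\<close>

lemma mixed_stratifying_cover:
  assumes ms: "mixed_stratifying \<C> \<Theta> P" and D: "direct_sum \<C> \<Theta> D" and Q: "direct_sum \<C> P Q"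
  shows "set P \<subseteq> filt \<C> D" "Q \<in> filt \<C> D" "X \<in> filt \<C> D \<Longrightarrow> trivial_group (Ext \<C> Q X)"
    "M \<in> filt \<C> D \<Longrightarrow> covered D Q M"
proof -
  have l: "length P = length \<Theta>" using ms unfolding mixed_stratifying_def by blast
  have ob: "set \<Theta> \<subseteq> Ob \<C>" using D direct_sum_Ob by blast
  have f: "filt \<C> (dsum \<C> \<Theta>) = filt \<C> D"
    using add_closure_isoc[OF direct_sum_unique[OF dsum_direct_sum[OF ob] D]] unfolding filt_def by simp
  have k: "\<exists>K \<in> filt \<C> D. \<exists>x y \<delta>. conflation \<C> K x (P ! i) y (\<Theta> ! i) \<delta>" if i: "i < length \<Theta>" for i
  proof -
    have "mset \<Theta> = mset (take i \<Theta> @ drop i \<Theta>)" by simp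
    also have "\<dots> = mset (drop i \<Theta> @ take i \<Theta>)" unfolding mset_append by (rule add.commute)
    finally have m: "mset \<Theta> = mset (drop i \<Theta> @ take i \<Theta>)" .
    have "direct_sum \<C> (drop i \<Theta>) (dsum \<C> (drop i \<Theta>))"
      using ob by (intro dsum_direct_sum) (meson order_trans set_drop_subset)
    then have "add_closure \<C> (dsum \<C> (drop i \<Theta>)) \<subseteq> add_closure \<C> D"
      using add_closure_sublist[OF D, of "drop i \<Theta>" "take i \<Theta>"] m by blast
    then show ?thesis using ms i filt_mono unfolding mixed_stratifying_def by blast
  qed
  have \<Theta>D: "\<Theta> ! i \<in> filt \<C> D" if "i < length \<Theta>" for i
    using add_closure_filt[OF summand_in_add_closure[OF D]] that by auto
  have PD: "P ! i \<in> filt \<C> D" if i: "i < length \<Theta>" for i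
    using k[OF i] filt_extension \<Theta>D[OF i] by blast
  then show P: "set P \<subseteq> filt \<C> D" using l by (metis in_set_conv_nth subsetI)
  then show QD: "Q \<in> filt \<C> D" using filt_direct_sum[OF Q] by blast
  have "trivial_group (Ext \<C> Y X)" if "Y \<in> set P" "X \<in> filt \<C> D" for X Y
    using ms that l unfolding mixed_stratifying_def f by (metis in_set_conv_nth)
  then show Ext: "trivial_group (Ext \<C> Q X)" if "X \<in> filt \<C> D" for X
    using E.trivial_F_direct_sum_left[OF Q] that filt_Ob by blast
  have covQ: "covered D Q Q" using covered_self[of 1] direct_sum_single direct_sum_Ob(1)[OF Q] by simp
  have cP: "covered D Q (P ! i)" if i: "i < length \<Theta>" for i
  proof -
    have "P ! i \<in> set P" using i l by simp
    then obtain us vs where "P = us @ P ! i # vs" by (meson split_list)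
    then have "mset P = mset (us @ P ! i # vs)" by (rule arg_cong)
    also have "\<dots> = mset ((us @ vs) @ [P ! i])" by simp
    finally obtain Ys where Ys: "mset P = mset (Ys @ [P ! i])" by blast
    have Yf: "set Ys \<subseteq> filt \<C> D" using P mset_eq_setD[OF Ys] by auto
    then obtain Y where Y: "direct_sum \<C> Ys Y" using direct_sum_exists filt_Ob by blast
    have "direct_sum \<C> [Y, P ! i] Q"
      using direct_sum_group[OF direct_sum_perm[OF Q Ys] Y direct_sum_single] PD[OF i] filt_Ob by blast
    then obtain a b c d where "bip Y (P ! i) Q a b c d" unfolding direct_sum_pair by blast
    from covered_deflation[OF bip_conflation[OF this] filt_direct_sum[OF Y Yf] covQ] show ?thesis .
  qed
  have "covered D Q (\<Theta> ! i)" if i: "i < length \<Theta>" for i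
    using k[OF i] covered_deflation cP[OF i] by blast
  then have cD: "covered D Q D" by (intro covered_direct_sum[OF D]) (metis in_set_conv_nth)
  show "covered D Q M" if "M \<in> filt \<C> D" for M
    using that
  proof (induction rule: filt_induct)
    case (add X)
    then show ?case using covered_add_closure cD by blast
  next
    case (ext A x B y C \<delta>)
    then show ?case using covered_extension Ext by blast
  qed
qed

end

section \<open>Vanishing negative extensions and cancellation\<close>

context extriangulated_category_neg
begin

lemma trivial_Neg_middle_right:
  assumes "conflation \<C> A x B y C \<delta>" "W \<in> Ob \<C>" "trivial_group (Neg \<C> W A)" "trivial_group (Neg \<C> W C)"
  shows "trivial_group (Neg \<C> W B)"
proof (rule trivial_groupI)
  note [simp] = conflationD[OF assms(1)] assms(2)
  fix u assume u: "u \<in> carrier (Neg \<C> W B)"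
  have "neg_push \<C> W B C y u = \<zero>\<^bsub>Neg \<C> W C\<^esub>" using trivial_groupD[OF assms(4)] u by simp
  then have "u \<in> neg_push \<C> W A B x ` carrier (Neg \<C> W A)"
    using exact_cov[OF assms(1,2)] u by (simp add: a_kernel_def')
  then show "u = \<zero>\<^bsub>Neg \<C> W B\<^esub>" using assms(3) unfolding trivial_group_def by auto
qed (use conflationD[OF assms(1)] assms(2) in simp)

lemma trivial_Neg_middle_left:
  assumes "conflation \<C> A x B y C \<delta>" "W \<in> Ob \<C>" "trivial_group (Neg \<C> A W)" "trivial_group (Neg \<C> C W)"
  shows "trivial_group (Neg \<C> B W)"
proof (rule trivial_groupI)
  note [simp] = conflationD[OF assms(1)] assms(2)
  fix u assume u: "u \<in> carrier (Neg \<C> B W)"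
  have "neg_pull \<C> B A W x u = \<zero>\<^bsub>Neg \<C> A W\<^esub>" using trivial_groupD[OF assms(3)] u by simp
  then have "u \<in> neg_pull \<C> C B W y ` carrier (Neg \<C> C W)"
    using exact_contra[OF assms(1,2)] u by (simp add: a_kernel_def')
  then show "u = \<zero>\<^bsub>Neg \<C> B W\<^esub>" using assms(4) unfolding trivial_group_def by auto
qed (use conflationD[OF assms(1)] assms(2) in simp)

text \<open>Two inductions over filtrations: first in the second variable with \<open>D\<close> in
  the first, then in the first variable.\<close>

lemma filt_trivial_Neg:
  assumes "D \<in> Ob \<C>" "trivial_group (Neg \<C> D D)" "W \<in> filt \<C> D" "X \<in> filt \<C> D"
  shows "trivial_group (Neg \<C> W X)"
proof -
  have D: "trivial_group (Neg \<C> D X)"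
    using assms(4)
  proof (induction rule: filt_induct)
    case (add X)
    then show ?case using N.trivial_F_add_closure_right assms by blast
  next
    case (ext A x B y C \<delta>)
    then show ?case using trivial_Neg_middle_right assms(1) by blast
  qed
  have X: "X \<in> Ob \<C>" using assms(4) filt_Ob by blast
  show ?thesis using assms(3)
  proof (induction rule: filt_induct)
    case (add W)
    then show ?case using N.trivial_F_add_closure_left D X by blast
  next
    case (ext A x B y C \<delta>)
    then show ?case using trivial_Neg_middle_left X by blast
  qed
qed

text \<open>The kernel of composition with \<open>x\<close> on maps from \<open>W\<close> is the
  image of \<open>Neg \<C> W C\<close>. This is the source of left exactness of \<Psi>.\<close>

lemma inflation_mono:
  assumes "conflation \<C> A x B y C \<delta>" "W \<in> Ob \<C>" "trivial_group (Neg \<C> W C)"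
    "f \<in> Mor W A" "comp \<C> W A B x f = Z0 W B"
  shows "f = Z0 W A"
proof -
  note [simp] = conflationD[OF assms(1)] assms(2)
  have "f \<in> neg_conn_contra \<C> C A \<delta> W ` carrier (Neg \<C> W C)"
    using exact_cov[OF assms(1,2)] assms(4,5) by (simp add: a_kernel_def')
  then have "f = neg_conn_contra \<C> C A \<delta> W \<zero>\<^bsub>Neg \<C> W C\<^esub>" using assms(3) unfolding trivial_group_def by auto
  also have "\<dots> = Z0 W A" by (rule add_hom_zero[OF N.group Hom_group neg_conn_contra_hom]) simp_all
  finally show ?thesis .
qed

text \<open>Dual to \<open>inflation_mono\<close>; it supplies the uniqueness that weak cokernels
  lack and thereby faithfulness of \<Psi>.\<close>

lemma deflation_epi:
  assumes "conflation \<C> A x B y C \<delta>" "W \<in> Ob \<C>" "trivial_group (Neg \<C> A W)"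
    "f \<in> Mor C W" "comp \<C> B C W f y = Z0 B W"
  shows "f = Z0 C W"
proof -
  note [simp] = conflationD[OF assms(1)] assms(2)
  have "f \<in> neg_conn_cov \<C> C A \<delta> W ` carrier (Neg \<C> A W)"
    using exact_contra[OF assms(1,2)] assms(4,5) by (simp add: a_kernel_def')
  then have "f = neg_conn_cov \<C> C A \<delta> W \<zero>\<^bsub>Neg \<C> A W\<^esub>" using assms(3) unfolding trivial_group_def by auto
  also have "\<dots> = Z0 C W" by (rule add_hom_zero[OF N.group Hom_group neg_conn_cov_hom]) simp_all
  finally show ?thesis .
qed

end

section \<open>Right modules\<close>

lemma right_moduleD:
  assumes "right_module A M"
  shows "ring A" "abelian_group M"
    "\<lbrakk>a \<in> carrier A; x \<in> carrier M\<rbrakk> \<Longrightarrow> a \<odot>\<^bsub>M\<^esub> x \<in> carrier M"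
    "\<lbrakk>a \<in> carrier A; b \<in> carrier A; x \<in> carrier M\<rbrakk> \<Longrightarrow> (a \<oplus>\<^bsub>A\<^esub> b) \<odot>\<^bsub>M\<^esub> x = a \<odot>\<^bsub>M\<^esub> x \<oplus>\<^bsub>M\<^esub> b \<odot>\<^bsub>M\<^esub> x"
    "\<lbrakk>a \<in> carrier A; x \<in> carrier M; y \<in> carrier M\<rbrakk> \<Longrightarrow> a \<odot>\<^bsub>M\<^esub> (x \<oplus>\<^bsub>M\<^esub> y) = a \<odot>\<^bsub>M\<^esub> x \<oplus>\<^bsub>M\<^esub> a \<odot>\<^bsub>M\<^esub> y"
    "\<lbrakk>a \<in> carrier A; b \<in> carrier A; x \<in> carrier M\<rbrakk> \<Longrightarrow> (a \<otimes>\<^bsub>A\<^esub> b) \<odot>\<^bsub>M\<^esub> x = b \<odot>\<^bsub>M\<^esub> (a \<odot>\<^bsub>M\<^esub> x)"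
    "x \<in> carrier M \<Longrightarrow> \<one>\<^bsub>A\<^esub> \<odot>\<^bsub>M\<^esub> x = x"
  using assms unfolding right_module_def by blast+

lemma rm_closed [simp]:
  assumes "right_module A M"
  shows "\<zero>\<^bsub>M\<^esub> \<in> carrier M" "\<lbrakk>x \<in> carrier M; y \<in> carrier M\<rbrakk> \<Longrightarrow> x \<oplus>\<^bsub>M\<^esub> y \<in> carrier M"
    "x \<in> carrier M \<Longrightarrow> \<ominus>\<^bsub>M\<^esub> x \<in> carrier M"
proof -
  interpret abelian_group M using assms right_moduleD by blast
  show "\<zero>\<^bsub>M\<^esub> \<in> carrier M" "\<lbrakk>x \<in> carrier M; y \<in> carrier M\<rbrakk> \<Longrightarrow> x \<oplus>\<^bsub>M\<^esub> y \<in> carrier M"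
    "x \<in> carrier M \<Longrightarrow> \<ominus>\<^bsub>M\<^esub> x \<in> carrier M" by simp_all
qed

lemma rm_smult_zero:
  assumes "right_module A M" "a \<in> carrier A"
  shows "a \<odot>\<^bsub>M\<^esub> \<zero>\<^bsub>M\<^esub> = \<zero>\<^bsub>M\<^esub>"
proof -
  interpret abelian_group M using assms right_moduleD by blast
  show ?thesis
    using right_moduleD(5)[OF assms zero_closed zero_closed] right_moduleD(3)[OF assms zero_closed]
    by (intro idem_zero) auto
qed

lemma rm_smult_uminus:
  assumes "right_module A M" "a \<in> carrier A" "x \<in> carrier M"
  shows "a \<odot>\<^bsub>M\<^esub> (\<ominus>\<^bsub>M\<^esub> x) = \<ominus>\<^bsub>M\<^esub> (a \<odot>\<^bsub>M\<^esub> x)"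
proof -
  interpret abelian_group M using assms right_moduleD by blast
  have "a \<odot>\<^bsub>M\<^esub> (\<ominus>\<^bsub>M\<^esub> x) \<oplus>\<^bsub>M\<^esub> a \<odot>\<^bsub>M\<^esub> x = \<zero>\<^bsub>M\<^esub>"
    using right_moduleD(5)[OF assms(1,2), of "\<ominus>\<^bsub>M\<^esub> x" x] assms rm_smult_zero[OF assms(1,2)] by (simp add: l_neg)
  then show ?thesis using right_moduleD(3)[OF assms(1,2)] assms(3) by (simp add: minus_equality)
qed

lemma rhomI:
  assumes "f \<in> extensional (carrier M)" "\<And>x. x \<in> carrier M \<Longrightarrow> f x \<in> carrier N"
    "\<And>x y. \<lbrakk>x \<in> carrier M; y \<in> carrier M\<rbrakk> \<Longrightarrow> f (x \<oplus>\<^bsub>M\<^esub> y) = f x \<oplus>\<^bsub>N\<^esub> f y"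
    "\<And>a x. \<lbrakk>a \<in> carrier A; x \<in> carrier M\<rbrakk> \<Longrightarrow> f (a \<odot>\<^bsub>M\<^esub> x) = a \<odot>\<^bsub>N\<^esub> f x"
  shows "f \<in> rhom A M N"
  using assms unfolding rhom_def by (auto simp: PiE_def)

lemma rhomD:
  assumes "f \<in> rhom A M N"
  shows "x \<in> carrier M \<Longrightarrow> f x \<in> carrier N"
    "\<lbrakk>x \<in> carrier M; y \<in> carrier M\<rbrakk> \<Longrightarrow> f (x \<oplus>\<^bsub>M\<^esub> y) = f x \<oplus>\<^bsub>N\<^esub> f y"
    "\<lbrakk>a \<in> carrier A; x \<in> carrier M\<rbrakk> \<Longrightarrow> f (a \<odot>\<^bsub>M\<^esub> x) = a \<odot>\<^bsub>N\<^esub> f x"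
    "f \<in> extensional (carrier M)"
  using assms unfolding rhom_def by (auto simp: PiE_def)

lemma rhom_eqI:
  "\<lbrakk>f \<in> rhom A M N; g \<in> rhom A M N'; \<And>x. x \<in> carrier M \<Longrightarrow> f x = g x\<rbrakk> \<Longrightarrow> f = g"
  using rhomD(4) extensionalityI by metis

lemma rhom_zero:
  assumes "f \<in> rhom A M N" "right_module A M" "right_module A N"
  shows "f \<zero>\<^bsub>M\<^esub> = \<zero>\<^bsub>N\<^esub>"
proof -
  interpret M: abelian_group M using assms right_moduleD by blast
  interpret N: abelian_group N using assms right_moduleD by blast
  show ?thesis using rhomD(1,2)[OF assms(1), of "\<zero>\<^bsub>M\<^esub>"] by (intro N.idem_zero) (simp, metis M.l_zero M.zero_closed rhomD(2)[OF assms(1)])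
qed

lemma rhom_uminus:
  assumes "f \<in> rhom A M N" "right_module A M" "right_module A N" "x \<in> carrier M"
  shows "f (\<ominus>\<^bsub>M\<^esub> x) = \<ominus>\<^bsub>N\<^esub> f x"
proof -
  interpret M: abelian_group M using assms right_moduleD by blast
  interpret N: abelian_group N using assms right_moduleD by blast
  have "f (\<ominus>\<^bsub>M\<^esub> x) \<oplus>\<^bsub>N\<^esub> f x = \<zero>\<^bsub>N\<^esub>"
    using rhomD(2)[OF assms(1), of "\<ominus>\<^bsub>M\<^esub> x" x] assms(4) rhom_zero[OF assms(1-3)] by (simp add: M.l_neg)
  then show ?thesis using rhomD(1)[OF assms(1)] assms(4) by (simp add: N.minus_equality)
qed

lemma rhom_compose:
  assumes "f \<in> rhom A L M" "g \<in> rhom A M N" "right_module A L"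
  shows "compose (carrier L) g f \<in> rhom A L N"
  by (rule rhomI) (use rhomD[OF assms(1)] rhomD[OF assms(2)] right_moduleD[OF assms(3)] assms(3) in \<open>auto simp: compose_def\<close>)

lemma compose_eval [simp]: "x \<in> S \<Longrightarrow> compose S g f x = g (f x)"
  by (simp add: compose_def)

lemma rhom_ident: "right_module A M \<Longrightarrow> (\<lambda>x \<in> carrier M. x) \<in> rhom A M M"
  by (rule rhomI) (auto dest: right_moduleD)

lemma rhom_const_zero:
  assumes "right_module A M" "right_module A N"
  shows "(\<lambda>x \<in> carrier M. \<zero>\<^bsub>N\<^esub>) \<in> rhom A M N"
  by (rule rhomI) (use right_moduleD[OF assms(1)] right_moduleD[OF assms(2)] assms rm_smult_zero[OF assms(2)] abelian_group.axioms(1)[of N] in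
    \<open>auto simp: abelian_monoid.l_zero\<close>)

lemma rhom_add:
  assumes "right_module A M" "right_module A N" "f \<in> rhom A M N" "g \<in> rhom A M N"
  shows "(\<lambda>x \<in> carrier M. f x \<oplus>\<^bsub>N\<^esub> g x) \<in> rhom A M N"
proof (rule rhomI)
  interpret N: abelian_group N using assms right_moduleD by blast
  note F = rhomD[OF assms(3)] rhomD[OF assms(4)]
  note [simp] = right_moduleD(3)[OF assms(1)] rm_closed[OF assms(1)] rm_closed[OF assms(2)]
  fix x y a
  show "(\<lambda>x \<in> carrier M. f x \<oplus>\<^bsub>N\<^esub> g x) (x \<oplus>\<^bsub>M\<^esub> y)
      = (\<lambda>x \<in> carrier M. f x \<oplus>\<^bsub>N\<^esub> g x) x \<oplus>\<^bsub>N\<^esub> (\<lambda>x \<in> carrier M. f x \<oplus>\<^bsub>N\<^esub> g x) y"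
    if "x \<in> carrier M" "y \<in> carrier M"
    using that assms(1) F N.a_ac by simp
  show "(\<lambda>x \<in> carrier M. f x \<oplus>\<^bsub>N\<^esub> g x) (a \<odot>\<^bsub>M\<^esub> x) = a \<odot>\<^bsub>N\<^esub> (\<lambda>x \<in> carrier M. f x \<oplus>\<^bsub>N\<^esub> g x) x"
    if "a \<in> carrier A" "x \<in> carrier M"
    using that F right_moduleD(5)[OF assms(2)] by simp
qed (use assms rhomD(1)[OF assms(3)] rhomD(1)[OF assms(4)] in auto)

lemma rhom_neg:
  assumes "right_module A M" "right_module A N" "f \<in> rhom A M N"
  shows "(\<lambda>x \<in> carrier M. \<ominus>\<^bsub>N\<^esub> f x) \<in> rhom A M N"
proof (rule rhomI)
  interpret N: abelian_group N using assms right_moduleD by blast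
  note F = rhomD[OF assms(3)]
  note [simp] = right_moduleD(3)[OF assms(1)] rm_closed[OF assms(1)] rm_closed[OF assms(2)]
  fix x y a
  show "(\<lambda>x \<in> carrier M. \<ominus>\<^bsub>N\<^esub> f x) (x \<oplus>\<^bsub>M\<^esub> y)
      = (\<lambda>x \<in> carrier M. \<ominus>\<^bsub>N\<^esub> f x) x \<oplus>\<^bsub>N\<^esub> (\<lambda>x \<in> carrier M. \<ominus>\<^bsub>N\<^esub> f x) y"
    if "x \<in> carrier M" "y \<in> carrier M"
    using that assms(1) F by (simp add: N.minus_add)
  show "(\<lambda>x \<in> carrier M. \<ominus>\<^bsub>N\<^esub> f x) (a \<odot>\<^bsub>M\<^esub> x) = a \<odot>\<^bsub>N\<^esub> (\<lambda>x \<in> carrier M. \<ominus>\<^bsub>N\<^esub> f x) x"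
    if "a \<in> carrier A" "x \<in> carrier M"
    using that F rm_smult_uminus[OF assms(2)] by simp
qed (use assms rhomD(1)[OF assms(3)] in auto)

lemma mod_Hom_simps [simp]:
  "carrier (mod_Hom A M N) = rhom A M N"
  "\<zero>\<^bsub>mod_Hom A M N\<^esub> = (\<lambda>x \<in> carrier M. \<zero>\<^bsub>N\<^esub>)"
  "f \<oplus>\<^bsub>mod_Hom A M N\<^esub> g = (\<lambda>x \<in> carrier M. f x \<oplus>\<^bsub>N\<^esub> g x)"
  "c \<odot>\<^bsub>mod_Hom A M N\<^esub> f = (\<lambda>x \<in> carrier M. (c \<odot>\<^bsub>A\<^esub> \<one>\<^bsub>A\<^esub>) \<odot>\<^bsub>N\<^esub> f x)"
  by (simp_all add: mod_Hom_def)

lemma mod_Hom_group: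
  assumes "right_module A M" "right_module A N"
  shows "abelian_group (mod_Hom A M N)"
proof (rule abelian_groupI)
  interpret N: abelian_group N using assms right_moduleD by blast
  fix f g h assume f: "f \<in> carrier (mod_Hom A M N)" and g: "g \<in> carrier (mod_Hom A M N)" and h: "h \<in> carrier (mod_Hom A M N)"
  note F [simp] = rhomD(1)[of f A M N] rhomD(1)[of g A M N] rhomD(1)[of h A M N] rhom_add[OF assms]
  show "f \<oplus>\<^bsub>mod_Hom A M N\<^esub> g \<in> carrier (mod_Hom A M N)" using f g by simp
  show "f \<oplus>\<^bsub>mod_Hom A M N\<^esub> g \<oplus>\<^bsub>mod_Hom A M N\<^esub> h = f \<oplus>\<^bsub>mod_Hom A M N\<^esub> (g \<oplus>\<^bsub>mod_Hom A M N\<^esub> h)"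
    using f g h by (auto simp: N.a_assoc intro!: restrict_ext)
  show "f \<oplus>\<^bsub>mod_Hom A M N\<^esub> g = g \<oplus>\<^bsub>mod_Hom A M N\<^esub> f"
    using f g by (auto simp: N.a_comm intro!: restrict_ext)
  show "\<zero>\<^bsub>mod_Hom A M N\<^esub> \<oplus>\<^bsub>mod_Hom A M N\<^esub> f = f"
    using f rhomD(4)[of f A M N] by (intro extensionalityI[of _ "carrier M"]) auto
  show "\<exists>y\<in>carrier (mod_Hom A M N). y \<oplus>\<^bsub>mod_Hom A M N\<^esub> f = \<zero>\<^bsub>mod_Hom A M N\<^esub>"
    using f rhom_neg[OF assms, of f]
    by (intro bexI[of _ "\<lambda>x \<in> carrier M. \<ominus>\<^bsub>N\<^esub> f x"]) (auto simp: N.l_neg intro!: restrict_ext)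
qed (use rhom_const_zero[OF assms] in simp)

lemma mod_cat_simps [simp]:
  "Ob (mod_cat A) = mod_Ob A" "Hom (mod_cat A) = mod_Hom A" "ident (mod_cat A) M = (\<lambda>x \<in> carrier M. x)"
  "comp (mod_cat A) X Y Z g f = compose (carrier X) g f"
  "Ext (mod_cat A) = mod_Ext A 1" "realization (mod_cat A) = mod_realization A"
  by (simp_all add: mod_cat_def)

lemma mod_ObD [simp]: "M \<in> mod_Ob A \<Longrightarrow> right_module A M" "M \<in> mod_Ob A \<Longrightarrow> fin_gen A M"
  by (auto simp: mod_Ob_def)

lemma preadditive_mod_cat: "preadditive (mod_cat A)"
proof (rule preadditive.intro, goal_cases)
  case (1 X Y)
  then show ?case by (auto intro!: mod_Hom_group)
next
  case (2 X)
  then show ?case by (simp add: rhom_ident)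
next
  case (3 X Y Z f g)
  then show ?case by (simp add: rhom_compose)
next
  case (4 X Y f)
  then show ?case
    using rhom_compose[of f A X Y "\<lambda>x \<in> carrier Y. x" Y] rhom_ident[of A Y]
    by (auto intro!: rhom_eqI[of _ A X Y] dest: rhomD(1))
next
  case (5 X Y f)
  then show ?case
    using rhom_compose[of "\<lambda>x \<in> carrier X. x" A X X f Y] rhom_ident[of A X]
    by (auto intro!: rhom_eqI[of _ A X Y])
next
  case (6 W X Y Z f g h)
  then show ?case by (auto simp: compose_def dest: rhomD(1) intro!: restrict_ext)
next
  case (7 X Y Z f g g')
  then show ?case by (auto simp: compose_def dest: rhomD(1) intro!: restrict_ext)
next
  case (8 X Y Z f f' g)
  then show ?case by (auto simp: compose_def rhomD intro!: restrict_ext)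
qed

subsection \<open>Submodules and kernels\<close>

lemma sub_right_module:
  assumes M: "right_module A M" and "U \<subseteq> carrier M" "\<zero>\<^bsub>M\<^esub> \<in> U"
    "\<And>x y. \<lbrakk>x \<in> U; y \<in> U\<rbrakk> \<Longrightarrow> x \<oplus>\<^bsub>M\<^esub> y \<in> U" "\<And>x. x \<in> U \<Longrightarrow> \<ominus>\<^bsub>M\<^esub> x \<in> U"
    "\<And>a x. \<lbrakk>a \<in> carrier A; x \<in> U\<rbrakk> \<Longrightarrow> a \<odot>\<^bsub>M\<^esub> x \<in> U"
  shows "right_module A (M\<lparr>carrier := U\<rparr>)"
proof -
  interpret M: abelian_group M using M right_moduleD by blast
  have U: "x \<in> U \<Longrightarrow> x \<in> carrier M" for x using assms(2) by blast
  have "abelian_group (M\<lparr>carrier := U\<rparr>)"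
  proof (rule abelian_groupI)
    fix x y z assume "x \<in> carrier (M\<lparr>carrier := U\<rparr>)" "y \<in> carrier (M\<lparr>carrier := U\<rparr>)" "z \<in> carrier (M\<lparr>carrier := U\<rparr>)"
    then show "x \<oplus>\<^bsub>M\<lparr>carrier := U\<rparr>\<^esub> y \<oplus>\<^bsub>M\<lparr>carrier := U\<rparr>\<^esub> z = x \<oplus>\<^bsub>M\<lparr>carrier := U\<rparr>\<^esub> (y \<oplus>\<^bsub>M\<lparr>carrier := U\<rparr>\<^esub> z)"
      using U by (simp add: M.a_assoc)
  next
    fix x assume "x \<in> carrier (M\<lparr>carrier := U\<rparr>)"
    then show "\<exists>y\<in>carrier (M\<lparr>carrier := U\<rparr>). y \<oplus>\<^bsub>M\<lparr>carrier := U\<rparr>\<^esub> x = \<zero>\<^bsub>M\<lparr>carrier := U\<rparr>\<^esub>"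
      using assms(5)[of x] U by (intro bexI[of _ "\<ominus>\<^bsub>M\<^esub> x"]) (auto simp: M.l_neg)
  qed (use assms(3,4) U in \<open>auto simp: M.a_comm\<close>)
  then show ?thesis unfolding right_module_def using right_moduleD[OF M] assms(6) U by simp
qed

lemma kernel_props:
  assumes "f \<in> rhom A M N" "right_module A M" "right_module A N"
  shows "a_kernel M N f \<subseteq> carrier M" "\<zero>\<^bsub>M\<^esub> \<in> a_kernel M N f"
    "\<lbrakk>x \<in> a_kernel M N f; y \<in> a_kernel M N f\<rbrakk> \<Longrightarrow> x \<oplus>\<^bsub>M\<^esub> y \<in> a_kernel M N f"
    "x \<in> a_kernel M N f \<Longrightarrow> \<ominus>\<^bsub>M\<^esub> x \<in> a_kernel M N f"
    "\<lbrakk>a \<in> carrier A; x \<in> a_kernel M N f\<rbrakk> \<Longrightarrow> a \<odot>\<^bsub>M\<^esub> x \<in> a_kernel M N f"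
proof -
  interpret N: abelian_group N using assms right_moduleD by blast
  note [simp] = rhomD[OF assms(1)] rhom_zero[OF assms] rhom_uminus[OF assms] right_moduleD(3)[OF assms(2)]
    rm_closed[OF assms(2)] rm_smult_zero[OF assms(3)]
  show "a_kernel M N f \<subseteq> carrier M" "\<zero>\<^bsub>M\<^esub> \<in> a_kernel M N f"
    "\<lbrakk>x \<in> a_kernel M N f; y \<in> a_kernel M N f\<rbrakk> \<Longrightarrow> x \<oplus>\<^bsub>M\<^esub> y \<in> a_kernel M N f"
    "x \<in> a_kernel M N f \<Longrightarrow> \<ominus>\<^bsub>M\<^esub> x \<in> a_kernel M N f"
    "\<lbrakk>a \<in> carrier A; x \<in> a_kernel M N f\<rbrakk> \<Longrightarrow> a \<odot>\<^bsub>M\<^esub> x \<in> a_kernel M N f"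
    by (auto simp: a_kernel_def' N.add.inv_one)
qed

lemma kernel_right_module:
  assumes "f \<in> rhom A M N" "right_module A M" "right_module A N"
  shows "right_module A (M\<lparr>carrier := a_kernel M N f\<rparr>)"
  using kernel_props[OF assms] by (intro sub_right_module[OF assms(2)])

lemma rm_a_inv_sub:
  assumes "right_module A M" "right_module A (M\<lparr>carrier := U\<rparr>)" "U \<subseteq> carrier M" "x \<in> U"
  shows "\<ominus>\<^bsub>M\<lparr>carrier := U\<rparr>\<^esub> x = \<ominus>\<^bsub>M\<^esub> x"
proof -
  interpret M: abelian_group M using assms right_moduleD by blast
  interpret U: abelian_group "M\<lparr>carrier := U\<rparr>" using assms right_moduleD by blast
  have "(\<ominus>\<^bsub>M\<lparr>carrier := U\<rparr>\<^esub> x) \<oplus>\<^bsub>M\<^esub> x = \<zero>\<^bsub>M\<^esub>" using U.l_neg[of x] assms by simp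
  moreover have "\<ominus>\<^bsub>M\<lparr>carrier := U\<rparr>\<^esub> x \<in> U" using U.a_inv_closed[of x] assms by simp
  ultimately show ?thesis using assms by (metis M.minus_equality subsetD)
qed

lemma submoduleI:
  assumes "right_module A M" "U \<subseteq> carrier M" "\<zero>\<^bsub>M\<^esub> \<in> U"
    "\<And>x y. \<lbrakk>x \<in> U; y \<in> U\<rbrakk> \<Longrightarrow> x \<oplus>\<^bsub>M\<^esub> y \<in> U" "\<And>x. x \<in> U \<Longrightarrow> \<ominus>\<^bsub>M\<^esub> x \<in> U"
    "\<And>a x. \<lbrakk>a \<in> carrier A; x \<in> U\<rbrakk> \<Longrightarrow> a \<odot>\<^bsub>M\<^esub> x \<in> U"
  shows "submodule U A M"
  using assms by unfold_locales (auto simp: a_inv_def)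

lemma submoduleD:
  assumes "submodule U A M"
  shows "U \<subseteq> carrier M" "\<zero>\<^bsub>M\<^esub> \<in> U" "\<lbrakk>x \<in> U; y \<in> U\<rbrakk> \<Longrightarrow> x \<oplus>\<^bsub>M\<^esub> y \<in> U" "x \<in> U \<Longrightarrow> \<ominus>\<^bsub>M\<^esub> x \<in> U"
    "\<lbrakk>a \<in> carrier A; x \<in> U\<rbrakk> \<Longrightarrow> a \<odot>\<^bsub>M\<^esub> x \<in> U"
  using assms unfolding submodule_def submodule_axioms_def subgroup_def by (auto simp: a_inv_def)

section \<open>Finite generation of images and extensions\<close>

lemma fin_gen_image:
  assumes "right_module A E" "right_module A M" "y \<in> rhom A E M" "y ` carrier E = carrier M" "fin_gen A E"
  shows "fin_gen A M"
proof -
  obtain S where S: "finite S" "S \<subseteq> carrier E" "\<And>U. submodule U A E \<Longrightarrow> S \<subseteq> U \<Longrightarrow> U = carrier E"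
    using assms(5) unfolding fin_gen_def by blast
  show ?thesis unfolding fin_gen_def
  proof (intro exI[of _ "y ` S"] conjI allI impI)
    show "finite (y ` S)" "y ` S \<subseteq> carrier M" using S assms(4) by auto
    fix U assume U: "submodule U A M" "y ` S \<subseteq> U"
    have "submodule {e \<in> carrier E. y e \<in> U} A E"
      by (rule submoduleI[OF assms(1)])
        (use submoduleD[OF U(1)] rhomD[OF assms(3)] assms right_moduleD[OF assms(1)] rhom_zero[OF assms(3,1,2)]
           rhom_uminus[OF assms(3,1,2)] in auto)
    then have "{e \<in> carrier E. y e \<in> U} = carrier E" using S(2) U(2) by (intro S(3)) auto
    then have "y ` carrier E \<subseteq> U" by auto
    then show "U = carrier M" using assms(4) submoduleD(1)[OF U(1)] by auto
  qed
qed

lemma rhom_image_submodule: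
  assumes "right_module A E" "right_module A M" "y \<in> rhom A E M" "submodule U A E"
  shows "submodule (y ` U) A M"
proof -
  note UD = submoduleD[OF assms(4)]
  show ?thesis
  proof (rule submoduleI[OF assms(2)])
    show "y ` U \<subseteq> carrier M" using UD(1) rhomD(1)[OF assms(3)] by blast
    show "\<zero>\<^bsub>M\<^esub> \<in> y ` U" using UD(2) rhom_zero[OF assms(3,1,2)] by (metis image_eqI)
  next
    fix v w assume "v \<in> y ` U" "w \<in> y ` U"
    then obtain v' w' where *: "v' \<in> U" "w' \<in> U" "v = y v'" "w = y w'" by auto
    then have "v \<oplus>\<^bsub>M\<^esub> w = y (v' \<oplus>\<^bsub>E\<^esub> w')" using rhomD(2)[OF assms(3)] UD(1) by (simp add: subset_iff)
    then show "v \<oplus>\<^bsub>M\<^esub> w \<in> y ` U" using UD(3) * by auto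
  next
    fix v assume "v \<in> y ` U"
    then obtain v' where *: "v' \<in> U" "v = y v'" by auto
    then have "\<ominus>\<^bsub>M\<^esub> v = y (\<ominus>\<^bsub>E\<^esub> v')" using rhom_uminus[OF assms(3,1,2)] UD(1) by auto
    then show "\<ominus>\<^bsub>M\<^esub> v \<in> y ` U" using UD(4) * by auto
  next
    fix a v assume a: "a \<in> carrier A" and "v \<in> y ` U"
    then obtain v' where *: "v' \<in> U" "v = y v'" by auto
    then have "a \<odot>\<^bsub>M\<^esub> v = y (a \<odot>\<^bsub>E\<^esub> v')" using rhomD(3)[OF assms(3) a] UD(1) by auto
    then show "a \<odot>\<^bsub>M\<^esub> v \<in> y ` U" using UD(5) a * by auto
  qed
qed

lemma submodule_carrier: "right_module A M \<Longrightarrow> submodule (carrier M) A M"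
  by (rule submoduleI) (simp_all add: right_moduleD)

text \<open>Generators of the kernel are joined with lifts of generators of the quotient. In
  \<open>ext_vanish_middle\<close> this makes a kernel finitely generated over an arbitrary algebra
  with enough projectives.\<close>

lemma fin_gen_extension:
  assumes "right_module A E" "right_module A M" "y \<in> rhom A E M" "y ` carrier E = carrier M"
    "fin_gen A M" "fin_gen A (E\<lparr>carrier := a_kernel E M y\<rparr>)"
  shows "fin_gen A E"
proof -
  interpret E: abelian_group E using assms right_moduleD by blast
  interpret M: abelian_group M using assms right_moduleD by blast
  let ?K = "a_kernel E M y"
  note K = kernel_props[OF assms(3,1,2)] and KM = kernel_right_module[OF assms(3,1,2)]
  obtain S where S: "finite S" "S \<subseteq> ?K" "\<And>U. submodule U A (E\<lparr>carrier := ?K\<rparr>) \<Longrightarrow> S \<subseteq> U \<Longrightarrow> U = ?K"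
    using assms(6) unfolding fin_gen_def by auto
  obtain T where T: "finite T" "T \<subseteq> carrier M" "\<And>U. submodule U A M \<Longrightarrow> T \<subseteq> U \<Longrightarrow> U = carrier M"
    using assms(5) unfolding fin_gen_def by auto
  obtain T' where T': "finite T'" "T' \<subseteq> carrier E" "T = y ` T'"
    using T(1,2) assms(4) by (metis finite_subset_image)
  show ?thesis unfolding fin_gen_def
  proof (intro exI[of _ "S \<union> T'"] conjI allI impI)
    show "finite (S \<union> T')" "S \<union> T' \<subseteq> carrier E" using S T' K by auto
    fix U assume U: "submodule U A E" "S \<union> T' \<subseteq> U"
    note UD = submoduleD[OF U(1)]
    have "submodule (U \<inter> ?K) A (E\<lparr>carrier := ?K\<rparr>)"
      by (rule submoduleI[OF KM]) (use UD K rm_a_inv_sub[OF assms(1) KM K(1)] in auto)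
    then have K1: "U \<inter> ?K = ?K" using S(2) U(2) by (intro S(3)) auto
    have "submodule (y ` U) A M" by (rule rhom_image_submodule[OF assms(1-3) U(1)])
    then have M1: "y ` U = carrier M" using T'(3) U(2) by (intro T(3)) auto
    have "e \<in> U" if e: "e \<in> carrier E" for e
    proof -
      obtain u where u: "u \<in> U" "y e = y u" using M1 rhomD(1)[OF assms(3) e] by auto
      have uE: "u \<in> carrier E" using u UD(1) by auto
      have "y (e \<oplus>\<^bsub>E\<^esub> \<ominus>\<^bsub>E\<^esub> u) = \<zero>\<^bsub>M\<^esub>"
        using rhomD(1,2)[OF assms(3)] rhom_uminus[OF assms(3,1,2)] e uE u by (simp add: M.r_neg)
      then have "e \<oplus>\<^bsub>E\<^esub> \<ominus>\<^bsub>E\<^esub> u \<in> U" using K1 e uE by (auto simp: a_kernel_def')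
      then have "(e \<oplus>\<^bsub>E\<^esub> \<ominus>\<^bsub>E\<^esub> u) \<oplus>\<^bsub>E\<^esub> u \<in> U" using UD(3) u by blast
      then show ?thesis using e uE by (simp add: E.a_assoc E.l_neg)
    qed
    then show "U = carrier E" using UD(1) by blast
  qed
qed

section \<open>Factoring and transporting homomorphisms\<close>

lemma rhom_sub_target: "\<lbrakk>f \<in> rhom A M N; \<And>x. x \<in> carrier M \<Longrightarrow> f x \<in> U\<rbrakk> \<Longrightarrow> f \<in> rhom A M (N\<lparr>carrier := U\<rparr>)"
  by (rule rhomI) (auto dest: rhomD)

lemma rhom_sub_target_D: "\<lbrakk>f \<in> rhom A M (N\<lparr>carrier := U\<rparr>); U \<subseteq> carrier N\<rbrakk> \<Longrightarrow> f \<in> rhom A M N"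
  by (rule rhomI) (use rhomD[of f A M "N\<lparr>carrier := U\<rparr>"] in auto)

lemma rhom_restrict:
  assumes "f \<in> rhom A M N" "right_module A (M\<lparr>carrier := U\<rparr>)" "U \<subseteq> carrier M"
  shows "restrict f U \<in> rhom A (M\<lparr>carrier := U\<rparr>) N"
proof (rule rhomI)
  fix x y a
  show "restrict f U (x \<oplus>\<^bsub>M\<lparr>carrier := U\<rparr>\<^esub> y) = restrict f U x \<oplus>\<^bsub>N\<^esub> restrict f U y"
    if "x \<in> carrier (M\<lparr>carrier := U\<rparr>)" "y \<in> carrier (M\<lparr>carrier := U\<rparr>)"
    using that rm_closed(2)[OF assms(2)] rhomD(2)[OF assms(1), of x y] assms(3) by auto
  show "restrict f U (a \<odot>\<^bsub>M\<lparr>carrier := U\<rparr>\<^esub> x) = a \<odot>\<^bsub>N\<^esub> restrict f U x"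
    if "a \<in> carrier A" "x \<in> carrier (M\<lparr>carrier := U\<rparr>)"
    using that right_moduleD(3)[OF assms(2)] rhomD(3)[OF assms(1), of a x] assms(3) by auto
qed (use rhomD(1)[OF assms(1)] assms(3) in auto)

text \<open>\<open>X\<close> is asked only to be closed under the operations and may have any
  element type; \<open>ext_vanish_of_cover\<close> applies this to a module of pairs, outside the
  fixed carrier type.\<close>

lemma rhom_factor:
  assumes s: "s \<in> rhom A X E" and t: "t \<in> rhom A X N" and surj: "s ` carrier X = carrier E"
    and cl: "\<And>x y. \<lbrakk>x \<in> carrier X; y \<in> carrier X\<rbrakk> \<Longrightarrow> x \<oplus>\<^bsub>X\<^esub> y \<in> carrier X"
      "\<And>a x. \<lbrakk>a \<in> carrier A; x \<in> carrier X\<rbrakk> \<Longrightarrow> a \<odot>\<^bsub>X\<^esub> x \<in> carrier X"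
    and wd: "\<And>x x'. \<lbrakk>x \<in> carrier X; x' \<in> carrier X; s x = s x'\<rbrakk> \<Longrightarrow> t x = t x'"
  obtains g where "g \<in> rhom A E N" "\<And>x. x \<in> carrier X \<Longrightarrow> g (s x) = t x"
proof -
  define c where "c e = (SOME x. x \<in> carrier X \<and> s x = e)" for e
  have c: "c e \<in> carrier X" "s (c e) = e" if "e \<in> carrier E" for e
  proof -
    have "\<exists>x. x \<in> carrier X \<and> s x = e" using that surj by (metis imageE)
    from someI_ex[OF this] show "c e \<in> carrier X" "s (c e) = e" unfolding c_def by auto
  qed
  define g where "g = (\<lambda>e \<in> carrier E. t (c e))"
  have g: "g e = t (c e)" if "e \<in> carrier E" for e using that by (simp add: g_def)
  have e: "g (s x) = t x" if "x \<in> carrier X" for x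
    using that wd[of "c (s x)" x] c[of "s x"] rhomD(1)[OF s] g by simp
  have "g \<in> rhom A E N"
  proof (rule rhomI)
    fix x y assume xy: "x \<in> carrier E" "y \<in> carrier E" 
    have "g (x \<oplus>\<^bsub>E\<^esub> y) = g (s (c x \<oplus>\<^bsub>X\<^esub> c y))" using c xy rhomD(2)[OF s] by simp
    also have "\<dots> = t (c x) \<oplus>\<^bsub>N\<^esub> t (c y)" using c xy cl(1) e rhomD(2)[OF t] by simp
    finally show "g (x \<oplus>\<^bsub>E\<^esub> y) = g x \<oplus>\<^bsub>N\<^esub> g y" using xy g by simp
  next
    fix x a assume xy: "a \<in> carrier A" "x \<in> carrier E" 
    have "g (a \<odot>\<^bsub>E\<^esub> x) = g (s (a \<odot>\<^bsub>X\<^esub> c x))" using c xy rhomD(3)[OF s] by simp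
    also have "\<dots> = a \<odot>\<^bsub>N\<^esub> t (c x)" using c xy cl(2) e rhomD(3)[OF t] by simp
    finally show "g (a \<odot>\<^bsub>E\<^esub> x) = a \<odot>\<^bsub>N\<^esub> g x" using xy g by simp
  qed (use c rhomD(1)[OF t] in \<open>auto simp: g_def\<close>)
  with e that show ?thesis by blast
qed

lemma rhom_lift_mono:
  assumes x: "x \<in> rhom A N E" "inj_on x (carrier N)" and z: "z \<in> rhom A Z E" "z ` carrier Z \<subseteq> x ` carrier N"
    and rm: "right_module A N" "right_module A Z"
  obtains l where "l \<in> rhom A Z N" "\<And>q. q \<in> carrier Z \<Longrightarrow> x (l q) = z q"
proof -
  define l where "l = (\<lambda>q \<in> carrier Z. inv_into (carrier N) x (z q))"
  have e: "x (l q) = z q" if "q \<in> carrier Z" for q using z(2) that by (auto intro!: f_inv_into_f simp: l_def)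
  have in_: "l q \<in> carrier N" if "q \<in> carrier Z" for q using z(2) that by (auto intro!: inv_into_into simp: l_def)
  have "l \<in> rhom A Z N"
  proof (rule rhomI)
    fix q r assume qr: "q \<in> carrier Z" "r \<in> carrier Z"
    have "x (l (q \<oplus>\<^bsub>Z\<^esub> r)) = x (l q \<oplus>\<^bsub>N\<^esub> l r)"
      using e qr in_ rm_closed(2)[OF rm(2)] rhomD(2)[OF z(1)] rhomD(2)[OF x(1)] by simp
    then show "l (q \<oplus>\<^bsub>Z\<^esub> r) = l q \<oplus>\<^bsub>N\<^esub> l r"
      by (rule inj_onD[OF x(2)]) (use in_ qr rm_closed(2)[OF rm(2)] rm_closed(2)[OF rm(1)] in auto)
  next
    fix a q assume qr: "a \<in> carrier A" "q \<in> carrier Z"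
    have "x (l (a \<odot>\<^bsub>Z\<^esub> q)) = x (a \<odot>\<^bsub>N\<^esub> l q)"
      using e qr in_ right_moduleD(3)[OF rm(2)] rhomD(3)[OF z(1)] rhomD(3)[OF x(1)] by simp
    then show "l (a \<odot>\<^bsub>Z\<^esub> q) = a \<odot>\<^bsub>N\<^esub> l q"
      by (rule inj_onD[OF x(2)]) (use in_ qr right_moduleD(3)[OF rm(1)] right_moduleD(3)[OF rm(2)] in auto)
  qed (use in_ in \<open>auto simp: l_def\<close>)
  with e that show ?thesis by blast
qed

text \<open>The module laws of \<open>M\<close> are transported from \<open>N\<close> along
  \<open>h\<close>, so they are verified only on the simpler side. In \<open>\<Psi>_duality\<close>
  the other side is a Hom module over \<open>mod_cat B\<close> with restricted scalars.\<close>

lemma rmod_iso_of_inverse: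
  assumes N: "right_module A N" and bij: "bij_betw h (carrier N) (carrier M)"
    and add: "\<And>u v. \<lbrakk>u \<in> carrier N; v \<in> carrier N\<rbrakk> \<Longrightarrow> h (u \<oplus>\<^bsub>N\<^esub> v) = h u \<oplus>\<^bsub>M\<^esub> h v"
    and smult: "\<And>a u. \<lbrakk>a \<in> carrier A; u \<in> carrier N\<rbrakk> \<Longrightarrow> h (a \<odot>\<^bsub>N\<^esub> u) = a \<odot>\<^bsub>M\<^esub> h u"
    and zero: "h \<zero>\<^bsub>N\<^esub> = \<zero>\<^bsub>M\<^esub>"
  shows "rmod_iso A M N"
proof -
  interpret N: abelian_group N using right_moduleD(2)[OF N] .
  define g where "g = restrict (inv_into (carrier N) h) (carrier M)"
  have g: "g x \<in> carrier N" "h (g x) = x" if "x \<in> carrier M" for x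
    using that bij unfolding g_def bij_betw_def by (auto intro: inv_into_into f_inv_into_f)
  have hM: "h u \<in> carrier M" if "u \<in> carrier N" for u using that bij unfolding bij_betw_def by blast
  have gh: "g (h u) = u" if "u \<in> carrier N" for u
    using that hM[OF that] bij unfolding g_def bij_betw_def by simp
  have add': "x \<oplus>\<^bsub>M\<^esub> y = h (g x \<oplus>\<^bsub>N\<^esub> g y)" if "x \<in> carrier M" "y \<in> carrier M" for x y
    using add[OF g(1)[OF that(1)] g(1)[OF that(2)]] g(2)[OF that(1)] g(2)[OF that(2)] by simp
  have smult': "a \<odot>\<^bsub>M\<^esub> x = h (a \<odot>\<^bsub>N\<^esub> g x)" if "a \<in> carrier A" "x \<in> carrier M" for a x
    using smult[OF that(1) g(1)[OF that(2)]] g(2)[OF that(2)] by simp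
  note cl = right_moduleD(3)[OF N]
  have grp: "abelian_group M"
  proof (rule abelian_groupI)
    show "\<zero>\<^bsub>M\<^esub> \<in> carrier M" using hM[OF N.zero_closed] zero by simp
    fix x y z assume m: "x \<in> carrier M" "y \<in> carrier M" "z \<in> carrier M"
    show "x \<oplus>\<^bsub>M\<^esub> y \<in> carrier M" using add'[OF m(1,2)] hM g(1) m by simp
    show "x \<oplus>\<^bsub>M\<^esub> y = y \<oplus>\<^bsub>M\<^esub> x" using add'[OF m(1,2)] add'[OF m(2,1)] N.a_comm g(1) m by simp
    show "x \<oplus>\<^bsub>M\<^esub> y \<oplus>\<^bsub>M\<^esub> z = x \<oplus>\<^bsub>M\<^esub> (y \<oplus>\<^bsub>M\<^esub> z)"
      using add' gh hM g(1) m by (simp add: N.a_assoc)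
  next
    fix x assume m: "x \<in> carrier M"
    show "\<zero>\<^bsub>M\<^esub> \<oplus>\<^bsub>M\<^esub> x = x" using add[OF N.zero_closed g(1)[OF m]] g[OF m] zero by simp
    show "\<exists>y\<in>carrier M. y \<oplus>\<^bsub>M\<^esub> x = \<zero>\<^bsub>M\<^esub>"
    proof
      show "h (\<ominus>\<^bsub>N\<^esub> g x) \<in> carrier M" using hM g(1)[OF m] by simp
      show "h (\<ominus>\<^bsub>N\<^esub> g x) \<oplus>\<^bsub>M\<^esub> x = \<zero>\<^bsub>M\<^esub>"
        using add[of "\<ominus>\<^bsub>N\<^esub> g x" "g x"] g[OF m] zero by (simp add: N.l_neg)
    qed
  qed
  have M: "right_module A M"
    unfolding right_module_def
  proof (intro conjI ballI)
    fix a b x y assume a: "a \<in> carrier A" and b: "b \<in> carrier A" and x: "x \<in> carrier M" and y: "y \<in> carrier M"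
    interpret A: ring A using right_moduleD(1)[OF N] .
    show "a \<odot>\<^bsub>M\<^esub> x \<in> carrier M" using smult'[OF a x] hM cl[OF a g(1)[OF x]] by simp
    show "(a \<oplus>\<^bsub>A\<^esub> b) \<odot>\<^bsub>M\<^esub> x = a \<odot>\<^bsub>M\<^esub> x \<oplus>\<^bsub>M\<^esub> b \<odot>\<^bsub>M\<^esub> x"
      using smult' a b x add cl g(1)[OF x] right_moduleD(4)[OF N a b] by simp
    show "a \<odot>\<^bsub>M\<^esub> (x \<oplus>\<^bsub>M\<^esub> y) = a \<odot>\<^bsub>M\<^esub> x \<oplus>\<^bsub>M\<^esub> a \<odot>\<^bsub>M\<^esub> y"
      using smult[OF a, of "g x \<oplus>\<^bsub>N\<^esub> g y"] add'[OF x y] smult'[OF a x] smult'[OF a y] add cl[OF a] g(1)[OF x] g(1)[OF y]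
        right_moduleD(5)[OF N a] by simp
    show "(a \<otimes>\<^bsub>A\<^esub> b) \<odot>\<^bsub>M\<^esub> x = b \<odot>\<^bsub>M\<^esub> (a \<odot>\<^bsub>M\<^esub> x)"
      using smult'[OF A.m_closed[OF a b] x] smult'[OF a x] smult[OF b cl[OF a g(1)[OF x]]] right_moduleD(6)[OF N a b g(1)[OF x]] by simp
  next
    fix x assume x: "x \<in> carrier M"
    interpret A: ring A using right_moduleD(1)[OF N] .
    show "\<one>\<^bsub>A\<^esub> \<odot>\<^bsub>M\<^esub> x = x" using smult'[OF A.one_closed x] right_moduleD(7)[OF N g(1)[OF x]] g(2)[OF x] by simp
  qed (use right_moduleD(1)[OF N] grp in auto)
  have "g \<in> rhom A M N"
  proof (rule rhomI)
    show "g \<in> extensional (carrier M)" by (simp add: g_def)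
    show "g (x \<oplus>\<^bsub>M\<^esub> y) = g x \<oplus>\<^bsub>N\<^esub> g y" if "x \<in> carrier M" "y \<in> carrier M" for x y
      using add'[OF that] gh[OF N.a_closed[OF g(1)[OF that(1)] g(1)[OF that(2)]]] by simp
    show "g (a \<odot>\<^bsub>M\<^esub> x) = a \<odot>\<^bsub>N\<^esub> g x" if "a \<in> carrier A" "x \<in> carrier M" for a x
      using smult'[OF that] gh[OF cl[OF that(1) g(1)[OF that(2)]]] by simp
  qed (rule g(1))
  moreover have "bij_betw g (carrier M) (carrier N)"
    by (rule bij_betwI[of _ _ _ h]) (use g hM gh in auto)
  ultimately show ?thesis unfolding rmod_iso_def using M N by blast
qed

section \<open>Vanishing of Ext\<close>

abbreviation kerm :: "('a, 'u) module \<Rightarrow> ('a, 'v) module \<Rightarrow> ('u \<Rightarrow> 'v) \<Rightarrow> ('a, 'u) module" where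
  "kerm E M y \<equiv> E\<lparr>carrier := a_kernel E M y\<rparr>"

text \<open>For \<open>E\<close> projective and \<open>U\<close> the kernel of a surjection from
  \<open>E\<close> onto \<open>M\<close>, this is the vanishing of
  \<open>Ext\<^sup>1 M N\<close>.\<close>

definition extends :: "('k, 'a) module \<Rightarrow> ('k, 'a) rmod \<Rightarrow> ('k, 'a) elt set \<Rightarrow> ('k, 'a) rmod \<Rightarrow> bool" where
  "extends A E U N \<longleftrightarrow> (\<forall>f \<in> rhom A (E\<lparr>carrier := U\<rparr>) N. \<exists>g \<in> rhom A E N. \<forall>x \<in> U. g x = f x)"

lemma extendsE:
  assumes "extends A E U N" "f \<in> rhom A (E\<lparr>carrier := U\<rparr>) N"
  obtains g where "g \<in> rhom A E N" "\<And>x. x \<in> U \<Longrightarrow> g x = f x"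
  using assms unfolding extends_def by blast

lemma (in abelian_group) add_diff_cancel:
  assumes "x \<in> carrier G" "y \<in> carrier G"
  shows "x \<oplus> (y \<oplus> \<ominus> x) = y"
  using assms a_lcomm[of x y "\<ominus> x"] by (simp add: r_neg)

text \<open>\<open>ext_vanish A M N\<close> expresses \<open>Ext\<^sup>1 M N = 0\<close> without reference to a resolution.\<close>

definition ext_vanish :: "('k, 'a) module \<Rightarrow> ('k, 'a) rmod \<Rightarrow> ('k, 'a) rmod \<Rightarrow> bool" where
  "ext_vanish A M N \<longleftrightarrow> (\<forall>E \<in> mod_Ob A. \<forall>y \<in> rhom A E M. y ` carrier E = carrier M \<longrightarrow>
     extends A E (a_kernel E M y) N)"

lemma projective_mod_Ob: "projective A Q \<Longrightarrow> Q \<in> mod_Ob A"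
  by (simp add: projective_def)

lemma projective_lift:
  assumes "projective A Q" "E \<in> mod_Ob A" "M \<in> mod_Ob A" "y \<in> rhom A E M" "y ` carrier E = carrier M"
    "f \<in> rhom A Q M"
  obtains h where "h \<in> rhom A Q E" "\<And>q. q \<in> carrier Q \<Longrightarrow> y (h q) = f q"
proof -
  obtain h where h: "h \<in> rhom A Q E" "compose (carrier Q) y h = f"
    using assms unfolding projective_def by blast
  then have "y (h q) = f q" if "q \<in> carrier Q" for q using that by auto
  with h that show ?thesis by blast
qed

text \<open>One projective surjection onto \<open>M\<close> decides about all surjections
  \<open>z\<close> from \<open>E\<close>: \<open>Q\<close> and the kernel of \<open>z\<close>
  together cover \<open>E\<close>, so \<open>f\<close> on that kernel and an extension
  \<open>g\<close> of \<open>f\<close> after \<open>h\<close> glue to a map on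
  \<open>E\<close>.\<close>

lemma ext_vanish_of_cover:
  fixes A :: "('k, 'a) module"
  assumes Q: "projective A Q" "y \<in> rhom A Q M" "y ` carrier Q = carrier M"
    and M: "M \<in> mod_Ob A" and N: "N \<in> mod_Ob A" and ext: "extends A Q (a_kernel Q M y) N"
  shows "ext_vanish A M N"
  unfolding ext_vanish_def extends_def
proof (intro ballI impI)
  fix E z f assume E: "E \<in> mod_Ob A" and z: "z \<in> rhom A E M" "z ` carrier E = carrier M"
    and f: "f \<in> rhom A (kerm E M z) N"
  note rm = mod_ObD(1)[OF projective_mod_Ob[OF Q(1)]] mod_ObD(1)[OF M] mod_ObD(1)[OF N] mod_ObD(1)[OF E]
  interpret Q: abelian_group Q using right_moduleD(2)[OF rm(1)] .
  interpret M: abelian_group M using right_moduleD(2)[OF rm(2)] .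
  interpret N: abelian_group N using right_moduleD(2)[OF rm(3)] .
  interpret E: abelian_group E using right_moduleD(2)[OF rm(4)] .
  let ?K = "a_kernel Q M y" and ?L = "a_kernel E M z"
  note K = kernel_props[OF Q(2) rm(1,2)] and L = kernel_props[OF z(1) rm(4,2)]
  obtain h where h: "h \<in> rhom A Q E" "\<And>q. q \<in> carrier Q \<Longrightarrow> z (h q) = y q"
    using projective_lift[OF Q(1) E M z Q(2)] by blast
  have hK: "h q \<in> ?L" if "q \<in> ?K" for q
    using that h(2)[of q] rhomD(1)[OF h(1)] by (auto simp: a_kernel_def')
  have "compose ?K f h \<in> rhom A (kerm Q M y) N"
    using rhom_compose[OF rhom_sub_target[OF rhom_restrict[OF h(1) kernel_right_module[OF Q(2) rm(1,2)] K(1)], of ?L] f]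
      hK kernel_right_module[OF Q(2) rm(1,2)] by (simp add: compose_def cong: restrict_cong)
  then obtain g where g: "g \<in> rhom A Q N" "\<And>q. q \<in> ?K \<Longrightarrow> g q = f (h q)"
    by (rule extendsE[OF ext]) simp
  \<comment> \<open>\<open>X\<close> is the direct sum of \<open>Q\<close> and the kernel of
    \<open>z\<close>; \<open>s\<close> maps it onto \<open>E\<close>, and \<open>t\<close> is the
    glued map that has to factor through \<open>s\<close>.\<close>
  define X :: "('a, ('k, 'a) elt \<times> ('k, 'a) elt) module" where
    "X = \<lparr>carrier = carrier Q \<times> ?L, monoid.mult = undefined, one = undefined, zero = (\<zero>\<^bsub>Q\<^esub>, \<zero>\<^bsub>E\<^esub>),
      add = (\<lambda>p p'. (fst p \<oplus>\<^bsub>Q\<^esub> fst p', snd p \<oplus>\<^bsub>E\<^esub> snd p')), smult = (\<lambda>a p. (a \<odot>\<^bsub>Q\<^esub> fst p, a \<odot>\<^bsub>E\<^esub> snd p))\<rparr>"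
  define s where "s = (\<lambda>p \<in> carrier X. h (fst p) \<oplus>\<^bsub>E\<^esub> snd p)"
  define t where "t = (\<lambda>p \<in> carrier X. g (fst p) \<oplus>\<^bsub>N\<^esub> f (snd p))"
  have LE: "w \<in> ?L \<Longrightarrow> w \<in> carrier E" for w using L(1) by blast
  note F = rhomD[OF f, simplified]
  have cl: "x \<oplus>\<^bsub>X\<^esub> x' \<in> carrier X" "a \<in> carrier A \<Longrightarrow> a \<odot>\<^bsub>X\<^esub> x \<in> carrier X"
    if "x \<in> carrier X" "x' \<in> carrier X" for a x x'
    using that L right_moduleD(3)[OF rm(1)] by (auto simp: X_def)
  have sh: "s \<in> rhom A X E"
  proof (rule rhomI)
    fix x x' assume *: "x \<in> carrier X" "x' \<in> carrier X"
    then have "fst x \<in> carrier Q" "fst x' \<in> carrier Q" "snd x \<in> carrier E" "snd x' \<in> carrier E"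
      using LE by (auto simp: X_def)
    then show "s (x \<oplus>\<^bsub>X\<^esub> x') = s x \<oplus>\<^bsub>E\<^esub> s x'"
      using cl[OF *] * rhomD(1,2)[OF h(1)] unfolding s_def by (simp add: X_def E.a_ac)
  next
    fix a x assume *: "a \<in> carrier A" "x \<in> carrier X"
    then have "fst x \<in> carrier Q" "snd x \<in> carrier E" using LE by (auto simp: X_def)
    then show "s (a \<odot>\<^bsub>X\<^esub> x) = a \<odot>\<^bsub>E\<^esub> s x"
      using cl(2)[OF *(2,2,1)] * rhomD(1,3)[OF h(1)] right_moduleD(5)[OF rm(4)] unfolding s_def by (simp add: X_def)
  next
    fix x assume *: "x \<in> carrier X"
    then show "s x \<in> carrier E" using LE rhomD(1)[OF h(1)] by (auto simp: s_def X_def)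
  qed (simp add: s_def)
  have th: "t \<in> rhom A X N"
  proof (rule rhomI)
    fix x x' assume *: "x \<in> carrier X" "x' \<in> carrier X"
    then have "fst x \<in> carrier Q" "fst x' \<in> carrier Q" "snd x \<in> ?L" "snd x' \<in> ?L"
      by (auto simp: X_def)
    then show "t (x \<oplus>\<^bsub>X\<^esub> x') = t x \<oplus>\<^bsub>N\<^esub> t x'"
      using cl[OF *] * rhomD(1,2)[OF g(1)] F(1,2) unfolding t_def by (simp add: X_def N.a_ac)
  next
    fix a x assume *: "a \<in> carrier A" "x \<in> carrier X"
    then have "fst x \<in> carrier Q" "snd x \<in> ?L" by (auto simp: X_def)
    then show "t (a \<odot>\<^bsub>X\<^esub> x) = a \<odot>\<^bsub>N\<^esub> t x"
      using cl(2)[OF *(2,2,1)] * rhomD(1,3)[OF g(1)] F(1,3) right_moduleD(5)[OF rm(3)] unfolding t_def by (simp add: X_def)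
  next
    fix x assume *: "x \<in> carrier X"
    then show "t x \<in> carrier N" using rhomD(1)[OF g(1)] F(1) by (auto simp: t_def X_def)
  qed (simp add: t_def)
  have surj: "s ` carrier X = carrier E"
  proof (intro equalityI subsetI)
    fix e assume e: "e \<in> carrier E"
    have "z e \<in> y ` carrier Q" using rhomD(1)[OF z(1) e] Q(3) by simp
    then obtain q where q: "q \<in> carrier Q" "y q = z e" by (metis imageE)
    let ?w = "e \<oplus>\<^bsub>E\<^esub> \<ominus>\<^bsub>E\<^esub> h q"
    have hq: "h q \<in> carrier E" using rhomD(1)[OF h(1)] q by simp
    have "z ?w = \<zero>\<^bsub>M\<^esub>"
      using e hq q h(2) rhomD(1,2)[OF z(1)] rhom_uminus[OF z(1) rm(4,2)] by (simp add: M.r_neg)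
    then have w: "?w \<in> ?L" using e hq by (simp add: a_kernel_def')
    have "h q \<oplus>\<^bsub>E\<^esub> ?w = e" using e hq by (intro E.add_diff_cancel)
    then have "s (q, ?w) = e" using q w by (simp add: s_def X_def)
    moreover have "(q, ?w) \<in> carrier X" using q w by (simp add: X_def)
    ultimately show "e \<in> s ` carrier X" by (metis image_eqI)
  qed (use rhomD(1)[OF sh] in auto)
  \<comment> \<open>Two preimages under \<open>s\<close> differ in the \<open>Q\<close>-component by
    an element of the kernel of \<open>y\<close>, on which \<open>g\<close> agrees with
    \<open>f\<close> after \<open>h\<close>; the changes in the two components cancel.\<close>
  have wd: "t x = t x'" if xx: "x \<in> carrier X" "x' \<in> carrier X" "s x = s x'" for x x'
  proof -
    obtain q w q' w' where x: "x = (q, w)" "x' = (q', w')" by (cases x, cases x')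
    have m: "q \<in> carrier Q" "q' \<in> carrier Q" "w \<in> ?L" "w' \<in> ?L" using xx x by (auto simp: X_def)
    have mh: "h q \<in> carrier E" "h q' \<in> carrier E" using m rhomD(1)[OF h(1)] by auto
    have eq: "h q \<oplus>\<^bsub>E\<^esub> w = h q' \<oplus>\<^bsub>E\<^esub> w'" using xx x by (simp add: s_def)
    let ?d = "q \<oplus>\<^bsub>Q\<^esub> \<ominus>\<^bsub>Q\<^esub> q'"
    have zh: "z (h r \<oplus>\<^bsub>E\<^esub> v) = y r" if r: "r \<in> carrier Q" "v \<in> ?L" for r v
      using rhomD(2)[OF z(1), of "h r" v] r LE[OF r(2)] rhomD(1)[OF h(1) r(1)] h(2)[OF r(1)] rhomD(1)[OF Q(2) r(1)]
      by (simp add: a_kernel_def')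
    have "y q = y q'" using arg_cong[OF eq, of z] zh[OF m(1,3)] zh[OF m(2,4)] by simp
    then have dK: "?d \<in> ?K" using m rhomD(1,2)[OF Q(2)] rhom_uminus[OF Q(2) rm(1,2)] by (simp add: a_kernel_def' M.r_neg)
    have qd: "q' \<oplus>\<^bsub>Q\<^esub> ?d = q" using m by (intro Q.add_diff_cancel)
    have "h q = h q' \<oplus>\<^bsub>E\<^esub> h ?d" using rhomD(2)[OF h(1), of q' ?d] qd m by simp
    then have "h q' \<oplus>\<^bsub>E\<^esub> (h ?d \<oplus>\<^bsub>E\<^esub> w) = h q' \<oplus>\<^bsub>E\<^esub> w'"
      using eq m mh LE[OF m(3)] LE[OF hK[OF dK]] by (simp add: E.a_assoc[symmetric])
    then have w': "w' = h ?d \<oplus>\<^bsub>E\<^esub> w" using mh LE[OF m(3)] LE[OF m(4)] LE[OF hK[OF dK]] by simp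
    have fw: "f w' = f (h ?d) \<oplus>\<^bsub>N\<^esub> f w" unfolding w' using F(2) hK[OF dK] m by simp
    have gq: "g q = g q' \<oplus>\<^bsub>N\<^esub> f (h ?d)" using rhomD(2)[OF g(1), of q' ?d] qd m g(2)[OF dK] by simp
    have "g q \<oplus>\<^bsub>N\<^esub> f w = g q' \<oplus>\<^bsub>N\<^esub> f w'"
      unfolding fw gq using m F(1) hK[OF dK] rhomD(1)[OF g(1)] by (simp add: N.a_assoc)
    then show ?thesis using xx x by (simp add: t_def)
  qed
  obtain G where G: "G \<in> rhom A E N" "\<And>x. x \<in> carrier X \<Longrightarrow> G (s x) = t x"
  proof (rule rhom_factor[OF sh th surj])
    show "a \<odot>\<^bsub>X\<^esub> x \<in> carrier X" if "a \<in> carrier A" "x \<in> carrier X" for a x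
      using cl(2)[OF that(2,2,1)] .
  qed (use cl(1) wd in blast)+
  have "G w = f w" if w: "w \<in> ?L" for w
  proof -
    have x: "(\<zero>\<^bsub>Q\<^esub>, w) \<in> carrier X" using w by (simp add: X_def)
    have "s (\<zero>\<^bsub>Q\<^esub>, w) = w" using x w LE rhom_zero[OF h(1) rm(1,4)] by (simp add: s_def)
    moreover have "t (\<zero>\<^bsub>Q\<^esub>, w) = f w" using x w F(1) rhom_zero[OF g(1) rm(1,3)] by (simp add: t_def)
    ultimately show ?thesis using G(2)[OF x] by simp
  qed
  with G show "\<exists>g\<in>rhom A E N. \<forall>x\<in>?L. g x = f x" by blast
qed

text \<open>\<open>M\<close> is a direct summand of \<open>M'\<close> plus a projective
  \<open>R\<close>, written with four maps so that no direct sum module has to be formed. The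
  relation survives passage to syzygies for any choice of covers.\<close>

definition stable_retract :: "('k, 'a) module \<Rightarrow> ('k, 'a) rmod \<Rightarrow> ('k, 'a) rmod \<Rightarrow> bool" where
  "stable_retract A M M' \<longleftrightarrow> (\<exists>R a b u v. projective A R \<and> a \<in> rhom A M M' \<and> b \<in> rhom A M' M \<and>
     u \<in> rhom A M R \<and> v \<in> rhom A R M \<and> (\<forall>m \<in> carrier M. b (a m) \<oplus>\<^bsub>M\<^esub> v (u m) = m))"

text \<open>Lift \<open>a\<close>, \<open>b\<close>, \<open>v\<close> to maps \<alpha>, \<beta>,
  \<nu> of projectives and put \<open>s = 1 - \<beta> \<alpha> - \<nu> u y\<close>. Then
  \<open>y s = (1 - b a - v u) y = 0\<close>, and on the kernel of \<open>y\<close> the last term of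
  \<open>s\<close> drops out.\<close>

lemma stable_retract_lift:
  assumes sr: "stable_retract A M M'" and M: "M \<in> mod_Ob A" "M' \<in> mod_Ob A"
    and Q: "projective A Q" "y \<in> rhom A Q M" "y ` carrier Q = carrier M"
    and Q': "projective A Q'" "y' \<in> rhom A Q' M'" "y' ` carrier Q' = carrier M'"
  obtains \<alpha> \<beta> s where "\<alpha> \<in> rhom A Q Q'" "\<beta> \<in> rhom A Q' Q" "s \<in> rhom A Q Q"
    "\<And>q. q \<in> carrier Q \<Longrightarrow> s q \<in> a_kernel Q M y"
    "\<And>q. q \<in> a_kernel Q M y \<Longrightarrow> \<alpha> q \<in> a_kernel Q' M' y'"
    "\<And>q. q \<in> a_kernel Q' M' y' \<Longrightarrow> \<beta> q \<in> a_kernel Q M y"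
    "\<And>q. q \<in> a_kernel Q M y \<Longrightarrow> \<beta> (\<alpha> q) \<oplus>\<^bsub>Q\<^esub> s q = q"
proof -
  obtain R a b u v where R: "projective A R" and a: "a \<in> rhom A M M'" and b: "b \<in> rhom A M' M"
    and u: "u \<in> rhom A M R" and v: "v \<in> rhom A R M" and eq: "\<And>m. m \<in> carrier M \<Longrightarrow> b (a m) \<oplus>\<^bsub>M\<^esub> v (u m) = m"
    using sr unfolding stable_retract_def by blast
  note Ob = projective_mod_Ob[OF Q(1)] projective_mod_Ob[OF Q'(1)] projective_mod_Ob[OF R]
  note rm = mod_ObD(1)[OF Ob(1)] mod_ObD(1)[OF Ob(2)] mod_ObD(1)[OF Ob(3)] mod_ObD(1)[OF M(1)] mod_ObD(1)[OF M(2)]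
  interpret Q: abelian_group Q using right_moduleD(2)[OF rm(1)] .
  interpret M: abelian_group M using right_moduleD(2)[OF rm(4)] .
  obtain \<alpha> where \<alpha>: "\<alpha> \<in> rhom A Q Q'" "\<And>q. q \<in> carrier Q \<Longrightarrow> y' (\<alpha> q) = a (y q)"
    using projective_lift[OF Q(1) Ob(2) M(2) Q'(2,3) rhom_compose[OF Q(2) a rm(1)]] by auto
  obtain \<beta> where \<beta>: "\<beta> \<in> rhom A Q' Q" "\<And>q. q \<in> carrier Q' \<Longrightarrow> y (\<beta> q) = b (y' q)"
    using projective_lift[OF Q'(1) Ob(1) M(1) Q(2,3) rhom_compose[OF Q'(2) b rm(2)]] by auto
  obtain \<nu> where \<nu>: "\<nu> \<in> rhom A R Q" "\<And>q. q \<in> carrier R \<Longrightarrow> y (\<nu> q) = v q"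
    using projective_lift[OF R Ob(1) M(1) Q(2,3) v] by blast
  define p where "p = (\<lambda>q \<in> carrier Q. compose (carrier Q) \<beta> \<alpha> q \<oplus>\<^bsub>Q\<^esub> compose (carrier Q) \<nu> (compose (carrier Q) u y) q)"
  have p: "p \<in> rhom A Q Q"
    unfolding p_def by (intro rhom_add rhom_compose[OF \<alpha>(1) \<beta>(1)] rhom_compose[OF rhom_compose[OF Q(2) u] \<nu>(1)] rm)
  define s where "s = (\<lambda>q \<in> carrier Q. (\<lambda>x \<in> carrier Q. x) q \<oplus>\<^bsub>Q\<^esub> (\<lambda>x \<in> carrier Q. \<ominus>\<^bsub>Q\<^esub> p x) q)"
  have s: "s \<in> rhom A Q Q"
    unfolding s_def by (intro rhom_add rhom_ident rhom_neg p rm)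
  have yp: "y (p q) = y q" if "q \<in> carrier Q" for q
    using that eq[of "y q"] \<alpha> \<beta> \<nu> rhomD(1)[OF \<alpha>(1)] rhomD(1)[OF \<beta>(1)] rhomD(1)[OF \<nu>(1)] rhomD(1,2)[OF Q(2)] rhomD(1)[OF u]
    by (simp add: p_def)
  have pin: "p q \<in> carrier Q" if "q \<in> carrier Q" for q using that rhomD(1)[OF p] by blast
  have "s q \<in> a_kernel Q M y" if q: "q \<in> carrier Q" for q
  proof -
    have "y (s q) = y q \<oplus>\<^bsub>M\<^esub> \<ominus>\<^bsub>M\<^esub> y (p q)"
      using q pin rhomD(2)[OF Q(2)] rhom_uminus[OF Q(2) rm(1,4)] by (simp add: s_def)
    then show ?thesis using yp q rhomD(1)[OF Q(2)] rhomD(1)[OF s] by (simp add: a_kernel_def' M.r_neg)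
  qed
  moreover have "\<alpha> q \<in> a_kernel Q' M' y'" if "q \<in> a_kernel Q M y" for q
    using that \<alpha> rhomD(1)[OF \<alpha>(1)] rhom_zero[OF a rm(4,5)] by (auto simp: a_kernel_def')
  moreover have "\<beta> q \<in> a_kernel Q M y" if "q \<in> a_kernel Q' M' y'" for q
    using that \<beta> rhomD(1)[OF \<beta>(1)] rhom_zero[OF b rm(5,4)] by (auto simp: a_kernel_def')
  moreover have "\<beta> (\<alpha> q) \<oplus>\<^bsub>Q\<^esub> s q = q" if "q \<in> a_kernel Q M y" for q
  proof -
    have q: "q \<in> carrier Q" "y q = \<zero>\<^bsub>M\<^esub>" using that by (auto simp: a_kernel_def')
    have ba: "\<beta> (\<alpha> q) \<in> carrier Q" using q rhomD(1)[OF \<alpha>(1)] rhomD(1)[OF \<beta>(1)] by blast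
    have "p q = \<beta> (\<alpha> q)"
      using q ba rhom_zero[OF u rm(4,3)] rhom_zero[OF \<nu>(1) rm(3,1)] by (simp add: p_def)
    then have "s q = q \<oplus>\<^bsub>Q\<^esub> \<ominus>\<^bsub>Q\<^esub> \<beta> (\<alpha> q)" using q by (simp add: s_def)
    then show ?thesis using q ba Q.add_diff_cancel by simp
  qed
  ultimately show ?thesis using that \<alpha>(1) \<beta>(1) s by blast
qed

text \<open>The extension of \<open>f\<close> is \<open>g \<alpha> + f s\<close>, where
  \<open>g\<close> extends \<open>f \<beta>\<close>: on the kernel of \<open>y\<close> it equals
  \<open>f (\<beta> \<alpha> + s) = f\<close>.\<close>

lemma stable_retract_extends:
  assumes sr: "stable_retract A M M'" and M: "M \<in> mod_Ob A" "M' \<in> mod_Ob A" and N: "N \<in> mod_Ob A"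
    and Q: "projective A Q" "y \<in> rhom A Q M" "y ` carrier Q = carrier M"
    and Q': "projective A Q'" "y' \<in> rhom A Q' M'" "y' ` carrier Q' = carrier M'"
    and ext: "extends A Q' (a_kernel Q' M' y') N"
  shows "extends A Q (a_kernel Q M y) N"
  unfolding extends_def
proof
  fix f assume f: "f \<in> rhom A (kerm Q M y) N"
  note rm = mod_ObD(1)[OF projective_mod_Ob[OF Q(1)]] mod_ObD(1)[OF projective_mod_Ob[OF Q'(1)]] mod_ObD(1)[OF M(1)] mod_ObD(1)[OF M(2)] mod_ObD(1)[OF N]
  obtain \<alpha> \<beta> s where l: "\<alpha> \<in> rhom A Q Q'" "\<beta> \<in> rhom A Q' Q" "s \<in> rhom A Q Q"
    "\<And>q. q \<in> carrier Q \<Longrightarrow> s q \<in> a_kernel Q M y"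
    "\<And>q. q \<in> a_kernel Q M y \<Longrightarrow> \<alpha> q \<in> a_kernel Q' M' y'"
    "\<And>q. q \<in> a_kernel Q' M' y' \<Longrightarrow> \<beta> q \<in> a_kernel Q M y"
    "\<And>q. q \<in> a_kernel Q M y \<Longrightarrow> \<beta> (\<alpha> q) \<oplus>\<^bsub>Q\<^esub> s q = q"
    using stable_retract_lift[OF sr M Q Q'] by blast
  note k = kernel_props(1)[OF Q(2) rm(1,3)] kernel_right_module[OF Q(2) rm(1,3)]
    kernel_props(1)[OF Q'(2) rm(2,4)] kernel_right_module[OF Q'(2) rm(2,4)]
  have "compose (carrier (kerm Q' M' y')) f (restrict \<beta> (a_kernel Q' M' y')) \<in> rhom A (kerm Q' M' y') N"
    by (rule rhom_compose[OF rhom_sub_target[OF rhom_restrict[OF l(2) k(4) k(3)]] f k(4)]) (use l(6) in auto)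
  then obtain g where g: "g \<in> rhom A Q' N" "\<And>q. q \<in> a_kernel Q' M' y' \<Longrightarrow> g q = f (\<beta> q)"
    by (rule extendsE[OF ext]) simp
  define G where "G = (\<lambda>q \<in> carrier Q. compose (carrier Q) g \<alpha> q \<oplus>\<^bsub>N\<^esub> compose (carrier Q) f s q)"
  have "G \<in> rhom A Q N"
    unfolding G_def by (intro rhom_add rhom_compose[OF l(1) g(1)] rhom_compose[OF rhom_sub_target[OF l(3)] f] rm l(4))
  moreover have "G q = f q" if q: "q \<in> a_kernel Q M y" for q
  proof -
    have qQ: "q \<in> carrier Q" using q k(1) by blast
    have "f q = f (\<beta> (\<alpha> q)) \<oplus>\<^bsub>N\<^esub> f (s q)" using rhomD(2)[OF f, of "\<beta> (\<alpha> q)" "s q"] l(4)[OF qQ] l(6)[OF l(5)[OF q]] l(7)[OF q] by simp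
    then show ?thesis using qQ g(2) l(5)[OF q] by (simp add: G_def)
  qed
  ultimately show "\<exists>g\<in>rhom A Q N. \<forall>x\<in>a_kernel Q M y. g x = f x" by blast
qed

text \<open>The identity of the kernel, decomposed as in \<open>stable_retract_lift\<close>, runs
  partly through the other kernel and partly through \<open>Q\<close>, which serves as the new
  projective.\<close>

lemma stable_retract_kernel:
  assumes sr: "stable_retract A M M'" and M: "M \<in> mod_Ob A" "M' \<in> mod_Ob A"
    and Q: "projective A Q" "y \<in> rhom A Q M" "y ` carrier Q = carrier M"
    and Q': "projective A Q'" "y' \<in> rhom A Q' M'" "y' ` carrier Q' = carrier M'"
  shows "stable_retract A (kerm Q M y) (kerm Q' M' y')"
proof -
  note rm = mod_ObD(1)[OF projective_mod_Ob[OF Q(1)]] mod_ObD(1)[OF projective_mod_Ob[OF Q'(1)]] mod_ObD(1)[OF M(1)] mod_ObD(1)[OF M(2)]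
  obtain \<alpha> \<beta> s where l: "\<alpha> \<in> rhom A Q Q'" "\<beta> \<in> rhom A Q' Q" "s \<in> rhom A Q Q"
    "\<And>q. q \<in> carrier Q \<Longrightarrow> s q \<in> a_kernel Q M y"
    "\<And>q. q \<in> a_kernel Q M y \<Longrightarrow> \<alpha> q \<in> a_kernel Q' M' y'"
    "\<And>q. q \<in> a_kernel Q' M' y' \<Longrightarrow> \<beta> q \<in> a_kernel Q M y"
    "\<And>q. q \<in> a_kernel Q M y \<Longrightarrow> \<beta> (\<alpha> q) \<oplus>\<^bsub>Q\<^esub> s q = q"
    using stable_retract_lift[OF sr M Q Q'] by blast
  note k = kernel_props(1)[OF Q(2) rm(1,3)] kernel_right_module[OF Q(2) rm(1,3)]
    kernel_props(1)[OF Q'(2) rm(2,4)] kernel_right_module[OF Q'(2) rm(2,4)]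
  show ?thesis unfolding stable_retract_def
  proof (intro exI conjI ballI)
    show "projective A Q" by fact
    show "restrict \<alpha> (a_kernel Q M y) \<in> rhom A (kerm Q M y) (kerm Q' M' y')"
      by (rule rhom_sub_target[OF rhom_restrict[OF l(1) k(2,1)]]) (use l(5) in auto)
    show "restrict \<beta> (a_kernel Q' M' y') \<in> rhom A (kerm Q' M' y') (kerm Q M y)"
      by (rule rhom_sub_target[OF rhom_restrict[OF l(2) k(4,3)]]) (use l(6) in auto)
    show "restrict (\<lambda>x \<in> carrier Q. x) (a_kernel Q M y) \<in> rhom A (kerm Q M y) Q"
      by (rule rhom_restrict[OF rhom_ident[OF rm(1)] k(2,1)])
    show "s \<in> rhom A Q (kerm Q M y)" by (rule rhom_sub_target[OF l(3,4)])
    fix q assume "q \<in> carrier (kerm Q M y)"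
    then show "restrict \<beta> (a_kernel Q' M' y') (restrict \<alpha> (a_kernel Q M y) q) \<oplus>\<^bsub>kerm Q M y\<^esub>
        s (restrict (\<lambda>x \<in> carrier Q. x) (a_kernel Q M y) q) = q"
      using l(5,7)[of q] k(1) by auto
  qed
qed

lemma stable_retract_of_retract:
  assumes "projective A R" "M \<in> mod_Ob A" "a \<in> rhom A M M'" "b \<in> rhom A M' M" "\<And>m. m \<in> carrier M \<Longrightarrow> b (a m) = m"
  shows "stable_retract A M M'"
proof -
  note rm = mod_ObD(1)[OF assms(2)] mod_ObD(1)[OF projective_mod_Ob[OF assms(1)]]
  interpret M: abelian_group M using right_moduleD(2)[OF rm(1)] .
  show ?thesis unfolding stable_retract_def
    using assms rhom_const_zero[OF rm] rhom_const_zero[OF rm(2,1)] rm_closed(1)[OF rm(2)]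
    by (intro exI[of _ R] exI[of _ a] exI[of _ b] exI[of _ "\<lambda>x \<in> carrier M. \<zero>\<^bsub>R\<^esub>"] exI[of _ "\<lambda>x \<in> carrier R. \<zero>\<^bsub>M\<^esub>"]) auto
qed

section \<open>Resolutions when there are enough projectives\<close>

lemma mod_ObI: "\<lbrakk>right_module A M; fin_gen A M\<rbrakk> \<Longrightarrow> M \<in> mod_Ob A"
  by (simp add: mod_Ob_def del: mod_ObD)

lemma proj_resolutionD:
  assumes "proj_resolution A M Q d"
  shows "projective A (Q n)" "d 0 \<in> rhom A (Q 0) M" "d 0 ` carrier (Q 0) = carrier M"
    "d (Suc n) \<in> rhom A (Q (Suc n)) (Q n)" "d 1 ` carrier (Q 1) = a_kernel (Q 0) M (d 0)"
    "d (Suc (Suc n)) ` carrier (Q (Suc (Suc n))) = a_kernel (Q (Suc n)) (Q n) (d (Suc n))"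
proof -
  note * = assms[unfolded proj_resolution_def]
  show "projective A (Q n)" by (rule *[THEN conjunct1, THEN spec])
  note * = *[THEN conjunct2]
  show "d 0 \<in> rhom A (Q 0) M" by (rule *[THEN conjunct1])
  note * = *[THEN conjunct2]
  show "d 0 ` carrier (Q 0) = carrier M" by (rule *[THEN conjunct1])
  note * = *[THEN conjunct2]
  show "d (Suc n) \<in> rhom A (Q (Suc n)) (Q n)" by (rule *[THEN conjunct1, THEN spec])
  note * = *[THEN conjunct2]
  show "d 1 ` carrier (Q 1) = a_kernel (Q 0) M (d 0)" by (rule *[THEN conjunct1])
  note * = *[THEN conjunct2]
  show "d (Suc (Suc n)) ` carrier (Q (Suc (Suc n))) = a_kernel (Q (Suc n)) (Q n) (d (Suc n))" by (rule *[THEN spec])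
qed

lemma ext_vanishD:
  "\<lbrakk>ext_vanish A M N; E \<in> mod_Ob A; y \<in> rhom A E M; y ` carrier E = carrier M\<rbrakk> \<Longrightarrow> extends A E (a_kernel E M y) N"
  unfolding ext_vanish_def by (drule bspec, assumption, drule bspec, assumption) (erule mp)

text \<open>Resolutions are built by covering kernels, hence the demand that the kernel be finitely
  generated; for endomorphism algebras it comes from finite dimension over \<open>k\<close>.\<close>

locale enough_projectives =
  fixes A :: "('k, 'a) module"
  assumes enough: "M \<in> mod_Ob A \<Longrightarrow> \<exists>Q y. projective A Q \<and> y \<in> rhom A Q M \<and> y ` carrier Q = carrier M \<and>
    fin_gen A (kerm Q M y)"
begin

lemma projective_cover:
  assumes M: "M \<in> mod_Ob A"
  obtains Q y where "projective A Q" "y \<in> rhom A Q M" "y ` carrier Q = carrier M" "kerm Q M y \<in> mod_Ob A"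
proof -
  obtain Q y where Q: "projective A Q" "y \<in> rhom A Q M" "y ` carrier Q = carrier M" "fin_gen A (kerm Q M y)"
    using enough[OF M] by blast
  have "right_module A (kerm Q M y)"
    by (rule kernel_right_module[OF Q(2)]) (simp_all add: M projective_mod_Ob[OF Q(1)])
  then have "kerm Q M y \<in> mod_Ob A" using Q(4) by (rule mod_ObI)
  with Q that show ?thesis by blast
qed

lemma proj_resolution_exists:
  assumes M: "M \<in> mod_Ob A"
  shows "\<exists>Q d. proj_resolution A M Q d"
proof -
  \<comment> \<open>Dependent choice of triples \<open>(Z, Q, y)\<close>, where \<open>y\<close> is
    a cover of \<open>Z\<close> by \<open>Q\<close> and the next \<open>Z\<close> is the kernel of
    \<open>y\<close>.\<close>
  define P where "P n t \<longleftrightarrow> (case t of (Z, Q, y) \<Rightarrow> (n = 0 \<longrightarrow> Z = M) \<and> Z \<in> mod_Ob A \<and> projective A Q \<and>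
    y \<in> rhom A Q Z \<and> y ` carrier Q = carrier Z \<and> kerm Q Z y \<in> mod_Ob A)"
    for n :: nat and t :: "('k, 'a) rmod \<times> ('k, 'a) rmod \<times> ('k, 'a) rmap"
  define R where "R n t t' \<longleftrightarrow> (case t of (Z, Q, y) \<Rightarrow> fst t' = kerm Q Z y)"
    for n :: nat and t t' :: "('k, 'a) rmod \<times> ('k, 'a) rmod \<times> ('k, 'a) rmap"
  have "\<exists>f. \<forall>n. P n (f n) \<and> R n (f n) (f (Suc n))"
  proof (rule dependent_nat_choice)
    obtain Q y where "projective A Q" "y \<in> rhom A Q M" "y ` carrier Q = carrier M" "kerm Q M y \<in> mod_Ob A"
      by (rule projective_cover[OF M])
    then show "\<exists>t. P 0 t" using M by (intro exI[of _ "(M, Q, y)"]) (simp add: P_def)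
  next
    fix t n assume t: "P n t"
    obtain Z Q y where [simp]: "t = (Z, Q, y)" by (cases t)
    have Z: "kerm Q Z y \<in> mod_Ob A" using t by (simp add: P_def)
    obtain Q' y' where "projective A Q'" "y' \<in> rhom A Q' (kerm Q Z y)" "y' ` carrier Q' = carrier (kerm Q Z y)"
      "kerm Q' (kerm Q Z y) y' \<in> mod_Ob A"
      by (rule projective_cover[OF Z])
    then show "\<exists>t'. P (Suc n) t' \<and> R n t t'"
      using Z by (intro exI[of _ "(kerm Q Z y, Q', y')"]) (simp add: P_def R_def)
  qed
  then obtain f where f: "\<And>n. P n (f n)" "\<And>n. R n (f n) (f (Suc n))" by blast
  define Z Q d where "Z n = fst (f n)" and "Q n = fst (snd (f n))" and "d n = snd (snd (f n))" for n
  have p: "Z 0 = M" "Z n \<in> mod_Ob A" "projective A (Q n)" "d n \<in> rhom A (Q n) (Z n)" "d n ` carrier (Q n) = carrier (Z n)" for n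
    using f(1)[of n] f(1)[of 0] unfolding P_def Z_def Q_def d_def by (simp_all add: split_beta)
  have Z: "Z (Suc n) = kerm (Q n) (Z n) (d n)" for n
    using f(2)[of n] unfolding R_def Z_def Q_def d_def by (simp add: split_beta)
  have rQ: "right_module A (Q n)" for n by (rule mod_ObD(1)[OF projective_mod_Ob[OF p(3)]])
  have dS: "d (Suc n) \<in> rhom A (Q (Suc n)) (Q n)" for n
    by (rule rhom_sub_target_D[OF p(4)[of "Suc n", unfolded Z] kernel_props(1)[OF p(4) rQ mod_ObD(1)[OF p(2)]]])
  \<comment> \<open>A kernel keeps the zero and the operations of \<open>Q n\<close> and changes
    only the carrier, so replacing it by \<open>Q n\<close> as a target does not change
    kernels.\<close>
  have k: "a_kernel (Q (Suc n)) (Z (Suc n)) (d (Suc n)) = a_kernel (Q (Suc n)) (Q n) (d (Suc n))" for n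
    by (simp add: a_kernel_def' Z)
  have "proj_resolution A M Q d"
    unfolding proj_resolution_def
  proof (intro conjI allI)
    show "projective A (Q n)" for n by (rule p(3))
    show "d 0 \<in> rhom A (Q 0) M" using p(4)[of 0] unfolding p(1) .
    show "d 0 ` carrier (Q 0) = carrier M" using p(5)[of 0] unfolding p(1) .
    show "d (Suc n) \<in> rhom A (Q (Suc n)) (Q n)" for n by (rule dS)
    show "d 1 ` carrier (Q 1) = a_kernel (Q 0) M (d 0)" using p(5)[of 1] unfolding One_nat_def Z p(1) by simp
    show "d (Suc (Suc n)) ` carrier (Q (Suc (Suc n))) = a_kernel (Q (Suc n)) (Q n) (d (Suc n))" for n
      using p(5)[of "Suc (Suc n)"] unfolding Z[of "Suc n"] k by simp
  qed
  then show ?thesis by blast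
qed

lemma res_proj_resolution:
  assumes "M \<in> mod_Ob A"
  shows "proj_resolution A M (res_mod A M) (res_map A M)"
proof -
  have "\<exists>t. case t of (Q, d) \<Rightarrow> proj_resolution A M Q d" using proj_resolution_exists[OF assms] by auto
  then have "case chosen_resolution A M of (Q, d) \<Rightarrow> proj_resolution A M Q d"
    unfolding chosen_resolution_def by (rule someI_ex)
  then show ?thesis unfolding res_mod_def res_map_def by (cases "chosen_resolution A M") simp
qed

primrec syz :: "('k, 'a) rmod \<Rightarrow> nat \<Rightarrow> ('k, 'a) rmod" where
  "syz M 0 = M"
| "syz M (Suc n) = kerm (res_mod A M n) (syz M n) (res_map A M n)"

context
  fixes M assumes M: "M \<in> mod_Ob A"
begin

lemma res_projective: "projective A (res_mod A M n)"
  by (rule proj_resolutionD(1)[OF res_proj_resolution[OF M]])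

lemma res_right_module: "right_module A (res_mod A M n)"
  by (rule mod_ObD(1)[OF projective_mod_Ob[OF res_projective]])

lemma res_map_Suc: "res_map A M (Suc n) \<in> rhom A (res_mod A M (Suc n)) (res_mod A M n)"
  by (rule proj_resolutionD(4)[OF res_proj_resolution[OF M]])

lemma res_map_Suc_image: "res_map A M (Suc n) ` carrier (res_mod A M (Suc n)) = carrier (syz M (Suc n))"
proof (cases n)
  case 0
  then show ?thesis using proj_resolutionD(5)[OF res_proj_resolution[OF M]] by simp
next
  case (Suc m)
  then show ?thesis using proj_resolutionD(6)[OF res_proj_resolution[OF M], of m]
    by (simp add: a_kernel_def')
qed

lemma syz_cover: "res_map A M n \<in> rhom A (res_mod A M n) (syz M n)"
  "res_map A M n ` carrier (res_mod A M n) = carrier (syz M n)"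
proof -
  show 1: "res_map A M n ` carrier (res_mod A M n) = carrier (syz M n)"
    using res_map_Suc_image proj_resolutionD(3)[OF res_proj_resolution[OF M]] by (cases n) (simp_all del: syz.simps(2))
  show "res_map A M n \<in> rhom A (res_mod A M n) (syz M n)"
  proof (cases n)
    case 0
    then show ?thesis using proj_resolutionD(2)[OF res_proj_resolution[OF M]] by simp
  next
    case (Suc m)
    have "res_map A M (Suc m) \<in> rhom A (res_mod A M (Suc m)) (kerm (res_mod A M m) (syz M m) (res_map A M m))"
      by (rule rhom_sub_target[OF res_map_Suc]) (use 1 Suc in auto)
    then show ?thesis using Suc by simp
  qed
qed

lemma syz_mod_Ob: "syz M n \<in> mod_Ob A"
proof (induction n)
  case (Suc n)
  have rm: "right_module A (syz M (Suc n))"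
    using kernel_right_module[OF syz_cover(1) res_right_module mod_ObD(1)[OF Suc]] by simp
  have "fin_gen A (res_mod A M (Suc n))" by (rule mod_ObD(2)[OF projective_mod_Ob[OF res_projective]])
  from fin_gen_image[OF res_right_module rm syz_cover this] rm show ?case by (intro mod_ObI)
qed (use M in simp)

text \<open>A cocycle of degree \<open>Suc n\<close> kills the next syzygy and so factors through
  \<open>syz M (Suc n)\<close>, a submodule of \<open>res_mod A M n\<close>. Extending the factor to
  the whole module exhibits the cocycle as a coboundary.\<close>

lemma trivial_mod_Ext_Suc:
  assumes N: "N \<in> mod_Ob A" and ext: "extends A (res_mod A M n) (carrier (syz M (Suc n))) N"
  shows "trivial_group (mod_Ext A (Suc n) M N)"
proof -
  interpret C: preadditive "mod_cat A" by (rule preadditive_mod_cat)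
  let ?Q = "res_mod A M" and ?d = "res_map A M"
  have ob: "?Q n \<in> mod_Ob A" for n using res_projective projective_mod_Ob by blast
  let ?G = "mod_Hom A (?Q (Suc n)) N" and ?B = "coboundaries A (Suc n) M N"
  have grp: "abelian_group ?G" by (rule mod_Hom_group[OF res_right_module mod_ObD(1)[OF N]])
  interpret G: abelian_group ?G by fact
  have B: "subgroup ?B (add_monoid ?G)"
  proof (rule G.add.subgroupI)
    show "?B \<subseteq> carrier ?G"
      using rhom_compose[OF res_map_Suc _ res_right_module] by auto
    show "?B \<noteq> {}" using rhom_const_zero[OF res_right_module mod_ObD(1)[OF N]] by auto
    fix b assume "b \<in> ?B"
    then obtain g where g: "g \<in> rhom A (?Q n) N" "b = compose (carrier (?Q (Suc n))) g (?d (Suc n))" by auto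
    have "\<ominus>\<^bsub>?G\<^esub> b = compose (carrier (?Q (Suc n))) (\<ominus>\<^bsub>mod_Hom A (?Q n) N\<^esub> g) (?d (Suc n))"
      using C.cmp_uminus_left[of "?Q (Suc n)" "?Q n" N "?d (Suc n)" g] ob N g res_map_Suc by simp
    moreover have "\<ominus>\<^bsub>mod_Hom A (?Q n) N\<^esub> g \<in> rhom A (?Q n) N" using C.uminus_in[of "?Q n" N g] ob N g by simp
    ultimately show "\<ominus>\<^bsub>?G\<^esub> b \<in> ?B" by auto
    fix b' assume "b' \<in> ?B"
    then obtain g' where g': "g' \<in> rhom A (?Q n) N" "b' = compose (carrier (?Q (Suc n))) g' (?d (Suc n))" by auto
    have "b \<oplus>\<^bsub>?G\<^esub> b' = compose (carrier (?Q (Suc n))) (g \<oplus>\<^bsub>mod_Hom A (?Q n) N\<^esub> g') (?d (Suc n))"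
      using C.cmp_add_left[of "?Q (Suc n)" "?Q n" N "?d (Suc n)" g g'] ob N g g' res_map_Suc by simp
    moreover have "g \<oplus>\<^bsub>mod_Hom A (?Q n) N\<^esub> g' \<in> rhom A (?Q n) N" using C.add_in[of "?Q n" N g g'] ob N g g' by simp
    ultimately show "b \<oplus>\<^bsub>?G\<^esub> b' \<in> ?B" by auto
  qed
  have coc: "f \<in> ?B" if f: "f \<in> cocycles A (Suc n) M N" for f
  proof -
    have fh: "f \<in> rhom A (?Q (Suc n)) N" and f0: "\<And>x. x \<in> carrier (?Q (Suc (Suc n))) \<Longrightarrow> f (?d (Suc (Suc n)) x) = \<zero>\<^bsub>N\<^esub>"
      using f unfolding cocycles_def by auto
    let ?X = "?Q (Suc n)" and ?S = "syz M (Suc n)"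
    interpret X: abelian_group ?X using right_moduleD(2)[OF res_right_module] .
    interpret S: abelian_group ?S using right_moduleD(2)[OF mod_ObD(1)[OF syz_mod_Ob]] .
    interpret N: abelian_group N using right_moduleD(2)[OF mod_ObD(1)[OF N]] .
    have wd: "f x = f x'" if x: "x \<in> carrier ?X" "x' \<in> carrier ?X" "?d (Suc n) x = ?d (Suc n) x'" for x x'
    proof -
      let ?w = "x \<oplus>\<^bsub>?X\<^esub> \<ominus>\<^bsub>?X\<^esub> x'"
      have w: "?w \<in> carrier ?X" using x by simp
      have "?d (Suc n) ?w = ?d (Suc n) x \<oplus>\<^bsub>?S\<^esub> \<ominus>\<^bsub>?S\<^esub> ?d (Suc n) x'"
        using rhomD(2)[OF syz_cover(1)[of "Suc n"], of x "\<ominus>\<^bsub>?X\<^esub> x'"] x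
          rhom_uminus[OF syz_cover(1)[of "Suc n"] res_right_module mod_ObD(1)[OF syz_mod_Ob], of x'] by simp
      also have "\<dots> = \<zero>\<^bsub>?S\<^esub>" unfolding x(3) using rhomD(1)[OF syz_cover(1)[of "Suc n"] x(2)] by (rule S.r_neg)
      finally have "?w \<in> carrier (syz M (Suc (Suc n)))" using w by (simp add: a_kernel_def')
      then obtain v where "v \<in> carrier (?Q (Suc (Suc n)))" "?w = ?d (Suc (Suc n)) v"
        using res_map_Suc_image[of "Suc n"] by blast
      then have "f ?w = \<zero>\<^bsub>N\<^esub>" using f0 by simp
      moreover have "f (x' \<oplus>\<^bsub>?X\<^esub> ?w) = f x' \<oplus>\<^bsub>N\<^esub> f ?w" using rhomD(2)[OF fh x(2) w] .
      ultimately show ?thesis using X.add_diff_cancel[OF x(2,1)] rhomD(1)[OF fh x(2)] by simp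
    qed
    obtain h where h: "h \<in> rhom A ?S N" "\<And>x. x \<in> carrier ?X \<Longrightarrow> h (?d (Suc n) x) = f x"
    proof (rule rhom_factor[OF syz_cover(1)[of "Suc n"] fh syz_cover(2)[of "Suc n"]])
      show "a \<odot>\<^bsub>?X\<^esub> x \<in> carrier ?X" if "a \<in> carrier A" "x \<in> carrier ?X" for a x
        using right_moduleD(3)[OF res_right_module that] .
    qed (use wd X.a_closed in blast)+
    have "h \<in> rhom A ((?Q n)\<lparr>carrier := carrier (syz M (Suc n))\<rparr>) N" using h(1) by simp
    then obtain g where g: "g \<in> rhom A (?Q n) N" "\<And>x. x \<in> carrier (syz M (Suc n)) \<Longrightarrow> g x = h x"
      by (rule extendsE[OF ext]) simp
    have "f = compose (carrier ?X) g (?d (Suc n))"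
      using h(2) g(2) rhomD(1)[OF syz_cover(1)[of "Suc n"]]
      by (intro rhom_eqI[OF fh rhom_compose[OF res_map_Suc g(1) res_right_module]]) simp
    with g(1) show ?thesis by auto
  qed
  \<comment> \<open>The elements of the group are cosets; as every cocycle is a coboundary, each of
    them is the subgroup \<open>?B\<close> itself.\<close>
  have cl: "ext_class A (Suc n) M N f = ?B" if "f \<in> cocycles A (Suc n) M N" for f
    unfolding ext_class_def a_r_coset_def
    using subgroup.rcos_const[OF B] coc[OF that] G.a_group by blast
  have "(\<lambda>x \<in> carrier (?Q (Suc n)). \<zero>\<^bsub>N\<^esub>) \<in> cocycles A (Suc n) M N"
    using rhom_const_zero[OF res_right_module mod_ObD(1)[OF N]] rhomD(1)[OF res_map_Suc]
    unfolding cocycles_def by auto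
  then have "ext_class A (Suc n) M N ` cocycles A (Suc n) M N = {?B}" using cl by blast
  then show ?thesis unfolding trivial_group_def mod_Ext_def by simp
qed

end

lemma ext_vanish_trivial_mod_Ext:
  assumes "M \<in> mod_Ob A" "N \<in> mod_Ob A" "ext_vanish A M N"
  shows "trivial_group (mod_Ext A 1 M N)"
proof -
  have "extends A (res_mod A M 0) (a_kernel (res_mod A M 0) M (res_map A M 0)) N"
    by (rule ext_vanishD[OF assms(3) projective_mod_Ob[OF res_projective[OF assms(1)]] syz_cover[OF assms(1), of 0, simplified]])
  then have "trivial_group (mod_Ext A (Suc 0) M N)" by (intro trivial_mod_Ext_Suc assms) simp
  then show ?thesis by simp
qed

section \<open>Vanishing for projectives, retracts and extensions\<close>

lemma ext_vanish_projective:
  assumes "projective A Q" "N \<in> mod_Ob A"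
  shows "ext_vanish A Q N"
proof (rule ext_vanish_of_cover[OF assms(1) rhom_ident])
  have Q: "Q \<in> mod_Ob A" using projective_mod_Ob assms by blast
  then show rm: "right_module A Q" "Q \<in> mod_Ob A" by simp_all
  have k: "a_kernel Q Q (\<lambda>x \<in> carrier Q. x) = {\<zero>\<^bsub>Q\<^esub>}" using rm_closed(1)[OF rm(1)] by (auto simp: a_kernel_def')
  show "extends A Q (a_kernel Q Q (\<lambda>x \<in> carrier Q. x)) N"
    unfolding extends_def
  proof
    fix f assume f: "f \<in> rhom A (kerm Q Q (\<lambda>x \<in> carrier Q. x)) N"
    have "f \<zero>\<^bsub>Q\<^esub> = \<zero>\<^bsub>N\<^esub>"
      using rhom_zero[OF f kernel_right_module[OF rhom_ident[OF rm(1)] rm(1) rm(1)] mod_ObD(1)[OF assms(2)]] by simp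
    then show "\<exists>g\<in>rhom A Q N. \<forall>x\<in>a_kernel Q Q (\<lambda>x \<in> carrier Q. x). g x = f x"
      using rhom_const_zero[OF rm(1) mod_ObD(1)[OF assms(2)]] rm_closed(1)[OF rm(1)] unfolding k
      by (intro bexI[of _ "\<lambda>x \<in> carrier Q. \<zero>\<^bsub>N\<^esub>"]) simp_all
  qed
qed (use assms in auto)

lemma ext_vanish_retract:
  assumes "M \<in> mod_Ob A" "M' \<in> mod_Ob A" "N \<in> mod_Ob A" "a \<in> rhom A M M'" "b \<in> rhom A M' M"
    "\<And>m. m \<in> carrier M \<Longrightarrow> b (a m) = m" "ext_vanish A M' N"
  shows "ext_vanish A M N"
proof -
  obtain Q y where Q: "projective A Q" "y \<in> rhom A Q M" "y ` carrier Q = carrier M"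
    by (rule projective_cover[OF assms(1)])
  obtain Q' y' where Q': "projective A Q'" "y' \<in> rhom A Q' M'" "y' ` carrier Q' = carrier M'"
    by (rule projective_cover[OF assms(2)])
  have "extends A Q' (a_kernel Q' M' y') N"
    by (rule ext_vanishD[OF assms(7) projective_mod_Ob[OF Q'(1)] Q'(2,3)])
  from stable_retract_extends[OF stable_retract_of_retract[OF Q(1) assms(1,4,5,6)] assms(1-3) Q Q' this]
  show ?thesis by (rule ext_vanish_of_cover[OF Q assms(1,3)])
qed

text \<open>Take a cover \<open>e\<close> of \<open>M\<close> by \<open>Q\<close> and let
  \<open>L\<close> be the kernel of \<open>Q -> M''\<close>. A map on the kernel of \<open>e\<close>
  extends first to \<open>L\<close>, because \<open>L\<close> covers \<open>M'\<close> with that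
  kernel, and then to \<open>Q\<close>.\<close>

lemma ext_vanish_middle:
  assumes ses: "mod_short_exact A M' x M y M''" and N: "N \<in> mod_Ob A"
    and ev: "ext_vanish A M' N" "ext_vanish A M'' N"
  shows "ext_vanish A M N"
proof -
  have M: "M' \<in> mod_Ob A" "M \<in> mod_Ob A" "M'' \<in> mod_Ob A" and x: "x \<in> rhom A M' M" "inj_on x (carrier M')"
    and y: "y \<in> rhom A M M''" "y ` carrier M = carrier M''" and ex: "x ` carrier M' = a_kernel M M'' y"
    using ses unfolding mod_short_exact_def by auto
  obtain Q e where Q: "projective A Q" "e \<in> rhom A Q M" "e ` carrier Q = carrier M" "kerm Q M e \<in> mod_Ob A"
    by (rule projective_cover[OF M(2)])
  note QO = projective_mod_Ob[OF Q(1)]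
  note rm = mod_ObD(1)[OF M(1)] mod_ObD(1)[OF M(2)] mod_ObD(1)[OF M(3)] mod_ObD(1)[OF QO]
  define ye where "ye = compose (carrier Q) y e"
  have ye: "ye \<in> rhom A Q M''" unfolding ye_def by (rule rhom_compose[OF Q(2) y(1) rm(4)])
  have ye_surj: "ye ` carrier Q = carrier M''"
    unfolding ye_def using Q(3) y(2) by (metis surj_compose)
  let ?L = "a_kernel Q M'' ye"
  note L = kernel_props[OF ye rm(4,3)] and LM = kernel_right_module[OF ye rm(4,3)]
  have eL: "e q \<in> x ` carrier M'" if "q \<in> ?L" for q
    using that rhomD(1)[OF Q(2)] unfolding ex by (auto simp: a_kernel_def' ye_def)
  have re: "restrict e ?L \<in> rhom A (kerm Q M'' ye) M" by (rule rhom_restrict[OF Q(2) LM L(1)])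
  obtain l where l: "l \<in> rhom A (kerm Q M'' ye) M'" "\<And>q. q \<in> ?L \<Longrightarrow> x (l q) = e q"
    using rhom_lift_mono[OF x re _ rm(1) LM] eL by (auto simp: image_subset_iff)
  have l_surj: "l ` carrier (kerm Q M'' ye) = carrier M'"
  proof (intro equalityI subsetI)
    fix m assume m: "m \<in> carrier M'"
    have "x m \<in> carrier M" using rhomD(1)[OF x(1) m] .
    then obtain q where q: "q \<in> carrier Q" "e q = x m" using Q(3) by (metis imageE)
    have "x m \<in> a_kernel M M'' y" using m ex by blast
    then have qL: "q \<in> ?L" using q by (simp add: a_kernel_def' ye_def)
    then have "l q = m" using l(2)[OF qL] q m rhomD(1)[OF l(1)] inj_onD[OF x(2)] by simp
    then show "m \<in> l ` carrier (kerm Q M'' ye)" using qL by auto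
  qed (use rhomD(1)[OF l(1)] in auto)
  have ker: "a_kernel (kerm Q M'' ye) M' l = a_kernel Q M e"
  proof -
    have "l q = \<zero>\<^bsub>M'\<^esub> \<longleftrightarrow> e q = \<zero>\<^bsub>M\<^esub>" if "q \<in> ?L" for q
    proof -
      have "l q \<in> carrier M'" using rhomD(1)[OF l(1), of q] that by simp
      then show ?thesis
        using l(2)[OF that] rhom_zero[OF x(1) rm(1,2)] inj_onD[OF x(2), of "l q" "\<zero>\<^bsub>M'\<^esub>"] rm_closed(1)[OF rm(1)] by auto
    qed
    moreover have "a_kernel Q M e \<subseteq> ?L"
      using rhom_zero[OF y(1) rm(2,3)] by (auto simp: a_kernel_def' ye_def)
    ultimately show ?thesis using L(1) by (auto simp: a_kernel_def')
  qed
  \<comment> \<open>\<open>l\<close> maps \<open>?L\<close> onto \<open>M'\<close> with the kernel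
    of \<open>e\<close> as its kernel. Both ends are finitely generated, so \<open>?L\<close> is an
    object to which vanishing for \<open>M'\<close> can be applied.\<close>
  have "fin_gen A (kerm (kerm Q M'' ye) M' l)"
    using mod_ObD(2)[OF Q(4)] by (simp add: ker)
  from fin_gen_extension[OF LM rm(1) l(1) l_surj mod_ObD(2)[OF M(1)] this]
  have LO: "kerm Q M'' ye \<in> mod_Ob A" using LM by (intro mod_ObI)
  have e1: "extends A (kerm Q M'' ye) (a_kernel Q M e) N"
    using ext_vanishD[OF ev(1) LO l(1) l_surj] unfolding ker .
  have e2: "extends A Q ?L N" by (rule ext_vanishD[OF ev(2) QO ye ye_surj])
  have "extends A Q (a_kernel Q M e) N"
    unfolding extends_def
  proof
    fix f assume "f \<in> rhom A (kerm Q M e) N"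
    then have "f \<in> rhom A ((kerm Q M'' ye)\<lparr>carrier := a_kernel Q M e\<rparr>) N" by simp
    then obtain g where g: "g \<in> rhom A (kerm Q M'' ye) N" "\<And>x. x \<in> a_kernel Q M e \<Longrightarrow> g x = f x"
      by (rule extendsE[OF e1]) blast
    obtain h where h: "h \<in> rhom A Q N" "\<And>x. x \<in> ?L \<Longrightarrow> h x = g x" by (rule extendsE[OF e2 g(1)]) blast
    have sub: "a_kernel Q M e \<subseteq> ?L"
      using rhom_zero[OF y(1) rm(2,3)] by (auto simp: a_kernel_def' ye_def)
    show "\<exists>g\<in>rhom A Q N. \<forall>x\<in>a_kernel Q M e. g x = f x"
    proof (intro bexI[OF _ h(1)] ballI)
      fix x assume x: "x \<in> a_kernel Q M e"
      show "h x = f x" using h(2)[OF subsetD[OF sub x]] g(2)[OF x] by simp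
    qed
  qed
  then show ?thesis by (rule ext_vanish_of_cover[OF Q(1-3) M(2) N])
qed

text \<open>Dimension shifting: along the chosen resolution of \<open>W\<close> the syzygies remain stable retracts
  of members of \<open>\<W>\<close>.\<close>

lemma trivial_mod_Ext_class:
  assumes \<W>: "\<W> \<subseteq> mod_Ob A" and N: "N \<in> mod_Ob A"
    and cov: "\<And>W. W \<in> \<W> \<Longrightarrow> \<exists>Q y. projective A Q \<and> y \<in> rhom A Q W \<and> y ` carrier Q = carrier W \<and>
       kerm Q W y \<in> \<W> \<and> extends A Q (a_kernel Q W y) N"
    and W: "W \<in> \<W>" and i: "i \<ge> 1"
  shows "trivial_group (mod_Ext A i W N)"
proof -
  obtain n where n: "i = Suc n" using i by (cases i) auto
  have WO: "W \<in> mod_Ob A" using W \<W> by blast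
  have sr: "\<exists>W'\<in>\<W>. stable_retract A (syz W n) W'" for n
  proof (induction n)
    case 0
    have "stable_retract A W W"
      by (rule stable_retract_of_retract[OF res_projective[OF WO, of 0] WO rhom_ident rhom_ident]) (use WO in auto)
    with W show ?case by auto
  next
    case (Suc n)
    then obtain W' where W': "W' \<in> \<W>" "stable_retract A (syz W n) W'" by blast
    obtain Q y where Q: "projective A Q" "y \<in> rhom A Q W'" "y ` carrier Q = carrier W'" "kerm Q W' y \<in> \<W>"
      using cov[OF W'(1)] by (elim exE conjE) (rule that)
    have "stable_retract A (syz W (Suc n)) (kerm Q W' y)"
      using stable_retract_kernel[OF W'(2) syz_mod_Ob[OF WO] subsetD[OF \<W> W'(1)] res_projective[OF WO] syz_cover[OF WO] Q(1-3)] by simp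
    with Q(4) show ?case by blast
  qed
  obtain W' where W': "W' \<in> \<W>" "stable_retract A (syz W n) W'" using sr by blast
  obtain Q y where Q: "projective A Q" "y \<in> rhom A Q W'" "y ` carrier Q = carrier W'" "extends A Q (a_kernel Q W' y) N"
    using cov[OF W'(1)] by (elim exE conjE) (rule that)
  have "extends A (res_mod A W n) (a_kernel (res_mod A W n) (syz W n) (res_map A W n)) N"
    by (rule stable_retract_extends[OF W'(2) syz_mod_Ob[OF WO] subsetD[OF \<W> W'(1)] N res_projective[OF WO] syz_cover[OF WO] Q])
  then show ?thesis unfolding n by (intro trivial_mod_Ext_Suc[OF WO N]) simp
qed

text \<open>The class is that of the cocycle \<open>f\<close> induced by a lift \<open>h\<close> of
  the augmentation. Filtrations quantify over the class, so knowing that some class exists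
  suffices.\<close>

lemma short_exact_conflation:
  assumes ses: "mod_short_exact A N x E y M"
  shows "\<exists>X. conflation (mod_cat A) N x E y M X"
proof -
  have O: "N \<in> mod_Ob A" "E \<in> mod_Ob A" "M \<in> mod_Ob A" and x: "x \<in> rhom A N E" "inj_on x (carrier N)"
    and y: "y \<in> rhom A E M" "y ` carrier E = carrier M" and ex: "x ` carrier N = a_kernel E M y"
    using ses unfolding mod_short_exact_def by auto
  note rm = mod_ObD(1)[OF O(1)] mod_ObD(1)[OF O(2)] mod_ObD(1)[OF O(3)] and rQ = res_right_module[OF O(3)]
  let ?Q = "res_mod A M" and ?d = "res_map A M"
  note d0 = syz_cover(1)[OF O(3), of 0, simplified]
  obtain h where h: "h \<in> rhom A (?Q 0) E" "\<And>q. q \<in> carrier (?Q 0) \<Longrightarrow> y (h q) = ?d 0 q"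
    using projective_lift[OF res_projective[OF O(3)] O(2,3) y d0] by blast
  have d1: "?d 1 \<in> rhom A (?Q 1) (?Q 0)" using res_map_Suc[OF O(3), of 0] by simp
  have dd: "?d n (?d (Suc n) q) = \<zero>\<^bsub>syz M n\<^esub>" "?d (Suc n) q \<in> carrier (?Q n)" if "q \<in> carrier (?Q (Suc n))" for n q
    using res_map_Suc_image[OF O(3), of n] that by (auto simp: a_kernel_def')
  have hd: "compose (carrier (?Q 1)) h (?d 1) \<in> rhom A (?Q 1) E" by (rule rhom_compose[OF d1 h(1) rQ])
  have "compose (carrier (?Q 1)) h (?d 1) ` carrier (?Q 1) \<subseteq> x ` carrier N"
  proof (rule image_subsetI)
    fix q assume q: "q \<in> carrier (?Q 1)"
    then show "compose (carrier (?Q 1)) h (?d 1) q \<in> x ` carrier N"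
      using dd[of q 0] rhomD(1)[OF h(1)] h(2)[of "?d 1 q"] unfolding ex by (simp add: a_kernel_def')
  qed
  then obtain f where f: "f \<in> rhom A (?Q 1) N" "\<And>q. q \<in> carrier (?Q 1) \<Longrightarrow> x (f q) = h (?d 1 q)"
    using rhom_lift_mono[OF x hd _ rm(1) rQ] by auto
  have fc: "f \<in> cocycles A 1 M N"
    unfolding cocycles_def
  proof (simp add: f[simplified], intro ballI)
    fix q assume q: "q \<in> carrier (?Q (Suc (Suc 0)))"
    have "x (f (?d (Suc (Suc 0)) q)) = h (?d 1 (?d (Suc (Suc 0)) q))" using f(2) dd(2)[OF q] by simp
    also have "?d 1 (?d (Suc (Suc 0)) q) = \<zero>\<^bsub>?Q 0\<^esub>" using dd(1)[OF q] by simp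
    also have "h \<zero>\<^bsub>?Q 0\<^esub> = x \<zero>\<^bsub>N\<^esub>" using rhom_zero[OF h(1) rQ rm(2)] rhom_zero[OF x(1) rm(1,2)] by simp
    finally show "f (?d (Suc (Suc 0)) q) = \<zero>\<^bsub>N\<^esub>"
      using inj_onD[OF x(2)] dd(2)[OF q] rhomD(1)[OF f(1)] rm_closed(1)[OF rm(1)] by simp
  qed
  let ?X = "ext_class A 1 M N f"
  \<comment> \<open>The zero map is a coboundary, so \<open>f\<close> lies in its own coset and can
    witness the realization.\<close>
  have fX: "f \<in> ?X"
  proof -
    have "(\<lambda>x \<in> carrier (?Q 0). \<zero>\<^bsub>N\<^esub>) \<in> rhom A (?Q 0) N" by (rule rhom_const_zero[OF rQ rm(1)])
    moreover have "compose (carrier (?Q 1)) (\<lambda>x \<in> carrier (?Q 0). \<zero>\<^bsub>N\<^esub>) (?d 1) = \<zero>\<^bsub>mod_Hom A (?Q 1) N\<^esub>"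
      using rhomD(1)[OF d1] by (auto simp: compose_def intro!: restrict_ext)
    ultimately have z: "\<zero>\<^bsub>mod_Hom A (?Q 1) N\<^esub> \<in> coboundaries A 1 M N"
      unfolding One_nat_def coboundaries.simps by (metis (mono_tags, lifting) mem_Collect_eq)
    have "\<zero>\<^bsub>mod_Hom A (?Q 1) N\<^esub> \<oplus>\<^bsub>mod_Hom A (?Q 1) N\<^esub> f = f"
      using abelian_monoid.l_zero[OF abelian_group.axioms(1)[OF mod_Hom_group[OF rQ rm(1)]], of f 1] f(1) by simp
    with z show ?thesis unfolding ext_class_def a_r_coset_def' by (metis (mono_tags, lifting) UN_I singletonI)
  qed
  have "(x, E, y) \<in> mod_realization A M N ?X"
  proof -
    have "compose (carrier (?Q 0)) y h = ?d 0"
      using h(2) by (intro rhom_eqI[OF rhom_compose[OF h(1) y(1) rQ] d0]) simp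
    moreover have "compose (carrier (?Q 1)) x f = compose (carrier (?Q 1)) h (?d 1)"
      using f(2) by (intro rhom_eqI[OF rhom_compose[OF f(1) x(1) rQ] hd]) simp
    ultimately show ?thesis unfolding mod_realization_def
      by (intro CollectI, unfold prod.case) (intro conjI ses bexI[OF _ fX] bexI[OF _ h(1)])
  qed
  moreover have "?X \<in> carrier (mod_Ext A 1 M N)" using fc by (simp add: mod_Ext_def)
  ultimately show ?thesis unfolding conflation_def using O by auto
qed

lemma conflation_short_exact: "conflation (mod_cat A) N x E y M X \<Longrightarrow> mod_short_exact A N x E y M"
  unfolding conflation_def by (simp add: mod_realization_def)

end

section \<open>Subspaces of finite dimensional vector spaces\<close>

lemma module_submoduleI:
  assumes "module k V" "U \<subseteq> carrier V" "\<zero>\<^bsub>V\<^esub> \<in> U"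
    "\<And>x y. \<lbrakk>x \<in> U; y \<in> U\<rbrakk> \<Longrightarrow> x \<oplus>\<^bsub>V\<^esub> y \<in> U"
    "\<And>a x. \<lbrakk>a \<in> carrier k; x \<in> U\<rbrakk> \<Longrightarrow> a \<odot>\<^bsub>V\<^esub> x \<in> U"
  shows "submodule U k V"
proof -
  interpret module k V by fact
  have m: "\<ominus>\<^bsub>V\<^esub> x \<in> U" if "x \<in> U" for x
  proof -
    have x: "x \<in> carrier V" using that assms(2) by blast
    have "\<ominus>\<^bsub>V\<^esub> x = (\<ominus>\<^bsub>k\<^esub> \<one>\<^bsub>k\<^esub>) \<odot>\<^bsub>V\<^esub> x" using x by (simp add: smult_l_minus)
    also have "\<dots> \<in> U" using that by (intro assms(5)) simp_all
    finally show ?thesis .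
  qed
  show ?thesis using assms m by unfold_locales (auto simp: a_inv_def[symmetric])
qed

text \<open>The linear span, taken as an intersection of submodules so that no linear combinations
  have to be written down.\<close>

definition sspan :: "('a, 'x) ring_scheme \<Rightarrow> ('a, 'u) module \<Rightarrow> 'u set \<Rightarrow> 'u set" where
  "sspan k V S = \<Inter> {W. submodule W k V \<and> S \<subseteq> W}"

text \<open>Induction on the spanning set: generators for the part of \<open>U\<close> inside the
  span of \<open>S\<close> are joined with at most one vector \<open>u\<close> of \<open>U\<close>
  whose coefficient at \<open>s\<close> is nonzero.\<close>

lemma subspace_fin_gen_aux:
  fixes k (structure)
  assumes "field k" and V: "module k V" and "finite S"
  shows "S \<subseteq> carrier V \<Longrightarrow> submodule U k V \<Longrightarrow> U \<subseteq> sspan k V S \<Longrightarrow>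
    \<exists>T. finite T \<and> T \<subseteq> U \<and> U \<subseteq> sspan k V T"
  using \<open>finite S\<close>
proof (induction S arbitrary: U)
  case empty
  then show ?case by (intro exI[of _ "{}"]) simp
next
  case (insert s S)
  interpret k: field k by fact
  interpret V: module k V by fact
  have s: "s \<in> carrier V" and S: "S \<subseteq> carrier V" using insert.prems by auto
  have cV: "submodule (carrier V) k V" by (rule module_submoduleI[OF V]) auto
  have sub: "submodule (sspan k V T) k V" if "T \<subseteq> carrier V" for T
  proof (rule module_submoduleI[OF V])
    show "sspan k V T \<subseteq> carrier V" unfolding sspan_def using cV that by blast
  qed (auto simp: sspan_def submoduleD)
  have mono: "sspan k V T \<subseteq> sspan k V T'" if "T \<subseteq> T'" for T T'
    using that unfolding sspan_def by blast
  have incl: "x \<in> sspan k V T" if "x \<in> T" for x T using that unfolding sspan_def by blast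
  note spS = submoduleD[OF sub[OF S]]
  let ?W = "{x. \<exists>c\<in>carrier k. \<exists>w\<in>sspan k V S. x = c \<odot>\<^bsub>V\<^esub> s \<oplus>\<^bsub>V\<^esub> w}"
  have W: "submodule ?W k V"
  proof (rule module_submoduleI[OF V])
    show "?W \<subseteq> carrier V" using s spS(1) by auto
    show "\<zero>\<^bsub>V\<^esub> \<in> ?W" using s spS(2) by (auto intro!: bexI[of _ "\<zero>\<^bsub>k\<^esub>"] bexI[of _ "\<zero>\<^bsub>V\<^esub>"])
  next
    fix x y assume "x \<in> ?W" "y \<in> ?W"
    then obtain c w d v where *: "c \<in> carrier k" "w \<in> sspan k V S" "x = c \<odot>\<^bsub>V\<^esub> s \<oplus>\<^bsub>V\<^esub> w"
       "d \<in> carrier k" "v \<in> sspan k V S" "y = d \<odot>\<^bsub>V\<^esub> s \<oplus>\<^bsub>V\<^esub> v" by blast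
    have c: "w \<in> carrier V" "v \<in> carrier V" using * spS(1) by auto
    have "x \<oplus>\<^bsub>V\<^esub> y = (c \<oplus>\<^bsub>k\<^esub> d) \<odot>\<^bsub>V\<^esub> s \<oplus>\<^bsub>V\<^esub> (w \<oplus>\<^bsub>V\<^esub> v)"
      using * c s by (simp add: V.smult_l_distr V.M.a_ac)
    then show "x \<oplus>\<^bsub>V\<^esub> y \<in> ?W" using * spS(3) by blast
  next
    fix a x assume a: "a \<in> carrier k" and "x \<in> ?W"
    then obtain c w where *: "c \<in> carrier k" "w \<in> sspan k V S" "x = c \<odot>\<^bsub>V\<^esub> s \<oplus>\<^bsub>V\<^esub> w" by blast
    have c: "w \<in> carrier V" using * spS(1) by auto
    have "a \<odot>\<^bsub>V\<^esub> x = (a \<otimes>\<^bsub>k\<^esub> c) \<odot>\<^bsub>V\<^esub> s \<oplus>\<^bsub>V\<^esub> a \<odot>\<^bsub>V\<^esub> w"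
      using * c s a by (simp add: V.smult_r_distr V.smult_assoc1)
    then show "a \<odot>\<^bsub>V\<^esub> x \<in> ?W" using * a spS(5) by blast
  qed
  have "insert s S \<subseteq> ?W"
  proof
    fix x assume "x \<in> insert s S"
    then consider "x = s" | "x \<in> S" by blast
    then show "x \<in> ?W"
    proof cases
      case 1
      have "s = \<one>\<^bsub>k\<^esub> \<odot>\<^bsub>V\<^esub> s \<oplus>\<^bsub>V\<^esub> \<zero>\<^bsub>V\<^esub>" using s by simp
      then show ?thesis using 1 spS(2) k.one_closed by blast
    next
      case 2
      have "x = \<zero>\<^bsub>k\<^esub> \<odot>\<^bsub>V\<^esub> s \<oplus>\<^bsub>V\<^esub> x" using s 2 S by auto
      then show ?thesis using incl[OF 2] k.zero_closed by blast
    qed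
  qed
  then have "sspan k V (insert s S) \<subseteq> ?W" using W unfolding sspan_def by blast
  then have dec: "\<exists>c\<in>carrier k. \<exists>w\<in>sspan k V S. u = c \<odot>\<^bsub>V\<^esub> s \<oplus>\<^bsub>V\<^esub> w" if "u \<in> U" for u
    using insert.prems(3) that by blast
  note U = submoduleD[OF insert.prems(2)]
  let ?U = "U \<inter> sspan k V S"
  have "submodule ?U k V"
    by (rule module_submoduleI[OF V]) (use U spS in auto)
  then obtain T where T: "finite T" "T \<subseteq> ?U" "?U \<subseteq> sspan k V T" using insert.IH[OF S, of ?U] by blast
  show ?case
  proof (cases "U \<subseteq> sspan k V S")
    case True
    then show ?thesis using T by blast
  next
    case False
    then obtain u where u: "u \<in> U" "u \<notin> sspan k V S" by blast
    obtain c w where c: "c \<in> carrier k" "w \<in> sspan k V S" "u = c \<odot>\<^bsub>V\<^esub> s \<oplus>\<^bsub>V\<^esub> w" using dec[OF u(1)] by blast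
    have wV: "w \<in> carrier V" and uV: "u \<in> carrier V" using c(2) spS(1) u U(1) by auto
    have "c \<noteq> \<zero>\<^bsub>k\<^esub>" using u(2) c s wV by auto
    then have cu: "inv\<^bsub>k\<^esub> c \<in> carrier k" "inv\<^bsub>k\<^esub> c \<otimes>\<^bsub>k\<^esub> c = \<one>\<^bsub>k\<^esub>" using c(1) by (simp_all add: k.field_Units)
    have TV: "insert u T \<subseteq> carrier V" using T(2) U(1) u by blast
    note spT = submoduleD[OF sub[OF TV]]
    have "x \<in> sspan k V (insert u T)" if x: "x \<in> U" for x
    proof -
      obtain d v where d: "d \<in> carrier k" "v \<in> sspan k V S" "x = d \<odot>\<^bsub>V\<^esub> s \<oplus>\<^bsub>V\<^esub> v" using dec[OF x] by blast
      have vV: "v \<in> carrier V" and xV: "x \<in> carrier V" using d(2) spS(1) x U(1) by auto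
      \<comment> \<open>\<open>?e\<close> is \<open>-d / c\<close>: adding this multiple of
        \<open>u\<close> to \<open>x\<close> cancels the multiple of \<open>s\<close> and leaves a
        vector in the span of \<open>S\<close>.\<close>
      let ?e = "\<ominus>\<^bsub>k\<^esub> (d \<otimes>\<^bsub>k\<^esub> inv\<^bsub>k\<^esub> c)"
      have e: "?e \<in> carrier k" using d cu by simp
      have "?e \<otimes>\<^bsub>k\<^esub> c = \<ominus>\<^bsub>k\<^esub> d" using d(1) cu c(1) by (simp add: k.l_minus k.m_assoc)
      then have "?e \<odot>\<^bsub>V\<^esub> (c \<odot>\<^bsub>V\<^esub> s) = \<ominus>\<^bsub>V\<^esub> (d \<odot>\<^bsub>V\<^esub> s)"
        using V.smult_assoc1[OF e c(1) s] V.smult_l_minus[OF d(1) s] by simp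
      moreover have "?e \<odot>\<^bsub>V\<^esub> u = ?e \<odot>\<^bsub>V\<^esub> (c \<odot>\<^bsub>V\<^esub> s) \<oplus>\<^bsub>V\<^esub> ?e \<odot>\<^bsub>V\<^esub> w"
        unfolding c(3) by (rule V.smult_r_distr[OF e V.smult_closed[OF c(1) s] wV])
      ultimately have eu: "?e \<odot>\<^bsub>V\<^esub> u = \<ominus>\<^bsub>V\<^esub> (d \<odot>\<^bsub>V\<^esub> s) \<oplus>\<^bsub>V\<^esub> ?e \<odot>\<^bsub>V\<^esub> w" by simp
      have "x \<oplus>\<^bsub>V\<^esub> ?e \<odot>\<^bsub>V\<^esub> u = (\<ominus>\<^bsub>V\<^esub> (d \<odot>\<^bsub>V\<^esub> s) \<oplus>\<^bsub>V\<^esub> ?e \<odot>\<^bsub>V\<^esub> w) \<oplus>\<^bsub>V\<^esub> (v \<oplus>\<^bsub>V\<^esub> d \<odot>\<^bsub>V\<^esub> s)"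
        unfolding eu d(3) using d(1) s vV wV e by (simp add: V.M.a_ac)
      also have "\<dots> = v \<oplus>\<^bsub>V\<^esub> ?e \<odot>\<^bsub>V\<^esub> w" using d(1) s vV wV e by (intro V.M.add_cancel_mid) auto
      finally have "x \<oplus>\<^bsub>V\<^esub> ?e \<odot>\<^bsub>V\<^esub> u \<in> sspan k V S" using spS(3)[OF d(2) spS(5)[OF e c(2)]] by simp
      moreover have "x \<oplus>\<^bsub>V\<^esub> ?e \<odot>\<^bsub>V\<^esub> u \<in> U" by (rule U(3)[OF x U(5)[OF e u(1)]])
      ultimately have "x \<oplus>\<^bsub>V\<^esub> ?e \<odot>\<^bsub>V\<^esub> u \<in> sspan k V (insert u T)" using T(3) mono[of T "insert u T"] by blast
      moreover have eu': "?e \<odot>\<^bsub>V\<^esub> u \<in> sspan k V (insert u T)" by (rule spT(5)[OF e incl]) simp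
      ultimately have "(x \<oplus>\<^bsub>V\<^esub> ?e \<odot>\<^bsub>V\<^esub> u) \<oplus>\<^bsub>V\<^esub> \<ominus>\<^bsub>V\<^esub> (?e \<odot>\<^bsub>V\<^esub> u) \<in> sspan k V (insert u T)"
        by (rule spT(3)[OF _ spT(4)])
      then have m: "(x \<oplus>\<^bsub>V\<^esub> ?e \<odot>\<^bsub>V\<^esub> u) \<oplus>\<^bsub>V\<^esub> \<ominus>\<^bsub>V\<^esub> (?e \<odot>\<^bsub>V\<^esub> u) \<in> sspan k V (insert u T)" .
      have "?e \<odot>\<^bsub>V\<^esub> u \<in> carrier V" using e uV by simp
      then have "(x \<oplus>\<^bsub>V\<^esub> ?e \<odot>\<^bsub>V\<^esub> u) \<oplus>\<^bsub>V\<^esub> \<ominus>\<^bsub>V\<^esub> (?e \<odot>\<^bsub>V\<^esub> u) = x" using xV by (simp add: V.M.a_assoc V.M.r_neg)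
      with m show ?thesis by (simp only:)
    qed
    moreover have "finite (insert u T)" "insert u T \<subseteq> U" using T u by auto
    ultimately show ?thesis by (intro exI[of _ "insert u T"]) blast
  qed
qed

lemma subspace_fin_gen:
  assumes "field k" "module k V" "fin_gen k V" "submodule U k V"
  obtains T where "finite T" "T \<subseteq> U" "\<And>W. \<lbrakk>submodule W k V; T \<subseteq> W\<rbrakk> \<Longrightarrow> U \<subseteq> W"
proof -
  obtain S where S: "finite S" "S \<subseteq> carrier V" "\<And>W. submodule W k V \<Longrightarrow> S \<subseteq> W \<Longrightarrow> W = carrier V"
    using assms(3) unfolding fin_gen_def by blast
  have "U \<subseteq> sspan k V S" using S(3) submoduleD(1)[OF assms(4)] unfolding sspan_def by blast
  from subspace_fin_gen_aux[OF assms(1,2) S(1,2) assms(4) this] obtain T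
    where T: "finite T" "T \<subseteq> U" "U \<subseteq> sspan k V T" by blast
  have "U \<subseteq> W" if "submodule W k V" "T \<subseteq> W" for W
    using T(3) that unfolding sspan_def by blast
  with T that show ?thesis by blast
qed

section \<open>The functor represented by an object\<close>

lemma EndAlg_simps [simp]:
  "carrier (EndAlg \<C> X) = carrier (Hom \<C> X X)" "zero (EndAlg \<C> X) = zero (Hom \<C> X X)"
  "add (EndAlg \<C> X) = add (Hom \<C> X X)" "f \<otimes>\<^bsub>EndAlg \<C> X\<^esub> g = comp \<C> X X X f g"
  "one (EndAlg \<C> X) = ident \<C> X" "smult (EndAlg \<C> X) = smult (Hom \<C> X X)"
  by (simp_all add: EndAlg_def)

lemma cov_hom_simps [simp]:
  "carrier (cov_hom \<C> Q X) = Inl ` carrier (Hom \<C> Q X)" "\<zero>\<^bsub>cov_hom \<C> Q X\<^esub> = Inl \<zero>\<^bsub>Hom \<C> Q X\<^esub>"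
  "Inl f \<oplus>\<^bsub>cov_hom \<C> Q X\<^esub> Inl g = Inl (f \<oplus>\<^bsub>Hom \<C> Q X\<^esub> g)"
  "b \<odot>\<^bsub>cov_hom \<C> Q X\<^esub> Inl f = Inl (comp \<C> Q Q X f b)"
  by (simp_all add: cov_hom_def)

lemma (in preadditive) ring_EndAlg: "X \<in> Ob \<C> \<Longrightarrow> ring (EndAlg \<C> X)"
proof (rule ringI)
  assume X: "X \<in> Ob \<C>"
  interpret abelian_group "Hom \<C> X X" using Hom_group X by blast
  show "abelian_group (EndAlg \<C> X)"
    by (rule abelian_groupI) (auto simp: a_assoc intro: a_comm l_neg)
  show "Group.monoid (EndAlg \<C> X)" by (rule monoidI) (use X in \<open>auto simp: cmp_assoc\<close>)
qed auto

locale cov_functor = Hom_finite_Krull_Schmidt_category k \<C>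
  for k :: "'k ring" and \<C> :: "('k, 'o, 'm, 'x) lin_cat_scheme" +
  fixes Q :: 'o
  assumes Q_in [simp]: "Q \<in> Ob \<C>"
begin

abbreviation B where "B \<equiv> EndAlg \<C> Q"
abbreviation \<Psi> :: "'o \<Rightarrow> ('k, 'm) rmod" where "\<Psi> \<equiv> cov_hom \<C> Q"
abbreviation \<Psi>m :: "'o \<Rightarrow> 'o \<Rightarrow> 'm \<Rightarrow> ('k, 'm) rmap" where "\<Psi>m \<equiv> cov_hom_map \<C> Q"

sublocale M: preadditive "mod_cat B" by (rule preadditive_mod_cat)

lemma \<Psi>_right_module:
  assumes [simp]: "X \<in> Ob \<C>"
  shows "right_module B (\<Psi> X)"
proof -
  interpret abelian_group "Hom \<C> Q X" using Hom_group by simp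
  have "abelian_group (\<Psi> X)"
    by (rule abelian_groupI) (auto simp: a_assoc intro: a_comm l_neg)
  then show ?thesis unfolding right_module_def using ring_EndAlg[OF Q_in] by (auto simp: cmp_assoc)
qed

text \<open>A scalar \<open>c\<close> acts as \<open>c\<close> times the identity of
  \<open>Q\<close>, so \<open>B\<close>-submodules are subspaces, and a finite spanning set over
  \<open>k\<close> generates over \<open>B\<close>. The form with \<open>U\<close> covers kernels,
  whose finite generation resolutions require.\<close>

lemma \<Psi>_sub_fin_gen:
  assumes X [simp]: "X \<in> Ob \<C>" and U: "right_module B ((\<Psi> X)\<lparr>carrier := U\<rparr>)" "U \<subseteq> carrier (\<Psi> X)"
  shows "fin_gen B ((\<Psi> X)\<lparr>carrier := U\<rparr>)"
proof -
  let ?V = "Hom \<C> Q X"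
  have V: "module k ?V" using Hom_module by simp
  have sc: "c \<odot>\<^bsub>?V\<^esub> f = comp \<C> Q Q X f (c \<odot>\<^bsub>Hom \<C> Q Q\<^esub> ident \<C> Q)" "c \<odot>\<^bsub>Hom \<C> Q Q\<^esub> ident \<C> Q \<in> Mor Q Q"
    if "c \<in> carrier k" "f \<in> Mor Q X" for c f
    using that comp_smult_right[of Q Q X "ident \<C> Q" f c] module.smult_closed[OF Hom_module[of Q Q]] by simp_all
  have sub: "submodule {f \<in> Mor Q X. Inl f \<in> W} k ?V" if W: "submodule W B ((\<Psi> X)\<lparr>carrier := U\<rparr>)" for W
  proof (rule module_submoduleI[OF V])
    show "{f \<in> Mor Q X. Inl f \<in> W} \<subseteq> Mor Q X" by blast
    show "\<zero>\<^bsub>?V\<^esub> \<in> {f \<in> Mor Q X. Inl f \<in> W}" using submoduleD(2)[OF W] by simp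
    show "x \<oplus>\<^bsub>?V\<^esub> y \<in> {f \<in> Mor Q X. Inl f \<in> W}"
      if "x \<in> {f \<in> Mor Q X. Inl f \<in> W}" "y \<in> {f \<in> Mor Q X. Inl f \<in> W}" for x y
      using submoduleD(3)[OF W, of "Inl x" "Inl y"] that by simp
    show "a \<odot>\<^bsub>?V\<^esub> x \<in> {f \<in> Mor Q X. Inl f \<in> W}"
      if a: "a \<in> carrier k" and x: "x \<in> {f \<in> Mor Q X. Inl f \<in> W}" for a x
      using submoduleD(5)[OF W, of "a \<odot>\<^bsub>Hom \<C> Q Q\<^esub> ident \<C> Q" "Inl x"] x sc[OF a, of x] by simp
  qed
  have Us: "submodule U B ((\<Psi> X)\<lparr>carrier := U\<rparr>)"
    by (rule submoduleI[OF U(1)]) (use rm_closed[OF U(1)] right_moduleD(3)[OF U(1)] in auto)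
  obtain T where T: "finite T" "T \<subseteq> {f \<in> Mor Q X. Inl f \<in> U}"
    "\<And>W. \<lbrakk>submodule W k ?V; T \<subseteq> W\<rbrakk> \<Longrightarrow> {f \<in> Mor Q X. Inl f \<in> U} \<subseteq> W"
    by (rule subspace_fin_gen[OF field V Hom_finite[OF Q_in X] sub[OF Us]]) blast
  show ?thesis unfolding fin_gen_def
  proof (intro exI[of _ "Inl ` T"] conjI allI impI)
    show "finite (Inl ` T)" using T(1) by simp
    show "Inl ` T \<subseteq> carrier ((\<Psi> X)\<lparr>carrier := U\<rparr>)" using T(2) by auto
    fix W assume W: "submodule W B ((\<Psi> X)\<lparr>carrier := U\<rparr>)" "Inl ` T \<subseteq> W"
    have "T \<subseteq> {f \<in> Mor Q X. Inl f \<in> W}" using T(2) W(2) by auto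
    from T(3)[OF sub[OF W(1)] this] have "U \<subseteq> W" using U(2) by auto
    then show "W = carrier ((\<Psi> X)\<lparr>carrier := U\<rparr>)" using submoduleD(1)[OF W(1)] by auto
  qed
qed

lemma \<Psi>_mod_Ob [simp]:
  assumes X: "X \<in> Ob \<C>"
  shows "\<Psi> X \<in> mod_Ob B"
proof (rule mod_ObI[OF \<Psi>_right_module[OF X]])
  have "(\<Psi> X)\<lparr>carrier := carrier (\<Psi> X)\<rparr> = \<Psi> X" by simp
  then show "fin_gen B (\<Psi> X)" using \<Psi>_sub_fin_gen[OF X, of "carrier (\<Psi> X)"] \<Psi>_right_module[OF X] by (simp del: cov_hom_simps)
qed

lemma \<Psi>m_eval [simp]: "u \<in> Mor Q X \<Longrightarrow> \<Psi>m X Y f (Inl u) = Inl (comp \<C> Q X Y f u)"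
  by (simp add: cov_hom_map_def)

lemma \<Psi>m_rhom [simp]:
  assumes "X \<in> Ob \<C>" "Y \<in> Ob \<C>" "f \<in> Mor X Y"
  shows "\<Psi>m X Y f \<in> rhom B (\<Psi> X) (\<Psi> Y)"
  by (rule rhomI) (use assms in \<open>auto simp: cmp_assoc cov_hom_map_def extensional_def\<close>)

lemma \<Psi>_rhom_eqI:
  assumes "\<phi> \<in> rhom A (\<Psi> X) N" "\<psi> \<in> rhom A (\<Psi> X) N'" "\<And>u. u \<in> Mor Q X \<Longrightarrow> \<phi> (Inl u) = \<psi> (Inl u)"
  shows "\<phi> = \<psi>"
  by (rule rhom_eqI[OF assms(1,2)]) (use assms(3) in auto)

lemma \<Psi>m_comp:
  assumes "X \<in> Ob \<C>" "Y \<in> Ob \<C>" "Z \<in> Ob \<C>" "f \<in> Mor X Y" "g \<in> Mor Y Z"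
  shows "\<Psi>m X Z (comp \<C> X Y Z g f) = compose (carrier (\<Psi> X)) (\<Psi>m Y Z g) (\<Psi>m X Y f)"
  by (rule \<Psi>_rhom_eqI[OF \<Psi>m_rhom rhom_compose[OF \<Psi>m_rhom \<Psi>m_rhom \<Psi>_right_module]])
    (use assms in \<open>simp_all add: cmp_assoc\<close>)

lemma \<Psi>m_ident: "X \<in> Ob \<C> \<Longrightarrow> \<Psi>m X X (ident \<C> X) = (\<lambda>x \<in> carrier (\<Psi> X). x)"
  by (rule \<Psi>_rhom_eqI[OF \<Psi>m_rhom rhom_ident[OF \<Psi>_right_module]]) simp_all

lemma \<Psi>m_zero: "\<lbrakk>X \<in> Ob \<C>; Y \<in> Ob \<C>\<rbrakk> \<Longrightarrow> \<Psi>m X Y (Z0 X Y) = (\<lambda>x \<in> carrier (\<Psi> X). \<zero>\<^bsub>\<Psi> Y\<^esub>)"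
  by (rule \<Psi>_rhom_eqI[OF \<Psi>m_rhom rhom_const_zero[OF \<Psi>_right_module \<Psi>_right_module]]) simp_all

lemma \<Psi>m_add:
  assumes "X \<in> Ob \<C>" "Y \<in> Ob \<C>" "f \<in> Mor X Y" "g \<in> Mor X Y"
  shows "\<Psi>m X Y (f \<oplus>\<^bsub>Hom \<C> X Y\<^esub> g) = \<Psi>m X Y f \<oplus>\<^bsub>mod_Hom B (\<Psi> X) (\<Psi> Y)\<^esub> \<Psi>m X Y g"
  unfolding mod_Hom_simps
  by (rule \<Psi>_rhom_eqI[OF \<Psi>m_rhom rhom_add[OF \<Psi>_right_module \<Psi>_right_module \<Psi>m_rhom \<Psi>m_rhom]])
    (use assms in simp_all)

lemma \<Psi>m_finsum:
  assumes "finite I" and X: "X \<in> Ob \<C>" "Y \<in> Ob \<C>" and "\<And>r. r \<in> I \<Longrightarrow> f r \<in> Mor X Y"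
  shows "\<Psi>m X Y (finsum (Hom \<C> X Y) f I) = finsum (mod_Hom B (\<Psi> X) (\<Psi> Y)) (\<lambda>r. \<Psi>m X Y (f r)) I"
  using assms(1,4)
proof (induction I)
  interpret a: abelian_group "Hom \<C> X Y" using X Hom_group by simp
  interpret b: abelian_group "mod_Hom B (\<Psi> X) (\<Psi> Y)" using X mod_Hom_group \<Psi>_right_module by blast
  case empty
  then show ?case using X by (simp add: \<Psi>m_zero del: cov_hom_simps)
next
  interpret a: abelian_group "Hom \<C> X Y" using X Hom_group by simp
  interpret b: abelian_group "mod_Hom B (\<Psi> X) (\<Psi> Y)" using X mod_Hom_group \<Psi>_right_module by blast
  case (insert x F)
  have 1: "finsum (Hom \<C> X Y) f (insert x F) = f x \<oplus>\<^bsub>Hom \<C> X Y\<^esub> finsum (Hom \<C> X Y) f F"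
    using insert by (intro a.finsum_insert) auto
  have 2: "finsum (mod_Hom B (\<Psi> X) (\<Psi> Y)) (\<lambda>r. \<Psi>m X Y (f r)) (insert x F)
    = \<Psi>m X Y (f x) \<oplus>\<^bsub>mod_Hom B (\<Psi> X) (\<Psi> Y)\<^esub> finsum (mod_Hom B (\<Psi> X) (\<Psi> Y)) (\<lambda>r. \<Psi>m X Y (f r)) F"
    using insert X by (intro b.finsum_insert) (auto simp del: cov_hom_simps)
  show ?case unfolding 1 2 using insert X finsum_in by (subst \<Psi>m_add) auto
qed

text \<open>An additive functor keeps the defining equations. Existence of direct sums in
  \<open>mod_cat B\<close> is drawn from \<C> in this way.\<close>

lemma \<Psi>_biproduct:
  assumes b: "biproduct \<C> Xs S i p"
  shows "biproduct (mod_cat B) (map \<Psi> Xs) (\<Psi> S) (\<lambda>r. \<Psi>m (Xs ! r) S (i r)) (\<lambda>r. \<Psi>m S (Xs ! r) (p r))"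
proof -
  note [simp] = biproductD[OF b]
  have "\<Psi>m S S (ident \<C> S) = finsum (mod_Hom B (\<Psi> S) (\<Psi> S)) (\<lambda>r. \<Psi>m S S (comp \<C> S (Xs ! r) S (i r) (p r))) {..<length Xs}"
    unfolding biproductD(6)[OF b, symmetric] by (rule \<Psi>m_finsum) auto
  also have "\<dots> = finsum (mod_Hom B (\<Psi> S) (\<Psi> S)) (\<lambda>r. comp (mod_cat B) (\<Psi> S) (map \<Psi> Xs ! r) (\<Psi> S) (\<Psi>m (Xs ! r) S (i r)) (\<Psi>m S (Xs ! r) (p r))) {..<length Xs}"
    using abelian_group.axioms(1)[OF mod_Hom_group[OF \<Psi>_right_module \<Psi>_right_module], of S S]
    by (intro abelian_monoid.finsum_cong') (auto simp: \<Psi>m_comp simp del: cov_hom_simps intro!: rhom_compose[OF \<Psi>m_rhom \<Psi>m_rhom \<Psi>_right_module])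
  finally have e: "ident (mod_cat B) (\<Psi> S) = \<dots>" by (simp add: \<Psi>m_ident del: cov_hom_simps)
  have d: "compose (carrier (\<Psi> (Xs ! r))) (\<Psi>m S (Xs ! s) (p s)) (\<Psi>m (Xs ! r) S (i r)) =
    (if r = s then ident (mod_cat B) (\<Psi> (Xs ! r)) else \<zero>\<^bsub>mod_Hom B (\<Psi> (Xs ! r)) (\<Psi> (Xs ! s))\<^esub>)"
    if "r < length Xs" "s < length Xs" for r s
    using that by (subst \<Psi>m_comp[symmetric]) (simp_all add: \<Psi>m_ident \<Psi>m_zero del: cov_hom_simps)
  have "set Xs \<subseteq> Ob \<C>" using b by (simp add: biproduct_def)
  then have s: "set (map \<Psi> Xs) \<subseteq> mod_Ob B" by auto
  show ?thesis unfolding biproduct_def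
    using e s d by (simp del: cov_hom_simps mod_Hom_simps(2) mod_cat_simps(3) add: mod_cat_simps(4))
qed

lemma \<Psi>_direct_sum: "direct_sum \<C> Xs S \<Longrightarrow> direct_sum (mod_cat B) (map \<Psi> Xs) (\<Psi> S)"
  using \<Psi>_biproduct unfolding direct_sum_def by blast

text \<open>\<open>\<Psi> Q\<close> is the regular module, so \<open>\<Psi> S\<close> is free on the
  elements \<open>Inl (i r)\<close>.\<close>

lemma \<Psi>_generator_eqI:
  assumes b: "biproduct \<C> (replicate n Q) S i p" and N: "N \<in> mod_Ob B"
    and f: "f \<in> rhom B (\<Psi> S) N" "g \<in> rhom B (\<Psi> S) N" and eq: "\<And>r. r < n \<Longrightarrow> f (Inl (i r)) = g (Inl (i r))"
  shows "f = g"
proof -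
  have S: "S \<in> Ob \<C>" using biproductD(1)[OF b] .
  have i: "i r \<in> Mor Q S" if "r < n" for r using biproductD(3)[OF b, of r] that by simp
  have "compose (carrier (\<Psi> Q)) f (\<Psi>m Q S (i r)) = compose (carrier (\<Psi> Q)) g (\<Psi>m Q S (i r))" if r: "r < n" for r
  proof (rule \<Psi>_rhom_eqI[OF rhom_compose[OF \<Psi>m_rhom f(1)] rhom_compose[OF \<Psi>m_rhom f(2)]])
    fix u assume u: "u \<in> Mor Q Q"
    have "f (Inl (comp \<C> Q Q S (i r) u)) = u \<odot>\<^bsub>N\<^esub> f (Inl (i r))" "g (Inl (comp \<C> Q Q S (i r) u)) = u \<odot>\<^bsub>N\<^esub> g (Inl (i r))"
      using rhomD(3)[OF f(1), of u "Inl (i r)"] rhomD(3)[OF f(2), of u "Inl (i r)"] u i[OF r] by simp_all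
    then show "compose (carrier (\<Psi> Q)) f (\<Psi>m Q S (i r)) (Inl u) = compose (carrier (\<Psi> Q)) g (\<Psi>m Q S (i r)) (Inl u)"
      using u eq[OF r] by simp
  qed (use S i[OF r] \<Psi>_right_module in auto)
  then show ?thesis
    using M.biproduct_eqI_left[OF \<Psi>_biproduct[OF b], of N f g] N f by (simp del: cov_hom_simps)
qed

lemma \<Psi>_generator_map:
  assumes b: "biproduct \<C> (replicate n Q) S i p" and N: "N \<in> mod_Ob B" and m: "\<And>r. r < n \<Longrightarrow> m r \<in> carrier N"
  obtains f where "f \<in> rhom B (\<Psi> S) N" "\<And>r. r < n \<Longrightarrow> f (Inl (i r)) = m r"
proof -
  have S: "S \<in> Ob \<C>" using biproductD(1)[OF b] .
  have i: "i r \<in> Mor Q S" if "r < n" for r using biproductD(3)[OF b, of r] that by simp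
  note rN = mod_ObD(1)[OF N]
  \<comment> \<open>The homomorphism from the regular module that sends the identity of
    \<open>Q\<close> to \<open>m r\<close>.\<close>
  define \<phi> where "\<phi> r = (\<lambda>v \<in> carrier (\<Psi> Q). projl v \<odot>\<^bsub>N\<^esub> m r)" for r
  have \<phi>: "\<phi> r \<in> rhom B (\<Psi> Q) N" if r: "r < n" for r
    by (rule rhomI) (use m[OF r] right_moduleD(3,4,6)[OF rN] in \<open>auto simp: \<phi>_def\<close>)
  obtain f where f: "f \<in> rhom B (\<Psi> S) N" "\<And>r. r < n \<Longrightarrow> compose (carrier (\<Psi> Q)) f (\<Psi>m Q S (i r)) = \<phi> r"
    using M.biproduct_copair[OF \<Psi>_biproduct[OF b], of N \<phi>] N \<phi> by (auto simp del: cov_hom_simps)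
  have "f (Inl (i r)) = m r" if r: "r < n" for r
  proof -
    have "compose (carrier (\<Psi> Q)) f (\<Psi>m Q S (i r)) (Inl (ident \<C> Q)) = \<phi> r (Inl (ident \<C> Q))" using f(2)[OF r] by simp
    then show ?thesis using i[OF r] S right_moduleD(7)[OF rN m[OF r]] by (simp add: \<phi>_def)
  qed
  with f(1) that show ?thesis by blast
qed

lemma \<Psi>_projective:
  assumes d: "direct_sum \<C> (replicate n Q) S"
  shows "projective B (\<Psi> S)"
proof -
  obtain i p where b: "biproduct \<C> (replicate n Q) S i p" using d unfolding direct_sum_def by blast
  have S: "S \<in> Ob \<C>" using biproductD(1)[OF b] .
  have i: "Inl (i r) \<in> carrier (\<Psi> S)" if "r < n" for r using biproductD(3)[OF b, of r] that by simp
  show ?thesis unfolding projective_def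
  proof (intro conjI ballI impI)
    fix X N g f assume X: "X \<in> mod_Ob B" and N: "N \<in> mod_Ob B" and g: "g \<in> rhom B X N" and f: "f \<in> rhom B (\<Psi> S) N"
      and surj: "g ` carrier X = carrier N"
    have "\<exists>x. r < n \<longrightarrow> x \<in> carrier X \<and> g x = f (Inl (i r))" for r
      using surj rhomD(1)[OF f i[of r]] by (metis imageE)
    then obtain m where m: "\<And>r. r < n \<Longrightarrow> m r \<in> carrier X" "\<And>r. r < n \<Longrightarrow> g (m r) = f (Inl (i r))" by metis
    obtain h where h: "h \<in> rhom B (\<Psi> S) X" "\<And>r. r < n \<Longrightarrow> h (Inl (i r)) = m r"
      by (rule \<Psi>_generator_map[OF b X m(1)]) auto
    have "compose (carrier (\<Psi> S)) g h = f"
    proof (rule \<Psi>_generator_eqI[OF b N rhom_compose[OF h(1) g \<Psi>_right_module[OF S]] f])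
      fix r assume r: "r < n"
      show "compose (carrier (\<Psi> S)) g h (Inl (i r)) = f (Inl (i r))"
        using compose_eval[OF i[OF r], of g h] h(2)[OF r] m(2)[OF r] by simp
    qed
    with h(1) show "\<exists>h\<in>rhom B (\<Psi> S) X. compose (carrier (\<Psi> S)) g h = f" by blast
  qed (use S in simp)
qed

text \<open>A module with \<open>n\<close> generators is a quotient of the image of a sum of
  \<open>n\<close> copies of \<open>Q\<close>. Free modules are thus found inside the fixed carrier
  type, and their submodules are finitely generated by \<open>\<Psi>_sub_fin_gen\<close>.\<close>

sublocale enough_projectives B
proof
  fix N assume N: "N \<in> mod_Ob B"
  note rN = mod_ObD(1)[OF N]
  obtain G where G: "finite G" "G \<subseteq> carrier N" "\<And>U. submodule U B N \<Longrightarrow> G \<subseteq> U \<Longrightarrow> U = carrier N"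
    using mod_ObD(2)[OF N] unfolding fin_gen_def by blast
  obtain gs where gs: "set gs = G" using finite_list[OF G(1)] by blast
  let ?n = "length gs"
  have "set (replicate ?n Q) \<subseteq> Ob \<C>" by auto
  then obtain S where S: "direct_sum \<C> (replicate ?n Q) S" using direct_sum_exists by blast
  obtain i p where b: "biproduct \<C> (replicate ?n Q) S i p" using S unfolding direct_sum_def by blast
  have SO: "S \<in> Ob \<C>" using biproductD(1)[OF b] .
  note rS = \<Psi>_right_module[OF SO]
  obtain f where f: "f \<in> rhom B (\<Psi> S) N" "\<And>r. r < ?n \<Longrightarrow> f (Inl (i r)) = gs ! r"
    by (rule \<Psi>_generator_map[OF b N, of "\<lambda>r. gs ! r"]) (use G(2) gs nth_mem in blast)+
  have "submodule (f ` carrier (\<Psi> S)) B N" by (rule rhom_image_submodule[OF rS rN f(1) submodule_carrier[OF rS]])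
  moreover have "G \<subseteq> f ` carrier (\<Psi> S)"
  proof
    fix x assume "x \<in> G"
    then obtain r where r: "r < ?n" "x = gs ! r" using gs by (metis in_set_conv_nth)
    have "Inl (i r) \<in> carrier (\<Psi> S)" using biproductD(3)[OF b, of r] r by simp
    then show "x \<in> f ` carrier (\<Psi> S)" using f(2)[OF r(1)] r(2) by (metis image_eqI)
  qed
  ultimately have surj: "f ` carrier (\<Psi> S) = carrier N" using G(3) by blast
  have "fin_gen B (kerm (\<Psi> S) N f)"
    by (rule \<Psi>_sub_fin_gen[OF SO kernel_right_module[OF f(1) rS rN] kernel_props(1)[OF f(1) rS rN]])
  with f(1) surj \<Psi>_projective[OF S]
  show "\<exists>Q y. projective B Q \<and> y \<in> rhom B Q N \<and> y ` carrier Q = carrier N \<and> fin_gen B (kerm Q N y)" by blast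
qed

lemma \<Psi>_full_generator:
  assumes d: "direct_sum \<C> (replicate n Q) S" and N: "N \<in> Ob \<C>" and \<phi>: "\<phi> \<in> rhom B (\<Psi> S) (\<Psi> N)"
  obtains g where "g \<in> Mor S N" "\<Psi>m S N g = \<phi>"
proof -
  obtain i p where b: "biproduct \<C> (replicate n Q) S i p" using d unfolding direct_sum_def by blast
  have S: "S \<in> Ob \<C>" using biproductD(1)[OF b] .
  have i: "i r \<in> Mor Q S" if "r < n" for r using biproductD(3)[OF b, of r] that by simp
  have p: "projl (\<phi> (Inl (i r))) \<in> Mor Q N" "\<phi> (Inl (i r)) = Inl (projl (\<phi> (Inl (i r))))" if r: "r < n" for r
    using rhomD(1)[OF \<phi>, of "Inl (i r)"] i[OF r] by auto
  obtain g where g: "g \<in> Mor S N" "\<And>r. r < n \<Longrightarrow> comp \<C> Q S N g (i r) = projl (\<phi> (Inl (i r)))"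
    using biproduct_copair[OF b N, of "\<lambda>r. projl (\<phi> (Inl (i r)))"] p by auto
  have "\<Psi>m S N g = \<phi>"
    by (rule \<Psi>_generator_eqI[OF b \<Psi>_mod_Ob[OF N] \<Psi>m_rhom[OF S N g(1)] \<phi>]) (use g(2) i p(2) in simp)
  with g(1) that show ?thesis by blast
qed

lemma \<Psi>_faithful_generator:
  assumes d: "direct_sum \<C> (replicate n Q) S" and N: "N \<in> Ob \<C>" and f: "f \<in> Mor S N" "g \<in> Mor S N"
    and eq: "\<Psi>m S N f = \<Psi>m S N g"
  shows "f = g"
proof -
  obtain i p where b: "biproduct \<C> (replicate n Q) S i p" using d unfolding direct_sum_def by blast
  show ?thesis
  proof (rule biproduct_eqI_left[OF b N f])
    fix r assume r: "r < length (replicate n Q)"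
    then have i: "i r \<in> Mor Q S" using biproductD(3)[OF b, of r] by simp
    have "\<Psi>m S N f (Inl (i r)) = \<Psi>m S N g (Inl (i r))" using eq by simp
    then show "comp \<C> (replicate n Q ! r) S N f (i r) = comp \<C> (replicate n Q ! r) S N g (i r)" using i r by simp
  qed
qed

end

section \<open>Idempotents in a Krull--Schmidt category\<close>

context preadditive
begin

lemma diff_zero_eq:
  assumes "X \<in> Ob \<C>" "Y \<in> Ob \<C>" "f \<in> Mor X Y" "g \<in> Mor X Y" "f \<oplus>\<^bsub>Hom \<C> X Y\<^esub> \<ominus>\<^bsub>Hom \<C> X Y\<^esub> g = Z0 X Y"
  shows "f = g"
proof -
  interpret abelian_group "Hom \<C> X Y" using Hom_group assms by blast
  have "f = \<ominus>\<^bsub>Hom \<C> X Y\<^esub> (\<ominus>\<^bsub>Hom \<C> X Y\<^esub> g)"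
    by (rule uminus_eqI[OF assms(1-3) _ assms(5)]) (use assms in simp)
  then show ?thesis using assms(4) by (simp add: minus_minus)
qed

text \<open>\<open>f\<close> and \<open>1 - f\<close> add up to a unit, so one of them is a unit;
  since their product is zero, the other one vanishes.\<close>

lemma idempotent_of_local:
  assumes Y: "Y \<in> Ob \<C>" and loc: "local_ring (EndAlg \<C> Y)" and f: "f \<in> Mor Y Y" "comp \<C> Y Y Y f f = f"
  shows "f = Z0 Y Y \<or> f = ident \<C> Y"
proof -
  interpret R: ring "EndAlg \<C> Y" using ring_EndAlg[OF Y] .
  let ?g = "ident \<C> Y \<oplus>\<^bsub>Hom \<C> Y Y\<^esub> \<ominus>\<^bsub>Hom \<C> Y Y\<^esub> f"
  have g: "?g \<in> Mor Y Y" using Y f by simp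
  have fg: "comp \<C> Y Y Y f ?g = Z0 Y Y" using Y f by simp
  interpret H: abelian_group "Hom \<C> Y Y" using Hom_group Y by blast
  have "f \<oplus>\<^bsub>Hom \<C> Y Y\<^esub> ?g = ident \<C> Y" by (rule H.add_diff_cancel) (use Y f in simp_all)
  moreover have "ident \<C> Y \<in> Units (EndAlg \<C> Y)" using R.Units_one_closed by simp
  ultimately have "f \<in> Units (EndAlg \<C> Y) \<or> ?g \<in> Units (EndAlg \<C> Y)"
    using loc f(1) g unfolding local_ring_def by (metis DiffI EndAlg_simps(1,3))
  then show ?thesis
  proof
    assume "f \<in> Units (EndAlg \<C> Y)"
    then obtain h where h: "h \<in> Mor Y Y" "comp \<C> Y Y Y h f = ident \<C> Y" unfolding Units_def by auto
    have "?g = comp \<C> Y Y Y (comp \<C> Y Y Y h f) ?g" unfolding h(2) using Y g by (simp only: cmp_Id_left)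
    also have "\<dots> = Z0 Y Y" unfolding cmp_assoc[OF Y Y Y Y g f(1) h(1)] fg using Y h(1) by simp
    finally show ?thesis using diff_zero_eq[OF Y Y Id_in[OF Y] f(1)] by simp
  next
    assume "?g \<in> Units (EndAlg \<C> Y)"
    then obtain h where h: "h \<in> Mor Y Y" "comp \<C> Y Y Y ?g h = ident \<C> Y" unfolding Units_def by auto
    have "f = comp \<C> Y Y Y f (comp \<C> Y Y Y ?g h)" unfolding h(2) using Y f by (simp only: cmp_Id_right)
    also have "\<dots> = Z0 Y Y" unfolding cmp_assoc[OF Y Y Y Y h(1) g f(1), symmetric] fg using Y h(1) by simp
    finally show ?thesis by simp
  qed
qed

end

text \<open>In a Krull--Schmidt decomposition of \<open>X\<close> the first summand \<open>Y\<close>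
  has a local endomorphism ring and is nonzero, so its complement is zero. Hence \<open>X\<close> is
  isomorphic to \<open>Y\<close>, and \<open>e\<close> is transported to an idempotent of a local
  ring.\<close>

lemma (in Hom_finite_Krull_Schmidt_category) indecomposable_idempotent:
  assumes ind: "indecomposable \<C> X" and e: "e \<in> Mor X X" "comp \<C> X X X e e = e"
  shows "e = Z0 X X \<or> e = ident \<C> X"
proof -
  have X [simp]: "X \<in> Ob \<C>" and nz: "\<not> zero_object \<C> X"
    and dec: "\<And>Y Z. direct_sum \<C> [Y, Z] X \<Longrightarrow> zero_object \<C> Y \<or> zero_object \<C> Z"
    using ind unfolding indecomposable_def by blast+
  obtain Xs where Xs: "direct_sum \<C> Xs X" "\<And>Y. Y \<in> set Xs \<Longrightarrow> local_ring (EndAlg \<C> Y)"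
    using Krull_Schmidt[OF X] by blast
  have "Xs \<noteq> []" using Xs(1) nz direct_sum_Nil by blast
  then obtain Y Ys where Y: "Xs = Y # Ys" by (cases Xs) auto
  obtain T i j p q where "direct_sum \<C> Ys T" and T: "bip Y T X i j p q"
    using direct_sum_Cons[OF Xs(1)[unfolded Y]] .
  note [simp] = bipD(1-11)[OF T] e
  have loc: "local_ring (EndAlg \<C> Y)" using Xs(2) Y by simp
  then have "\<not> zero_object \<C> Y" unfolding local_ring_def zero_object_iff by simp
  moreover have "direct_sum \<C> [Y, T] X" using T unfolding direct_sum_pair by blast
  ultimately have "zero_object \<C> T" using dec by blast
  then have "comp \<C> X T X j q = Z0 X X"
    using cmp_Id_left[of X T q] cmp_zero_left[of X T T q] cmp_zero_right[of X T X j] unfolding zero_object_iff by simp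
  then have ip: "comp \<C> X Y X i p = ident \<C> X" using bipD(12)[OF T] by simp
  define f where "f = comp \<C> Y X Y p (comp \<C> Y X X e i)"
  have f [simp]: "f \<in> Mor Y Y" by (simp add: f_def)
  have bk: "comp \<C> X Y X i (comp \<C> X Y Y f p) = e"
  proof -
    have "comp \<C> X Y X i (comp \<C> X Y Y f p) = comp \<C> X X X (comp \<C> X Y X i p) (comp \<C> X X X e (comp \<C> X Y X i p))"
      by (simp add: f_def cmp_assoc)
    then show ?thesis by (simp add: ip)
  qed
  have "comp \<C> Y Y Y f f = comp \<C> Y X Y p (comp \<C> Y X X e (comp \<C> Y X X (comp \<C> X Y X i p) (comp \<C> Y X X e i)))"
    by (simp add: f_def cmp_assoc)
  also have "\<dots> = comp \<C> Y X Y p (comp \<C> Y X X (comp \<C> X X X e e) i)"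
    unfolding ip by (simp add: cmp_assoc del: e(2))
  finally have "comp \<C> Y Y Y f f = f" by (simp add: f_def)
  then consider "f = Z0 Y Y" | "f = ident \<C> Y" using idempotent_of_local[OF bipD(1)[OF T] loc f] by blast
  then show ?thesis
  proof cases
    case 1
    then show ?thesis using bk by simp
  next
    case 2
    then show ?thesis using bk ip by simp
  qed
qed

section \<open>The functor \<open>\<Psi>\<close> on an extension-closed class with enough projectives\<close>

text \<open>Collects what exactness, full faithfulness and the transfer of vanishing extensions draw
  from the class of filtered objects, stated through copies of \<open>Q\<close>.\<close>

locale exact_class = extriangulated_category_neg k \<C> + cov_functor k \<C> Q
  for k :: "'k ring" and \<C> :: "('k, 'o, 'm, 'e, 'n, 'x) ext_cat_scheme" and Q :: 'o +
  fixes \<F> :: "'o set"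
  assumes \<F>_Ob: "M \<in> \<F> \<Longrightarrow> M \<in> Ob \<C>"
    and \<F>_Neg: "\<lbrakk>W \<in> \<F>; X \<in> \<F>\<rbrakk> \<Longrightarrow> trivial_group (Neg \<C> W X)"
    and \<F>_gen: "direct_sum \<C> (replicate n Q) S \<Longrightarrow> S \<in> \<F>"
    and \<F>_Ext: "X \<in> \<F> \<Longrightarrow> trivial_group (Ext \<C> Q X)"
    and \<F>_cover: "M \<in> \<F> \<Longrightarrow> \<exists>K \<in> \<F>. \<exists>n S x y \<delta>. direct_sum \<C> (replicate n Q) S \<and> conflation \<C> K x S y M \<delta>"
begin

lemma Q_\<F>: "Q \<in> \<F>"
  using \<F>_gen[of 1 Q] direct_sum_single[OF Q_in] by simp

text \<open>Each position has its own reason: injectivity comes from vanishing of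
  \<open>Neg \<C> Q Z\<close>, exactness in the middle from weak kernels, and surjectivity from
  vanishing of \<open>Ext \<C> Q X\<close>.\<close>

lemma \<Psi>_exact:
  assumes c: "conflation \<C> X x M y Z \<delta>" and X: "X \<in> \<F>" and Z: "Z \<in> \<F>"
  shows "mod_short_exact B (\<Psi> X) (\<Psi>m X M x) (\<Psi> M) (\<Psi>m M Z y) (\<Psi> Z)"
  unfolding mod_short_exact_def
proof (intro conjI)
  note [simp] = conflationD[OF c]
  show "\<Psi> X \<in> mod_Ob B" "\<Psi> M \<in> mod_Ob B" "\<Psi> Z \<in> mod_Ob B"
    "\<Psi>m X M x \<in> rhom B (\<Psi> X) (\<Psi> M)" "\<Psi>m M Z y \<in> rhom B (\<Psi> M) (\<Psi> Z)" by simp_all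
  show "inj_on (\<Psi>m X M x) (carrier (\<Psi> X))"
  proof (rule inj_onI)
    fix a b assume "a \<in> carrier (\<Psi> X)" "b \<in> carrier (\<Psi> X)" and eq: "\<Psi>m X M x a = \<Psi>m X M x b"
    then obtain u v where u: "u \<in> Mor Q X" "v \<in> Mor Q X" "a = Inl u" "b = Inl v" by auto
    have "comp \<C> Q X M x u = comp \<C> Q X M x v" using eq u by simp
    then have "comp \<C> Q X M x (u \<oplus>\<^bsub>Hom \<C> Q X\<^esub> \<ominus>\<^bsub>Hom \<C> Q X\<^esub> v) = Z0 Q M" using u by simp
    then have "u \<oplus>\<^bsub>Hom \<C> Q X\<^esub> \<ominus>\<^bsub>Hom \<C> Q X\<^esub> v = Z0 Q X"
      using inflation_mono[OF c Q_in \<F>_Neg[OF Q_\<F> Z]] u by simp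
    then show "a = b" using diff_zero_eq[of Q X u v] u by simp
  qed
  show "\<Psi>m X M x ` carrier (\<Psi> X) = a_kernel (\<Psi> M) (\<Psi> Z) (\<Psi>m M Z y)"
  proof (intro equalityI subsetI)
    fix a assume "a \<in> \<Psi>m X M x ` carrier (\<Psi> X)"
    then obtain u where u: "u \<in> Mor Q X" "a = Inl (comp \<C> Q X M x u)" by auto
    then show "a \<in> a_kernel (\<Psi> M) (\<Psi> Z) (\<Psi>m M Z y)"
      by (simp add: a_kernel_def' cmp_assoc[symmetric] conflation_comp_zero[OF c])
  next
    fix a assume "a \<in> a_kernel (\<Psi> M) (\<Psi> Z) (\<Psi>m M Z y)"
    then obtain u where u: "u \<in> Mor Q M" "a = Inl u" "comp \<C> Q M Z y u = Z0 Q Z" by (auto simp: a_kernel_def')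
    obtain v where v: "v \<in> Mor Q X" "comp \<C> Q X M x v = u" using weak_kernel[OF c Q_in u(1,3)] .
    have "a = \<Psi>m X M x (Inl v)" using u v by simp
    then show "a \<in> \<Psi>m X M x ` carrier (\<Psi> X)" by (rule image_eqI) (use v(1) in simp)
  qed
  show "\<Psi>m M Z y ` carrier (\<Psi> M) = carrier (\<Psi> Z)"
  proof (intro equalityI subsetI)
    fix a assume "a \<in> carrier (\<Psi> Z)"
    then obtain u where u: "u \<in> Mor Q Z" "a = Inl u" by auto
    have "ext_pull \<C> Z Q X u \<delta> = \<zero>\<^bsub>Ext \<C> Q X\<^esub>" using trivial_groupD[OF \<F>_Ext[OF X]] u by simp
    then obtain v where v: "v \<in> Mor Q M" "comp \<C> Q M Z y v = u" using lift_along_deflation[OF c Q_in u(1)] by blast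
    have "a = \<Psi>m M Z y (Inl v)" using u v by simp
    then show "a \<in> \<Psi>m M Z y ` carrier (\<Psi> M)" by (rule image_eqI) (use v(1) in simp)
  qed auto
qed

text \<open>After the cover \<open>y\<close> the two maps agree, because maps out of a sum of copies
  of \<open>Q\<close> are seen by \<Psi>; \<open>y\<close> can be cancelled since \<open>Neg\<close>
  vanishes from \<open>K\<close> to \<open>N\<close>.\<close>

lemma \<Psi>_faithful:
  assumes M: "M \<in> \<F>" and N: "N \<in> \<F>" and f: "f \<in> Mor M N" "g \<in> Mor M N" and eq: "\<Psi>m M N f = \<Psi>m M N g"
  shows "f = g"
proof -
  obtain K n S x y \<delta> where K: "K \<in> \<F>" "direct_sum \<C> (replicate n Q) S" and c: "conflation \<C> K x S y M \<delta>"
    using \<F>_cover[OF M] by blast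
  note [simp] = conflationD[OF c] \<F>_Ob[OF N] f
  have "comp \<C> S M N f y = comp \<C> S M N g y"
    by (rule \<Psi>_faithful_generator[OF K(2) \<F>_Ob[OF N]]) (simp_all add: \<Psi>m_comp eq)
  then have "comp \<C> S M N (f \<oplus>\<^bsub>Hom \<C> M N\<^esub> \<ominus>\<^bsub>Hom \<C> M N\<^esub> g) y = Z0 S N" by simp
  then have "f \<oplus>\<^bsub>Hom \<C> M N\<^esub> \<ominus>\<^bsub>Hom \<C> M N\<^esub> g = Z0 M N"
    by (intro deflation_epi[OF c \<F>_Ob[OF N] \<F>_Neg[OF K(1) N]]) simp_all
  then show ?thesis by (rule diff_zero_eq[OF \<F>_Ob[OF M] \<F>_Ob[OF N] f])
qed

text \<open>On the cover, where the image is free, \<phi> comes from a map \<open>g\<close>; this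
  map descends to \<open>M\<close> along the weak cokernel \<open>y\<close>.\<close>

lemma \<Psi>_full:
  assumes M: "M \<in> \<F>" and N: "N \<in> \<F>" and \<phi>: "\<phi> \<in> rhom B (\<Psi> M) (\<Psi> N)"
  obtains f where "f \<in> Mor M N" "\<Psi>m M N f = \<phi>"
proof -
  obtain K n S x y \<delta> where K: "K \<in> \<F>" "direct_sum \<C> (replicate n Q) S" and c: "conflation \<C> K x S y M \<delta>"
    using \<F>_cover[OF M] by blast
  note [simp] = conflationD[OF c] \<F>_Ob[OF N]
  have "compose (carrier (\<Psi> S)) \<phi> (\<Psi>m S M y) \<in> rhom B (\<Psi> S) (\<Psi> N)"
    by (rule rhom_compose[OF \<Psi>m_rhom \<phi> \<Psi>_right_module]) simp_all
  from \<Psi>_full_generator[OF K(2) \<F>_Ob[OF N] this] obtain g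
    where g: "g \<in> Mor S N" "\<Psi>m S N g = compose (carrier (\<Psi> S)) \<phi> (\<Psi>m S M y)" .
  have ge: "Inl (comp \<C> Q S N g u) = \<phi> (Inl (comp \<C> Q S M y u))" if "u \<in> Mor Q S" for u
    using arg_cong[OF g(2), of "\<lambda>h. h (Inl u)"] that by simp
  \<comment> \<open>\<phi> applied to zero is zero, so the image of \<open>g\<close> after
    \<open>x\<close> vanishes; faithfulness on \<open>K\<close> then yields the condition for
    \<open>g\<close> to factor through \<open>y\<close>.\<close>
  have "\<Psi>m K N (comp \<C> K S N g x) = \<Psi>m K N (Z0 K N)"
  proof (rule \<Psi>_rhom_eqI[OF \<Psi>m_rhom \<Psi>m_rhom])
    fix u assume u: "u \<in> Mor Q K"
    have "Inl (comp \<C> Q S N g (comp \<C> Q K S x u)) = \<phi> (Inl (comp \<C> Q K M (comp \<C> K S M y x) u))"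
      using ge[of "comp \<C> Q K S x u"] u by (simp add: cmp_assoc)
    also have "\<dots> = \<phi> (\<zero>\<^bsub>\<Psi> M\<^esub>)" using u by (simp add: conflation_comp_zero[OF c])
    also have "\<dots> = \<zero>\<^bsub>\<Psi> N\<^esub>" by (rule rhom_zero[OF \<phi> \<Psi>_right_module \<Psi>_right_module]) simp_all
    finally show "\<Psi>m K N (comp \<C> K S N g x) (Inl u) = \<Psi>m K N (Z0 K N) (Inl u)" using u g(1) by (simp add: cmp_assoc)
  qed (use g(1) in simp_all)
  then have "comp \<C> K S N g x = Z0 K N" by (intro \<Psi>_faithful[OF K(1) N]) (use g(1) in simp_all)
  then obtain f where f: "f \<in> Mor M N" "comp \<C> S M N f y = g" using weak_cokernel[OF c \<F>_Ob[OF N] g(1)] by blast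
  have surj: "\<Psi>m S M y ` carrier (\<Psi> S) = carrier (\<Psi> M)" using \<Psi>_exact[OF c K(1) M] unfolding mod_short_exact_def by blast
  have "\<Psi>m M N f = \<phi>"
  proof (rule rhom_eqI[OF \<Psi>m_rhom \<phi>])
    fix a assume "a \<in> carrier (\<Psi> M)"
    then obtain b where b: "b \<in> carrier (\<Psi> S)" "a = \<Psi>m S M y b" using surj by blast
    then obtain u where u: "u \<in> Mor Q S" "b = Inl u" by auto
    have "\<Psi>m M N f a = Inl (comp \<C> Q S N g u)" using b(2) u f by (simp add: cmp_assoc[symmetric])
    then show "\<Psi>m M N f a = \<phi> a" using ge[OF u(1)] b(2) u by simp
  qed (use f in simp_all)
  with f(1) that show ?thesis by blast
qed

text \<open>By \<open>ext_vanish_of_cover\<close> the cover \<open>\<Psi> S -> \<Psi> M\<close>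
  decides. Its kernel is a copy of \<open>\<Psi> K\<close>, so by fullness a map on it comes from
  some \<open>g\<close> on \<open>K\<close>; the pushout of \<delta> along \<open>g\<close> is zero
  and \<open>g\<close> extends to \<open>S\<close>.\<close>

lemma \<Psi>_ext_vanish:
  assumes M: "M \<in> \<F>" and N: "N \<in> \<F>" and triv: "trivial_group (Ext \<C> M N)"
  shows "ext_vanish B (\<Psi> M) (\<Psi> N)"
proof -
  obtain K n S x y \<delta> where K: "K \<in> \<F>" "direct_sum \<C> (replicate n Q) S" and c: "conflation \<C> K x S y M \<delta>"
    using \<F>_cover[OF M] by blast
  note [simp] = conflationD[OF c] \<F>_Ob[OF N]
  have ses: "\<Psi>m S M y ` carrier (\<Psi> S) = carrier (\<Psi> M)" "\<Psi>m K S x ` carrier (\<Psi> K) = a_kernel (\<Psi> S) (\<Psi> M) (\<Psi>m S M y)"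
    using \<Psi>_exact[OF c K(1) M] unfolding mod_short_exact_def by blast+
  have yM: "\<Psi>m S M y \<in> rhom B (\<Psi> S) (\<Psi> M)" by simp
  have "extends B (\<Psi> S) (a_kernel (\<Psi> S) (\<Psi> M) (\<Psi>m S M y)) (\<Psi> N)"
    unfolding extends_def
  proof
    fix f assume f: "f \<in> rhom B (kerm (\<Psi> S) (\<Psi> M) (\<Psi>m S M y)) (\<Psi> N)"
    have xk: "\<Psi>m K S x \<in> rhom B (\<Psi> K) (kerm (\<Psi> S) (\<Psi> M) (\<Psi>m S M y))"
      by (rule rhom_sub_target[OF \<Psi>m_rhom]) (use ses(2) in auto)
    obtain g where g: "g \<in> Mor K N" "\<Psi>m K N g = compose (carrier (\<Psi> K)) f (\<Psi>m K S x)"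
      by (rule \<Psi>_full[OF K(1) N rhom_compose[OF xk f \<Psi>_right_module]]) simp_all
    have "ext_push \<C> M K N g \<delta> = \<zero>\<^bsub>Ext \<C> M N\<^esub>" using trivial_groupD[OF triv] g by simp
    then obtain h where h: "h \<in> Mor S N" "comp \<C> K S N h x = g" using extend_along_inflation[OF c \<F>_Ob[OF N] g(1)] by blast
    show "\<exists>g\<in>rhom B (\<Psi> S) (\<Psi> N). \<forall>a\<in>a_kernel (\<Psi> S) (\<Psi> M) (\<Psi>m S M y). g a = f a"
    proof (intro bexI[of _ "\<Psi>m S N h"] ballI)
      fix a assume "a \<in> a_kernel (\<Psi> S) (\<Psi> M) (\<Psi>m S M y)"
      then obtain b where b: "b \<in> carrier (\<Psi> K)" "a = \<Psi>m K S x b" using ses(2) by blast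
      then obtain u where u: "u \<in> Mor Q K" "b = Inl u" by auto
      have "\<Psi>m S N h a = \<Psi>m K N g b" using b(2) u h by (simp add: cmp_assoc[symmetric])
      then show "\<Psi>m S N h a = f a" using g(2) b by simp
    qed (use h in simp)
  qed
  then show ?thesis by (intro ext_vanish_of_cover[OF \<Psi>_projective[OF K(2)] yM ses(1)]) simp_all
qed

lemma \<Psi>m_alg_iso:
  assumes M: "M \<in> \<F>"
  shows "\<Psi>m M M \<in> alg_iso k (EndAlg \<C> M) (EndAlg (mod_cat B) (\<Psi> M))"
proof -
  have [simp]: "M \<in> Ob \<C>" using \<F>_Ob M .
  have "bij_betw (\<Psi>m M M) (Mor M M) (rhom B (\<Psi> M) (\<Psi> M))"
    unfolding bij_betw_def
  proof
    show "inj_on (\<Psi>m M M) (Mor M M)" by (rule inj_onI) (rule \<Psi>_faithful[OF M M])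
    show "\<Psi>m M M ` Mor M M = rhom B (\<Psi> M) (\<Psi> M)"
    proof (intro equalityI subsetI)
      fix \<phi> assume "\<phi> \<in> rhom B (\<Psi> M) (\<Psi> M)"
      then show "\<phi> \<in> \<Psi>m M M ` Mor M M" by (rule \<Psi>_full[OF M M]) blast
    qed auto
  qed
  moreover have "\<Psi>m M M (c \<odot>\<^bsub>Hom \<C> M M\<^esub> a) = c \<odot>\<^bsub>mod_Hom B (\<Psi> M) (\<Psi> M)\<^esub> \<Psi>m M M a"
    if c: "c \<in> carrier k" and a: "a \<in> Mor M M" for c a
  proof -
    have ca: "c \<odot>\<^bsub>Hom \<C> X Y\<^esub> h \<in> Mor X Y" if "X \<in> Ob \<C>" "Y \<in> Ob \<C>" "h \<in> Mor X Y" for X Y h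
      using module.smult_closed[OF Hom_module] c that by blast
    \<comment> \<open>Scalars act on modules through multiples of the identity of \<open>Q\<close>;
      bilinearity of composition moves \<open>c\<close> from one side to the other.\<close>
    have "\<Psi>m M M (c \<odot>\<^bsub>Hom \<C> M M\<^esub> a) v = (c \<odot>\<^bsub>Hom \<C> Q Q\<^esub> ident \<C> Q) \<odot>\<^bsub>\<Psi> M\<^esub> \<Psi>m M M a v"
      if v: "v \<in> carrier (\<Psi> M)" for v
    proof -
      obtain u where u: "u \<in> Mor Q M" "v = Inl u" using v by auto
      have au: "comp \<C> Q M M a u \<in> Mor Q M" using a u by simp
      show ?thesis using u a ca comp_smult_left[of Q M M u a c] comp_smult_right[of Q Q M "ident \<C> Q" "comp \<C> Q M M a u" c] c au
        by simp
    qed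
    then show ?thesis
      using rhomD(4)[OF \<Psi>m_rhom[of M M "c \<odot>\<^bsub>Hom \<C> M M\<^esub> a"]] ca[of M M a] a unfolding mod_Hom_simps
      by (intro extensionalityI[of _ "carrier (\<Psi> M)"]) (auto simp del: cov_hom_simps)
  qed
  ultimately show ?thesis
    unfolding alg_iso_def ring_iso_def ring_hom_def
    by (auto simp: \<Psi>m_comp \<Psi>m_add \<Psi>m_ident simp del: cov_hom_simps mod_Hom_simps(3,4))
qed

end

section \<open>Bricks, stones and indecomposables under \<Psi>\<close>

lemma skew_field_iso:
  assumes R: "skew_field R" and S: "ring S" and h: "h \<in> ring_iso R S"
  shows "skew_field S"
proof -
  interpret R: ring R using R unfolding skew_field_def by blast
  interpret S: ring S by fact
  have U: "Units R = carrier R - {\<zero>\<^bsub>R\<^esub>}" using R unfolding skew_field_def by blast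
  have hh: "h \<in> ring_hom R S" and bij: "bij_betw h (carrier R) (carrier S)" using h unfolding ring_iso_def by auto
  have h0: "h \<zero>\<^bsub>R\<^esub> = \<zero>\<^bsub>S\<^esub>" using ring_hom_zero[OF hh R.ring_axioms S] .
  have "s \<in> Units S" if s: "s \<in> carrier S" "s \<noteq> \<zero>\<^bsub>S\<^esub>" for s
  proof -
    obtain r where r: "r \<in> carrier R" "s = h r" using bij s unfolding bij_betw_def by blast
    then have "r \<in> Units R" using U s h0 by auto
    then obtain r' where r': "r' \<in> carrier R" "r' \<otimes>\<^bsub>R\<^esub> r = \<one>\<^bsub>R\<^esub>" "r \<otimes>\<^bsub>R\<^esub> r' = \<one>\<^bsub>R\<^esub>" unfolding Units_def by auto
    have "h r' \<otimes>\<^bsub>S\<^esub> s = \<one>\<^bsub>S\<^esub>" "s \<otimes>\<^bsub>S\<^esub> h r' = \<one>\<^bsub>S\<^esub>"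
      using ring_hom_mult[OF hh r'(1) r(1)] ring_hom_mult[OF hh r(1) r'(1)] r' r ring_hom_one[OF hh] by simp_all
    moreover have "h r' \<in> carrier S" using ring_hom_closed[OF hh r'(1)] .
    ultimately show ?thesis unfolding Units_def using s(1) by blast
  qed
  moreover have "\<zero>\<^bsub>S\<^esub> \<notin> Units S"
  proof
    assume "\<zero>\<^bsub>S\<^esub> \<in> Units S"
    then have "\<zero>\<^bsub>S\<^esub> = \<one>\<^bsub>S\<^esub>" unfolding Units_def using S.l_null by auto
    then have "h \<zero>\<^bsub>R\<^esub> = h \<one>\<^bsub>R\<^esub>" using h0 ring_hom_one[OF hh] by simp
    then have "\<zero>\<^bsub>R\<^esub> = \<one>\<^bsub>R\<^esub>" using bij_betw_imp_inj_on[OF bij] by (auto dest: inj_onD)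
    then have "\<zero>\<^bsub>R\<^esub> \<in> Units R" using R.Units_one_closed by simp
    then show False using U by simp
  qed
  ultimately show ?thesis unfolding skew_field_def using S S.Units_closed by auto
qed

context exact_class
begin

lemma \<Psi>_brick:
  assumes "M \<in> \<F>" "brick \<C> M"
  shows "brick (mod_cat B) (\<Psi> M)"
proof -
  have M: "\<Psi> M \<in> Ob (mod_cat B)" using \<F>_Ob[OF assms(1)] by simp
  have "\<Psi>m M M \<in> ring_iso (EndAlg \<C> M) (EndAlg (mod_cat B) (\<Psi> M))"
    using \<Psi>m_alg_iso[OF assms(1)] unfolding alg_iso_def by blast
  then have "skew_field (EndAlg (mod_cat B) (\<Psi> M))"
    using skew_field_iso M.ring_EndAlg[OF M] assms(2) unfolding brick_def by blast
  with M show ?thesis unfolding brick_def by blast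
qed

text \<open>A decomposition of \<open>\<Psi> X\<close> gives the idempotent \<open>i p\<close>,
  which by full faithfulness is the image of an idempotent of \<open>X\<close>. That idempotent is
  zero or the identity, and accordingly one of the two summands has zero identity.\<close>

lemma \<Psi>_indecomposable:
  assumes X: "X \<in> \<F>" and ind: "indecomposable \<C> X"
  shows "indecomposable (mod_cat B) (\<Psi> X)"
  unfolding indecomposable_def
proof (intro conjI allI impI)
  have XO [simp]: "X \<in> Ob \<C>" using \<F>_Ob X .
  show XM: "\<Psi> X \<in> Ob (mod_cat B)" by simp
  show "\<not> zero_object (mod_cat B) (\<Psi> X)"
  proof
    assume "zero_object (mod_cat B) (\<Psi> X)"
    then have "\<Psi>m X X (ident \<C> X) = \<Psi>m X X (Z0 X X)"
      unfolding M.zero_object_iff by (simp add: \<Psi>m_ident \<Psi>m_zero del: cov_hom_simps)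
    then have "ident \<C> X = Z0 X X" by (intro \<Psi>_faithful[OF X X]) simp_all
    then show False using ind unfolding indecomposable_def zero_object_iff by simp
  qed
  fix Y Z assume "direct_sum (mod_cat B) [Y, Z] (\<Psi> X)"
  then obtain i j p q where b: "M.bip Y Z (\<Psi> X) i j p q" using M.direct_sum_pair by blast
  note bD = M.bipD[OF b]
  define e' where "e' = comp (mod_cat B) (\<Psi> X) Y (\<Psi> X) i p"
  have e'M: "e' \<in> M.Mor (\<Psi> X) (\<Psi> X)" unfolding e'_def by (rule M.cmp_in[OF XM bD(1) XM bD(6) bD(4)])
  then obtain e where e: "e \<in> Mor X X" "\<Psi>m X X e = e'" using \<Psi>_full[OF X X, of e'] by (auto simp del: cov_hom_simps)
  have "comp (mod_cat B) (\<Psi> X) (\<Psi> X) (\<Psi> X) e' e' = 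
      comp (mod_cat B) (\<Psi> X) Y (\<Psi> X) i (comp (mod_cat B) (\<Psi> X) Y Y (comp (mod_cat B) Y (\<Psi> X) Y p i) p)"
    unfolding e'_def using XM bD(1,4,6) by (simp only: M.cmp_assoc M.cmp_in)
  also have "\<dots> = e'" unfolding bD(8) e'_def using XM bD(1,6) by (simp only: M.cmp_Id_left)
  finally have ee': "comp (mod_cat B) (\<Psi> X) (\<Psi> X) (\<Psi> X) e' e' = e'" .
  have "\<Psi>m X X (comp \<C> X X X e e) = \<Psi>m X X e"
    using ee' e by (simp add: \<Psi>m_comp del: cov_hom_simps)
  then have ee: "comp \<C> X X X e e = e" by (intro \<Psi>_faithful[OF X X]) (use e in simp_all)
  consider "e = Z0 X X" | "e = ident \<C> X" using indecomposable_idempotent[OF ind e(1) ee] by blast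
  then show "zero_object (mod_cat B) Y \<or> zero_object (mod_cat B) Z"
  proof cases
    case 1
    then have 0: "e' = M.Z0 (\<Psi> X) (\<Psi> X)" using e(2) by (simp add: \<Psi>m_zero del: cov_hom_simps)
    have "ident (mod_cat B) Y = comp (mod_cat B) Y (\<Psi> X) Y p (comp (mod_cat B) Y (\<Psi> X) (\<Psi> X) e' i)"
      unfolding e'_def using XM bD(1,4,6)
      by (simp only: M.cmp_assoc M.cmp_in bD(8) M.cmp_Id_right)
    also have "\<dots> = M.Z0 Y Y" unfolding 0 using XM bD(1,4,6) by (simp only: M.cmp_zero_left M.cmp_zero_right)
    finally show ?thesis using M.zero_object_iff bD(1) by blast
  next
    case 2
    then have 1: "e' = ident (mod_cat B) (\<Psi> X)" using e(2) by (simp add: \<Psi>m_ident del: cov_hom_simps)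
    have "q = comp (mod_cat B) (\<Psi> X) (\<Psi> X) Z q e'" unfolding 1 using M.cmp_Id_right[OF XM bD(2,7)] by simp
    also have "\<dots> = comp (mod_cat B) (\<Psi> X) Y Z (comp (mod_cat B) Y (\<Psi> X) Z q i) p"
      unfolding e'_def using XM bD(1,2,4,6,7) by (simp only: M.cmp_assoc)
    also have "\<dots> = M.Z0 (\<Psi> X) Z" unfolding bD(10) using XM bD(1,2,6) by (simp only: M.cmp_zero_left)
    finally have q0: "q = M.Z0 (\<Psi> X) Z" .
    have "ident (mod_cat B) Z = M.Z0 Z Z" unfolding bD(9)[symmetric] q0 by (rule M.cmp_zero_left[OF bD(2) XM bD(2,5)])
    then show ?thesis using M.zero_object_iff bD(2) by blast
  qed
qed

lemma \<Psi>_stone: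
  assumes "M \<in> \<F>" "stone \<C> M"
  shows "stone (mod_cat B) (\<Psi> M)"
  using assms \<Psi>_indecomposable[OF assms(1)] ext_vanish_trivial_mod_Ext[OF _ _ \<Psi>_ext_vanish[OF assms(1,1)]] \<F>_Ob[OF assms(1)]
  unfolding stone_def by simp

lemma \<Psi>_trivial_Hom:
  assumes "M \<in> \<F>" "N \<in> \<F>" "trivial_group (Hom \<C> M N)"
  shows "trivial_group (Hom (mod_cat B) (\<Psi> M) (\<Psi> N))"
proof (rule trivial_groupI)
  have O: "M \<in> Ob \<C>" "N \<in> Ob \<C>" using assms \<F>_Ob by blast+
  show "\<zero>\<^bsub>Hom (mod_cat B) (\<Psi> M) (\<Psi> N)\<^esub> \<in> carrier (Hom (mod_cat B) (\<Psi> M) (\<Psi> N))"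
    by (rule M.zero_in) (use O in simp_all)
  fix \<phi> assume "\<phi> \<in> carrier (Hom (mod_cat B) (\<Psi> M) (\<Psi> N))"
  then have "\<phi> \<in> rhom B (\<Psi> M) (\<Psi> N)" by simp
  then obtain f where f: "f \<in> Mor M N" "\<Psi>m M N f = \<phi>" by (rule \<Psi>_full[OF assms(1,2)])
  have "f = Z0 M N" using trivial_groupD[OF assms(3) f(1)] .
  then show "\<phi> = \<zero>\<^bsub>Hom (mod_cat B) (\<Psi> M) (\<Psi> N)\<^esub>" using f(2) O by (simp add: \<Psi>m_zero del: cov_hom_simps)
qed

end

section \<open>Opposite algebras and the injective side\<close>

lemma opp_simps [simp]:
  "carrier (opp A) = carrier A" "zero (opp A) = zero A" "add (opp A) = add A" "x \<otimes>\<^bsub>opp A\<^esub> y = y \<otimes>\<^bsub>A\<^esub> x"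
  "one (opp A) = one A" "smult (opp A) = smult A"
  by (simp_all add: opp_def)

lemma ring_opp:
  assumes "ring A"
  shows "ring (opp A)"
proof (rule ringI)
  interpret ring A by fact
  show "abelian_group (opp A)"
    by (rule abelian_groupI) (auto simp: a_assoc intro: a_comm l_neg)
  show "Group.monoid (opp A)" by (rule monoidI) (auto simp: m_assoc)
  fix x y z assume "x \<in> carrier (opp A)" "y \<in> carrier (opp A)" "z \<in> carrier (opp A)"
  then show "(x \<oplus>\<^bsub>opp A\<^esub> y) \<otimes>\<^bsub>opp A\<^esub> z = x \<otimes>\<^bsub>opp A\<^esub> z \<oplus>\<^bsub>opp A\<^esub> y \<otimes>\<^bsub>opp A\<^esub> z"
    "z \<otimes>\<^bsub>opp A\<^esub> (x \<oplus>\<^bsub>opp A\<^esub> y) = z \<otimes>\<^bsub>opp A\<^esub> x \<oplus>\<^bsub>opp A\<^esub> z \<otimes>\<^bsub>opp A\<^esub> y"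
    by (simp_all add: l_distr r_distr)
qed

text \<open>Adds the injective side: \<open>J\<close> stands for the direct sum of \<bbbI>, with
  conflations into powers of \<open>J\<close> dual to \<open>\<F>_cover\<close>. They feed the
  coresolution in \<open>\<Psi>_wakamatsu\<close>.\<close>

locale exact_filt = exact_class k \<C> Q "filt \<C> D"
  for k :: "'k ring" and \<C> :: "('k, 'o, 'm, 'e, 'n, 'x) ext_cat_scheme" and Q D :: 'o +
  fixes J :: 'o
  assumes D_in: "D \<in> Ob \<C>"
    and J_gen: "direct_sum \<C> (replicate n J) S \<Longrightarrow> S \<in> filt \<C> D"
    and J_in: "J \<in> filt \<C> D"
    and J_Ext: "M \<in> filt \<C> D \<Longrightarrow> trivial_group (Ext \<C> M J)"
    and J_cocover: "M \<in> filt \<C> D \<Longrightarrow>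
      \<exists>C \<in> filt \<C> D. \<exists>n S x y \<delta>. direct_sum \<C> (replicate n J) S \<and> conflation \<C> M x S y C \<delta>"
begin

abbreviation \<F> where "\<F> \<equiv> filt \<C> D"

section \<open>Filtrations by images in the module category\<close>

lemma \<Psi>_add_closure:
  assumes "X \<in> add_closure \<C> M"
  shows "\<Psi> X \<in> add_closure (mod_cat B) (\<Psi> M)"
proof -
  obtain n S Y where S: "direct_sum \<C> (replicate n M) S" "direct_sum \<C> [X, Y] S"
    using assms unfolding add_closure_def by auto
  have "direct_sum (mod_cat B) (replicate n (\<Psi> M)) (\<Psi> S)" "direct_sum (mod_cat B) [\<Psi> X, \<Psi> Y] (\<Psi> S)"
    using \<Psi>_direct_sum[OF S(1)] \<Psi>_direct_sum[OF S(2)] by (simp_all add: map_replicate)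
  then show ?thesis unfolding add_closure_def by blast
qed

text \<open>The object chosen by \<open>dsum\<close> is a direct sum because \<Psi> turns
  \<open>S\<close> into one, and any two direct sums are isomorphic.\<close>

lemma add_closure_dsum:
  assumes "direct_sum \<C> Xs S"
  shows "add_closure (mod_cat B) (dsum (mod_cat B) (map \<Psi> Xs)) = add_closure (mod_cat B) (\<Psi> S)"
proof -
  have "direct_sum (mod_cat B) (map \<Psi> Xs) (dsum (mod_cat B) (map \<Psi> Xs))"
    unfolding dsum_def by (rule someI, rule \<Psi>_direct_sum[OF assms])
  from M.add_closure_isoc[OF M.direct_sum_unique[OF this \<Psi>_direct_sum[OF assms]]] show ?thesis .
qed

text \<open>The number of factors is preserved; the hypothesis \<open>sub\<close> keeps both ends of
  each conflation in \<F>, where \<Psi> is exact.\<close>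

lemma \<Psi>_filt:
  assumes Xs: "direct_sum \<C> Xs S" and sub: "filt \<C> S \<subseteq> \<F>" and X: "X \<in> filt \<C> S"
  shows "\<Psi> X \<in> filt (mod_cat B) (dsum (mod_cat B) (map \<Psi> Xs))"
proof -
  let ?A = "add_closure (mod_cat B) (\<Psi> S)"
  have "\<Psi> X \<in> star_power (mod_cat B) ?A l" if "X \<in> star_power \<C> (add_closure \<C> S) l" for X l
    using that
  proof (induction l arbitrary: X)
    case 0
    then show ?case using \<Psi>_add_closure by simp
  next
    case (Suc l)
    then obtain U V x y \<delta> where *: "U \<in> add_closure \<C> S" "V \<in> star_power \<C> (add_closure \<C> S) l"
      and c: "conflation \<C> U x X y V \<delta>" unfolding star_power.simps star_def by blast
    have "V \<in> filt \<C> S" using *(2) unfolding filt_def by blast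
    then have "U \<in> \<F>" "V \<in> \<F>" using sub add_closure_filt[OF *(1)] by blast+
    from short_exact_conflation[OF \<Psi>_exact[OF c this]] show ?case
      unfolding star_power.simps star_def using \<Psi>_add_closure[OF *(1)] Suc.IH[OF *(2)] by blast
  qed
  then show ?thesis using X unfolding filt_def add_closure_dsum[OF Xs] by blast
qed

text \<open>A filtered module need not be literally an image under \<Psi>. Vanishing is therefore
  passed inside \<open>mod B\<close> from images to their retracts, which gives the additive
  closure, and then along short exact sequences by \<open>ext_vanish_middle\<close>.\<close>

lemma ext_vanish_filt:
  assumes Xs: "direct_sum \<C> Xs D" and X: "X \<in> filt (mod_cat B) (dsum (mod_cat B) (map \<Psi> Xs))"
    and N: "N \<in> \<F>" and triv: "\<And>M. M \<in> \<F> \<Longrightarrow> trivial_group (Ext \<C> M N)"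
  shows "X \<in> mod_Ob B \<and> ext_vanish B X (\<Psi> N)"
proof -
  let ?A = "add_closure (mod_cat B) (\<Psi> D)"
  have NO: "\<Psi> N \<in> mod_Ob B" using \<F>_Ob[OF N] by simp
  have add: "X \<in> mod_Ob B \<and> ext_vanish B X (\<Psi> N)" if X: "X \<in> ?A" for X
  proof -
    obtain n S Y where S: "direct_sum (mod_cat B) (replicate n (\<Psi> D)) S" "direct_sum (mod_cat B) [X, Y] S"
      using X unfolding add_closure_def by auto
    obtain i j p q where b: "M.bip X Y S i j p q" using S(2) unfolding M.direct_sum_pair by blast
    note bD = M.bipD[OF b, simplified]
    have "set (replicate n D) \<subseteq> Ob \<C>" using D_in by auto
    then obtain T where T: "direct_sum \<C> (replicate n D) T" using direct_sum_exists by blast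
    have TF: "T \<in> \<F>" using add_closure_filt[OF replicate_in_add_closure[OF T]] .
    have "direct_sum (mod_cat B) (replicate n (\<Psi> D)) (\<Psi> T)" using \<Psi>_direct_sum[OF T] by (simp add: map_replicate)
    \<comment> \<open>\<open>S\<close> and \<open>\<Psi> T\<close> are both direct sums of
      \<open>n\<close> copies of \<open>\<Psi> D\<close>, so the summand \<open>X\<close> of
      \<open>S\<close> becomes a retract of \<open>\<Psi> T\<close>.\<close>
    then obtain a c where a: "a \<in> rhom B S (\<Psi> T)" "c \<in> rhom B (\<Psi> T) S"
      "compose (carrier S) c a = (\<lambda>x \<in> carrier S. x)"
      using M.direct_sum_unique[OF S(1)] M.isocE[of S "\<Psi> T"] by (metis mod_cat_simps(2-4) mod_Hom_simps(1))
    have XO: "X \<in> mod_Ob B" using bD(1) .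
    have rS: "right_module B S" and rX: "right_module B X" using mod_ObD(1) bD(1,3) by blast+
    have "ext_vanish B X (\<Psi> N)"
    proof (rule ext_vanish_retract[OF XO \<Psi>_mod_Ob[OF \<F>_Ob[OF TF]] NO rhom_compose[OF bD(4) a(1) rX]
        rhom_compose[OF a(2) bD(6) \<Psi>_right_module[OF \<F>_Ob[OF TF]]] _ \<Psi>_ext_vanish[OF TF N triv[OF TF]]])
      fix m assume m: "m \<in> carrier X"
      have iS: "i m \<in> carrier S" using rhomD(1)[OF bD(4) m] .
      have "c (a (i m)) = i m" using fun_cong[OF a(3), of "i m"] iS by simp
      moreover have "p (i m) = m" using fun_cong[OF bD(8), of m] m by simp
      ultimately show "compose (carrier (\<Psi> T)) p c (compose (carrier X) a i m) = m"
        using m rhomD(1)[OF a(1) iS] by (simp del: cov_hom_simps)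
    qed
    with XO show ?thesis by blast
  qed
  have "X \<in> mod_Ob B \<and> ext_vanish B X (\<Psi> N)" if "X \<in> star_power (mod_cat B) ?A l" for X l
    using that
  proof (induction l arbitrary: X)
    case 0
    then show ?case using add by simp
  next
    case (Suc l)
    then obtain U V x y \<delta> where *: "U \<in> ?A" "V \<in> star_power (mod_cat B) ?A l"
      and c: "conflation (mod_cat B) U x X y V \<delta>" unfolding star_power.simps star_def by blast
    have ses: "mod_short_exact B U x X y V" using conflation_short_exact[OF c] .
    then have "X \<in> mod_Ob B" unfolding mod_short_exact_def by blast
    moreover have "ext_vanish B X (\<Psi> N)"
      using ext_vanish_middle[OF ses NO] add[OF *(1)] Suc.IH[OF *(2)] by blast
    ultimately show ?case by blast
  qed
  then show ?thesis using X unfolding filt_def add_closure_dsum[OF Xs] by blast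
qed

section \<open>Higher extensions and the Wakamatsu property\<close>

lemma isoc_modE:
  assumes "M.isoc W V"
  obtains a b where "W \<in> mod_Ob B" "V \<in> mod_Ob B" "a \<in> rhom B W V" "b \<in> rhom B V W"
    "\<And>w. w \<in> carrier W \<Longrightarrow> b (a w) = w" "\<And>v. v \<in> carrier V \<Longrightarrow> a (b v) = v"
proof -
  obtain a b where *: "W \<in> Ob (mod_cat B)" "V \<in> Ob (mod_cat B)" "a \<in> M.Mor W V" "b \<in> M.Mor V W"
    "comp (mod_cat B) W V W b a = ident (mod_cat B) W" "comp (mod_cat B) V W V a b = ident (mod_cat B) V"
    using assms by (rule M.isocE)
  have "b (a w) = w" if "w \<in> carrier W" for w using fun_cong[OF *(5), of w] that by simp
  moreover have "a (b v) = v" if "v \<in> carrier V" for v using fun_cong[OF *(6), of v] that by simp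
  ultimately show ?thesis using that *(1-4) by simp
qed

lemma isoc_modI:
  assumes "W \<in> mod_Ob B" "V \<in> mod_Ob B" "a \<in> rhom B W V" "b \<in> rhom B V W"
    "\<And>w. w \<in> carrier W \<Longrightarrow> b (a w) = w" "\<And>v. v \<in> carrier V \<Longrightarrow> a (b v) = v"
  shows "M.isoc W V"
proof (rule M.isocI)
  note rm = mod_ObD(1)[OF assms(1)] mod_ObD(1)[OF assms(2)]
  show "comp (mod_cat B) W V W b a = ident (mod_cat B) W"
    unfolding mod_cat_simps using assms(5)
    by (intro rhom_eqI[OF rhom_compose[OF assms(3,4) rm(1)] rhom_ident[OF rm(1)]]) simp
  show "comp (mod_cat B) V W V a b = ident (mod_cat B) V"
    unfolding mod_cat_simps using assms(6)
    by (intro rhom_eqI[OF rhom_compose[OF assms(4,3) rm(2)] rhom_ident[OF rm(2)]]) simp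
qed (use assms in simp_all)

text \<open>Dimension shifting in the class of modules isomorphic to some \<open>\<Psi> M\<close>.
  Closing under isomorphism is essential: the kernel of the cover is a submodule of
  \<open>\<Psi> S\<close> and only isomorphic to \<open>\<Psi> K\<close>.\<close>

lemma \<Psi>_trivial_Ext:
  assumes M: "M \<in> \<F>" and N: "N \<in> \<F>" and triv: "\<And>M. M \<in> \<F> \<Longrightarrow> trivial_group (Ext \<C> M N)" and i: "i \<ge> 1"
  shows "trivial_group (mod_Ext B i (\<Psi> M) (\<Psi> N))"
proof (rule trivial_mod_Ext_class[where \<W> = "{W. \<exists>M \<in> \<F>. M.isoc W (\<Psi> M)}"])
  show "{W. \<exists>M \<in> \<F>. M.isoc W (\<Psi> M)} \<subseteq> mod_Ob B" unfolding M.isoc_def by auto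
  show NO: "\<Psi> N \<in> mod_Ob B" using \<F>_Ob[OF N] by simp
  show "\<Psi> M \<in> {W. \<exists>M \<in> \<F>. M.isoc W (\<Psi> M)}" 
  proof -
    have "M.isoc (\<Psi> M) (\<Psi> M)" by (rule M.isoc_refl) (use \<F>_Ob[OF M] in simp)
    then show ?thesis using M by blast
  qed
  show "1 \<le> i" by fact
  fix W assume "W \<in> {W. \<exists>M \<in> \<F>. M.isoc W (\<Psi> M)}"
  then obtain M where M: "M \<in> \<F>" "M.isoc W (\<Psi> M)" by blast
  obtain a b where ab: "W \<in> mod_Ob B" "\<Psi> M \<in> mod_Ob B" "a \<in> rhom B W (\<Psi> M)" "b \<in> rhom B (\<Psi> M) W"
    "\<And>w. w \<in> carrier W \<Longrightarrow> b (a w) = w" "\<And>v. v \<in> carrier (\<Psi> M) \<Longrightarrow> a (b v) = v"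
    using isoc_modE[OF M(2)] by blast
  obtain K n S x y \<delta> where K: "K \<in> \<F>" "direct_sum \<C> (replicate n Q) S" and c: "conflation \<C> K x S y M \<delta>"
    using \<F>_cover[OF M(1)] by blast
  note O = conflationD(1-3)[OF c] and rm = \<Psi>_right_module[OF conflationD(1)[OF c]] \<Psi>_right_module[OF conflationD(2)[OF c]]
    \<Psi>_right_module[OF conflationD(3)[OF c]] mod_ObD(1)[OF ab(1)]
  have x: "\<Psi>m K S x \<in> rhom B (\<Psi> K) (\<Psi> S)" "inj_on (\<Psi>m K S x) (carrier (\<Psi> K))"
    and y: "\<Psi>m S M y \<in> rhom B (\<Psi> S) (\<Psi> M)" "\<Psi>m S M y ` carrier (\<Psi> S) = carrier (\<Psi> M)"
    and ex: "\<Psi>m K S x ` carrier (\<Psi> K) = a_kernel (\<Psi> S) (\<Psi> M) (\<Psi>m S M y)"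
    using \<Psi>_exact[OF c K(1) M(1)] unfolding mod_short_exact_def by - (elim conjE, assumption)+
  \<comment> \<open>The cover of \<open>\<Psi> M\<close>, transported to \<open>W\<close>; as
    \<open>b\<close> is injective, the kernel is still the image of \<open>\<Psi> K\<close>.\<close>
  define z where "z = compose (carrier (\<Psi> S)) b (\<Psi>m S M y)"
  have z: "z \<in> rhom B (\<Psi> S) W" unfolding z_def by (rule rhom_compose[OF y(1) ab(4) rm(2)])
  have "b ` carrier (\<Psi> M) = carrier W"
  proof (intro equalityI subsetI)
    fix w assume w: "w \<in> carrier W"
    show "w \<in> b ` carrier (\<Psi> M)" by (rule image_eqI[of _ _ "a w"]) (use ab(5)[OF w] rhomD(1)[OF ab(3) w] in simp_all)
  next
    fix w assume "w \<in> b ` carrier (\<Psi> M)"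
    then show "w \<in> carrier W" using rhomD(1)[OF ab(4)] by blast
  qed
  then have z_surj: "z ` carrier (\<Psi> S) = carrier W" unfolding z_def using y(2) by (rule surj_compose[rotated])
  have b0: "b v = \<zero>\<^bsub>W\<^esub> \<longleftrightarrow> v = \<zero>\<^bsub>\<Psi> M\<^esub>" if v: "v \<in> carrier (\<Psi> M)" for v
  proof
    assume "b v = \<zero>\<^bsub>W\<^esub>"
    then have "a (b v) = \<zero>\<^bsub>\<Psi> M\<^esub>" using rhom_zero[OF ab(3) rm(4,3)] by (simp del: cov_hom_simps)
    then show "v = \<zero>\<^bsub>\<Psi> M\<^esub>" using ab(6)[OF v] by simp
  qed (use rhom_zero[OF ab(4) rm(3,4)] in \<open>simp del: cov_hom_simps\<close>)
  have ker: "a_kernel (\<Psi> S) W z = \<Psi>m K S x ` carrier (\<Psi> K)"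
    unfolding ex a_kernel_def' z_def
    by (intro Collect_cong conj_cong refl) (simp only: compose_eval b0 rhomD(1)[OF y(1)])
  let ?Z = "kerm (\<Psi> S) W z"
  note k = kernel_props(1)[OF z rm(2,4)] kernel_right_module[OF z rm(2,4)]
  have ZO: "?Z \<in> mod_Ob B" by (rule mod_ObI[OF k(2) \<Psi>_sub_fin_gen[OF O(2) k(2,1)]])
  have inc: "restrict (\<lambda>v \<in> carrier (\<Psi> S). v) (a_kernel (\<Psi> S) W z) \<in> rhom B ?Z (\<Psi> S)"
    by (rule rhom_restrict[OF rhom_ident[OF rm(2)] k(2,1)])
  have kS: "q \<in> carrier (\<Psi> S)" if "q \<in> a_kernel (\<Psi> S) W z" for q using that k(1) by blast
  obtain l where l: "l \<in> rhom B ?Z (\<Psi> K)"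
    "\<And>q. q \<in> carrier ?Z \<Longrightarrow> \<Psi>m K S x (l q) = restrict (\<lambda>v \<in> carrier (\<Psi> S). v) (a_kernel (\<Psi> S) W z) q"
  proof (rule rhom_lift_mono[OF x inc _ rm(1) k(2)])
    show "restrict (\<lambda>v \<in> carrier (\<Psi> S). v) (a_kernel (\<Psi> S) W z) ` carrier ?Z \<subseteq> \<Psi>m K S x ` carrier (\<Psi> K)"
      unfolding ker[symmetric] using kS by (auto simp del: cov_hom_simps)
  qed blast
  have l2: "\<Psi>m K S x (l q) = q" if "q \<in> carrier ?Z" for q using l(2)[OF that] that kS by (simp del: cov_hom_simps)
  have xk: "\<Psi>m K S x \<in> rhom B (\<Psi> K) ?Z"
    by (rule rhom_sub_target[OF x(1)]) (unfold ker, rule imageI)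
  have "M.isoc ?Z (\<Psi> K)"
  proof (rule isoc_modI[OF ZO \<Psi>_mod_Ob[OF O(1)] l(1) xk l2])
    fix v assume v: "v \<in> carrier (\<Psi> K)"
    have vz: "\<Psi>m K S x v \<in> carrier ?Z" using rhomD(1)[OF xk v] .
    show "l (\<Psi>m K S x v) = v" by (rule inj_onD[OF x(2) l2[OF vz] rhomD(1)[OF l(1) vz] v])
  qed
  then have ZW: "?Z \<in> {W. \<exists>M \<in> \<F>. M.isoc W (\<Psi> M)}" using K(1) by blast
  have "ext_vanish B W (\<Psi> N)"
    by (rule ext_vanish_retract[OF ab(1,2) NO ab(3,4,5) \<Psi>_ext_vanish[OF M(1) N triv[OF M(1)]]])
  from ext_vanishD[OF this \<Psi>_mod_Ob[OF O(2)] z z_surj]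
  have "extends B (\<Psi> S) (a_kernel (\<Psi> S) W z) (\<Psi> N)" .
  with ZW z z_surj \<Psi>_projective[OF K(2)]
  show "\<exists>Q y. projective B Q \<and> y \<in> rhom B Q W \<and> y ` carrier Q = carrier W \<and>
       kerm Q W y \<in> {W. \<exists>M \<in> \<F>. M.isoc W (\<Psi> M)} \<and> extends B Q (a_kernel Q W y) (\<Psi> N)"
    by (intro exI[of _ "\<Psi> S"] exI[of _ z] conjI)
qed

text \<open>Both records use the same encoding by \<open>Inl\<close>, so this is an equality and a
  coresolution of \<open>Q\<close> starts literally at the regular module.\<close>

lemma regular_module_\<Psi>: "regular_module B = \<Psi> Q"
  by (simp add: regular_module_def cov_hom_def)

text \<open>Conflations \<open>M n -> S n -> M (Suc n)\<close> with \<open>M 0 = Q\<close> and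
  \<open>S n\<close> in the additive closure of \<open>J\<close> are spliced. All \<open>M n\<close>
  stay in \<F>, so the cokernels are images of filtered objects and have no higher extensions into
  \<open>\<Psi> J\<close>.\<close>

lemma \<Psi>_wakamatsu: "wakamatsu_tilting B (\<Psi> J)"
proof -
  \<comment> \<open>Dependent choice of conflations, the first starting at \<open>Q\<close> and each
    further one at the cone of its predecessor.\<close>
  define P where "P n t \<longleftrightarrow> (case t of (M, x, S, y, C) \<Rightarrow> (n = 0 \<longrightarrow> M = Q) \<and> M \<in> \<F> \<and> C \<in> \<F> \<and>
     S \<in> add_closure \<C> J \<and> (\<exists>\<delta>. conflation \<C> M x S y C \<delta>))" for n :: nat and t
  define R where "R n t t' \<longleftrightarrow> (case t of (M, x, S, y, C) \<Rightarrow> fst t' = C)"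
    for n :: nat and t t' :: "'o \<times> 'm \<times> 'o \<times> 'm \<times> 'o"
  have ex: "\<exists>x S y C. C \<in> \<F> \<and> S \<in> add_closure \<C> J \<and> (\<exists>\<delta>. conflation \<C> M x S y C \<delta>)" if M: "M \<in> \<F>" for M
  proof -
    obtain C n S x y \<delta> where "C \<in> \<F>" "direct_sum \<C> (replicate n J) S" "conflation \<C> M x S y C \<delta>"
      using J_cocover[OF M] by blast
    then show ?thesis using replicate_in_add_closure by blast
  qed
  have "\<exists>f. \<forall>n. P n (f n) \<and> R n (f n) (f (Suc n))"
  proof (rule dependent_nat_choice)
    show "\<exists>t. P 0 t" using ex[OF Q_\<F>] Q_\<F> by (auto simp: P_def)
  next
    fix t n assume t: "P n t"
    obtain M x S y C where [simp]: "t = (M, x, S, y, C)" by (cases t)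
    have C: "C \<in> \<F>" using t by (simp add: P_def)
    show "\<exists>t'. P (Suc n) t' \<and> R n t t'" using ex[OF C] C by (auto simp: P_def R_def)
  qed
  then obtain f where f: "\<And>n. P n (f n)" "\<And>n. R n (f n) (f (Suc n))" by blast
  define M x S y where "M n = fst (f n)" and "x n = fst (snd (f n))" and "S n = fst (snd (snd (f n)))"
    and "y n = fst (snd (snd (snd (f n))))" for n
  have C: "snd (snd (snd (snd (f n)))) = M (Suc n)" for n
    using f(2)[of n] unfolding R_def M_def by (simp add: split_beta)
  have p: "M 0 = Q" "M n \<in> \<F>" "S n \<in> add_closure \<C> J" "\<exists>\<delta>. conflation \<C> (M n) (x n) (S n) (y n) (M (Suc n)) \<delta>" for n
    using f(1)[of n] f(1)[of 0] unfolding P_def C[symmetric] unfolding M_def S_def x_def y_def by (simp_all add: split_beta)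
  have MO [simp]: "M n \<in> Ob \<C>" for n using \<F>_Ob[OF p(2)] .
  have SO [simp]: "S n \<in> Ob \<C>" for n using add_closure_Ob[OF p(3)] .
  have ses: "mod_short_exact B (\<Psi> (M n)) (\<Psi>m (M n) (S n) (x n)) (\<Psi> (S n)) (\<Psi>m (S n) (M (Suc n)) (y n)) (\<Psi> (M (Suc n)))" for n
    using p(4)[of n] \<Psi>_exact[OF _ p(2) p(2)] by blast
  have xm [simp]: "x n \<in> Mor (M n) (S n)" and ym [simp]: "y n \<in> Mor (S n) (M (Suc n))" for n
  proof -
    obtain \<delta> where "conflation \<C> (M n) (x n) (S n) (y n) (M (Suc n)) \<delta>" using p(4)[of n] by blast
    from conflationD(5,6)[OF this] show "x n \<in> Mor (M n) (S n)" "y n \<in> Mor (S n) (M (Suc n))" by blast+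
  qed
  have inj: "inj_on (\<Psi>m (M n) (S n) (x n)) (carrier (\<Psi> (M n)))"
    and surj: "\<Psi>m (S n) (M (Suc n)) (y n) ` carrier (\<Psi> (S n)) = carrier (\<Psi> (M (Suc n)))"
    and exact: "\<Psi>m (M n) (S n) (x n) ` carrier (\<Psi> (M n)) = a_kernel (\<Psi> (S n)) (\<Psi> (M (Suc n))) (\<Psi>m (S n) (M (Suc n)) (y n))" for n
    using ses[of n] unfolding mod_short_exact_def by - (elim conjE, assumption)+
  \<comment> \<open>Index shift: position \<open>0\<close> is the image of \<open>Q\<close> and
    position \<open>Suc n\<close> that of \<open>S n\<close>. Beyond the first map, \<open>g\<close>
    passes through the image of the cosyzygy \<open>M (Suc n)\<close>.\<close>
  define E where "E n = (case n of 0 \<Rightarrow> \<Psi> Q | Suc i \<Rightarrow> \<Psi> (S i))" for n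
  define g where "g n = (case n of 0 \<Rightarrow> \<Psi>m Q (S 0) (x 0)
     | Suc i \<Rightarrow> compose (carrier (\<Psi> (S i))) (\<Psi>m (M (Suc i)) (S (Suc i)) (x (Suc i))) (\<Psi>m (S i) (M (Suc i)) (y i)))" for n
  have E [simp]: "E 0 = \<Psi> Q" "E (Suc n) = \<Psi> (S n)" for n by (simp_all add: E_def)
  have g0: "g 0 = \<Psi>m (M 0) (S 0) (x 0)" by (simp add: g_def p(1))
  have gS: "g (Suc n) = compose (carrier (\<Psi> (S n))) (\<Psi>m (M (Suc n)) (S (Suc n)) (x (Suc n))) (\<Psi>m (S n) (M (Suc n)) (y n))" for n
    by (simp add: g_def)
  have gh: "g n \<in> rhom B (E n) (E (Suc n))" for n
  proof (cases n)
    case 0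
    have "\<Psi>m (M 0) (S 0) (x 0) \<in> rhom B (\<Psi> (M 0)) (\<Psi> (S 0))" by simp
    then show ?thesis unfolding 0 g0 E p(1) .
  next
    case (Suc m)
    show ?thesis unfolding Suc gS E by (rule rhom_compose[OF \<Psi>m_rhom \<Psi>m_rhom \<Psi>_right_module]) simp_all
  qed
  have img: "g n ` carrier (E n) = \<Psi>m (M n) (S n) (x n) ` carrier (\<Psi> (M n))" for n
  proof (cases n)
    case 0
    then show ?thesis by (simp only: g0 E p(1))
  next
    case (Suc m)
    have "g (Suc m) ` carrier (E (Suc m)) = \<Psi>m (M (Suc m)) (S (Suc m)) (x (Suc m)) ` (\<Psi>m (S m) (M (Suc m)) (y m) ` carrier (\<Psi> (S m)))"
      unfolding gS E image_image by (rule image_cong) (simp_all del: cov_hom_simps)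
    then show ?thesis unfolding Suc surj .
  qed
  \<comment> \<open>The image of the next inflation is injective, so a spliced map has the kernel of
    its first factor.\<close>
  have ker: "a_kernel (E (Suc n)) (E (Suc (Suc n))) (g (Suc n)) = a_kernel (\<Psi> (S n)) (\<Psi> (M (Suc n))) (\<Psi>m (S n) (M (Suc n)) (y n))" for n
  proof -
    have 1: "\<Psi>m (M (Suc n)) (S (Suc n)) (x (Suc n)) v = \<zero>\<^bsub>\<Psi> (S (Suc n))\<^esub> \<longleftrightarrow> v = \<zero>\<^bsub>\<Psi> (M (Suc n))\<^esub>" if v: "v \<in> carrier (\<Psi> (M (Suc n)))" for v
    proof -
      have z: "\<Psi>m (M (Suc n)) (S (Suc n)) (x (Suc n)) \<zero>\<^bsub>\<Psi> (M (Suc n))\<^esub> = \<zero>\<^bsub>\<Psi> (S (Suc n))\<^esub>"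
        by (rule rhom_zero[OF \<Psi>m_rhom \<Psi>_right_module \<Psi>_right_module]) simp_all
      have z1: "\<zero>\<^bsub>\<Psi> (M (Suc n))\<^esub> \<in> carrier (\<Psi> (M (Suc n)))" by simp
      show ?thesis using inj_onD[OF inj _ v z1] z by (metis (full_types))
    qed
    have 2: "\<Psi>m (S n) (M (Suc n)) (y n) v \<in> carrier (\<Psi> (M (Suc n)))" if v: "v \<in> carrier (\<Psi> (S n))" for v
      by (rule rhomD(1)[OF \<Psi>m_rhom v]) simp_all
    show ?thesis unfolding a_kernel_def' gS E
      by (intro Collect_cong conj_cong refl) (simp only: compose_eval 1 2)
  qed
  show ?thesis unfolding wakamatsu_tilting_def
  proof (intro conjI exI[of _ E] exI[of _ g] allI impI)
    show "\<Psi> J \<in> mod_Ob B" using \<F>_Ob[OF J_in] by simp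
    show "trivial_group (mod_Ext B i (\<Psi> J) (\<Psi> J))" if "1 \<le> i" for i
      by (rule \<Psi>_trivial_Ext[OF J_in J_in J_Ext that])
    show "E 0 = regular_module B" unfolding regular_module_\<Psi> by simp
    show "E (Suc i) \<in> add_closure (mod_cat B) (\<Psi> J)" for i unfolding E by (rule \<Psi>_add_closure[OF p(3)])
    show "g i \<in> rhom B (E i) (E (Suc i))" for i by (rule gh)
    show "inj_on (g 0) (carrier (E 0))" using inj[of 0] unfolding g0 p(1) E .
    show "g i ` carrier (E i) = a_kernel (E (Suc i)) (E (Suc (Suc i))) (g (Suc i))" for i
      unfolding img ker exact ..
    show "\<exists>L\<in>mod_Ob B. \<exists>q\<in>rhom B (E (Suc i)) L. q ` carrier (E (Suc i)) = carrier L \<and>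
        a_kernel (E (Suc i)) L q = g i ` carrier (E i) \<and> (\<forall>j\<ge>1. trivial_group (mod_Ext B j L (\<Psi> J)))" for i
    proof (intro bexI[of _ "\<Psi> (M (Suc i))"] bexI[of _ "\<Psi>m (S i) (M (Suc i)) (y i)"] conjI allI impI)
      show "\<Psi>m (S i) (M (Suc i)) (y i) ` carrier (E (Suc i)) = carrier (\<Psi> (M (Suc i)))" unfolding E surj ..
      show "a_kernel (E (Suc i)) (\<Psi> (M (Suc i))) (\<Psi>m (S i) (M (Suc i)) (y i)) = g i ` carrier (E i)"
        unfolding img exact E ..
      show "trivial_group (mod_Ext B j (\<Psi> (M (Suc i))) (\<Psi> J))" if "1 \<le> j" for j
        by (rule \<Psi>_trivial_Ext[OF p(2) J_in J_Ext that])
    qed (simp_all del: cov_hom_simps)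
  qed
qed

lemma \<Psi>_mixed_base:
  assumes mb: "mixed_base \<C> \<Theta>" and \<Theta>: "set \<Theta> \<subseteq> \<F>"
  shows "mixed_base (mod_cat B) (map \<Psi> \<Theta>)"
  unfolding mixed_base_def
proof (intro conjI ballI allI impI)
  fix Y assume "Y \<in> set (map \<Psi> \<Theta>)"
  then obtain X where X: "X \<in> set \<Theta>" "Y = \<Psi> X" by auto
  then show "brick (mod_cat B) Y \<or> stone (mod_cat B) Y"
    using mb \<Theta> \<Psi>_brick \<Psi>_stone unfolding mixed_base_def by blast
next
  fix i j assume i: "i < length (map \<Psi> \<Theta>)" and j: "j < i"
  have "\<Theta> ! i \<in> \<F>" "\<Theta> ! j \<in> \<F>" using i j \<Theta> nth_mem[of i \<Theta>] nth_mem[of j \<Theta>] by auto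
  moreover have "trivial_group (Hom \<C> (\<Theta> ! i) (\<Theta> ! j))" using mb i j unfolding mixed_base_def by simp
  ultimately have "trivial_group (Hom (mod_cat B) (\<Psi> (\<Theta> ! i)) (\<Psi> (\<Theta> ! j)))" by (rule \<Psi>_trivial_Hom)
  then show "trivial_group (Hom (mod_cat B) (map \<Psi> \<Theta> ! i) (map \<Psi> \<Theta> ! j))"
    using i j by simp
\<comment> \<open>What remains is the condition on \<open>Neg\<close>, whose groups over
  \<open>mod_cat\<close> have a single element.\<close>
qed (auto simp: trivial_group_def mod_cat_def)

text \<open>The inverse of \<open>f \<mapsto> \<Psi> f\<close> identifies \<open>\<Psi>' (\<Psi> X)\<close> with \<open>\<Phi> X\<close>.\<close>

lemma \<Psi>_duality:
  assumes X: "X \<in> \<F>"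
  shows "rmod_iso (opp (EndAlg \<C> J)) (restrict_scalars (\<Psi>m J J) (contra_hom (mod_cat B) (\<Psi> J) (\<Psi> X))) (contra_hom \<C> J X)"
    (is "rmod_iso ?A ?M ?N")
proof -
  have XO [simp]: "X \<in> Ob \<C>" and JO [simp]: "J \<in> Ob \<C>" using X J_in \<F>_Ob by blast+
  interpret H: abelian_group "Hom \<C> X J" using Hom_group by simp
  have A: "ring ?A" using ring_opp[OF ring_EndAlg[OF JO]] .
  have N: "right_module ?A ?N"
  proof -
    have "abelian_group ?N"
      by (rule abelian_groupI) (auto simp: contra_hom_def H.a_assoc intro: H.a_comm H.l_neg)
    with A show ?thesis unfolding right_module_def by (auto simp: contra_hom_def cmp_assoc)
  qed
  define h where "h u = (Inl (\<Psi>m X J (projl u)) :: ('k, ('k, 'm) rmap) elt)" for u :: "('k, 'm) elt"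
  have "bij_betw h (carrier ?N) (carrier ?M)"
    unfolding bij_betw_def
  proof
    show "inj_on h (carrier ?N)"
      by (rule inj_onI) (auto simp: h_def contra_hom_def dest: \<Psi>_faithful[OF X J_in])
    show "h ` carrier ?N = carrier ?M"
    proof (intro equalityI subsetI)
      fix v assume "v \<in> carrier ?M"
      then obtain \<phi> where \<phi>: "\<phi> \<in> rhom B (\<Psi> X) (\<Psi> J)" "v = Inl \<phi>"
        by (auto simp: restrict_scalars_def contra_hom_def simp del: cov_hom_simps)
      obtain f where "f \<in> Mor X J" "\<Psi>m X J f = \<phi>" using \<Psi>_full[OF X J_in \<phi>(1)] .
      then show "v \<in> h ` carrier ?N" using \<phi>(2) by (auto simp: h_def contra_hom_def image_iff)
    qed (auto simp: h_def contra_hom_def restrict_scalars_def simp del: cov_hom_simps)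
  qed
  moreover have "h (u \<oplus>\<^bsub>?N\<^esub> v) = h u \<oplus>\<^bsub>?M\<^esub> h v" if "u \<in> carrier ?N" "v \<in> carrier ?N" for u v
    using that by (auto simp: h_def contra_hom_def restrict_scalars_def \<Psi>m_add simp del: cov_hom_simps mod_Hom_simps(3))
  moreover have "h (a \<odot>\<^bsub>?N\<^esub> u) = a \<odot>\<^bsub>?M\<^esub> h u" if "a \<in> carrier ?A" "u \<in> carrier ?N" for a u
    using that by (auto simp: h_def contra_hom_def restrict_scalars_def \<Psi>m_comp simp del: cov_hom_simps)
  moreover have "h \<zero>\<^bsub>?N\<^esub> = \<zero>\<^bsub>?M\<^esub>"
    by (simp add: h_def contra_hom_def restrict_scalars_def \<Psi>m_zero del: cov_hom_simps)
  ultimately show ?thesis using rmod_iso_of_inverse[OF N] by blast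
qed

end

section \<open>The opposite category\<close>

text \<open>Restricted to records without further fields, so that applying the construction twice
  gives back the same record.\<close>

definition op_cat :: "('k, 'o, 'm, 'e, 'n) ext_cat \<Rightarrow> ('k, 'o, 'm, 'e, 'n) ext_cat" where
  "op_cat \<C> = \<lparr>Ob = Ob \<C>, Hom = (\<lambda>X Y. Hom \<C> Y X), ident = ident \<C>,
     comp = (\<lambda>X Y Z g f. comp \<C> Z Y X f g), Ext = (\<lambda>C A. Ext \<C> A C),
     ext_push = (\<lambda>C A A' a. ext_pull \<C> A A' C a), ext_pull = (\<lambda>C C' A c. ext_push \<C> A C C' c),
     realization = (\<lambda>C A \<delta>. {(x, B, y). (y, B, x) \<in> realization \<C> A C \<delta>}),
     Neg = (\<lambda>C A. Neg \<C> A C), neg_push = (\<lambda>C A A' a. neg_pull \<C> A A' C a),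
     neg_pull = (\<lambda>C C' A c. neg_push \<C> A C C' c),
     neg_conn_contra = (\<lambda>C A \<delta> W. neg_conn_cov \<C> A C \<delta> W),
     neg_conn_cov = (\<lambda>C A \<delta> W. neg_conn_contra \<C> A C \<delta> W)\<rparr>"

lemma op_cat_simps [simp]:
  "Ob (op_cat \<C>) = Ob \<C>" "Hom (op_cat \<C>) X Y = Hom \<C> Y X" "ident (op_cat \<C>) = ident \<C>"
  "comp (op_cat \<C>) X Y Z g f = comp \<C> Z Y X f g" "Ext (op_cat \<C>) C A = Ext \<C> A C"
  "ext_push (op_cat \<C>) C A A' a = ext_pull \<C> A A' C a" "ext_pull (op_cat \<C>) C C' A c = ext_push \<C> A C C' c"
  "(x, Y, y) \<in> realization (op_cat \<C>) C A \<delta> \<longleftrightarrow> (y, Y, x) \<in> realization \<C> A C \<delta>"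
  "Neg (op_cat \<C>) C A = Neg \<C> A C" "neg_push (op_cat \<C>) C A A' a = neg_pull \<C> A A' C a"
  "neg_pull (op_cat \<C>) C C' A c = neg_push \<C> A C C' c"
  "neg_conn_contra (op_cat \<C>) C A \<delta> W = neg_conn_cov \<C> A C \<delta> W"
  "neg_conn_cov (op_cat \<C>) C A \<delta> W = neg_conn_contra \<C> A C \<delta> W"
  by (simp_all add: op_cat_def)

lemma op_op_cat [simp]: "op_cat (op_cat \<C>) = \<C>"
  by (simp add: op_cat_def)

lemma op_biproduct: "biproduct (op_cat \<C>) Xs S i p \<longleftrightarrow> biproduct \<C> Xs S p i"
  unfolding biproduct_def by (auto simp: eq_commute)

lemma op_direct_sum [simp]: "direct_sum (op_cat \<C>) = direct_sum \<C>"
  unfolding direct_sum_def by (intro ext) (metis op_biproduct)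

lemma op_dsum [simp]: "dsum (op_cat \<C>) = dsum \<C>"
  unfolding dsum_def by simp

lemma op_zero_object [simp]: "zero_object (op_cat \<C>) = zero_object \<C>"
  unfolding zero_object_def by (intro ext) auto

lemma op_indecomposable [simp]: "indecomposable (op_cat \<C>) = indecomposable \<C>"
  unfolding indecomposable_def by simp

lemma op_add_closure [simp]: "add_closure (op_cat \<C>) = add_closure \<C>"
  unfolding add_closure_def by simp

lemma op_EndAlg: "EndAlg (op_cat \<C>) X = opp (EndAlg \<C> X)"
  by (rule module.equality) (simp_all add: EndAlg_def opp_def op_cat_def)

lemma opp_opp [simp]: "opp (opp A) = A"
  by (simp add: opp_def)

lemma Units_opp [simp]: "Units (opp A) = Units A"
  unfolding Units_def by auto

lemma local_ring_opp: "local_ring A \<Longrightarrow> local_ring (opp A)"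
  unfolding local_ring_def using ring_opp[of A] by simp

lemma skew_field_opp: "skew_field A \<Longrightarrow> skew_field (opp A)"
  unfolding skew_field_def using ring_opp[of A] by simp

lemma op_conflation [simp]: "conflation (op_cat \<C>) A x Y y C \<delta> \<longleftrightarrow> conflation \<C> C y Y x A \<delta>"
  unfolding conflation_def by auto

lemma op_ext_morphism [simp]:
  "ext_morphism (op_cat \<C>) C A \<delta> C' A' \<delta>' a c \<longleftrightarrow> ext_morphism \<C> A' C' \<delta>' A C \<delta> c a"
  unfolding ext_morphism_def by auto

lemma op_linear_category:
  fixes \<C> :: "('k, 'o, 'm, 'e, 'n) ext_cat"
  assumes "linear_category k \<C>"
  shows "linear_category k (op_cat \<C>)"
proof -
  interpret linear_category k \<C> by fact
  show ?thesis
    by (rule linear_category.intro) (simp_all add: field Hom_module comp_smult_left comp_smult_right cmp_assoc)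
qed

lemma op_Krull_Schmidt:
  fixes \<C> :: "('k, 'o, 'm, 'e, 'n) ext_cat"
  assumes "Hom_finite_Krull_Schmidt_category k \<C>"
  shows "Hom_finite_Krull_Schmidt_category k (op_cat \<C>)"
proof -
  interpret Hom_finite_Krull_Schmidt_category k \<C> by fact
  interpret op: linear_category k "op_cat \<C>" by (rule op_linear_category[OF linear_category_axioms])
  show ?thesis
  proof unfold_locales
    show "\<exists>S. direct_sum (op_cat \<C>) Xs S" if "set Xs \<subseteq> Ob (op_cat \<C>)" for Xs
      using direct_sum_exists that by simp
    show "fin_gen k (Hom (op_cat \<C>) X Y)" if "X \<in> Ob (op_cat \<C>)" "Y \<in> Ob (op_cat \<C>)" for X Y
      using Hom_finite that by simp
    show "\<exists>Xs. direct_sum (op_cat \<C>) Xs X \<and> (\<forall>Y\<in>set Xs. local_ring (EndAlg (op_cat \<C>) Y))" if X: "X \<in> Ob (op_cat \<C>)" for X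
    proof -
      obtain Xs where "direct_sum \<C> Xs X" "\<forall>Y\<in>set Xs. local_ring (EndAlg \<C> Y)" using Krull_Schmidt[of X] X by auto
      then show ?thesis unfolding op_EndAlg by (intro exI[of _ Xs]) (simp add: local_ring_opp)
    qed
  qed
qed

lemma op_bifunctor:
  fixes \<C> :: "('k, 'o, 'm, 'e, 'n) ext_cat"
  assumes "additive_bifunctor \<C> F push pull"
  shows "additive_bifunctor (op_cat \<C>) (\<lambda>C A. F A C) (\<lambda>C A A' a. pull A A' C a) (\<lambda>C C' A c. push A C C' c)"
proof -
  interpret additive_bifunctor \<C> F push pull by fact
  show ?thesis
  proof (rule additive_bifunctor.intro, goal_cases)
    case (2 C A A' a)
    then show ?case unfolding op_cat_simps by (intro pull_hom)
  next
    case (3 C C' A c)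
    then show ?case unfolding op_cat_simps by (intro push_hom)
  qed (simp_all add: group push_ident pull_ident push_comp pull_comp push_pull push_add pull_add)
qed

text \<open>Passing to the opposite category reverses the comparison isomorphism; symmetry of the
  relation turns it back.\<close>

lemma seq_equiv_op:
  assumes "preadditive \<C>" "A \<in> Ob \<C>" "C \<in> Ob \<C>"
  shows "((x, Y, y), (x', Y', y')) \<in> seq_equiv (op_cat \<C>) A C \<longleftrightarrow> ((y, Y, x), (y', Y', x')) \<in> seq_equiv \<C> C A"
proof -
  interpret preadditive \<C> by fact
  have iso: "cat_iso (op_cat \<C>) Y Y' b \<longleftrightarrow> cat_iso \<C> Y' Y b" for b
    unfolding cat_iso_def by auto
  have "((x, Y, y), (x', Y', y')) \<in> seq_equiv (op_cat \<C>) A C \<longleftrightarrow> ((y', Y', x'), (y, Y, x)) \<in> seq_equiv \<C> C A"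
    unfolding seq_equiv_def iso sequences_def by (auto simp: iso)
  also have "\<dots> \<longleftrightarrow> ((y, Y, x), (y', Y', x')) \<in> seq_equiv \<C> C A"
    using sym_seq_equiv[OF assms(3,2)] by (meson symD)
  finally show ?thesis .
qed

text \<open>(ET3) and (ET4) are exchanged with their duals. The axioms on classes, split sequences
  and sums are self-dual up to the direction or order of the data.\<close>

lemma op_extriangulated:
  fixes \<C> :: "('k, 'o, 'm, 'e, 'n) ext_cat"
  assumes "extriangulated_category k \<C>"
  shows "extriangulated_category k (op_cat \<C>)"
proof -
  interpret extriangulated_category k \<C> by fact
  have add: "additive_linear_category k (op_cat \<C>)"
    using direct_sum_exists
    by (intro additive_linear_category.intro additive_linear_category_axioms.intro op_linear_category linear_category_axioms) simp
  have ET1': "additive_bifunctor (op_cat \<C>) (Ext (op_cat \<C>)) (ext_push (op_cat \<C>)) (ext_pull (op_cat \<C>))"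
    using op_bifunctor[OF ET1] by (simp add: op_cat_def)
  show ?thesis
  proof (rule extriangulated_category.intro[OF add extriangulated_category_axioms.intro[OF ET1']], goal_cases)
    case (1 C A \<delta>)
    then have O: "C \<in> Ob \<C>" "A \<in> Ob \<C>" "\<delta> \<in> carrier (Ext \<C> A C)" by simp_all
    obtain s where s: "s \<in> sequences \<C> C A" "realization \<C> A C \<delta> = seq_equiv \<C> C A `` {s}"
      using realization_class[OF O(2,1,3)] by (rule quotientE)
    obtain x Y y where xy: "s = (x, Y, y)" by (cases s)
    have "realization (op_cat \<C>) C A \<delta> = seq_equiv (op_cat \<C>) A C `` {(y, Y, x)}"
    proof (rule Set.set_eqI)
      fix t :: "'m \<times> 'o \<times> 'm" obtain x' Y' y' where t: "t = (x', Y', y')" by (cases t)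
      show "t \<in> realization (op_cat \<C>) C A \<delta> \<longleftrightarrow> t \<in> seq_equiv (op_cat \<C>) A C `` {(y, Y, x)}"
        unfolding t using s(2) xy seq_equiv_op[OF preadditive_axioms O(2,1)] by simp
    qed
    moreover have "(y, Y, x) \<in> sequences (op_cat \<C>) A C" using s(1) unfolding xy sequences_def by simp
    ultimately show ?case by (auto intro: quotientI)
  next
    case (2 A x Y y C \<delta> A' x' Y' y' C' \<delta>' a c)
    then have c: "conflation \<C> C' y' Y' x' A' \<delta>'" "conflation \<C> C y Y x A \<delta>" "ext_morphism \<C> A' C' \<delta>' A C \<delta> c a"
      by simp_all
    obtain b where b: "b \<in> Mor Y' Y" "comp \<C> C' Y' Y b y' = comp \<C> C' C Y y c" "comp \<C> Y' Y A x b = comp \<C> Y' A' A a x'"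
      using realization_morphism[OF c] by (elim bexE conjE)
    show ?case by (rule bexI[of _ b]) (simp_all add: b)
  next
    case (3 A C S i p)
    then have "biproduct \<C> [A, C] S p i" by (simp only: op_biproduct)
    then have "bip A C S (p 0) (p 1) (i 0) (i 1)" unfolding biproduct_pair .
    \<comment> \<open>Injections and projections have changed roles, which leaves the two summands
      in the wrong order; \<open>bip_swap\<close> corrects it.\<close>
    from bip_conflation[OF bip_swap[OF this]] show ?case by (simp add: conflation_def)
  next
    case (4 A x Y y C \<delta> A' x' Y' y' C' \<delta>' SA iA pA SB iB pB SC iC pC)
    then have c: "conflation \<C> C y Y x A \<delta>" "conflation \<C> C' y' Y' x' A' \<delta>'"
      and b: "biproduct \<C> [C, C'] SC pC iC" "biproduct \<C> [Y, Y'] SB pB iB" "biproduct \<C> [A, A'] SA pA iA"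
      by (simp_all add: op_biproduct)
    note [simp] = conflationD[OF c(1)] conflationD[OF c(2)] bipD(1-7)[OF b(1)[unfolded biproduct_pair]]
      bipD(1-7)[OF b(2)[unfolded biproduct_pair]] bipD(1-7)[OF b(3)[unfolded biproduct_pair]]
    \<comment> \<open>Reversal also interchanges pushing and pulling in the sum of the classes;
      naturality in the form \<open>push_pull\<close> restores the order.\<close>
    show ?case using realization_sum[OF c b] by (simp add: cmp_assoc E.push_pull del: One_nat_def)
  next
    case (5 A x Y y C \<delta> A' x' Y' y' C' \<delta>' a b)
    then have c: "conflation \<C> C' y' Y' x' A' \<delta>'" "conflation \<C> C y Y x A \<delta>" "b \<in> Mor Y' Y" "a \<in> Mor A' A"
      "comp \<C> Y' A' A a x' = comp \<C> Y' Y A x b" by simp_all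
    obtain d where "ext_morphism \<C> A' C' \<delta>' A C \<delta> d a" "comp \<C> C' Y' Y b y' = comp \<C> C' C Y y d"
      using ET3_op[OF c] by (elim exE conjE)
    then show ?case by (intro exI[of _ d]) simp
  next
    case (6 A x Y y C \<delta> A' x' Y' y' C' \<delta>' b c)
    then have c: "conflation \<C> C' y' Y' x' A' \<delta>'" "conflation \<C> C y Y x A \<delta>" "c \<in> Mor C' C" "b \<in> Mor Y' Y"
      "comp \<C> C' Y' Y b y' = comp \<C> C' C Y y c" by simp_all
    obtain d where "ext_morphism \<C> A' C' \<delta>' A C \<delta> c d" "comp \<C> Y' A' A d x' = comp \<C> Y' Y A x b"
      using ET3[OF c] by (elim exE conjE)
    then show ?case by (intro exI[of _ d]) simp
  next
    case (7 A f Y f' D \<delta> g C g' F \<delta>')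
    then have c: "conflation \<C> F g' C g Y \<delta>'" "conflation \<C> D f' Y f A \<delta>" by simp_all
    obtain E h h' d e \<delta>'' where *: "conflation \<C> E h' C h A \<delta>''" "d \<in> Mor F E" "e \<in> Mor E D"
      "comp \<C> C Y A f g = h" "comp \<C> F E C h' d = g'" "comp \<C> E C Y g h' = comp \<C> E D Y f' e"
      "conflation \<C> F d E e D (ext_pull \<C> Y D F f' \<delta>')" "ext_push \<C> A E D e \<delta>'' = \<delta>"
      "ext_push \<C> Y F E d \<delta>' = ext_pull \<C> A Y E f \<delta>''"
      using ET4_op[OF c] by (elim exE conjE)
    show ?case
      by (rule exI[of _ E], rule exI[of _ h], rule exI[of _ h'], rule exI[of _ e], rule exI[of _ d], rule exI[of _ \<delta>''])
        (simp add: *)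
  next
    case (8 D f' A f Y \<delta> F g' g C \<delta>')
    then have c: "conflation \<C> C g Y g' F \<delta>'" "conflation \<C> Y f A f' D \<delta>" by simp_all
    obtain E h h' d e \<delta>'' where *: "conflation \<C> C h A h' E \<delta>''" "d \<in> Mor F E" "e \<in> Mor E D"
      "comp \<C> C Y A f g = h" "comp \<C> Y A E h' f = comp \<C> Y F E d g'" "comp \<C> A E D e h' = f'"
      "conflation \<C> F d E e D (ext_push \<C> D Y F g' \<delta>)" "ext_pull \<C> E F C d \<delta>'' = \<delta>'"
      "ext_push \<C> E C Y g \<delta>'' = ext_pull \<C> D E Y e \<delta>"
      using ET4[OF c] by (elim exE conjE)
    show ?case
      by (rule exI[of _ E], rule exI[of _ h], rule exI[of _ h'], rule exI[of _ e], rule exI[of _ d], rule exI[of _ \<delta>''])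
        (simp add: *)
  qed
qed

lemma op_extriangulated_neg:
  fixes \<C> :: "('k, 'o, 'm, 'e, 'n) ext_cat"
  assumes "extriangulated_category_neg k \<C>"
  shows "extriangulated_category_neg k (op_cat \<C>)"
proof -
  interpret extriangulated_category_neg k \<C> by fact
  have bif: "additive_bifunctor (op_cat \<C>) (Neg (op_cat \<C>)) (neg_push (op_cat \<C>)) (neg_pull (op_cat \<C>))"
    using op_bifunctor[OF neg_bifunctor] by (simp add: op_cat_def)
  show ?thesis
  proof (rule extriangulated_category_neg.intro[OF op_extriangulated[OF extriangulated_category_axioms]
      extriangulated_category_neg_axioms.intro[OF bif]], goal_cases)
    case (1 A C W \<delta>)
    then show ?case unfolding op_cat_simps by (intro neg_conn_cov_hom)
  next
    case (2 A C W W' \<delta> w u)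
    then show ?case using neg_conn_cov_natural[of C A W W' \<delta> w u] by simp
  next
    case (3 A C W \<delta>)
    then show ?case unfolding op_cat_simps by (intro neg_conn_contra_hom)
  next
    case (4 A C W W' \<delta> w u)
    then show ?case using neg_conn_contra_natural[of C A W W' \<delta> w u] by simp
  next
    case (5 A x Y y C \<delta> W)
    then have c: "conflation \<C> C y Y x A \<delta>" and W: "W \<in> Ob \<C>" by simp_all
    show ?case using exact_contra[OF c W] by (simp add: op_cat_def)
  next
    case (6 A x Y y C \<delta> W)
    then have c: "conflation \<C> C y Y x A \<delta>" and W: "W \<in> Ob \<C>" by simp_all
    show ?case using exact_cov[OF c W] by (simp add: op_cat_def)
  qed
qed

text \<open>One inclusion is proved for all categories; the other is the same inclusion for the
  opposite category.\<close>

lemma star_op: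
  fixes \<C> :: "('k, 'o, 'm, 'e, 'n) ext_cat"
  shows "star (op_cat \<C>) \<X> \<Y> = star \<C> \<Y> \<X>"
proof -
  have "star (op_cat \<D>) \<U> \<V> \<subseteq> star \<D> \<V> \<U>" for \<D> :: "('k, 'o, 'm, 'e, 'n) ext_cat" and \<U> \<V>
  proof
    fix M assume "M \<in> star (op_cat \<D>) \<U> \<V>"
    then obtain X Y x y \<delta> where *: "X \<in> \<U>" "Y \<in> \<V>" "conflation (op_cat \<D>) X x M y Y \<delta>"
      unfolding star_def by blast
    have "conflation \<D> Y y M x X \<delta>" using *(3) by simp
    with *(1,2) show "M \<in> star \<D> \<V> \<U>" unfolding star_def by blast
  qed
  from this[of \<C> \<X> \<Y>] this[of "op_cat \<C>" \<Y> \<X>] show ?thesis by simp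
qed

lemma (in extriangulated_category) star_power_Suc_right: "star_power \<C> \<X> (Suc l) = star \<C> (star_power \<C> \<X> l) \<X>"
  using star_star_power[of \<X> l 0] by simp

section \<open>Mixed bistratifying systems\<close>

locale ks_extriangulated = Hom_finite_Krull_Schmidt_category k \<C> + extriangulated_category_neg k \<C>
  for k :: "'k ring" and \<C> :: "('k, 'o, 'm, 'e, 'n) ext_cat"
begin

lemma op_ks_extriangulated: "ks_extriangulated k (op_cat \<C>)"
  by (intro ks_extriangulated.intro op_Krull_Schmidt op_extriangulated_neg
    Hom_finite_Krull_Schmidt_category_axioms extriangulated_category_neg_axioms)

text \<open>In the opposite category factors are added on the right instead of on the left, which by
  associativity makes no difference.\<close>

lemma filt_op: "filt (op_cat \<C>) M = filt \<C> M"
proof -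
  have "star_power (op_cat \<C>) \<X> l = star_power \<C> \<X> l" for \<X> l
  proof (induction l)
    case (Suc l)
    then show ?case using star_power_Suc_right[of \<X> l] by (simp add: star_op)
  qed simp
  then show ?thesis unfolding filt_def by simp
qed

section \<open>Passage to the opposite system\<close>

lemma filt_direct_sum_cong:
  assumes "direct_sum \<C> Xs S" "direct_sum \<C> Ys T" "mset Xs = mset Ys"
  shows "filt \<C> S = filt \<C> T"
  using add_closure_isoc[OF direct_sum_unique[OF direct_sum_perm[OF assms(1,3)] assms(2)]] unfolding filt_def by simp

text \<open>\<open>dsum\<close> may choose different objects for a list and for its reversal; they
  are isomorphic and have the same filtered objects.\<close>

lemma filt_dsum_rev:
  assumes "set Xs \<subseteq> Ob \<C>"
  shows "filt (op_cat \<C>) (dsum (op_cat \<C>) (rev Xs)) = filt \<C> (dsum \<C> Xs)"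
  unfolding filt_op op_dsum
  by (rule filt_direct_sum_cong[OF dsum_direct_sum dsum_direct_sum]) (use assms in auto)

text \<open>Carries vanishing of \<open>Neg\<close> from the direct sum chosen for \<Theta> to the
  one chosen for its reversal.\<close>

lemma trivial_Neg_isoc:
  assumes "isoc S T" "trivial_group (Neg \<C> S S)"
  shows "trivial_group (Neg \<C> T T)"
proof -
  obtain f g where *: "S \<in> Ob \<C>" "T \<in> Ob \<C>" "f \<in> Mor S T" "g \<in> Mor T S"
    "comp \<C> S T S g f = ident \<C> S" "comp \<C> T S T f g = ident \<C> T" using assms(1) by (rule isocE)
  have "trivial_group (Neg \<C> T S)"
    using N.trivial_F_retract_left[OF assms(2) *(1,2,1,4,3,6)] .
  then show ?thesis using N.trivial_F_retract_right[OF _ *(1,2,2,4,3,6)] by blast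
qed

lemma mixed_base_Ob: "mixed_base \<C> \<Theta> \<Longrightarrow> set \<Theta> \<subseteq> Ob \<C>"
  unfolding mixed_base_def brick_def stone_def indecomposable_def by blast

lemma mixed_base_op:
  assumes mb: "mixed_base \<C> \<Theta>"
  shows "mixed_base (op_cat \<C>) (rev \<Theta>)"
  unfolding mixed_base_def
proof (intro conjI ballI allI impI)
  fix X assume "X \<in> set (rev \<Theta>)"
  then have "brick \<C> X \<or> stone \<C> X" using mb unfolding mixed_base_def by simp
  then show "brick (op_cat \<C>) X \<or> stone (op_cat \<C>) X"
    unfolding brick_def stone_def op_EndAlg using skew_field_opp by auto
next
  fix i j assume "i < length (rev \<Theta>)" "j < i"
  then have "length \<Theta> - Suc j < length \<Theta>" "length \<Theta> - Suc i < length \<Theta> - Suc j" "j < length \<Theta>" "i < length \<Theta>" by auto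
  then show "trivial_group (Hom (op_cat \<C>) (rev \<Theta> ! i) (rev \<Theta> ! j))"
    using mb unfolding mixed_base_def by (simp add: rev_nth)
next
  have "direct_sum \<C> (rev \<Theta>) (dsum \<C> \<Theta>)"
    by (rule direct_sum_perm[OF dsum_direct_sum[OF mixed_base_Ob[OF mb]]]) simp
  moreover have "direct_sum \<C> (rev \<Theta>) (dsum \<C> (rev \<Theta>))"
    by (rule dsum_direct_sum) (use mixed_base_Ob[OF mb] in simp)
  ultimately have "isoc (dsum \<C> \<Theta>) (dsum \<C> (rev \<Theta>))" by (rule direct_sum_unique)
  then show "trivial_group (Neg (op_cat \<C>) (dsum (op_cat \<C>) (rev \<Theta>)) (dsum (op_cat \<C>) (rev \<Theta>)))"
    using trivial_Neg_isoc mb unfolding mixed_base_def by simp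
qed

lemma mixed_stratifying_op:
  assumes ms: "mixed_costratifying \<C> \<Theta> I"
  shows "mixed_stratifying (op_cat \<C>) (rev \<Theta>) (rev I)"
  unfolding mixed_stratifying_def
proof (intro conjI allI impI)
  have mb: "mixed_base \<C> \<Theta>" and l: "length I = length \<Theta>" and ind: "\<And>X. X \<in> set I \<Longrightarrow> indecomposable \<C> X"
    and ms': "\<And>i. i < length \<Theta> \<Longrightarrow> (\<exists>C \<in> filt \<C> (dsum \<C> (take (Suc i) \<Theta>)). \<exists>x y \<delta>. conflation \<C> (\<Theta> ! i) x (I ! i) y C \<delta>) \<and>
        (\<forall>X \<in> filt \<C> (dsum \<C> \<Theta>). trivial_group (Ext \<C> X (I ! i)))"
    using ms unfolding mixed_costratifying_def by blast+
  note ob = mixed_base_Ob[OF mb]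
  show "mixed_base (op_cat \<C>) (rev \<Theta>)" by (rule mixed_base_op[OF mb])
  show "length (rev I) = length (rev \<Theta>)" using l by simp
  show "\<forall>X\<in>set (rev I). indecomposable (op_cat \<C>) X" using ind by simp
  fix i assume "i < length (rev \<Theta>)"
  then have i: "i < length \<Theta>" by simp
  \<comment> \<open>Position \<open>i\<close> of the reversed list is position \<open>?j\<close> of
    the original one, and the tail from \<open>i\<close> on is the reversal of the initial segment
    that ends at \<open>?j\<close>.\<close>
  let ?j = "length \<Theta> - Suc i"
  have j: "?j < length \<Theta>" "length \<Theta> - i = Suc ?j" using i by auto
  have n: "rev \<Theta> ! i = \<Theta> ! ?j" "rev I ! i = I ! ?j" using i l by (simp_all add: rev_nth)
  have "set (take (Suc ?j) \<Theta>) \<subseteq> Ob \<C>" using ob set_take_subset by (rule order_trans[rotated])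
  from filt_dsum_rev[OF this] have f: "filt (op_cat \<C>) (dsum (op_cat \<C>) (drop i (rev \<Theta>))) = filt \<C> (dsum \<C> (take (Suc ?j) \<Theta>))"
    unfolding drop_rev j(2) .
  show "\<exists>K\<in>filt (op_cat \<C>) (dsum (op_cat \<C>) (drop i (rev \<Theta>))).
        \<exists>x y \<delta>. conflation (op_cat \<C>) K x (rev I ! i) y (rev \<Theta> ! i) \<delta>"
    unfolding f n op_conflation using ms'[OF j(1)] by blast
  show "\<forall>X\<in>filt (op_cat \<C>) (dsum (op_cat \<C>) (rev \<Theta>)). trivial_group (Ext (op_cat \<C>) (rev I ! i) X)"
    unfolding filt_dsum_rev[OF ob] n op_cat_simps using ms'[OF j(1)] by blast
qed

lemma mixed_costratifying_op:
  assumes ms: "mixed_stratifying \<C> \<Theta> P"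
  shows "mixed_costratifying (op_cat \<C>) (rev \<Theta>) (rev P)"
  unfolding mixed_costratifying_def
proof (intro conjI allI impI)
  have mb: "mixed_base \<C> \<Theta>" and l: "length P = length \<Theta>" and ind: "\<And>X. X \<in> set P \<Longrightarrow> indecomposable \<C> X"
    and ms': "\<And>i. i < length \<Theta> \<Longrightarrow> (\<exists>K \<in> filt \<C> (dsum \<C> (drop i \<Theta>)). \<exists>x y \<delta>. conflation \<C> K x (P ! i) y (\<Theta> ! i) \<delta>) \<and>
        (\<forall>X \<in> filt \<C> (dsum \<C> \<Theta>). trivial_group (Ext \<C> (P ! i) X))"
    using ms unfolding mixed_stratifying_def by blast+
  note ob = mixed_base_Ob[OF mb]
  show "mixed_base (op_cat \<C>) (rev \<Theta>)" by (rule mixed_base_op[OF mb])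
  show "length (rev P) = length (rev \<Theta>)" using l by simp
  show "\<forall>X\<in>set (rev P). indecomposable (op_cat \<C>) X" using ind by simp
  fix i assume "i < length (rev \<Theta>)"
  then have i: "i < length \<Theta>" by simp
  let ?j = "length \<Theta> - Suc i"
  have j: "?j < length \<Theta>" using i by auto
  have n: "rev \<Theta> ! i = \<Theta> ! ?j" "rev P ! i = P ! ?j" using i l by (simp_all add: rev_nth)
  have "set (drop ?j \<Theta>) \<subseteq> Ob \<C>" using ob set_drop_subset by (rule order_trans[rotated])
  from filt_dsum_rev[OF this] have f: "filt (op_cat \<C>) (dsum (op_cat \<C>) (take (Suc i) (rev \<Theta>))) = filt \<C> (dsum \<C> (drop ?j \<Theta>))"
    unfolding take_rev .
  show "\<exists>C\<in>filt (op_cat \<C>) (dsum (op_cat \<C>) (take (Suc i) (rev \<Theta>))).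
        \<exists>x y \<delta>. conflation (op_cat \<C>) (rev \<Theta> ! i) x (rev P ! i) y C \<delta>"
    unfolding f n op_conflation using ms'[OF j] by blast
  show "\<forall>X\<in>filt (op_cat \<C>) (dsum (op_cat \<C>) (rev \<Theta>)). trivial_group (Ext (op_cat \<C>) X (rev P ! i))"
    unfolding filt_dsum_rev[OF ob] n op_cat_simps using ms'[OF j] by blast
qed

lemma mixed_bistratifying_op:
  "mixed_bistratifying \<C> \<Theta> P I \<Longrightarrow> mixed_bistratifying (op_cat \<C>) (rev \<Theta>) (rev I) (rev P)"
  unfolding mixed_bistratifying_def using mixed_stratifying_op mixed_costratifying_op by blast

text \<open>This is \<open>mixed_stratifying_cover\<close> in the opposite category, where the
  costratifying system has become a stratifying one.\<close>

lemma mixed_costratifying_cocover: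
  assumes ms: "mixed_costratifying \<C> \<Theta> I" and D: "direct_sum \<C> \<Theta> D" and J: "direct_sum \<C> I J"
  shows "set I \<subseteq> filt \<C> D" "J \<in> filt \<C> D" "X \<in> filt \<C> D \<Longrightarrow> trivial_group (Ext \<C> X J)"
    "M \<in> filt \<C> D \<Longrightarrow> \<exists>C \<in> filt \<C> D. \<exists>n S x y \<delta>. direct_sum \<C> (replicate n J) S \<and> conflation \<C> M x S y C \<delta>"
proof -
  interpret op: ks_extriangulated k "op_cat \<C>" by (rule op_ks_extriangulated)
  have D': "direct_sum (op_cat \<C>) (rev \<Theta>) D" and J': "direct_sum (op_cat \<C>) (rev I) J"
    using direct_sum_perm[OF D, of "rev \<Theta>"] direct_sum_perm[OF J, of "rev I"] by simp_all
  note * = op.mixed_stratifying_cover[OF mixed_stratifying_op[OF ms] D' J']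
  show "set I \<subseteq> filt \<C> D" "J \<in> filt \<C> D" using *(1,2) by (simp_all add: filt_op)
  show "X \<in> filt \<C> D \<Longrightarrow> trivial_group (Ext \<C> X J)" using *(3) by (simp add: filt_op)
  show "M \<in> filt \<C> D \<Longrightarrow> \<exists>C \<in> filt \<C> D. \<exists>n S x y \<delta>. direct_sum \<C> (replicate n J) S \<and> conflation \<C> M x S y C \<delta>"
    using *(4)[of M] unfolding op.covered_def filt_op op_direct_sum op_conflation by blast
qed

text \<open>Contains part (2) in full. \<open>Q\<close> and \<open>J\<close> are arbitrary direct
  sums of \<open>P\<close> and \<open>I\<close>, so that the lemma also applies to the reversed
  lists in the opposite category without changing the chosen objects.\<close>

lemma bistratifying_image:
  assumes mb: "mixed_bistratifying \<C> \<Theta> P I" and Q: "direct_sum \<C> P Q" and J: "direct_sum \<C> I J"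
  defines "B \<equiv> EndAlg \<C> Q" and "\<Psi> \<equiv> cov_hom \<C> Q" and "\<tau> \<equiv> cov_hom_map \<C> Q J J"
  shows "mixed_bistratifying (mod_cat B) (map \<Psi> \<Theta>) (map \<Psi> P) (map \<Psi> I)"
    and "wakamatsu_tilting B (\<Psi> J)"
    and "\<tau> \<in> alg_iso k (EndAlg \<C> J) (EndAlg (mod_cat B) (\<Psi> J))"
    and "X \<in> set \<Theta> \<union> set P \<union> set I \<Longrightarrow> rmod_iso (opp (EndAlg \<C> J))
      (restrict_scalars \<tau> (contra_hom (mod_cat B) (\<Psi> J) (\<Psi> X))) (contra_hom \<C> J X)"
proof -
  have strat: "mixed_stratifying \<C> \<Theta> P" and costrat: "mixed_costratifying \<C> \<Theta> I"
    using mb unfolding mixed_bistratifying_def by blast+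
  have base: "mixed_base \<C> \<Theta>" using strat unfolding mixed_stratifying_def by blast
  define D where "D = dsum \<C> \<Theta>"
  have D: "direct_sum \<C> \<Theta> D" unfolding D_def by (rule dsum_direct_sum[OF mixed_base_Ob[OF base]])
  have DO: "D \<in> Ob \<C>" using direct_sum_Ob(1)[OF D] .
  note cov = mixed_stratifying_cover[OF strat D Q] and cocov = mixed_costratifying_cocover[OF costrat D J]
  have Neg: "trivial_group (Neg \<C> D D)" using base unfolding mixed_base_def D_def by blast
  interpret exact_filt k \<C> Q D J
  proof (intro exact_filt.intro exact_class.intro cov_functor.intro)
    show "extriangulated_category_neg k \<C>" "Hom_finite_Krull_Schmidt_category k \<C>"
      by (rule extriangulated_category_neg_axioms Hom_finite_Krull_Schmidt_category_axioms)+
    show "cov_functor_axioms \<C> Q" by unfold_locales (rule direct_sum_Ob(1)[OF Q])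
    show "exact_class_axioms \<C> Q (filt \<C> D)"
    proof
      show "M \<in> Ob \<C>" if "M \<in> filt \<C> D" for M using filt_Ob[OF that] .
      show "trivial_group (Neg \<C> W X)" if "W \<in> filt \<C> D" "X \<in> filt \<C> D" for W X using filt_trivial_Neg[OF DO Neg that] .
      show "S \<in> filt \<C> D" if "direct_sum \<C> (replicate n Q) S" for n S
        by (rule filt_direct_sum[OF that]) (use cov(2) in auto)
      show "trivial_group (Ext \<C> Q X)" if "X \<in> filt \<C> D" for X using cov(3)[OF that] .
      show "\<exists>K\<in>filt \<C> D. \<exists>n S x y \<delta>. direct_sum \<C> (replicate n Q) S \<and> conflation \<C> K x S y M \<delta>" if "M \<in> filt \<C> D" for M
        using cov(4)[OF that] unfolding covered_def .
    qed
    show "exact_filt_axioms \<C> D J"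
    proof
      show "D \<in> Ob \<C>" by (rule DO)
      show "S \<in> filt \<C> D" if "direct_sum \<C> (replicate n J) S" for n S
        by (rule filt_direct_sum[OF that]) (use cocov(2) in auto)
      show "J \<in> filt \<C> D" by (rule cocov(2))
      show "trivial_group (Ext \<C> M J)" if "M \<in> filt \<C> D" for M using cocov(3)[OF that] .
      show "\<exists>C\<in>filt \<C> D. \<exists>n S x y \<delta>. direct_sum \<C> (replicate n J) S \<and> conflation \<C> M x S y C \<delta>" if "M \<in> filt \<C> D" for M
        using cocov(4)[OF that] .
    qed
  qed
  have \<Theta>F: "set \<Theta> \<subseteq> filt \<C> D" using summand_in_add_closure[OF D] add_closure_filt by blast
  have subF: "\<exists>S. direct_sum \<C> Ys S \<and> direct_sum \<C> Ys (dsum \<C> Ys) \<and> filt \<C> (dsum \<C> Ys) \<subseteq> filt \<C> D"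
    if "mset \<Theta> = mset (Ys @ Zs)" for Ys Zs
  proof -
    have "set Ys \<subseteq> Ob \<C>" using mixed_base_Ob[OF base] mset_eq_setD[OF that] by auto
    then have s: "direct_sum \<C> Ys (dsum \<C> Ys)" by (rule dsum_direct_sum)
    with filt_mono[OF add_closure_sublist[OF D that s]] show ?thesis by blast
  qed
  have mapF: "\<Psi> X \<in> filt (mod_cat B) (dsum (mod_cat B) (map \<Psi> Ys))"
    if "mset \<Theta> = mset (Ys @ Zs)" "X \<in> filt \<C> (dsum \<C> Ys)" for X Ys Zs
    using subF[OF that(1)] \<Psi>_filt[of Ys "dsum \<C> Ys" X] that(2) unfolding B_def \<Psi>_def by blast
  have ses: "\<exists>x' y' \<delta>'. conflation (mod_cat B) (\<Psi> X) x' (\<Psi> M) y' (\<Psi> Z) \<delta>'"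
    if "conflation \<C> X x M y Z \<delta>" "X \<in> filt \<C> D" "Z \<in> filt \<C> D" for X x M y Z \<delta>
    using short_exact_conflation[OF \<Psi>_exact[OF that]] unfolding B_def \<Psi>_def by blast
  have mbase: "mixed_base (mod_cat B) (map \<Psi> \<Theta>)" unfolding B_def \<Psi>_def by (rule \<Psi>_mixed_base[OF base \<Theta>F])
  have lP: "length P = length \<Theta>" and lI: "length I = length \<Theta>"
    using strat costrat unfolding mixed_stratifying_def mixed_costratifying_def by blast+
  have take: "mset \<Theta> = mset (take i \<Theta> @ drop i \<Theta>)" for i by simp
  have drop: "mset \<Theta> = mset (drop i \<Theta> @ take i \<Theta>)" for i
    using take[of i] unfolding mset_append by (simp only: add.commute)
  have "mixed_stratifying (mod_cat B) (map \<Psi> \<Theta>) (map \<Psi> P)"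
    unfolding mixed_stratifying_def
  proof (intro conjI allI impI ballI)
    show "indecomposable (mod_cat B) Y" if "Y \<in> set (map \<Psi> P)" for Y
      using that \<Psi>_indecomposable cov(1) strat unfolding mixed_stratifying_def B_def \<Psi>_def by auto
    fix i assume "i < length (map \<Psi> \<Theta>)"
    then have i: "i < length \<Theta>" "i < length P" using lP by simp_all
    obtain K x y \<delta> where K: "K \<in> filt \<C> (dsum \<C> (drop i \<Theta>))" "conflation \<C> K x (P ! i) y (\<Theta> ! i) \<delta>"
      using strat i unfolding mixed_stratifying_def by blast
    have KF: "K \<in> filt \<C> D" using K(1) subF[OF drop[of i]] by blast
    have TF: "\<Theta> ! i \<in> filt \<C> D" using \<Theta>F i by auto
    show "\<exists>K\<in>filt (mod_cat B) (dsum (mod_cat B) (drop i (map \<Psi> \<Theta>))).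
       \<exists>x y \<delta>. conflation (mod_cat B) K x (map \<Psi> P ! i) y (map \<Psi> \<Theta> ! i) \<delta>"
      using mapF[OF drop K(1)] ses[OF K(2) KF TF] i by (intro bexI[of _ "\<Psi> K"]) (simp_all add: drop_map)
    fix X assume X: "X \<in> filt (mod_cat B) (dsum (mod_cat B) (map \<Psi> \<Theta>))"
    \<comment> \<open>Vanishing against \<open>J\<close> serves here to learn that a filtered object
      is a finitely generated module.\<close>
    have XO: "X \<in> mod_Ob B"
      using ext_vanish_filt[OF D _ J_in J_Ext] X unfolding B_def \<Psi>_def by blast
    \<comment> \<open>\<open>P ! i\<close> is a summand of \<open>Q\<close>, so its image is a
      retract of the projective module \<open>\<Psi> Q\<close>, which has no extensions by any
      module.\<close>
    obtain as bs where "biproduct \<C> P Q as bs" using Q unfolding direct_sum_def by blast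
    from biproductD(3,4)[OF this i(2)] biproductD(5)[OF this i(2,2)]
    obtain a b where ab: "a \<in> Mor (P ! i) Q" "b \<in> Mor Q (P ! i)" "comp \<C> (P ! i) Q (P ! i) b a = ident \<C> (P ! i)"
      by simp
    have PO: "P ! i \<in> Ob \<C>" using cov(1) i filt_Ob by (meson nth_mem subsetD)
    have QO: "Q \<in> Ob \<C>" by simp
    have "ext_vanish B (\<Psi> (P ! i)) X"
      unfolding B_def \<Psi>_def
    proof (rule ext_vanish_retract[OF _ _ _ \<Psi>m_rhom[OF PO QO ab(1)] \<Psi>m_rhom[OF QO PO ab(2)]])
      have "direct_sum \<C> (replicate 1 Q) Q" using direct_sum_single[OF QO] by simp
      then show "ext_vanish (EndAlg \<C> Q) (cov_hom \<C> Q Q) X"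
        using ext_vanish_projective[OF \<Psi>_projective] XO unfolding B_def by blast
      fix m assume "m \<in> carrier (cov_hom \<C> Q (P ! i))"
      then obtain u where u: "u \<in> Mor Q (P ! i)" "m = Inl u" by auto
      have "comp \<C> Q Q (P ! i) b (comp \<C> Q (P ! i) Q a u) = u"
        using cmp_assoc[OF QO PO QO PO u(1) ab(1,2)] ab(3) u(1) PO by simp
      then show "cov_hom_map \<C> Q Q (P ! i) b (cov_hom_map \<C> Q (P ! i) Q a m) = m" using u ab PO by simp
    qed (use PO XO B_def in simp_all)
    then have "trivial_group (mod_Ext B 1 (\<Psi> (P ! i)) X)"
      using ext_vanish_trivial_mod_Ext[OF _ _] XO \<Psi>_mod_Ob[OF PO] unfolding B_def \<Psi>_def by blast
    then show "trivial_group (Ext (mod_cat B) (map \<Psi> P ! i) X)" using i by simp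
  qed (use mbase lP in simp_all)
  moreover have "mixed_costratifying (mod_cat B) (map \<Psi> \<Theta>) (map \<Psi> I)"
    unfolding mixed_costratifying_def
  proof (intro conjI allI impI ballI)
    show "indecomposable (mod_cat B) Y" if "Y \<in> set (map \<Psi> I)" for Y
      using that \<Psi>_indecomposable cocov(1) costrat unfolding mixed_costratifying_def B_def \<Psi>_def by auto
    fix i assume "i < length (map \<Psi> \<Theta>)"
    then have i: "i < length \<Theta>" "i < length I" using lI by simp_all
    obtain C x y \<delta> where C: "C \<in> filt \<C> (dsum \<C> (take (Suc i) \<Theta>))" "conflation \<C> (\<Theta> ! i) x (I ! i) y C \<delta>"
      using costrat i unfolding mixed_costratifying_def by blast
    have CF: "C \<in> filt \<C> D" using C(1) subF[OF take[of "Suc i"]] by blast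
    have TF: "\<Theta> ! i \<in> filt \<C> D" using \<Theta>F i by auto
    show "\<exists>C\<in>filt (mod_cat B) (dsum (mod_cat B) (take (Suc i) (map \<Psi> \<Theta>))).
       \<exists>x y \<delta>. conflation (mod_cat B) (map \<Psi> \<Theta> ! i) x (map \<Psi> I ! i) y C \<delta>"
      using mapF[OF take C(1)] ses[OF C(2) TF CF] i by (intro bexI[of _ "\<Psi> C"]) (simp_all add: take_map)
    fix X assume X: "X \<in> filt (mod_cat B) (dsum (mod_cat B) (map \<Psi> \<Theta>))"
    have IF: "I ! i \<in> filt \<C> D" using cocov(1) i by auto
    have IE: "trivial_group (Ext \<C> M (I ! i))" if "M \<in> filt \<C> D" for M
      using costrat i that unfolding mixed_costratifying_def D_def by blast
    have "X \<in> mod_Ob B \<and> ext_vanish B X (\<Psi> (I ! i))"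
      using ext_vanish_filt[OF D _ IF IE] X unfolding B_def \<Psi>_def by blast
    then have "trivial_group (mod_Ext B 1 X (\<Psi> (I ! i)))"
      using ext_vanish_trivial_mod_Ext[of X] \<Psi>_mod_Ob[OF filt_Ob[OF IF]] unfolding B_def \<Psi>_def by blast
    then show "trivial_group (Ext (mod_cat B) X (map \<Psi> I ! i))" using i by simp
  qed (use mbase lI in simp_all)
  ultimately show "mixed_bistratifying (mod_cat B) (map \<Psi> \<Theta>) (map \<Psi> P) (map \<Psi> I)"
    unfolding mixed_bistratifying_def by blast
  show "wakamatsu_tilting B (\<Psi> J)" unfolding B_def \<Psi>_def by (rule \<Psi>_wakamatsu)
  show "\<tau> \<in> alg_iso k (EndAlg \<C> J) (EndAlg (mod_cat B) (\<Psi> J))"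
    unfolding B_def \<Psi>_def \<tau>_def by (rule \<Psi>m_alg_iso[OF J_in])
  show "rmod_iso (opp (EndAlg \<C> J)) (restrict_scalars \<tau> (contra_hom (mod_cat B) (\<Psi> J) (\<Psi> X))) (contra_hom \<C> J X)"
    if "X \<in> set \<Theta> \<union> set P \<union> set I"
    unfolding B_def \<Psi>_def \<tau>_def by (rule \<Psi>_duality) (use that \<Theta>F cov(1) cocov(1) in blast)
qed

end

text \<open>An equality of functions and not merely an isomorphism: statements for the opposite
  category become statements about \<open>contra_hom\<close> by rewriting.\<close>

lemma cov_hom_op: "cov_hom (op_cat \<C>) Q = contra_hom \<C> Q"
  by (simp add: fun_eq_iff cov_hom_def contra_hom_def)

lemma contra_hom_op: "contra_hom (op_cat \<C>) Q = cov_hom \<C> Q"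
  by (simp add: fun_eq_iff cov_hom_def contra_hom_def)

lemma cov_hom_map_op: "cov_hom_map (op_cat \<C>) Q X Y = contra_hom_map \<C> Q Y X"
  by (simp add: fun_eq_iff cov_hom_map_def contra_hom_map_def restrict_def)

text \<open>Reversing the multiplication on both sides leaves the conditions unchanged. The opposite
  category delivers the isomorphism with source \<open>opp B\<close>, whereas part (1) reverses the
  target.\<close>

lemma alg_iso_opp: "h \<in> alg_iso k (opp A) A' \<Longrightarrow> h \<in> alg_iso k A (opp A')"
  unfolding alg_iso_def ring_iso_def ring_hom_def by simp

lemma rmod_iso_list:
  assumes "\<And>X. X \<in> set Xs \<Longrightarrow> rmod_iso A (f (g X)) (h X)"
  shows "list_all2 (rmod_iso A) (map f (map g Xs)) (map h Xs)"
  using assms by (simp add: list_all2_conv_all_nth)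

theorem theorem1p3:
  fixes k :: "'k ring"
    and \<C> :: "('k, 'o, 'm, 'e, 'n) ext_cat"
    and \<Theta> P I :: "'o list"
    and B C :: "('k, 'm) module"
    and \<Psi> \<Phi> :: "'o \<Rightarrow> ('k, 'm) rmod"
  assumes "Hom_finite_Krull_Schmidt_category k \<C>"
    and "extriangulated_category_neg k \<C>"
    and "mixed_bistratifying \<C> \<Theta> P I"
    and "B = EndAlg \<C> (dsum \<C> P)"
    and "\<Psi> = cov_hom \<C> (dsum \<C> P)"
    and "C = opp (EndAlg \<C> (dsum \<C> I))"
    and "\<Phi> = contra_hom \<C> (dsum \<C> I)"
    and "\<Phi>' = contra_hom (mod_cat C) (\<Phi> (dsum \<C> P))"
    and "\<Psi>' = contra_hom (mod_cat B) (\<Psi> (dsum \<C> I))"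
    and "\<sigma> = contra_hom_map \<C> (dsum \<C> I) (dsum \<C> P) (dsum \<C> P)"
    and "\<tau> = cov_hom_map \<C> (dsum \<C> P) (dsum \<C> I) (dsum \<C> I)"
  shows "(mixed_bistratifying (mod_cat C) (contra_map \<Phi> \<Theta>) (contra_map \<Phi> I) (contra_map \<Phi> P) \<and>
          wakamatsu_tilting C (\<Phi> (dsum \<C> P)) \<and>
          \<sigma> \<in> alg_iso k B (opp (EndAlg (mod_cat C) (\<Phi> (dsum \<C> P)))) \<and>
          list_all2 (rmod_iso B)
            (map (restrict_scalars \<sigma>) (contra_map \<Phi>' (contra_map \<Phi> \<Theta>))) (map \<Psi> \<Theta>) \<and>
          list_all2 (rmod_iso B)
            (map (restrict_scalars \<sigma>) (contra_map \<Phi>' (contra_map \<Phi> P))) (map \<Psi> P) \<and>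
          list_all2 (rmod_iso B)
            (map (restrict_scalars \<sigma>) (contra_map \<Phi>' (contra_map \<Phi> I))) (map \<Psi> I))
       \<and> (mixed_bistratifying (mod_cat B) (map \<Psi> \<Theta>) (map \<Psi> P) (map \<Psi> I) \<and>
          wakamatsu_tilting B (\<Psi> (dsum \<C> I)) \<and>
          \<tau> \<in> alg_iso k (EndAlg \<C> (dsum \<C> I)) (EndAlg (mod_cat B) (\<Psi> (dsum \<C> I))) \<and>
          list_all2 (rmod_iso C)
            (map (restrict_scalars \<tau>) (contra_map \<Psi>' (map \<Psi> \<Theta>))) (contra_map \<Phi> \<Theta>) \<and>
          list_all2 (rmod_iso C)
            (map (restrict_scalars \<tau>) (contra_map \<Psi>' (map \<Psi> I))) (contra_map \<Phi> I) \<and>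
          list_all2 (rmod_iso C)
            (map (restrict_scalars \<tau>) (contra_map \<Psi>' (map \<Psi> P))) (contra_map \<Phi> P))"
proof -
  interpret ks_extriangulated k \<C> using assms(1,2) by (rule ks_extriangulated.intro)
  interpret op: ks_extriangulated k "op_cat \<C>" by (rule op_ks_extriangulated)
  have "set P \<subseteq> Ob \<C>" "set I \<subseteq> Ob \<C>"
    using assms(3) unfolding mixed_bistratifying_def mixed_stratifying_def mixed_costratifying_def indecomposable_def
    by blast+
  then have P: "direct_sum \<C> P (dsum \<C> P)" and I: "direct_sum \<C> I (dsum \<C> I)" by (simp_all add: dsum_direct_sum)
  have P': "direct_sum (op_cat \<C>) (rev P) (dsum \<C> P)" and I': "direct_sum (op_cat \<C>) (rev I) (dsum \<C> I)"
    using direct_sum_perm[OF P, of "rev P"] direct_sum_perm[OF I, of "rev I"] by simp_all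
  note right = bistratifying_image[OF assms(3) P I, folded assms(4,5)]
  \<comment> \<open>In the opposite category \<open>rev I\<close> supplies the projectives and
    \<open>rev P\<close> the injectives, with the direct sums chosen in \<C> retained.\<close>
  note left = op.bistratifying_image[OF mixed_bistratifying_op[OF assms(3)] I' P',
    unfolded cov_hom_op contra_hom_op cov_hom_map_op op_EndAlg opp_opp, folded assms(4,5,6,7,10)]
  have \<Psi>': "rmod_iso C (restrict_scalars \<tau> (\<Psi>' (\<Psi> X))) (\<Phi> X)" if "X \<in> set \<Theta> \<union> set P \<union> set I" for X
    using right(4)[OF that] unfolding assms(6,7,9,11) .
  have \<Phi>': "rmod_iso B (restrict_scalars \<sigma> (\<Phi>' (\<Phi> X))) (\<Psi> X)" if "X \<in> set \<Theta> \<union> set P \<union> set I" for X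
    using left(4)[of X] that unfolding assms(8) by auto
  \<comment> \<open>Two contravariant functors reverse the list twice, so the original order is
    back.\<close>
  have l: "list_all2 (rmod_iso B) (map (restrict_scalars \<sigma>) (contra_map \<Phi>' (contra_map \<Phi> Xs))) (map \<Psi> Xs)"
    if "set Xs \<subseteq> set \<Theta> \<union> set P \<union> set I" for Xs
    using rmod_iso_list[of Xs B "restrict_scalars \<sigma>" "\<lambda>X. \<Phi>' (\<Phi> X)" \<Psi>] \<Phi>' that
    by (auto simp: contra_map_def rev_map o_def)
  \<comment> \<open>Only \<open>\<Psi>'\<close> reverses the list on the left, which matches the
    reversal by \<Phi> on the right.\<close>
  have r: "list_all2 (rmod_iso C) (map (restrict_scalars \<tau>) (contra_map \<Psi>' (map \<Psi> Xs))) (contra_map \<Phi> Xs)"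
    if "set Xs \<subseteq> set \<Theta> \<union> set P \<union> set I" for Xs
    using rmod_iso_list[of "rev Xs" C "restrict_scalars \<tau>" "\<lambda>X. \<Psi>' (\<Psi> X)" \<Phi>] \<Psi>' that
    by (auto simp: contra_map_def rev_map o_def)
  have "mixed_bistratifying (mod_cat C) (contra_map \<Phi> \<Theta>) (contra_map \<Phi> I) (contra_map \<Phi> P)"
    using left(1) unfolding contra_map_def rev_map .
  moreover have "\<tau> \<in> alg_iso k (EndAlg \<C> (dsum \<C> I)) (EndAlg (mod_cat B) (\<Psi> (dsum \<C> I)))"
    using right(3) unfolding assms(11) .
  ultimately show ?thesis
    using left(2) alg_iso_opp[OF left(3)] right(1,2) l[of \<Theta>] l[of P] l[of I] r[of \<Theta>] r[of P] r[of I] by blast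
qed

end
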